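(* Let $\Omega\subset\mathbb R^N$ be a bounded open set, let $\kappa$ be a (positive) Borel measure on $\partial\Omega$ and $\theta$ a symmetric (positive) Radon measure on $(\partial\Omega\times\partial\Omega)\setminus d$, where $d$ is the diagonal, such that the pair $(\kappa,\theta)$ is admissible. Then $$e^{t\Delta_D}\le e^{t\Delta_{\kappa,\theta}}\qquad(t\ge0)$$ in the sense of positive operators on $L^2(\Omega)$.
   Context: For operators $S,T$ on $L^2(\Omega)$, $S\le T$ means $Sf\le Tf$ a.e. for every $f\in L^2(\Omega)$ with $f\ge0$ a.e. $\Delta_D$ is the Dirichlet Laplacian: $-\Delta_D$ is the self-adjoint operator on $L^2(\Omega)$ associated with the closed form $\int_\Omega\nabla u\cdot\nabla v\,dx$ with domain $H^1_0(\Omega)$. $C_c(\overline\Omega)$ is the space of continuous real-valued functions with compact support in $\overline\Omega$. The form $\mathcal E_{\kappa,\theta}$ has domain $$E=\Big\{u\in H^1(\Omega)\cap C_c(\overline\Omega):\int_{\partial\Omega}|u|^2\,d\kappa+\int_{(\partial\Omega\times\partial\Omega)\setminus d}(u(x)-u(y))^2\,d\theta(x,y)<\infty\Big\}$$ and is given by $$\mathcal E_{\kappa,\theta}(u,v)=\int_\Omega\nabla u\cdot\nabla v\,dx+\int_{\partial\Omega}uv\,d\kappa+\int_{(\partial\Omega\times\partial\Omega)\setminus d}(u(x)-u(y))(v(x)-v(y))\,d\theta(x,y).$$ $\widetilde H^1(\Omega)$ is the closure of $H^1(\Omega)\cap C_c(\overline\Omega)$ in $H^1(\Omega)$. The relative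 capacity of $A\subset\overline\Omega$ is $$\mathrm{Cap}_{\overline\Omega}(A)=\inf\{\|u\|_{H^1(\Omega)}: u\in\widetilde H^1(\Omega),\ \exists\,O\subset\mathbb R^N\text{ open},\ A\subset O,\ u\ge1\text{ a.e. on }\Omega\cap O\}.$$ $\hat\theta$ is the Borel measure on $\partial\Omega$ given by $\hat\theta(B)=\theta((B\times\partial\Omega)\setminus d)$. Let $$\Gamma_{\kappa,\theta}=\{z\in\partial\Omega:\exists r>0,\ \kappa(\partial\Omega\cap B(z,r))+\hat\theta(\partial\Omega\cap B(z,r))<\infty\}.$$ The pair $(\kappa,\theta)$ is admissible if for each Borel set $A\subset\Gamma_{\kappa,\theta}$, $\mathrm{Cap}_{\overline\Omega}(A)=0$ implies $(\kappa+\hat\theta)(A)=0$. When $(\kappa,\theta)$ is admissible the form $(\mathcal E_{\kappa,\theta},E)$ is closable in $L^2(\Omega)$; its closure is denoted by the same symbol, with domain $\mathfrak D$. The operator $-\Delta_{\kappa,\theta}$ is the self-adjoint operator on $L^2(\Omega)$ associated with the closure: $D(\Delta_{\kappa,\theta})=\{u\in\mathfrak D:\exists v\in L^2(\Omega),\ \mathcal E_{\kappa,\theta}(u,\varphi)=(v,\varphi)_{L^2(\Omega)}\ \forall\varphi\in\mathfrak D\}$, $\Delta_{\kappa,\theta}u=-v$. *)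

theory Defs
  imports "HOL-Analysis.Analysis"
begin

text \<open>
  Elements of \<open>L\<^sup>2(\<Omega>)\<close> are represented by functions on the whole space. Only their values on
  \<open>\<Omega>\<close> matter, and equality in \<open>L\<^sup>2(\<Omega>)\<close> is equality almost everywhere on \<open>\<Omega>\<close>.
\<close>

definition L2 :: "'a::euclidean_space set \<Rightarrow> ('a \<Rightarrow> real) set" where
  "L2 \<Omega> = {f \<in> borel_measurable (lebesgue_on \<Omega>). integrable (lebesgue_on \<Omega>) (\<lambda>x. (f x)\<^sup>2)}"

definition L2_inner :: "'a::euclidean_space set \<Rightarrow> ('a \<Rightarrow> real) \<Rightarrow> ('a \<Rightarrow> real) \<Rightarrow> real" where
  "L2_inner \<Omega> f g = (LINT x|lebesgue_on \<Omega>. f x * g x)"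

definition L2_norm :: "'a::euclidean_space set \<Rightarrow> ('a \<Rightarrow> real) \<Rightarrow> real" where
  "L2_norm \<Omega> f = sqrt (L2_inner \<Omega> f f)"


subsection \<open>Sobolev spaces\<close>

primrec Ck :: "nat \<Rightarrow> ('a::euclidean_space \<Rightarrow> real) \<Rightarrow> bool" where
  "Ck 0 f \<longleftrightarrow> continuous_on UNIV f"
| "Ck (Suc k) f \<longleftrightarrow> (\<forall>x. f differentiable (at x)) \<and>
     (\<forall>b\<in>Basis. Ck k (\<lambda>x. frechet_derivative f (at x) b))"

definition test_functions :: "'a::euclidean_space set \<Rightarrow> ('a \<Rightarrow> real) set" where
  "test_functions \<Omega> = {\<phi>. (\<forall>k. Ck k \<phi>) \<and>
     (\<exists>K. compact K \<and> K \<subseteq> \<Omega> \<and> (\<forall>x. x \<notin> K \<longrightarrow> \<phi> x = 0))}"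

definition weak_gradient :: "'a::euclidean_space set \<Rightarrow> ('a \<Rightarrow> real) \<Rightarrow> ('a \<Rightarrow> 'a) \<Rightarrow> bool" where
  "weak_gradient \<Omega> u g \<longleftrightarrow>
     g \<in> borel_measurable (lebesgue_on \<Omega>) \<and>
     integrable (lebesgue_on \<Omega>) (\<lambda>x. (norm (g x))\<^sup>2) \<and>
     (\<forall>\<phi>\<in>test_functions \<Omega>. \<forall>b\<in>Basis.
        (LINT x|lebesgue_on \<Omega>. u x * frechet_derivative \<phi> (at x) b) =
        - (LINT x|lebesgue_on \<Omega>. (g x \<bullet> b) * \<phi> x))"

definition H1 :: "'a::euclidean_space set \<Rightarrow> ('a \<Rightarrow> real) set" where
  "H1 \<Omega> = {u \<in> L2 \<Omega>. \<exists>g. weak_gradient \<Omega> u g}"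

text \<open>The weak gradient is unique up to equality almost everywhere on \<open>\<Omega>\<close>.\<close>

definition grad :: "'a::euclidean_space set \<Rightarrow> ('a \<Rightarrow> real) \<Rightarrow> 'a \<Rightarrow> 'a" where
  "grad \<Omega> u = (SOME g. weak_gradient \<Omega> u g)"

definition dirichlet_form :: "'a::euclidean_space set \<Rightarrow> ('a \<Rightarrow> real) \<Rightarrow> ('a \<Rightarrow> real) \<Rightarrow> real" where
  "dirichlet_form \<Omega> u v = (LINT x|lebesgue_on \<Omega>. grad \<Omega> u x \<bullet> grad \<Omega> v x)"

definition H1_norm :: "'a::euclidean_space set \<Rightarrow> ('a \<Rightarrow> real) \<Rightarrow> real" where
  "H1_norm \<Omega> u = sqrt (L2_inner \<Omega> u u + dirichlet_form \<Omega> u u)"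

definition H1_closure :: "'a::euclidean_space set \<Rightarrow> ('a \<Rightarrow> real) set \<Rightarrow> ('a \<Rightarrow> real) set" where
  "H1_closure \<Omega> S = {u \<in> H1 \<Omega>. \<exists>us. (\<forall>n. us n \<in> S) \<and>
     (\<lambda>n. H1_norm \<Omega> (\<lambda>x. us n x - u x)) \<longlonglongrightarrow> 0}"

definition H10 :: "'a::euclidean_space set \<Rightarrow> ('a \<Rightarrow> real) set" where
  "H10 \<Omega> = H1_closure \<Omega> (test_functions \<Omega>)"

definition Cc :: "'a::euclidean_space set \<Rightarrow> ('a \<Rightarrow> real) set" where
  "Cc S = {u. continuous_on S u \<and> (\<exists>K. compact K \<and> K \<subseteq> S \<and> (\<forall>x\<in>S - K. u x = 0))}"

definition H1_tilde :: "'a::euclidean_space set \<Rightarrow> ('a \<Rightarrow> real) set" where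
  "H1_tilde \<Omega> = H1_closure \<Omega> (H1 \<Omega> \<inter> Cc (closure \<Omega>))"

definition relative_capacity :: "'a::euclidean_space set \<Rightarrow> 'a set \<Rightarrow> ennreal" where
  "relative_capacity \<Omega> A =
     Inf {ennreal (H1_norm \<Omega> u) | u. u \<in> H1_tilde \<Omega> \<and>
       (\<exists>U. open U \<and> A \<subseteq> U \<and> (AE x in lebesgue_on \<Omega>. x \<in> U \<longrightarrow> 1 \<le> u x))}"


subsection \<open>Boundary measures\<close>

definition borel_measure_on :: "'a::topological_space set \<Rightarrow> 'a measure \<Rightarrow> bool" where
  "borel_measure_on X \<mu> \<longleftrightarrow> sets \<mu> = sets (restrict_space borel X)"

definition radon_measure_on :: "'a::topological_space set \<Rightarrow> 'a measure \<Rightarrow> bool" where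
  "radon_measure_on X \<mu> \<longleftrightarrow> borel_measure_on X \<mu> \<and>
     (\<forall>K. compact K \<and> K \<subseteq> X \<longrightarrow> emeasure \<mu> K < \<infinity>) \<and>
     (\<forall>A\<in>sets \<mu>. emeasure \<mu> A = (SUP K\<in>{K. compact K \<and> K \<subseteq> A}. emeasure \<mu> K))"

definition symmetric_measure :: "('a \<times> 'a) measure \<Rightarrow> bool" where
  "symmetric_measure \<theta> \<longleftrightarrow> (\<forall>A\<in>sets \<theta>. emeasure \<theta> (prod.swap ` A) = emeasure \<theta> A)"

text \<open>The relation \<^const>\<open>Id\<close> is the diagonal \<open>d\<close>.\<close>

definition off_diagonal :: "'a set \<Rightarrow> ('a \<times> 'a) set" where
  "off_diagonal X = X \<times> X - Id"

definition theta_hat ::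
  "'a::euclidean_space set \<Rightarrow> ('a \<times> 'a) measure \<Rightarrow> 'a set \<Rightarrow> ennreal" where
  "theta_hat \<Omega> \<theta> B = emeasure \<theta> (B \<times> frontier \<Omega> - Id)"

definition Gamma_set ::
  "'a::euclidean_space set \<Rightarrow> 'a measure \<Rightarrow> ('a \<times> 'a) measure \<Rightarrow> 'a set" where
  "Gamma_set \<Omega> \<kappa> \<theta> = {z \<in> frontier \<Omega>. \<exists>r>0.
     emeasure \<kappa> (frontier \<Omega> \<inter> ball z r) + theta_hat \<Omega> \<theta> (frontier \<Omega> \<inter> ball z r) < \<infinity>}"

definition admissible ::
  "'a::euclidean_space set \<Rightarrow> 'a measure \<Rightarrow> ('a \<times> 'a) measure \<Rightarrow> bool" where
  "admissible \<Omega> \<kappa> \<theta> \<longleftrightarrow> (\<forall>A\<in>sets borel. A \<subseteq> Gamma_set \<Omega> \<kappa> \<theta> \<longrightarrow>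
     relative_capacity \<Omega> A = 0 \<longrightarrow> emeasure \<kappa> A + theta_hat \<Omega> \<theta> A = 0)"


subsection \<open>Forms and associated operators\<close>

definition E_domain ::
  "'a::euclidean_space set \<Rightarrow> 'a measure \<Rightarrow> ('a \<times> 'a) measure \<Rightarrow> ('a \<Rightarrow> real) set" where
  "E_domain \<Omega> \<kappa> \<theta> = {u \<in> H1 \<Omega> \<inter> Cc (closure \<Omega>).
     (\<integral>\<^sup>+x. ennreal ((u x)\<^sup>2) \<partial>\<kappa>) + (\<integral>\<^sup>+z. ennreal ((u (fst z) - u (snd z))\<^sup>2) \<partial>\<theta>) < \<infinity>}"

definition E_form :: "'a::euclidean_space set \<Rightarrow> 'a measure \<Rightarrow> ('a \<times> 'a) measure \<Rightarrow>
    ('a \<Rightarrow> real) \<Rightarrow> ('a \<Rightarrow> real) \<Rightarrow> real" where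
  "E_form \<Omega> \<kappa> \<theta> u v = dirichlet_form \<Omega> u v + (LINT x|\<kappa>. u x * v x) +
     (LINT z|\<theta>. (u (fst z) - u (snd z)) * (v (fst z) - v (snd z)))"

text \<open>
  An unbounded operator \<open>A\<close> on \<open>L\<^sup>2(\<Omega>)\<close> is represented by its graph, the set of all pairs of
  representatives of \<open>u \<in> D(A)\<close> and of \<open>A u\<close>. Both operators below carry the sign of the
  Laplacian, hence the minus signs.
\<close>

type_synonym 'a L2_operator = "(('a \<Rightarrow> real) \<times> ('a \<Rightarrow> real)) set"

definition dirichlet_laplacian :: "'a::euclidean_space set \<Rightarrow> 'a L2_operator" where
  "dirichlet_laplacian \<Omega> = {(u, w). u \<in> H10 \<Omega> \<and> w \<in> L2 \<Omega> \<and>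
     (\<forall>\<phi>\<in>H10 \<Omega>. dirichlet_form \<Omega> u \<phi> = - L2_inner \<Omega> w \<phi>)}"

text \<open>
  The sequence \<open>us\<close> in the form domain \<open>D\<close> is Cauchy for the form \<open>a\<close> and converges to \<open>u\<close> in
  \<open>L\<^sup>2(\<Omega>)\<close>; the domain of the closure of \<open>a\<close> consists of those \<open>u\<close> that have such a sequence.
\<close>

definition closure_seq :: "'a::euclidean_space set \<Rightarrow> ('a \<Rightarrow> real) set \<Rightarrow>
    (('a \<Rightarrow> real) \<Rightarrow> ('a \<Rightarrow> real) \<Rightarrow> real) \<Rightarrow> (nat \<Rightarrow> 'a \<Rightarrow> real) \<Rightarrow> ('a \<Rightarrow> real) \<Rightarrow> bool" where
  "closure_seq \<Omega> D a us u \<longleftrightarrow> u \<in> L2 \<Omega> \<and> (\<forall>n. us n \<in> D) \<and>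
     (\<lambda>n. L2_norm \<Omega> (\<lambda>x. us n x - u x)) \<longlonglongrightarrow> 0 \<and>
     (\<forall>e>0. \<exists>M. \<forall>m\<ge>M. \<forall>n\<ge>M. a (\<lambda>x. us m x - us n x) (\<lambda>x. us m x - us n x) < e)"

text \<open>
  The closure of \<open>a\<close> takes the value \<open>lim a (us n) (\<phi>s n)\<close> at \<open>(u, \<phi>)\<close>, where \<open>us\<close> and \<open>\<phi>s\<close> are
  any approximating sequences of \<open>u\<close> and \<open>\<phi>\<close>. For closable \<open>a\<close> this limit does not depend on the
  sequences, so the operator below is the one associated with the closure: \<open>u\<close> lies in the domain
  of the closure and the closure at \<open>(u, \<phi>)\<close> is \<open>- (w, \<phi>)\<close> for all \<open>\<phi>\<close> in that domain.
  Writing out the limit makes the definition meaningful without a choice of value for the closure.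
\<close>

definition closure_operator :: "'a::euclidean_space set \<Rightarrow> ('a \<Rightarrow> real) set \<Rightarrow>
    (('a \<Rightarrow> real) \<Rightarrow> ('a \<Rightarrow> real) \<Rightarrow> real) \<Rightarrow> 'a L2_operator" where
  "closure_operator \<Omega> D a = {(u, w). w \<in> L2 \<Omega> \<and> (\<exists>us. closure_seq \<Omega> D a us u \<and>
     (\<forall>\<phi> \<phi>s. closure_seq \<Omega> D a \<phi>s \<phi> \<longrightarrow>
        (\<lambda>n. a (us n) (\<phi>s n)) \<longlonglongrightarrow> - L2_inner \<Omega> w \<phi>))}"

definition boundary_laplacian ::
  "'a::euclidean_space set \<Rightarrow> 'a measure \<Rightarrow> ('a \<times> 'a) measure \<Rightarrow> 'a L2_operator" where
  "boundary_laplacian \<Omega> \<kappa> \<theta> = closure_operator \<Omega> (E_domain \<Omega> \<kappa> \<theta>) (E_form \<Omega> \<kappa> \<theta>)"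


subsection \<open>Semigroups\<close>

text \<open>
  Linearity, taken with boundedness, implies that the operators respect equality in \<open>L\<^sup>2(\<Omega>)\<close>.
\<close>

definition bounded_operator ::
  "'a::euclidean_space set \<Rightarrow> (('a \<Rightarrow> real) \<Rightarrow> ('a \<Rightarrow> real)) \<Rightarrow> bool" where
  "bounded_operator \<Omega> S \<longleftrightarrow> (\<forall>f\<in>L2 \<Omega>. S f \<in> L2 \<Omega>) \<and>
     (\<forall>c. \<forall>f\<in>L2 \<Omega>. \<forall>g\<in>L2 \<Omega>. AE x in lebesgue_on \<Omega>.
        S (\<lambda>y. c * f y + g y) x = c * S f x + S g x) \<and>
     (\<exists>C. \<forall>f\<in>L2 \<Omega>. L2_norm \<Omega> (S f) \<le> C * L2_norm \<Omega> f)"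

definition C0_semigroup ::
  "'a::euclidean_space set \<Rightarrow> (real \<Rightarrow> ('a \<Rightarrow> real) \<Rightarrow> ('a \<Rightarrow> real)) \<Rightarrow> bool" where
  "C0_semigroup \<Omega> T \<longleftrightarrow> (\<forall>t\<ge>0. bounded_operator \<Omega> (T t)) \<and>
     (\<forall>f\<in>L2 \<Omega>. AE x in lebesgue_on \<Omega>. T 0 f x = f x) \<and>
     (\<forall>s\<ge>0. \<forall>t\<ge>0. \<forall>f\<in>L2 \<Omega>. AE x in lebesgue_on \<Omega>. T (s + t) f x = T s (T t f) x) \<and>
     (\<forall>f\<in>L2 \<Omega>. ((\<lambda>t. L2_norm \<Omega> (\<lambda>x. T t f x - f x)) \<longlongrightarrow> 0) (at_right 0))"

definition generator :: "'a::euclidean_space set \<Rightarrow>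
    (real \<Rightarrow> ('a \<Rightarrow> real) \<Rightarrow> ('a \<Rightarrow> real)) \<Rightarrow> 'a L2_operator" where
  "generator \<Omega> T = {(u, w). u \<in> L2 \<Omega> \<and> w \<in> L2 \<Omega> \<and>
     ((\<lambda>t. L2_norm \<Omega> (\<lambda>x. (T t u x - u x) / t - w x)) \<longlongrightarrow> 0) (at_right 0)}"

text \<open>
  The semigroup generated by \<open>A\<close>, written \<open>e\<^sup>t\<^sup>A\<close>. A generator determines its semigroup only up to
  equality almost everywhere of the representatives, hence the use of \<open>SOME\<close>.
\<close>

definition semigroup_exp ::
  "'a::euclidean_space set \<Rightarrow> 'a L2_operator \<Rightarrow> real \<Rightarrow> ('a \<Rightarrow> real) \<Rightarrow> ('a \<Rightarrow> real)" where
  "semigroup_exp \<Omega> A = (SOME T. C0_semigroup \<Omega> T \<and> generator \<Omega> T = A)"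

definition operator_le :: "'a::euclidean_space set \<Rightarrow>
    (('a \<Rightarrow> real) \<Rightarrow> ('a \<Rightarrow> real)) \<Rightarrow> (('a \<Rightarrow> real) \<Rightarrow> ('a \<Rightarrow> real)) \<Rightarrow> bool" where
  "operator_le \<Omega> S T \<longleftrightarrow> (\<forall>f\<in>L2 \<Omega>. (AE x in lebesgue_on \<Omega>. 0 \<le> f x) \<longrightarrow>
     (AE x in lebesgue_on \<Omega>. S f x \<le> T f x))"

end

theory Submission
  imports Defs "HOL-Computational_Algebra.Polynomial"
begin

text \<open>
  Both Laplacians are m-dissipative on \<open>L\<^sup>2(\<Omega>)\<close>, so that each semigroup is the limit of the implicit
  Euler scheme, and it suffices to compare resolvents. For \<open>f \<ge> 0\<close> the resolvent \<open>u = (1 - s A)\<^sup>-\<^sup>1 f\<close> is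
  the limit of the minimizing sequences of \<open>s a(v, v) + \<parallel>v\<parallel>\<^sup>2 - 2 (f, v)\<close>. Passing to \<open>\<bar>v\<bar>\<close> does not
  increase this energy, hence \<open>u \<ge> 0\<close>. Now let \<open>u\<^sub>n\<close> be a minimizing sequence of test functions for the
  Dirichlet form and \<open>v\<^sub>n \<ge> 0\<close> one for the form with boundary terms. Replacing the pair \<open>(u\<^sub>n, v\<^sub>n)\<close> by
  \<open>(min u\<^sub>n v\<^sub>n, max u\<^sub>n v\<^sub>n)\<close> does not increase the sum of the two energies: the functions \<open>v\<^sub>n\<close> and
  \<open>max u\<^sub>n v\<^sub>n\<close> have the same boundary values, and \<open>min u\<^sub>n v\<^sub>n\<close> has compact support in \<open>\<Omega>\<close>. Hence the
  minima are again minimizing and lie below \<open>v\<^sub>n\<close>, and the limits satisfy the same inequality. The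
  functions \<open>\<bar>u\<bar>\<close> and \<open>min u v\<close> are handled by mollification, since they are continuous up to the
  boundary, respectively continuous with compact support in \<open>\<Omega>\<close>.
\<close>

subsection \<open>Linear m-dissipative operators and their semigroups\<close>

text \<open>Two features of the setting shape the argument. \<open>semigroup_exp\<close> is an
  unspecified choice among the semigroups with the given generator. So one such semigroup has to be
  constructed, and the Euler scheme has to converge to every one of them, although a
  \<open>C0_semigroup\<close> is not contractive by definition. Moreover, the operators are defined
  through sequences in a form domain of honest functions, and the form at a limit is known only as a
  limit of values. Lattice operations are therefore applied to members of the form domain alone,
  where values at points and on the boundary make sense, and only the inequality between the
  \<open>L\<^sup>2\<close> limits is kept. The passage to the limit rests on one fact: if the
  energies tend to the minimum \<open>- (f, u)\<close>, the sequence converges to \<open>u\<close>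
  in norm. The test functions, which are the domain for the Dirichlet form, are not closed under
  absolute value and minimum, and the smoothing that repairs this must not raise the form. For this
  the weak derivatives of an absolute value are obtained by duality from an estimate, without a
  chain rule.\<close>

lemma eventually_at_right_0_ex:
  fixes P :: "real \<Rightarrow> bool"
  assumes "\<forall>\<^sub>F s in at_right 0. P s" shows "\<exists>s>0. P s"
proof -
  obtain b where "b > 0" "\<And>y. 0 < y \<Longrightarrow> y < b \<Longrightarrow> P y" using assms unfolding eventually_at_right_field by auto
  then show ?thesis by (intro exI[of _ "b/2"]) auto
qed

lemma norm_triangle3: "norm (a + b + c) \<le> norm a + norm b + norm c" for a b c :: "'b::real_normed_vector"
  using norm_triangle_ineq[of "a + b" c] norm_triangle_ineq[of a b] by simp

text \<open>Banach-Steinhaus on a complete subspace of a possibly incomplete space, for maps that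
  are linear on \<open>H\<close> only. In place of Baire's theorem it rests on the remark that one
  of \<open>x + h\<close> and \<open>x - h\<close> has an image of norm at least
  \<open>norm (T n h)\<close>.\<close>

lemma uniform_boundedness_sequence:
  fixes H :: "'b::real_normed_vector set" and T :: "nat \<Rightarrow> 'b \<Rightarrow> 'b"
  assumes H: "subspace H" "complete H"
    and lin: "\<And>n c f g. f \<in> H \<Longrightarrow> g \<in> H \<Longrightarrow> T n (c *\<^sub>R f + g) = c *\<^sub>R T n f + T n g"
    and bdd: "\<And>n. \<exists>C. \<forall>f\<in>H. norm (T n f) \<le> C * norm f"
    and pw: "\<And>f. f \<in> H \<Longrightarrow> \<exists>K. \<forall>n. norm (T n f) \<le> K"
  shows "\<exists>M. \<forall>n. \<forall>f\<in>H. norm (T n f) \<le> M * norm f"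
proof (rule ccontr)
  assume neg: "\<not> ?thesis"
  have T0: "T n 0 = 0" for n
    using lin[of 0 0 n 1] subspace_0[OF H(1)] by simp
  have big: "\<exists>n. \<exists>f\<in>H. norm f = 1 \<and> norm (T n f) > M" for M
  proof -
    define M' where "M' = max M 0"
    obtain n f where nf: "f \<in> H" "norm (T n f) > M' * norm f" using neg by (meson not_le)
    have "f \<noteq> 0" using nf T0 by auto
    let ?g = "(1 / norm f) *\<^sub>R f"
    have g: "?g \<in> H" using H nf subspace_scale by blast
    have "T n ?g = (1 / norm f) *\<^sub>R T n f"
      using lin[of f 0 n "1 / norm f"] nf(1) subspace_0[OF H(1)] T0 by simp
    then have "norm (T n ?g) = norm (T n f) / norm f" by simp
    also have "\<dots> > M'" using nf \<open>f \<noteq> 0\<close> by (simp add: field_simps)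
    finally show ?thesis using g \<open>f \<noteq> 0\<close> unfolding M'_def
      by (intro exI[of _ n] bexI[of _ ?g]) auto
  qed
  \<comment> \<open>Gliding hump: each step moves by \<open>3\<^sup>-\<^sup>k\<close> in a direction in which the \<open>k\<close>-th operator is large.\<close>
  have hump: "\<exists>y\<in>H. norm (y - x) \<le> (1/3)^k \<and> (\<exists>n. \<forall>z\<in>H. norm (z - y) \<le> (1/3)^k / 2 \<longrightarrow> norm (T n z) \<ge> real k)"
    if x: "x \<in> H" for x k
  proof -
    \<comment> \<open>\<open>C\<close> is the norm of \<open>T n\<close> and \<open>f\<close>
      attains it up to the factor \<open>3/4\<close>. On the ball of radius \<open>r / 2\<close>
      about \<open>y\<close> the perturbation is at most \<open>C * r / 2\<close>, hence less than
      \<open>2/3 * r * norm (T n f)\<close>, and a third of \<open>r * norm (T n f)\<close>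
      survives. This third is at least \<open>real k\<close> because of the factor
      \<open>4 * 3 ^ k\<close>.\<close>
    have ex: "\<exists>n C. (\<forall>f\<in>H. norm (T n f) \<le> C * norm f) \<and> 
      (\<exists>f\<in>H. norm f = 1 \<and> norm (T n f) > 3/4 * C \<and> norm (T n f) > 4 * real k * 3 ^ k)"
    proof -
      obtain n f where f: "f \<in> H" "norm f = 1" "norm (T n f) > 4 * real k * 3 ^ k" using big by blast
      obtain C0 where C0: "\<forall>f\<in>H. norm (T n f) \<le> C0 * norm f" using bdd by blast
      define S where "S = {norm (T n g) | g. g \<in> H \<and> norm g = 1}"
      have S: "bdd_above S" "norm (T n f) \<in> S" unfolding S_def using C0 f by (force intro!: bdd_aboveI[of _ C0])+
      define C where "C = Sup S"
      have Cge: "norm (T n f) \<le> C" unfolding C_def using S cSup_upper by blast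
      then have Cpos: "C > 0" using f(3) by (smt (verit) mult_nonneg_nonneg of_nat_0_le_iff zero_le_power)
      have Cb: "norm (T n g) \<le> C * norm g" if g: "g \<in> H" for g
      proof (cases "g = 0")
        case False
        let ?g = "(1 / norm g) *\<^sub>R g"
        have gH: "?g \<in> H" using H g subspace_scale by blast
        have "T n ?g = (1 / norm g) *\<^sub>R T n g"
          using lin[of g 0 n "1 / norm g"] g subspace_0[OF H(1)] T0 by simp
        then have "norm (T n ?g) = norm (T n g) / norm g" by simp
        moreover have "norm (T n ?g) \<in> S" unfolding S_def using gH False by force
        ultimately have "norm (T n g) / norm g \<le> C" unfolding C_def using S cSup_upper by metis
        then show ?thesis using False by (simp add: field_simps)
      qed (simp add: T0)
      have "3/4 * C < C" using Cpos by simp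
      then have m: "max (3/4 * C) (4 * real k * 3 ^ k) < C \<or> C = norm (T n f)" using Cge f(3) by linarith
      have "\<exists>g\<in>H. norm g = 1 \<and> norm (T n g) > 3/4 * C \<and> norm (T n g) > 4 * real k * 3 ^ k"
      proof (cases "C = norm (T n f)")
        case True then show ?thesis using f Cpos by auto
      next
        case False
        then have "max (3/4 * C) (4 * real k * 3 ^ k) < Sup S" using m C_def by simp
        then obtain s where "s \<in> S" "max (3/4 * C) (4 * real k * 3 ^ k) < s" using S less_cSupE by blast
        then show ?thesis unfolding S_def by auto
      qed
      then show ?thesis using Cb by blast
    qed
    then obtain n C f where C: "\<And>g. g \<in> H \<Longrightarrow> norm (T n g) \<le> C * norm g"
      and f: "f \<in> H" "norm f = 1" "norm (T n f) > 3/4 * C" "norm (T n f) > 4 * real k * 3 ^ k" by blast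
    define r where "r = (1/3 :: real)^k"
    have r: "r > 0" "r * 3 ^ k = 1" unfolding r_def by (auto simp: power_one_over)
    let ?p = "r *\<^sub>R f + x" and ?m = "(- r) *\<^sub>R f + x"
    have pm: "?p \<in> H" "?m \<in> H" using H x f subspace_add subspace_scale by metis+
    have "T n ?p = r *\<^sub>R T n f + T n x" "T n ?m = (- r) *\<^sub>R T n f + T n x" using lin x f by blast+
    \<comment> \<open>The images of \<open>x + r f\<close> and \<open>x - r f\<close> differ by
      \<open>2 r T n f\<close>, so at least one of them is as long as
      \<open>r * norm (T n f)\<close>. Which sign wins is irrelevant.\<close>
    then have "T n ?p - T n ?m = (2 * r) *\<^sub>R T n f" by (simp add: scaleR_2[symmetric])
    then have "norm (T n ?p - T n ?m) = 2 * r * norm (T n f)" using r by simp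
    then have "norm (T n ?p) + norm (T n ?m) \<ge> 2 * r * norm (T n f)" by (metis norm_triangle_ineq4)
    then have "norm (T n ?p) \<ge> r * norm (T n f) \<or> norm (T n ?m) \<ge> r * norm (T n f)" by linarith
    moreover have "norm (?p - x) \<le> r" "norm (?m - x) \<le> r" using f r by auto
    ultimately obtain y where y: "y \<in> H" "norm (y - x) \<le> r" "norm (T n y) \<ge> r * norm (T n f)" using pm by blast
    have "norm (T n z) \<ge> real k" if z: "z \<in> H" "norm (z - y) \<le> r / 2" for z
    proof -
      have zy: "z - y \<in> H" using H z y subspace_diff by blast
      have "T n z = T n (z - y) + T n y" using lin[OF zy y(1), of n 1] by simp
      then have 1: "norm (T n z) \<ge> norm (T n y) - norm (T n (z - y))"
        using norm_diff_ineq[of "T n y" "T n (z - y)"] by (simp add: add.commute)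
      have "norm (T n f) \<le> C" using C[OF f(1)] f(2) by simp
      then have "C \<ge> 0" using norm_ge_zero order_trans by blast
      then have "norm (T n (z - y)) \<le> C * (r / 2)" using order_trans[OF C[OF zy] mult_left_mono[OF z(2)]] by simp
      moreover have "r * norm (T n f) > r * (3/4 * C)" using f(3) r by (intro mult_strict_left_mono) auto
      ultimately have "norm (T n z) \<ge> r * norm (T n f) * (1/3)" using 1 y(3) by (simp add: algebra_simps)
      moreover have "r * norm (T n f) \<ge> r * (4 * real k * 3 ^ k)" using f(4) r by (intro mult_left_mono) auto
      moreover have "r * (4 * real k * 3 ^ k) = 4 * real k" using r(2) by (metis mult.assoc mult.commute mult.right_neutral)
      ultimately show ?thesis by linarith
    qed
    then show ?thesis using y unfolding r_def by blast
  qed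
  from hump have "\<forall>k x. \<exists>y. x \<in> H \<longrightarrow> y \<in> H \<and> norm (y - x) \<le> (1/3)^k \<and> (\<exists>n. \<forall>z\<in>H. norm (z - y) \<le> (1/3)^k / 2 \<longrightarrow> norm (T n z) \<ge> real k)" by metis
  then obtain Y where Y: "\<And>k x. x \<in> H \<Longrightarrow> Y k x \<in> H \<and> norm (Y k x - x) \<le> (1/3)^k \<and> 
     (\<exists>n. \<forall>z\<in>H. norm (z - Y k x) \<le> (1/3)^k / 2 \<longrightarrow> norm (T n z) \<ge> real k)" by metis
  \<comment> \<open>Step number \<open>Suc k\<close> has length at most
    \<open>(1/3) ^ Suc k\<close>, so everything after \<open>X k\<close> stays within
    \<open>(1/3) ^ k / 2\<close> of it. For positive \<open>k\<close> this is exactly the radius on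
    which the operator chosen at stage \<open>k\<close> remains large.\<close>
  define X where "X = rec_nat 0 (\<lambda>k x. Y (Suc k) x)"
  have XS: "X (Suc k) = Y (Suc k) (X k)" and X00: "X 0 = 0" for k unfolding X_def by auto
  have XH: "X k \<in> H" for k by (induction k) (use XS X00 Y subspace_0[OF H(1)] in auto)
  have step: "norm (X (Suc k) - X k) \<le> (1/3)^Suc k" for k using Y[OF XH, of "Suc k"] XS by metis
  have dist: "norm (X (k + m) - X k) \<le> (1/3)^k / 2 * (1 - (1/3)^m)" for k m
  proof (induction m)
    case (Suc m)
    have "norm (X (k + Suc m) - X k) \<le> norm (X (Suc (k + m)) - X (k + m)) + norm (X (k + m) - X k)"
      by (metis add_Suc_right norm_triangle_ineq diff_add_cancel add_diff_eq)
    also have "\<dots> \<le> (1/3)^Suc (k+m) + (1/3)^k / 2 * (1 - (1/3)^m)" using step Suc add_mono by blast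
    also have "\<dots> = (1/3)^k / 2 * (1 - (1/3)^Suc m)" by (simp add: power_add field_simps)
    finally show ?case .
  qed simp
  have dist': "norm (X (k + m) - X k) \<le> (1/3)^k / 2" for k m
    using dist[of k m] by (smt (verit) mult_left_le zero_le_power divide_nonneg_nonneg)
  have "Cauchy X"
  proof (rule metric_CauchyI)
    fix e :: real assume "e > 0"
    obtain N where N: "(1/3::real)^N < e" using \<open>e > 0\<close> real_arch_pow_inv[of e "1/3"] by auto
    have "dist (X m) (X n) < e" if "m \<ge> N" "n \<ge> N" for m n
    proof -
      have "norm (X m - X N) \<le> (1/3)^N / 2" "norm (X n - X N) \<le> (1/3)^N / 2" 
        using dist'[of N "m - N"] dist'[of N "n - N"] that by auto
      then have "dist (X m) (X N) \<le> (1/3)^N / 2" "dist (X n) (X N) \<le> (1/3)^N / 2" by (auto simp: dist_norm)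
      then show ?thesis using N dist_triangle2[of "X m" "X n" "X N"] by linarith
    qed
    then show "\<exists>M. \<forall>m\<ge>M. \<forall>n\<ge>M. dist (X m) (X n) < e" by blast
  qed
  then obtain x where x: "x \<in> H" "X \<longlonglongrightarrow> x" using H(2) XH unfolding complete_def by blast
  have lim: "norm (x - X k) \<le> (1/3)^k / 2" for k
  proof (rule LIMSEQ_le_const2)
    show "(\<lambda>m. norm (X (m + k) - X k)) \<longlonglongrightarrow> norm (x - X k)"
      using LIMSEQ_ignore_initial_segment[OF x(2), of k] by (intro tendsto_intros)
    show "\<exists>N. \<forall>n\<ge>N. norm (X (n + k) - X k) \<le> (1/3)^k / 2" using dist'[of k] by (auto simp: add.commute)
  qed
  obtain K where K: "\<And>n. norm (T n x) \<le> K" using pw x by blast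
  obtain k where k: "real (Suc k) > K" by (meson less_Suc_eq of_nat_less_iff order_less_trans reals_Archimedean2)
  obtain n where "\<forall>z\<in>H. norm (z - X (Suc k)) \<le> (1/3)^(Suc k) / 2 \<longrightarrow> norm (T n z) \<ge> real (Suc k)"
    using Y[OF XH, of "Suc k" k] XS by metis
  then have "norm (T n x) \<ge> real (Suc k)" using x lim by blast
  then show False using K[of n] k by linarith
qed

text \<open>The hypotheses of the Lumer-Phillips theorem, for an operator given by its graph.
  \<open>H\<close> is a subspace rather than the whole type because the classes of functions on
  \<Omega> will form a subspace of a type that does not depend on \<Omega>.\<close>

locale m_dissipative =
  fixes H :: "'b::real_normed_vector set" and A :: "('b \<times> 'b) set"
  assumes subspace_H: "subspace H" and complete_H: "complete H"
    and A_sub: "A \<subseteq> H \<times> H" and subspace_A: "subspace A"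
    and dissipative: "\<And>u w s. (u, w) \<in> A \<Longrightarrow> s > 0 \<Longrightarrow> norm u \<le> norm (u - s *\<^sub>R w)"
    and range: "\<And>f s. f \<in> H \<Longrightarrow> s > 0 \<Longrightarrow> \<exists>u w. (u, w) \<in> A \<and> u - s *\<^sub>R w = f"
    and dense: "\<And>f e. f \<in> H \<Longrightarrow> e > 0 \<Longrightarrow> \<exists>(u, w)\<in>A. norm (f - u) < e"
begin

lemma A_in: assumes "(u, w) \<in> A" shows "u \<in> H" "w \<in> H" using A_sub assms by auto

lemma A_add: "(u, w) \<in> A \<Longrightarrow> (u', w') \<in> A \<Longrightarrow> (u + u', w + w') \<in> A"
  using subspace_add[OF subspace_A] by fastforce

lemma A_scale: "(u, w) \<in> A \<Longrightarrow> (c *\<^sub>R u, c *\<^sub>R w) \<in> A"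
  using subspace_scale[OF subspace_A] by fastforce

lemma A_diff: "(u, w) \<in> A \<Longrightarrow> (u', w') \<in> A \<Longrightarrow> (u - u', w - w') \<in> A"
  using subspace_diff[OF subspace_A] by fastforce

lemmas H_add = subspace_add[OF subspace_H] and H_diff = subspace_diff[OF subspace_H]
  and H_scale = subspace_scale[OF subspace_H] and H_0 = subspace_0[OF subspace_H]

lemma H_lim: assumes "\<And>n. x n \<in> H" "x \<longlonglongrightarrow> l" shows "l \<in> H"
  using closed_sequentially[OF complete_imp_closed[OF complete_H]] assms by blast

lemma resolvent_inj:
  assumes "(u, w) \<in> A" "(u', w') \<in> A" "s > 0" "u - s *\<^sub>R w = u' - s *\<^sub>R w'"
  shows "u = u'" "w = w'"
proof -
  have "norm (u - u') \<le> norm ((u - u') - s *\<^sub>R (w - w'))" using dissipative A_diff assms by blast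
  also have "(u - u') - s *\<^sub>R (w - w') = 0" using assms(4) by (simp add: algebra_simps)
  finally show "u = u'" by simp
  then show "w = w'" using assms by simp
qed

text \<open>The resolvent, the inverse of \<open>1 - s A\<close>. The value at \<open>s = 0\<close>
  is set by hand, so that the Euler scheme and its estimates include \<open>t = 0\<close>.\<close>

definition J :: "real \<Rightarrow> 'b \<Rightarrow> 'b" where
  "J s f = (if s = 0 then f else THE u. \<exists>w. (u, w) \<in> A \<and> u - s *\<^sub>R w = f)"

lemma J_0 [simp]: "J 0 f = f" by (simp add: J_def)

lemma J_eqI: assumes "(u, w) \<in> A" "s > 0" "u - s *\<^sub>R w = f" shows "J s f = u"
proof -
  have "(THE u. \<exists>w. (u, w) \<in> A \<and> u - s *\<^sub>R w = f) = u"
    by (rule the_equality) (use assms resolvent_inj in blast)+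
  then show ?thesis using assms by (simp add: J_def)
qed

lemma J_graph: assumes "f \<in> H" "s > 0" shows "(J s f, (1/s) *\<^sub>R (J s f - f)) \<in> A"
proof -
  obtain u w where u: "(u, w) \<in> A" "u - s *\<^sub>R w = f" using range assms by blast
  then have "J s f = u" using J_eqI assms by blast
  moreover have "w = (1/s) *\<^sub>R (u - f)" using u(2)[symmetric] assms by simp
  ultimately show ?thesis using u by simp
qed

lemma J_in: assumes "f \<in> H" "s \<ge> 0" shows "J s f \<in> H"
  using J_graph[OF assms(1), of s] A_in assms by (cases "s = 0") auto

lemma J_lin: assumes "f \<in> H" "g \<in> H" "s \<ge> 0" shows "J s (c *\<^sub>R f + g) = c *\<^sub>R J s f + J s g"
proof (cases "s = 0")
  case False
  then have "(c *\<^sub>R J s f + J s g, c *\<^sub>R ((1/s) *\<^sub>R (J s f - f)) + (1/s) *\<^sub>R (J s g - g)) \<in> A"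
    using A_add[OF A_scale[OF J_graph] J_graph] assms by simp
  then show ?thesis by (rule J_eqI) (use False assms in \<open>auto simp: algebra_simps\<close>)
qed simp

lemma J_contraction: assumes "f \<in> H" "s \<ge> 0" shows "norm (J s f) \<le> norm f"
  using dissipative[OF J_graph[OF assms(1), of s], of s] assms by (cases "s = 0") auto

lemma J_commute_A: assumes "(u, w) \<in> A" "s \<ge> 0" shows "(J s u, J s w) \<in> A"
proof (cases "s = 0")
  case False
  have "J s (u - s *\<^sub>R w) = u" using J_eqI assms False by simp
  moreover have "J s ((- s) *\<^sub>R w + u) = (- s) *\<^sub>R J s w + J s u" using J_lin A_in assms by blast
  ultimately have "J s u - u = s *\<^sub>R J s w" by (simp add: algebra_simps)
  then have "J s w = (1/s) *\<^sub>R (J s u - u)" using False by simp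
  then show ?thesis using J_graph[of u s] A_in[OF assms(1)] False assms by simp
qed (use assms in simp)

lemma J_of_graph: assumes "(u, w) \<in> A" "s \<ge> 0" shows "J s u - u = s *\<^sub>R J s w"
proof (cases "s = 0")
  case False
  have "J s (u - s *\<^sub>R w) = u" using J_eqI assms False by simp
  moreover have "J s ((- s) *\<^sub>R w + u) = (- s) *\<^sub>R J s w + J s u" using J_lin A_in assms by blast
  ultimately show ?thesis by (simp add: algebra_simps)
qed simp

text \<open>Stated for any linear \<open>B\<close> that maps the graph into itself, since it is
  needed for another resolvent and, later on, for the operators of a semigroup.\<close>

lemma J_commute_graph:
  assumes B: "\<And>u w. (u, w) \<in> A \<Longrightarrow> (B u, B w) \<in> A" "f \<in> H" "s \<ge> 0"
    and lin: "\<And>c f g. f \<in> H \<Longrightarrow> g \<in> H \<Longrightarrow> B (c *\<^sub>R f + g) = c *\<^sub>R B f + B g"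
  shows "J s (B f) = B (J s f)"
proof (cases "s = 0")
  case False
  define w where "w = (1/s) *\<^sub>R (J s f - f)"
  have g: "(J s f, w) \<in> A" using J_graph assms False unfolding w_def by simp
  have f: "(-s) *\<^sub>R w + J s f = f" using False unfolding w_def by simp
  have "B ((-s) *\<^sub>R w + J s f) = (-s) *\<^sub>R B w + B (J s f)" using lin A_in[OF g] by blast
  then have "B (J s f) - s *\<^sub>R B w = B f" unfolding f by simp
  from J_eqI[OF B(1)[OF g] _ this] show ?thesis using False assms(3) by simp
qed simp

lemma J_commute: assumes "f \<in> H" "s \<ge> 0" "t \<ge> 0" shows "J s (J t f) = J t (J s f)"
  by (rule J_commute_graph) (use assms J_commute_A J_lin in auto)

text \<open>On the domain \<open>J s u - u = s *\<^sub>R J s w\<close> tends to \<open>0\<close>;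
  contractivity extends this to all of \<open>H\<close> by density.\<close>

lemma J_lim: assumes f: "f \<in> H" shows "((\<lambda>s. J s f) \<longlongrightarrow> f) (at_right 0)"
proof (rule tendstoI)
  fix e :: real assume e: "e > 0"
  obtain u w where u: "(u, w) \<in> A" "norm (f - u) < e/3" using dense[OF f, of "e/3"] e by auto
  let ?d = "e / (3 * (norm w + 1))"
  have d: "?d > 0" using e by (simp add: add_nonneg_pos)
  have "dist (J s f) f < e" if s: "s > 0" "s < ?d" for s
  proof -
    have "J s f = J s (f - u) + J s u" using J_lin[of "f - u" u s 1] f A_in[OF u(1)] H_diff s by simp
    then have "J s f - f = J s (f - u) + (J s u - u) + (u - f)" by simp
    then have "norm (J s f - f) \<le> norm (J s (f - u)) + norm (J s u - u) + norm (u - f)" by (simp only: norm_triangle3)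
    moreover have "norm (J s (f - u)) \<le> norm (f - u)" using J_contraction f A_in[OF u(1)] H_diff s by simp
    moreover have "norm (J s u - u) \<le> s * norm w" 
      using J_of_graph[OF u(1), of s] J_contraction[OF A_in(2)[OF u(1)], of s] s by simp
    moreover have "s * norm w < e/3"
    proof -
      have "s * norm w \<le> s * (norm w + 1)" using s by simp
      also have "\<dots> < ?d * (norm w + 1)" using s by (intro mult_strict_right_mono) (auto simp: add_nonneg_pos)
      also have "\<dots> = e/3" using add_nonneg_pos[of "norm w" 1] by (simp add: field_simps)
      finally show ?thesis .
    qed
    ultimately show ?thesis using u(2) by (simp add: dist_norm norm_minus_commute)
  qed
  then show "\<forall>\<^sub>F s in at_right 0. dist (J s f) f < e" unfolding eventually_at_right_field using d by blast
qed

text \<open>This is the identity \<open>(1 - a A) (1 - b A) = 1 - (a + b) A + a b A A\<close>.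
  Applied to \<open>J (a + b) f\<close>, it shows that two steps differ from one by
  \<open>a b\<close> times resolvents of \<open>f2\<close>, which is \<open>A A f\<close>.\<close>

lemma second_order:
  assumes "(f, f1) \<in> A" "(f1, f2) \<in> A" "a \<ge> 0" "b \<ge> 0"
  shows "norm (J a (J b f) - J (a + b) f) \<le> a * b * norm f2"
proof (cases "a = 0 \<or> b = 0")
  case True then show ?thesis by auto
next
  case False
  then have ab: "a > 0" "b > 0" "a + b > 0" using assms by auto
  let ?p = "J (a + b) f" and ?q = "J (a + b) f1" and ?r = "J (a + b) f2"
  note in_H = A_in[OF assms(1)] A_in[OF assms(2)]
  have pq: "(?p, ?q) \<in> A" and qr: "(?q, ?r) \<in> A" using J_commute_A assms ab by auto
  note in_H' = A_in[OF pq] A_in[OF qr]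
  have eq: "?p - f = (a + b) *\<^sub>R ?q" using J_of_graph assms ab by simp
  have 1: "J b ((a * b) *\<^sub>R ?r + f) = ?p - a *\<^sub>R ?q"
  proof (rule J_eqI)
    show "(?p - a *\<^sub>R ?q, ?q - a *\<^sub>R ?r) \<in> A" using A_diff A_scale pq qr by blast
    show "?p - a *\<^sub>R ?q - b *\<^sub>R (?q - a *\<^sub>R ?r) = (a * b) *\<^sub>R ?r + f"
      using eq by (simp add: algebra_simps)
  qed (use ab in auto)
  have 2: "J a (?p - a *\<^sub>R ?q) = ?p" using J_eqI pq ab by blast
  have "J b ((a * b) *\<^sub>R ?r + f) = (a * b) *\<^sub>R J b ?r + J b f" using J_lin in_H in_H' ab by simp
  then have "?p = J a ((a * b) *\<^sub>R J b ?r + J b f)" using 1 2 by simp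
  also have "\<dots> = (a * b) *\<^sub>R J a (J b ?r) + J a (J b f)" using J_lin J_in in_H in_H' ab by simp
  finally have "J a (J b f) - ?p = - ((a * b) *\<^sub>R J a (J b ?r))" by (simp add: algebra_simps)
  then have "norm (J a (J b f) - ?p) = a * b * norm (J a (J b ?r))" using ab by simp
  moreover have "norm (J a (J b ?r)) \<le> norm f2"
    using J_contraction J_in in_H in_H' ab by (meson less_imp_le order_trans)
  ultimately show ?thesis using ab by (simp add: mult_left_mono)
qed

text \<open>\<open>P ^^ n - Q ^^ n\<close> telescopes into \<open>n\<close> terms. Only
  \<open>Q\<close> is assumed contractive; for \<open>P\<close> a bound on the powers below
  \<open>n\<close> is enough, which is what a semigroup bounded on a compact interval of times
  provides.\<close>

lemma power_estimate:
  fixes P Q :: "'b \<Rightarrow> 'b"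
  assumes P: "\<And>f. f \<in> H \<Longrightarrow> P f \<in> H" and Q: "\<And>f. f \<in> H \<Longrightarrow> Q f \<in> H"
    and Plin: "\<And>f g. f \<in> H \<Longrightarrow> g \<in> H \<Longrightarrow> P (f - g) = P f - P g"
    and Qlin: "\<And>f g. f \<in> H \<Longrightarrow> g \<in> H \<Longrightarrow> Q (f - g) = Q f - Q g"
    and PQ: "\<And>f. f \<in> H \<Longrightarrow> P (Q f) = Q (P f)"
    and Q1: "\<And>f. f \<in> H \<Longrightarrow> norm (Q f) \<le> norm f"
    and PM: "\<And>k f. k < n \<Longrightarrow> f \<in> H \<Longrightarrow> norm ((P ^^ k) f) \<le> M * norm f"
    and f: "f \<in> H"
  shows "norm ((P ^^ n) f - (Q ^^ n) f) \<le> real n * M * norm (P f - Q f)"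
  using PM
proof (induction n)
  case (Suc n)
  have Pn: "(P ^^ k) g \<in> H" if "g \<in> H" for k g using that by (induction k) (auto simp: P)
  have Qn: "(Q ^^ k) g \<in> H" if "g \<in> H" for k g using that by (induction k) (auto simp: Q)
  have Pnlin: "(P ^^ k) (g - h) = (P ^^ k) g - (P ^^ k) h" if "g \<in> H" "h \<in> H" for k g h
    using that by (induction k) (auto simp: Plin Pn)
  have PnQ: "(P ^^ k) (Q g) = Q ((P ^^ k) g)" if "g \<in> H" for k g
    using that by (induction k) (auto simp: PQ Pn)
  have "(P ^^ Suc n) f - (Q ^^ Suc n) f = (P ^^ n) (P f - Q f) + Q ((P ^^ n) f - (Q ^^ n) f)"
    using f by (simp add: Pnlin Qlin Pn Qn P Q PnQ funpow_swap1)
  then have "norm ((P ^^ Suc n) f - (Q ^^ Suc n) f) \<le> norm ((P ^^ n) (P f - Q f)) + norm (Q ((P ^^ n) f - (Q ^^ n) f))"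
    using norm_triangle_ineq by metis
  also have "\<dots> \<le> M * norm (P f - Q f) + real n * M * norm (P f - Q f)"
  proof (rule add_mono)
    show "norm ((P ^^ n) (P f - Q f)) \<le> M * norm (P f - Q f)" using Suc.prems[of n "P f - Q f"] H_diff P Q f by simp
    have "norm (Q ((P ^^ n) f - (Q ^^ n) f)) \<le> norm ((P ^^ n) f - (Q ^^ n) f)" using Q1 H_diff Pn Qn f by simp
    also have "\<dots> \<le> real n * M * norm (P f - Q f)" using Suc.IH Suc.prems by simp
    finally show "norm (Q ((P ^^ n) f - (Q ^^ n) f)) \<le> real n * M * norm (P f - Q f)" .
  qed
  finally show ?case by (simp add: algebra_simps)
qed simp

section \<open>The dyadic Euler scheme\<close>

definition euler :: "nat \<Rightarrow> real \<Rightarrow> 'b \<Rightarrow> 'b" where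
  "euler k t = J (t / 2^k) ^^ (2^k)"

lemma Jpow_in: assumes "f \<in> H" "s \<ge> 0" shows "(J s ^^ n) f \<in> H"
  by (induction n) (use assms J_in in auto)

lemma Jpow_lin: assumes "f \<in> H" "g \<in> H" "s \<ge> 0" 
  shows "(J s ^^ n) (c *\<^sub>R f + g) = c *\<^sub>R (J s ^^ n) f + (J s ^^ n) g"
  by (induction n) (use assms J_lin Jpow_in in auto)

lemma Jpow_contraction: assumes "f \<in> H" "s \<ge> 0" shows "norm ((J s ^^ n) f) \<le> norm f"
proof (induction n)
  case (Suc n)
  have "norm ((J s ^^ Suc n) f) \<le> norm ((J s ^^ n) f)" using J_contraction[OF Jpow_in] assms by simp
  then show ?case using Suc by linarith
qed simp

lemma J_minus: assumes "f \<in> H" "g \<in> H" "s \<ge> 0" shows "J s (f - g) = J s f - J s g"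
  using J_lin[OF assms(2,1,3), of "-1"] by simp

lemma euler_in: assumes "f \<in> H" "t \<ge> 0" shows "euler k t f \<in> H" unfolding euler_def using Jpow_in assms by simp

lemma euler_lin: assumes "f \<in> H" "g \<in> H" "t \<ge> 0" shows "euler k t (c *\<^sub>R f + g) = c *\<^sub>R euler k t f + euler k t g"
  unfolding euler_def using Jpow_lin assms by simp

lemma euler_contraction: assumes "f \<in> H" "t \<ge> 0" shows "norm (euler k t f) \<le> norm f"
  unfolding euler_def using Jpow_contraction assms by simp

lemma euler_minus: assumes "f \<in> H" "g \<in> H" "s \<ge> 0" shows "euler k s (f - g) = euler k s f - euler k s g"
  using euler_lin[OF assms(2,1,3), of k "-1"] by simp

text \<open>With dyadic steps a refinement replaces each step by two steps of half the length. Each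
  of the \<open>2 ^ k\<close> replacements costs \<open>(t / 2 ^ Suc k)\<^sup>2 * norm f2\<close> by
  \<open>second_order\<close>, so the total errors are summable in \<open>k\<close>.\<close>

lemma euler_step:
  assumes "(f, f1) \<in> A" "(f1, f2) \<in> A" "t \<ge> 0"
  shows "norm (euler (Suc k) t f - euler k t f) \<le> t\<^sup>2 * norm f2 / 2 ^ (k + 2)"
proof -
  let ?h = "t / 2 ^ Suc k"
  have h: "?h \<ge> 0" "?h + ?h = t / 2 ^ k" using assms by auto
  have f: "f \<in> H" using A_in assms by blast
  have e: "euler (Suc k) t f = ((\<lambda>g. J ?h (J ?h g)) ^^ (2 ^ k)) f"
  proof -
    have "(\<lambda>g. J ?h (J ?h g)) = J ?h ^^ 2" by (auto simp: fun_eq_iff numeral_2_eq_2)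
    then show ?thesis unfolding euler_def by (simp add: funpow_mult)
  qed
  have "norm (euler (Suc k) t f - euler k t f) \<le> real (2 ^ k) * 1 * norm (J ?h (J ?h f) - J (t / 2 ^ k) f)"
    unfolding e unfolding euler_def
  proof (rule power_estimate)
    fix m and g :: 'b assume "g \<in> H"
    show "norm (((\<lambda>g. J ?h (J ?h g)) ^^ m) g) \<le> 1 * norm g"
    proof -
      have "((\<lambda>g. J ?h (J ?h g)) ^^ m) g = (J ?h ^^ (2 * m)) g" by (induction m) auto
      then show ?thesis using Jpow_contraction \<open>g \<in> H\<close> h by simp
    qed
  next
    fix g assume "g \<in> H"
    then show "J ?h (J ?h (J (t / 2 ^ k) g)) = J (t / 2 ^ k) (J ?h (J ?h g))"
      using J_commute J_in assms(3) h(1) by simp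
  qed (use J_in J_minus J_contraction h assms f in auto)
  also have "\<dots> \<le> 2 ^ k * (?h * ?h * norm f2)"
    using mult_left_mono[OF second_order[OF assms(1,2) h(1) h(1), unfolded h(2)], of "2 ^ k"] by simp
  also have "\<dots> = t\<^sup>2 * norm f2 / 2 ^ (k + 2)" by (simp add: power2_eq_square field_simps power_add)
  finally show ?thesis .
qed

lemma euler_dist:
  assumes "(f, f1) \<in> A" "(f1, f2) \<in> A" "t \<ge> 0"
  shows "norm (euler (k + m) t f - euler k t f) \<le> t\<^sup>2 * norm f2 / 2 ^ k"
proof -
  have "norm (euler (k + m) t f - euler k t f) \<le> t\<^sup>2 * norm f2 / 2 ^ k * (1 - 1 / 2 ^ m)"
  proof (induction m)
    case (Suc m)
    have "norm (euler (k + Suc m) t f - euler k t f) \<le> 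
      norm (euler (Suc (k + m)) t f - euler (k + m) t f) + norm (euler (k + m) t f - euler k t f)"
      by (metis add_Suc_right norm_triangle_ineq diff_add_cancel add_diff_eq)
    also have "\<dots> \<le> t\<^sup>2 * norm f2 / 2 ^ (k + m + 2) + t\<^sup>2 * norm f2 / 2 ^ k * (1 - 1 / 2 ^ m)"
      using euler_step[OF assms] Suc add_mono by blast
    \<comment> \<open>One factor of \<open>2\<close> is given away so that the errors are exactly
      the increments of \<open>1 - 1 / 2 ^ m\<close>.\<close>
    also have "\<dots> \<le> t\<^sup>2 * norm f2 / 2 ^ (k + m + 1) + t\<^sup>2 * norm f2 / 2 ^ k * (1 - 1 / 2 ^ m)"
      by (intro add_right_mono divide_left_mono) auto
    also have "\<dots> = t\<^sup>2 * norm f2 / 2 ^ k * (1 - 1 / 2 ^ Suc m)" by (simp add: power_add field_simps)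
    finally show ?case .
  qed simp
  also have "\<dots> \<le> t\<^sup>2 * norm f2 / 2 ^ k * 1" by (rule mult_left_mono) auto
  finally show ?thesis by simp
qed

text \<open>A resolvent gains one order: if \<open>(u, w)\<close> is in the graph then so is
  \<open>(J s u, J s w)\<close>, and \<open>J s w\<close> again lies in the domain. Hence the domain
  of the square of \<open>A\<close>, where \<open>second_order\<close> applies, is dense.\<close>

lemma dense2: assumes "f \<in> H" "e > 0" shows "\<exists>g g1 g2. (g, g1) \<in> A \<and> (g1, g2) \<in> A \<and> norm (f - g) < e"
proof -
  obtain u w where u: "(u, w) \<in> A" "norm (f - u) < e/2" using dense[OF assms(1), of "e/2"] assms by auto
  have "\<forall>\<^sub>F s in at_right 0. dist (J s u) u < e/2" by (rule tendstoD[OF J_lim[OF A_in(1)[OF u(1)]]]) (use assms in simp)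
  then obtain s where s: "s > 0" "dist (J s u) u < e/2" using eventually_at_right_0_ex by blast
  have "(J s u, J s w) \<in> A" using J_commute_A u s by simp
  moreover have "(J s w, (1/s) *\<^sub>R (J s w - w)) \<in> A" using J_graph A_in[OF u(1)] s by simp
  moreover have "norm (f - J s u) < e" using u s norm_triangle_ineq[of "f - u" "u - J s u"] 
    by (simp add: dist_norm norm_minus_commute)
  ultimately show ?thesis by blast
qed

lemma euler_convergent: assumes f: "f \<in> H" and t: "t \<ge> 0" shows "\<exists>l\<in>H. (\<lambda>k. euler k t f) \<longlonglongrightarrow> l"
proof -
  have "Cauchy (\<lambda>k. euler k t f)"
  proof (rule metric_CauchyI)
    fix e :: real assume "e > 0"
    \<comment> \<open>The error estimate needs the domain of the square; contractivity, uniform in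
      the index, carries the Cauchy property over to \<open>f\<close>.\<close>
    obtain g g1 g2 where g: "(g, g1) \<in> A" "(g1, g2) \<in> A" "norm (f - g) < e/4" using dense2[OF f, of "e/4"] \<open>e > 0\<close> by auto
    have gH: "g \<in> H" using A_in g by blast
    define C where "C = t\<^sup>2 * norm g2"
    have C0: "C \<ge> 0" unfolding C_def by simp
    obtain N where N: "(1/2)^N < e / (4 * (C + 1))"
    proof -
      have "e / (4 * (C + 1)) > 0" using \<open>e > 0\<close> C0 by (intro divide_pos_pos mult_pos_pos) linarith+
      then show ?thesis using real_arch_pow_inv[of "e / (4 * (C + 1))" "1/2"] that by auto
    qed
    have N': "C / 2 ^ N < e/4"
    proof -
      have "C / 2 ^ N \<le> (C + 1) * (1/2)^N" by (simp add: power_one_over field_simps)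
      also have "\<dots> < (C + 1) * (e / (4 * (C + 1)))" using N C0 by (intro mult_strict_left_mono) linarith+
      also have "\<dots> = e/4" using C0 by (simp add: field_simps)
      finally show ?thesis .
    qed
    have d: "norm (euler m t f - euler N t g) < e/2" if "m \<ge> N" for m
    proof -
      have "norm (euler m t g - euler N t g) \<le> C / 2 ^ N" using euler_dist[OF g(1,2) t, of N "m - N"] that unfolding C_def by simp
      moreover have "norm (euler m t f - euler m t g) \<le> norm (f - g)"
        using euler_minus[OF f gH t] euler_contraction[OF H_diff[OF f gH] t] by metis
      moreover have "norm (euler m t f - euler N t g) \<le> norm (euler m t f - euler m t g) + norm (euler m t g - euler N t g)"
        using norm_triangle_ineq[of "euler m t f - euler m t g" "euler m t g - euler N t g"] by simp
      ultimately show ?thesis using N' g(3) by linarith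
    qed
    have "dist (euler m t f) (euler n t f) < e" if "m \<ge> N" "n \<ge> N" for m n
      using d[OF that(1)] d[OF that(2)] by (metis dist_norm dist_triangle_half_l)
    then show "\<exists>M. \<forall>m\<ge>M. \<forall>n\<ge>M. dist (euler m t f) (euler n t f) < e" by blast
  qed
  then show ?thesis using completeE[OF complete_H, of "\<lambda>k. euler k t f"] euler_in[OF f t] by metis
qed

section \<open>The limit semigroup and its generator\<close>

definition sg :: "real \<Rightarrow> 'b \<Rightarrow> 'b" where "sg t f = lim (\<lambda>k. euler k t f)"

lemma sg_lim: assumes "f \<in> H" "t \<ge> 0" shows "(\<lambda>k. euler k t f) \<longlonglongrightarrow> sg t f"
  unfolding sg_def using euler_convergent[OF assms] limI by metis

lemma sg_in: assumes "f \<in> H" "t \<ge> 0" shows "sg t f \<in> H"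
  using H_lim[OF _ sg_lim[OF assms]] euler_in assms by blast

lemma sg_lin: assumes "f \<in> H" "g \<in> H" "t \<ge> 0" shows "sg t (c *\<^sub>R f + g) = c *\<^sub>R sg t f + sg t g"
proof (rule LIMSEQ_unique)
  show "(\<lambda>k. euler k t (c *\<^sub>R f + g)) \<longlonglongrightarrow> sg t (c *\<^sub>R f + g)" using sg_lim assms H_add H_scale by simp
  show "(\<lambda>k. euler k t (c *\<^sub>R f + g)) \<longlonglongrightarrow> c *\<^sub>R sg t f + sg t g"
    unfolding euler_lin[OF assms] by (intro tendsto_intros sg_lim assms)
qed

lemma sg_minus: assumes "f \<in> H" "g \<in> H" "s \<ge> 0" shows "sg s (f - g) = sg s f - sg s g"
  using sg_lin[OF assms(2,1,3), of "-1"] by simp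

lemma sg_contraction: assumes "f \<in> H" "t \<ge> 0" shows "norm (sg t f) \<le> norm f"
  by (rule LIMSEQ_le_const2[OF tendsto_norm[OF sg_lim[OF assms]]]) (use euler_contraction assms in auto)

lemma sg_0: assumes "f \<in> H" shows "sg 0 f = f"
proof -
  have "(J 0 ^^ n) f = f" for n by (induction n) auto
  then have "euler k 0 f = f" for k unfolding euler_def by simp
  then have "(\<lambda>k. euler k 0 f) \<longlonglongrightarrow> f" by simp
  then show ?thesis using LIMSEQ_unique[OF sg_lim[OF assms]] by simp
qed

lemma funpow_eq_compose:
  assumes "f \<in> H" "a \<ge> 0" "b \<ge> 0"
  shows "((\<lambda>g. J a (J b g)) ^^ n) f = (J a ^^ n) ((J b ^^ n) f)"
proof (induction n)
  case (Suc n)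
  have c: "(J a ^^ m) (J b g) = J b ((J a ^^ m) g)" if "g \<in> H" for m g
    using that by (induction m) (auto simp: J_commute Jpow_in assms)
  show ?case using Suc c[of "(J b ^^ n) f" n] Jpow_in assms by simp
qed simp

text \<open>\<open>euler k s\<close> after \<open>euler k t\<close> is not
  \<open>euler k (s + t)\<close>. The \<open>2 ^ k\<close> pairs of steps \<open>s / 2 ^ k\<close>
  and \<open>t / 2 ^ k\<close> are compared with single steps of length
  \<open>(s + t) / 2 ^ k\<close>, at a cost of \<open>s * t * norm f2 / 2 ^ k\<close> in
  total.\<close>

lemma sg_semigroup: assumes "f \<in> H" "s \<ge> 0" "t \<ge> 0" shows "sg (s + t) f = sg s (sg t f)"
proof -
  have core: "sg (s + t) f = sg s (sg t f)" if f: "(f, f1) \<in> A" "(f1, f2) \<in> A" for f f1 f2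
  proof -
    have fH: "f \<in> H" using A_in f by blast
    have bound: "norm (euler k s (euler k t f) - euler k (s + t) f) \<le> s * t * norm f2 / 2 ^ k" for k
    proof -
      let ?a = "s / 2^k" and ?b = "t / 2^k"
      have ab: "?a \<ge> 0" "?b \<ge> 0" "?a + ?b = (s + t) / 2 ^ k" using assms by (auto simp: add_divide_distrib)
      have c: "euler k s (euler k t f) = ((\<lambda>g. J ?a (J ?b g)) ^^ (2^k)) f"
        unfolding euler_def using funpow_eq_compose ab fH by simp
      have "norm (euler k s (euler k t f) - euler k (s + t) f) \<le> real (2 ^ k) * 1 * norm (J ?a (J ?b f) - J ((s + t) / 2 ^ k) f)"
        unfolding c unfolding euler_def
      proof (rule power_estimate)
        fix m and g :: 'b assume "g \<in> H"
        then show "norm (((\<lambda>g. J ?a (J ?b g)) ^^ m) g) \<le> 1 * norm g"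
          using Jpow_contraction[OF Jpow_in, of g ?b ?a m m] Jpow_contraction[of g ?b m] funpow_eq_compose ab by simp
      next
        fix g assume "g \<in> H"
        then show "J ?a (J ?b (J ((s + t) / 2 ^ k) g)) = J ((s + t) / 2 ^ k) (J ?a (J ?b g))"
          using J_commute J_in ab assms by simp
      qed (use J_in J_minus J_contraction ab assms fH in auto)
      also have "\<dots> \<le> 2 ^ k * (?a * ?b * norm f2)"
        using mult_left_mono[OF second_order[OF f ab(1,2), unfolded ab(3)], of "2 ^ k"] by simp
      also have "\<dots> = s * t * norm f2 / 2 ^ k" by simp
      finally show ?thesis .
    qed
    have 1: "(\<lambda>k. euler k s (euler k t f) - euler k (s + t) f) \<longlonglongrightarrow> 0"
    proof (rule Lim_null_comparison[OF always_eventually[OF allI[OF bound]]])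
      have "(\<lambda>k. (s * t * norm f2) * (1/2) ^ k) \<longlonglongrightarrow> (s * t * norm f2) * 0" by (intro tendsto_intros LIMSEQ_realpow_zero) auto
      then show "(\<lambda>k. s * t * norm f2 / 2 ^ k) \<longlonglongrightarrow> 0" by (simp add: power_one_over)
    qed
    have 2: "(\<lambda>k. euler k s (euler k t f) - euler k s (sg t f)) \<longlonglongrightarrow> 0"
    proof (rule Lim_null_comparison[OF always_eventually[OF allI]])
      show "norm (euler k s (euler k t f) - euler k s (sg t f)) \<le> norm (euler k t f - sg t f)" for k
        using euler_minus[of "euler k t f" "sg t f" s k] euler_contraction[of "euler k t f - sg t f" s k]
          H_diff sg_in euler_in fH assms by simp
      show "(\<lambda>k. norm (euler k t f - sg t f)) \<longlonglongrightarrow> 0" using sg_lim[OF fH assms(3)] LIM_zero tendsto_norm_zero by blast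
    qed
    have "(\<lambda>k. (euler k s (euler k t f) - euler k s (sg t f)) - (euler k s (euler k t f) - euler k (s + t) f) + euler k s (sg t f)) \<longlonglongrightarrow> 0 - 0 + sg s (sg t f)"
      by (intro tendsto_intros 1 2 sg_lim sg_in fH assms)
    then have "(\<lambda>k. euler k (s + t) f) \<longlonglongrightarrow> sg s (sg t f)" by simp
    moreover have "(\<lambda>k. euler k (s + t) f) \<longlonglongrightarrow> sg (s + t) f" using sg_lim[OF fH] assms by simp
    ultimately show ?thesis using LIMSEQ_unique by blast
  qed
  have "norm (sg (s + t) f - sg s (sg t f)) \<le> e" if e: "e > 0" for e
  proof -
    obtain g g1 g2 where g: "(g, g1) \<in> A" "(g1, g2) \<in> A" "norm (f - g) < e/2" using dense2[OF assms(1) half_gt_zero[OF e]] by blast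
    have gH: "g \<in> H" using A_in g by blast
    have st: "s + t \<ge> 0" using assms by simp
    have "sg (s + t) f - sg s (sg t f) = sg (s + t) (f - g) - sg s (sg t (f - g))"
      using core[OF g(1,2)] sg_minus assms gH sg_in st by simp
    then have "norm (sg (s + t) f - sg s (sg t f)) \<le> norm (sg (s + t) (f - g)) + norm (sg s (sg t (f - g)))"
      using norm_triangle_ineq4 by metis
    moreover have "norm (sg (s + t) (f - g)) \<le> norm (f - g)" using sg_contraction H_diff assms gH st by simp
    moreover have "norm (sg s (sg t (f - g))) \<le> norm (f - g)"
      using sg_contraction[of "sg t (f - g)" s] sg_contraction[of "f - g" t] sg_in H_diff assms gH by fastforce
    ultimately show ?thesis using g(3) by linarith
  qed
  then have "norm (sg (s + t) f - sg s (sg t f)) \<le> 0" by (rule field_le_epsilon) simp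
  then show ?thesis by simp
qed

lemma sg_graph_bound: assumes "(f, f1) \<in> A" "t \<ge> 0" shows "norm (sg t f - f) \<le> t * norm f1"
proof (rule LIMSEQ_le_const2)
  note fH = A_in[OF assms(1)]
  show "(\<lambda>k. norm (euler k t f - f)) \<longlonglongrightarrow> norm (sg t f - f)" by (intro tendsto_intros sg_lim fH assms)
  have "norm (euler k t f - f) \<le> t * norm f1" for k
  proof -
    let ?h = "t / 2^k"
    have h: "?h \<ge> 0" using assms by simp
    \<comment> \<open>Telescoping against the identity: each of the \<open>2 ^ k\<close> steps moves
      \<open>f\<close> by at most \<open>?h * norm f1\<close>.\<close>
    have id: "((\<lambda>x. x) ^^ n) f = f" for n :: nat by (induction n) auto
    have "norm ((J ?h ^^ (2^k)) f - ((\<lambda>x. x) ^^ (2^k)) f) \<le> real (2^k) * 1 * norm (J ?h f - f)"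
      by (rule power_estimate) (use J_in J_minus Jpow_contraction h fH in auto)
    also have "\<dots> \<le> 2^k * (?h * norm f1)"
      using J_of_graph[OF assms(1) h] J_contraction[OF fH(2) h] h assms by (simp add: divide_right_mono mult_left_mono)
    finally show ?thesis unfolding euler_def id by simp
  qed
  then show "\<exists>N. \<forall>k\<ge>N. norm (euler k t f - f) \<le> t * norm f1" by blast
qed

lemma sg_continuous: assumes f: "f \<in> H" shows "((\<lambda>t. sg t f) \<longlongrightarrow> f) (at_right 0)"
proof (rule tendstoI)
  fix e :: real assume e: "e > 0"
  obtain u w where u: "(u, w) \<in> A" "norm (f - u) < e/3" using dense[OF f, of "e/3"] e by auto
  let ?d = "e / (3 * (norm w + 1))"
  have d: "?d > 0" using e by (simp add: add_nonneg_pos)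
  have "dist (sg s f) f < e" if s: "s > 0" "s < ?d" for s
  proof -
    have "sg s f = sg s (f - u) + sg s u" using sg_minus[of f u s] f A_in[OF u(1)] s by simp
    then have "sg s f - f = sg s (f - u) + (sg s u - u) + (u - f)" by simp
    then have "norm (sg s f - f) \<le> norm (sg s (f - u)) + norm (sg s u - u) + norm (u - f)" by (simp only: norm_triangle3)
    moreover have "norm (sg s (f - u)) \<le> norm (f - u)" using sg_contraction f A_in[OF u(1)] H_diff s by simp
    moreover have "norm (sg s u - u) \<le> s * norm w" using sg_graph_bound[OF u(1), of s] s by simp
    moreover have "s * norm w < e/3"
    proof -
      have "s * norm w \<le> s * (norm w + 1)" using s by simp
      also have "\<dots> < ?d * (norm w + 1)" using s by (intro mult_strict_right_mono) (auto simp: add_nonneg_pos)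
      also have "\<dots> = e/3" using add_nonneg_pos[of "norm w" 1] by (simp add: field_simps)
      finally show ?thesis .
    qed
    ultimately show ?thesis using u(2) by (simp add: dist_norm norm_minus_commute)
  qed
  then show "\<forall>\<^sub>F s in at_right 0. dist (sg s f) f < e" unfolding eventually_at_right_field using d by blast
qed

text \<open>\<open>J t\<close> is the Euler approximation with a single step, so
  \<open>euler_dist\<close> from index \<open>0\<close> compares it with \<open>sg t\<close>. The
  remaining expansion of \<open>J t f\<close> is explicit, since
  \<open>J t f - f = t *\<^sub>R J t f1\<close>.\<close>

lemma sg_second_order:
  assumes "(f, f1) \<in> A" "(f1, f2) \<in> A" "t > 0"
  shows "norm ((1/t) *\<^sub>R (sg t f - f) - f1) \<le> 2 * t * norm f2"
proof -
  note fH = A_in[OF assms(1)]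
  have t: "t \<ge> 0" using assms by simp
  have "norm (sg t f - J t f) \<le> t\<^sup>2 * norm f2"
  proof (rule LIMSEQ_le_const2)
    show "(\<lambda>k. norm (euler k t f - J t f)) \<longlonglongrightarrow> norm (sg t f - J t f)" by (intro tendsto_intros sg_lim fH t)
    have "euler 0 t f = J t f" unfolding euler_def by simp
    then show "\<exists>N. \<forall>k\<ge>N. norm (euler k t f - J t f) \<le> t\<^sup>2 * norm f2" using euler_dist[OF assms(1,2) t, of 0] by simp
  qed
  moreover have "norm (J t f - f - t *\<^sub>R f1) \<le> t\<^sup>2 * norm f2"
  proof -
    have "J t f - f - t *\<^sub>R f1 = t *\<^sub>R (J t f1 - f1)" using J_of_graph[OF assms(1) t] by (simp add: algebra_simps)
    also have "\<dots> = (t * t) *\<^sub>R J t f2" using J_of_graph[OF assms(2) t] by simp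
    finally show ?thesis using J_contraction[OF A_in(2)[OF assms(2)] t] by (simp add: power2_eq_square mult_left_mono)
  qed
  moreover have "sg t f - f - t *\<^sub>R f1 = (sg t f - J t f) + (J t f - f - t *\<^sub>R f1)" by simp
  ultimately have "norm (sg t f - f - t *\<^sub>R f1) \<le> t\<^sup>2 * norm f2 + t\<^sup>2 * norm f2" using norm_triangle_le add_mono by metis
  moreover have "(1/t) *\<^sub>R (sg t f - f) - f1 = (1/t) *\<^sub>R (sg t f - f - t *\<^sub>R f1)" using assms by (simp add: algebra_simps)
  ultimately have eq: "norm ((1/t) *\<^sub>R (sg t f - f) - f1) = norm (sg t f - f - t *\<^sub>R f1) / t"
    and "norm (sg t f - f - t *\<^sub>R f1) \<le> t\<^sup>2 * norm f2 + t\<^sup>2 * norm f2" using assms by auto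
  then have le: "norm (sg t f - f - t *\<^sub>R f1) \<le> 2 * t\<^sup>2 * norm f2" using assms by (auto simp: algebra_simps)
  have "norm ((1/t) *\<^sub>R (sg t f - f) - f1) \<le> 2 * t\<^sup>2 * norm f2 / t" using divide_right_mono[OF le t] unfolding eq .
  also have "\<dots> = 2 * t * norm f2" using assms by (simp add: power2_eq_square)
  finally show ?thesis .
qed

text \<open>The expansion \<open>sg_second_order\<close> needs the domain of the square of
  \<open>A\<close>. \<open>J s f\<close> lies there and is close to \<open>f\<close> in the graph
  norm, and by \<open>sg_graph_bound\<close> the difference quotients of \<open>f - J s f\<close>
  are at most \<open>norm (f1 - g1)\<close>, uniformly in \<open>t\<close>.\<close>

lemma sg_generator_of_graph:
  assumes "(f, f1) \<in> A" shows "((\<lambda>t. (1/t) *\<^sub>R (sg t f - f)) \<longlongrightarrow> f1) (at_right 0)"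
proof (rule tendstoI)
  fix e :: real assume e: "e > 0"
  note fH = A_in[OF assms]
  have "\<forall>\<^sub>F s in at_right 0. dist (J s f1) f1 < e/4" by (rule tendstoD[OF J_lim[OF fH(2)]]) (use e in simp)
  then obtain s where s: "s > 0" "dist (J s f1) f1 < e/4" using eventually_at_right_0_ex by blast
  define g g1 g2 where gs: "g = J s f" "g1 = J s f1" "g2 = (1/s) *\<^sub>R (J s f1 - f1)"
  have g: "(g, g1) \<in> A" "(g1, g2) \<in> A" unfolding gs using J_commute_A assms s J_graph fH by auto
  have d: "(f - g, f1 - g1) \<in> A" using A_diff assms g by blast
  define d where "d = e / (4 * (norm g2 + 1))"
  have n: "norm g2 + 1 > 0" by (simp add: add_nonneg_pos)
  have dpos: "d > 0" unfolding d_def using e n by simp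
  have "dist ((1/t) *\<^sub>R (sg t f - f)) f1 < e" if t: "t > 0" "t < d" for t
  proof -
    have m: "sg t (f - g) = sg t f - sg t g" using sg_minus fH A_in[OF g(1)] t by simp
    have "(1/t) *\<^sub>R (sg t f - f) - f1 = (1/t) *\<^sub>R (sg t (f - g) - (f - g)) + ((1/t) *\<^sub>R (sg t g - g) - g1) + (g1 - f1)"
      unfolding m by (simp add: algebra_simps)
    then have "norm ((1/t) *\<^sub>R (sg t f - f) - f1) \<le> norm ((1/t) *\<^sub>R (sg t (f - g) - (f - g))) + norm ((1/t) *\<^sub>R (sg t g - g) - g1) + norm (g1 - f1)"
      by (simp only: norm_triangle3)
    moreover have "norm ((1/t) *\<^sub>R (sg t (f - g) - (f - g))) \<le> norm (f1 - g1)"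
    proof -
      have le: "norm (sg t (f - g) - (f - g)) \<le> t * norm (f1 - g1)" using sg_graph_bound[OF d] t by simp
      have "norm ((1/t) *\<^sub>R (sg t (f - g) - (f - g))) = norm (sg t (f - g) - (f - g)) / t" using t by simp
      also have "\<dots> \<le> t * norm (f1 - g1) / t" by (rule divide_right_mono[OF le]) (use t in simp)
      finally show ?thesis using t by simp
    qed
    moreover have "norm ((1/t) *\<^sub>R (sg t g - g) - g1) \<le> 2 * (t * norm g2)" using sg_second_order[OF g t(1)] by simp
    moreover have "t * norm g2 < e/4"
    proof -
      have "t * norm g2 \<le> t * (norm g2 + 1)" using t by simp
      also have "\<dots> < d * (norm g2 + 1)" using t n by (intro mult_strict_right_mono)
      also have "\<dots> = e/4" unfolding d_def using n by (simp add: field_simps)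
      finally show ?thesis .
    qed
    moreover have "norm (g1 - f1) < e/4" "norm (f1 - g1) < e/4" using s(2) unfolding gs by (auto simp: dist_norm norm_minus_commute)
    ultimately have "norm ((1/t) *\<^sub>R (sg t f - f) - f1) < e" by linarith
    then show ?thesis by (simp add: dist_norm)
  qed
  then show "\<forall>\<^sub>F t in at_right 0. dist ((1/t) *\<^sub>R (sg t f - f)) f1 < e" unfolding eventually_at_right_field using dpos by blast
qed

text \<open>The new point is that the graph cannot be enlarged. If \<open>w\<close> is the
  derivative of \<open>sg t u\<close> at \<open>0\<close>, the range condition gives
  \<open>(p, q)\<close> in the graph with \<open>p - q = u - w\<close>, so \<open>z = u - p\<close>
  has derivative \<open>z\<close>. Then \<open>sg t z\<close> is close to \<open>(1 + t) z\<close>,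
  which is longer than \<open>z\<close> and contradicts contractivity unless
  \<open>z = 0\<close>.\<close>

lemma sg_generator:
  assumes "u \<in> H" "w \<in> H"
  shows "((\<lambda>t. (1/t) *\<^sub>R (sg t u - u)) \<longlongrightarrow> w) (at_right 0) \<longleftrightarrow> (u, w) \<in> A"
proof
  assume lim: "((\<lambda>t. (1/t) *\<^sub>R (sg t u - u)) \<longlongrightarrow> w) (at_right 0)"
  obtain p q where pq: "(p, q) \<in> A" "p - 1 *\<^sub>R q = u - w" using range[of "u - w" 1] assms H_diff by auto
  define z where "z = u - p"
  have zH: "z \<in> H" unfolding z_def using H_diff assms A_in[OF pq(1)] by simp
  have wq: "w - q = z" unfolding z_def using pq(2) by (simp add: algebra_simps)
  have "((\<lambda>t. (1/t) *\<^sub>R (sg t u - u) - (1/t) *\<^sub>R (sg t p - p)) \<longlongrightarrow> w - q) (at_right 0)"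
    by (intro tendsto_intros lim sg_generator_of_graph pq)
  moreover have "\<forall>\<^sub>F t in at_right 0. (1/t) *\<^sub>R (sg t u - u) - (1/t) *\<^sub>R (sg t p - p) = (1/t) *\<^sub>R (sg t z - z)"
  proof -
    have "(1/t) *\<^sub>R (sg t u - u) - (1/t) *\<^sub>R (sg t p - p) = (1/t) *\<^sub>R (sg t z - z)" if "t > 0" for t
    proof -
      have m: "sg t z = sg t u - sg t p" unfolding z_def using sg_minus assms(1) A_in(1)[OF pq(1)] that by simp
      show ?thesis unfolding m unfolding z_def by (simp add: algebra_simps)
    qed
    then show ?thesis unfolding eventually_at_right_field by (intro exI[of _ 1]) auto
  qed
  ultimately have zlim: "((\<lambda>t. (1/t) *\<^sub>R (sg t z - z)) \<longlongrightarrow> z) (at_right 0)"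
    unfolding wq by (rule Lim_transform_eventually)
  have "z = 0"
  proof (rule ccontr)
    assume "z \<noteq> 0"
    then have "\<forall>\<^sub>F t in at_right 0. dist ((1/t) *\<^sub>R (sg t z - z)) z < norm z" by (intro tendstoD[OF zlim]) simp
    then obtain t where t: "t > 0" "dist ((1/t) *\<^sub>R (sg t z - z)) z < norm z" using eventually_at_right_0_ex by blast
    have "t *\<^sub>R ((1/t) *\<^sub>R (sg t z - z) - z) = sg t z - (1 + t) *\<^sub>R z" using t by (simp add: algebra_simps)
    then have "norm (sg t z - (1 + t) *\<^sub>R z) = t * norm ((1/t) *\<^sub>R (sg t z - z) - z)" using t norm_scaleR[of t "(1/t) *\<^sub>R (sg t z - z) - z"] by simp
    then have "norm (sg t z - (1 + t) *\<^sub>R z) < t * norm z" using t by (simp add: dist_norm)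
    moreover have "norm ((1 + t) *\<^sub>R z) \<le> norm (sg t z) + norm (sg t z - (1 + t) *\<^sub>R z)"
      using norm_triangle_sub[of "(1 + t) *\<^sub>R z" "sg t z"] by (simp add: norm_minus_commute)
    moreover have "norm ((1 + t) *\<^sub>R z) = norm z + t * norm z" using t by (simp add: distrib_right)
    moreover have "norm (sg t z) \<le> norm z" using sg_contraction[OF zH] t by simp
    ultimately show False by linarith
  qed
  then have "u = p" "w = q" using wq z_def by auto
  then show "(u, w) \<in> A" using pq by simp
qed (rule sg_generator_of_graph)

end

text \<open>
  \<open>T\<close> is not assumed to be contractive: uniform boundedness makes it locally bounded, and the
  \<open>n\<close>-th powers of \<open>T (t / n)\<close> and of the resolvent, which commute, are then compared by telescoping.
\<close>

locale generated_semigroup = m_dissipative H A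
  for H :: "'b::real_normed_vector set" and A :: "('b \<times> 'b) set" +
  fixes T :: "real \<Rightarrow> 'b \<Rightarrow> 'b"
  assumes T_in: "\<And>t f. t \<ge> 0 \<Longrightarrow> f \<in> H \<Longrightarrow> T t f \<in> H"
    and T_lin: "\<And>t c f g. t \<ge> 0 \<Longrightarrow> f \<in> H \<Longrightarrow> g \<in> H \<Longrightarrow> T t (c *\<^sub>R f + g) = c *\<^sub>R T t f + T t g"
    and T_bdd: "\<And>t. t \<ge> 0 \<Longrightarrow> \<exists>C. \<forall>f\<in>H. norm (T t f) \<le> C * norm f"
    and T_0: "\<And>f. f \<in> H \<Longrightarrow> T 0 f = f"
    and T_add: "\<And>s t f. s \<ge> 0 \<Longrightarrow> t \<ge> 0 \<Longrightarrow> f \<in> H \<Longrightarrow> T (s + t) f = T s (T t f)"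
    and T_cont: "\<And>f. f \<in> H \<Longrightarrow> ((\<lambda>t. T t f) \<longlongrightarrow> f) (at_right 0)"
    and T_gen: "\<And>u w. u \<in> H \<Longrightarrow> w \<in> H \<Longrightarrow> ((\<lambda>t. (1/t) *\<^sub>R (T t u - u)) \<longlongrightarrow> w) (at_right 0) \<longleftrightarrow> (u, w) \<in> A"
begin

section \<open>Convergence of the Euler scheme to any semigroup with this generator\<close>

lemma T_minus: assumes "f \<in> H" "g \<in> H" "s \<ge> 0" shows "T s (f - g) = T s f - T s g"
  using T_lin[OF assms(3,2,1), of "-1"] by simp

text \<open>Strong continuity at \<open>0\<close> gives no uniform bound by itself. Along times
  \<open>t n\<close> that tend to \<open>0\<close> the orbits converge, so the operators
  \<open>T (t n)\<close> are pointwise bounded, and the uniform boundedness principle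
  applies.\<close>

lemma local_bound: "\<exists>d>0. \<exists>M. \<forall>t f. 0 \<le> t \<longrightarrow> t < d \<longrightarrow> f \<in> H \<longrightarrow> norm (T t f) \<le> M * norm f"
proof (rule ccontr)
  assume neg: "\<not> ?thesis"
  have "\<exists>t f. 0 \<le> t \<and> t < 1 / real (Suc n) \<and> f \<in> H \<and> norm (T t f) > real n * norm f" for n
    using neg by (meson not_le zero_less_divide_1_iff of_nat_0_less_iff zero_less_Suc)
  then obtain t f where tf: "\<And>n. 0 \<le> t n \<and> t n < 1 / real (Suc n) \<and> f n \<in> H \<and> norm (T (t n) (f n)) > real n * norm (f n)" by metis
  have t0: "t \<longlonglongrightarrow> 0"
  proof (rule tendsto_sandwich[OF _ _ tendsto_const])
    show "\<forall>\<^sub>F n in sequentially. 0 \<le> t n" "\<forall>\<^sub>F n in sequentially. t n \<le> inverse (real (Suc n))" 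
      using tf by (auto intro!: always_eventually less_imp_le simp: inverse_eq_divide)
    show "(\<lambda>n. inverse (real (Suc n))) \<longlonglongrightarrow> 0" by (rule LIMSEQ_inverse_real_of_nat)
  qed
  have "\<exists>M. \<forall>n. \<forall>g\<in>H. norm (T (t n) g) \<le> M * norm g"
  proof (rule uniform_boundedness_sequence[OF subspace_H complete_H])
    fix g assume g: "g \<in> H"
    have "(\<lambda>n. T (t n) g) \<longlonglongrightarrow> g"
    proof (rule tendstoI)
      fix e :: real assume "e > 0"
      then have "\<forall>\<^sub>F s in at_right 0. dist (T s g) g < e" using tendstoD[OF T_cont[OF g]] by blast
      then obtain d where d: "d > 0" "\<And>s. 0 < s \<Longrightarrow> s < d \<Longrightarrow> dist (T s g) g < e" unfolding eventually_at_right_field by auto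
      have "\<forall>\<^sub>F n in sequentially. t n < d" using t0 d(1) by (simp add: order_tendstoD(2))
      then show "\<forall>\<^sub>F n in sequentially. dist (T (t n) g) g < e"
      proof eventually_elim
        case (elim n)
        \<comment> \<open>\<open>T_cont\<close> concerns positive times, so \<open>t n = 0\<close>
          is settled by \<open>T_0\<close>.\<close>
        then show ?case using d(2)[of "t n"] tf[of n] T_0[OF g] \<open>e > 0\<close> by (cases "t n = 0") auto
      qed
    qed
    then have "Bseq (\<lambda>n. T (t n) g)" using convergentI convergent_imp_Bseq by blast
    then show "\<exists>K. \<forall>n. norm (T (t n) g) \<le> K" unfolding Bseq_def by blast
  qed (use T_lin T_bdd tf in auto)
  then obtain M where M: "\<And>n g. g \<in> H \<Longrightarrow> norm (T (t n) g) \<le> M * norm g" by blast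
  obtain n where n: "real n > M" using reals_Archimedean2 by blast
  have "norm (T (t n) (f n)) \<le> M * norm (f n)" using M tf by blast
  also have "\<dots> \<le> real n * norm (f n)" using n by (intro mult_right_mono) auto
  finally show False using tf[of n] by linarith
qed

lemma bound: assumes t: "t \<ge> 0" shows "\<exists>M. \<forall>s f. 0 \<le> s \<longrightarrow> s \<le> t \<longrightarrow> f \<in> H \<longrightarrow> norm (T s f) \<le> M * norm f"
proof -
  obtain d M0 where d: "d > 0" and M0: "\<And>s f. 0 \<le> s \<Longrightarrow> s < d \<Longrightarrow> f \<in> H \<Longrightarrow> norm (T s f) \<le> M0 * norm f"
    using local_bound by blast
  \<comment> \<open>\<open>M \<ge> 1\<close> is wanted for \<open>M \<le> M ^ Suc n\<close>. The
    steps of length \<open>d / 2\<close> below stay strictly inside the interval on which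
    \<open>M\<close> is valid.\<close>
  define M where "M = max M0 1"
  have M: "norm (T s f) \<le> M * norm f" if "0 \<le> s" "s < d" "f \<in> H" for s f
    using M0[OF that] mult_right_mono[of M0 M "norm f"] unfolding M_def by simp
  have M1: "M \<ge> 1" unfolding M_def by simp
  have "\<forall>s f. 0 \<le> s \<longrightarrow> s \<le> real n * (d/2) \<longrightarrow> f \<in> H \<longrightarrow> norm (T s f) \<le> M ^ n * norm f" for n
  proof (induction n)
    case 0 then show ?case using T_0 by auto
  next
    case (Suc n)
    show ?case
    proof (intro allI impI)
      fix s f assume s: "0 \<le> s" "s \<le> real (Suc n) * (d/2)" and f: "f \<in> H"
      show "norm (T s f) \<le> M ^ Suc n * norm f"
      proof (cases "s < d")
        case True
        have "M \<le> M ^ Suc n" using M1 by (simp add: mult_le_cancel_left1)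
        then show ?thesis using M[OF s(1) True f] mult_right_mono[of M "M ^ Suc n" "norm f"] by simp
      next
        case False
        let ?r = "s - d/2"
        have r: "0 \<le> ?r" "?r \<le> real n * (d/2)" using False d s by (auto simp: algebra_simps)
        have "T s f = T (d/2) (T ?r f)" using T_add[of "d/2" ?r f] d r f by simp
        then have "norm (T s f) \<le> M * norm (T ?r f)" using M[of "d/2" "T ?r f"] T_in r f d by simp
        also have "\<dots> \<le> M * (M ^ n * norm f)" using Suc r f M1 by (intro mult_left_mono) auto
        finally show ?thesis by simp
      qed
    qed
  qed
  moreover obtain n where "t \<le> real n * (d/2)"
    using real_arch_simple[of "t / (d/2)"] d by (auto simp: field_simps)
  ultimately show ?thesis by (intro exI[of _ "M ^ n"]) auto
qed

text \<open>\<open>T t\<close> is bounded and commutes with \<open>T s\<close>, hence it may be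
  taken inside the limit of the difference quotients that characterizes the graph by
  \<open>T_gen\<close>.\<close>

lemma T_graph: assumes uw: "(u, w) \<in> A" and t: "t \<ge> 0" shows "(T t u, T t w) \<in> A"
proof -
  note uH = A_in[OF uw]
  obtain C where C: "\<And>f. f \<in> H \<Longrightarrow> norm (T t f) \<le> C * norm f" using T_bdd t by blast
  have "((\<lambda>s. (1/s) *\<^sub>R (T s u - u)) \<longlongrightarrow> w) (at_right 0)" using T_gen uH uw by blast
  then have "((\<lambda>s. norm ((1/s) *\<^sub>R (T s u - u) - w)) \<longlongrightarrow> 0) (at_right 0)" using LIM_zero tendsto_norm_zero by blast
  then have 0: "((\<lambda>s. C * norm ((1/s) *\<^sub>R (T s u - u) - w)) \<longlongrightarrow> 0) (at_right 0)" by (rule tendsto_mult_right_zero)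
  have "((\<lambda>s. (1/s) *\<^sub>R (T s (T t u) - T t u) - T t w) \<longlongrightarrow> 0) (at_right 0)"
  proof (rule Lim_null_comparison[OF _ 0])
    have "norm ((1/s) *\<^sub>R (T s (T t u) - T t u) - T t w) \<le> C * norm ((1/s) *\<^sub>R (T s u - u) - w)" if s: "s > 0" for s
    proof -
      have d: "T s u - u \<in> H" using H_diff T_in s uH by simp
      have "T s (T t u) = T t (T s u)" using T_add[of s t u] T_add[of t s u] s t uH by (simp add: add.commute)
      moreover have "T t 0 = 0" using T_lin[of t 0 0 1] H_0 t by simp
      moreover have "T t ((1/s) *\<^sub>R (T s u - u) + 0) = (1/s) *\<^sub>R T t (T s u - u) + T t 0"
        by (rule T_lin[OF t d H_0])
      moreover have "T t (T s u - u) = T t (T s u) - T t u" using T_minus T_in s t uH by simp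
      moreover have "T t ((1/s) *\<^sub>R (T s u - u) - w) = T t ((1/s) *\<^sub>R (T s u - u)) - T t w"
        by (rule T_minus[OF H_scale[OF d] uH(2) t])
      ultimately have "(1/s) *\<^sub>R (T s (T t u) - T t u) - T t w = T t ((1/s) *\<^sub>R (T s u - u) - w)" by simp
      then show ?thesis using C[OF H_diff[OF H_scale[OF d] uH(2)]] by simp
    qed
    then show "\<forall>\<^sub>F s in at_right 0. norm ((1/s) *\<^sub>R (T s (T t u) - T t u) - T t w) \<le> C * norm ((1/s) *\<^sub>R (T s u - u) - w)"
      unfolding eventually_at_right_field by (intro exI[of _ 1]) simp
  qed
  then have "((\<lambda>s. (1/s) *\<^sub>R (T s (T t u) - T t u)) \<longlongrightarrow> T t w) (at_right 0)" by (rule LIM_zero_cancel)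
  then show ?thesis using T_gen T_in uH t by blast
qed

lemma T_power: assumes "h \<ge> 0" "f \<in> H" shows "(T h ^^ n) f = T (real n * h) f"
proof (induction n)
  case (Suc n)
  have "(T h ^^ Suc n) f = T h (T (real n * h) f)" using Suc by simp
  also have "\<dots> = T (h + real n * h) f" using T_add assms by simp
  finally show ?case by (simp add: algebra_simps)
qed (use assms T_0 in simp)

text \<open>On the graph the quotients \<open>(T h g - g) / h\<close> and
  \<open>(J h g - g) / h\<close> have the same limit \<open>g1\<close>. Telescoping over
  \<open>2 ^ k\<close> steps of length \<open>h = t / 2 ^ k\<close> multiplies the error of one step
  by \<open>2 ^ k = t / h\<close>, so the total error is at most \<open>t * M\<close> times the norm
  of the difference of the quotients.\<close>

lemma euler_tendsto: assumes f: "f \<in> H" and t: "t \<ge> 0" shows "(\<lambda>k. euler k t f) \<longlonglongrightarrow> T t f"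
proof (cases "t = 0")
  case True
  then show ?thesis using sg_lim[OF f, of 0] sg_0[OF f] T_0[OF f] by simp
next
  case False
  then have t: "t > 0" using t by simp
  obtain M where M: "\<And>s f. 0 \<le> s \<Longrightarrow> s \<le> t \<Longrightarrow> f \<in> H \<Longrightarrow> norm (T s f) \<le> M * norm f" using bound t less_imp_le by meson
  have core: "(\<lambda>k. T t g - euler k t g) \<longlonglongrightarrow> 0" if g: "(g, g1) \<in> A" for g g1
  proof -
    note gH = A_in[OF g]
    have diff: "norm (T t g - euler k t g) \<le> t * M * norm ((1 / (t / 2^k)) *\<^sub>R (T (t / 2^k) g - J (t / 2^k) g))" for k
    proof -
      let ?h = "t / 2^k"
      have h: "?h \<ge> 0" "?h > 0" using t by auto
      have "norm ((T ?h ^^ (2^k)) g - (J ?h ^^ (2^k)) g) \<le> real (2^k) * M * norm (T ?h g - J ?h g)"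
      proof (rule power_estimate)
        fix m :: nat and f :: 'b assume m: "m < 2^k" and f: "f \<in> H"
        have "real m * ?h \<le> real (2^k) * ?h" using m h by (intro mult_right_mono) auto
        then have "real m * ?h \<le> t" by simp
        moreover have "0 \<le> real m * ?h" using h(1) by (rule mult_nonneg_nonneg[OF of_nat_0_le_iff])
        ultimately show "norm ((T ?h ^^ m) f) \<le> M * norm f" unfolding T_power[OF h(1) f] by (intro M f)
      next
        fix f assume "f \<in> H"
        then show "T ?h (J ?h f) = J ?h (T ?h f)" using J_commute_graph[of "T ?h" f ?h] T_graph T_lin h by simp
      qed (use T_in J_in T_minus J_minus J_contraction h gH in auto)
      moreover have "(T ?h ^^ (2^k)) g = T t g" using T_power[OF h(1) gH(1), of "2^k"] by simp
      moreover have "real (2^k) * M * norm (T ?h g - J ?h g) = t * M * norm ((1 / ?h) *\<^sub>R (T ?h g - J ?h g))"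
      proof -
        have "norm ((1 / ?h) *\<^sub>R (T ?h g - J ?h g)) = (1 / ?h) * norm (T ?h g - J ?h g)"
          unfolding norm_scaleR using h by (simp only: abs_of_pos zero_less_divide_1_iff)
        then show ?thesis using t by simp
      qed
      ultimately show ?thesis unfolding euler_def by simp
    qed
    have hlim: "filterlim (\<lambda>k. t / 2^k) (at_right 0) sequentially"
    proof -
      have "(\<lambda>k. t * (1/2) ^ k) \<longlonglongrightarrow> t * 0" by (intro tendsto_intros LIMSEQ_realpow_zero) auto
      then have "(\<lambda>k. t / 2^k) \<longlonglongrightarrow> 0" by (simp add: power_one_over)
      then show ?thesis using t by (intro tendsto_imp_filterlim_at_right) auto
    qed
    have 1: "((\<lambda>h. (1/h) *\<^sub>R (T h g - g)) \<longlongrightarrow> g1) (at_right 0)" using T_gen gH g by blast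
    have 2: "((\<lambda>h. (1/h) *\<^sub>R (J h g - g)) \<longlongrightarrow> g1) (at_right 0)"
    proof -
      have "\<forall>\<^sub>F h in at_right 0. J h g1 = (1/h) *\<^sub>R (J h g - g)" unfolding eventually_at_right_field 
        using J_of_graph[OF g] by (intro exI[of _ 1]) auto
      then show ?thesis by (rule Lim_transform_eventually[OF J_lim[OF gH(2)]])
    qed
    have "((\<lambda>h. (1/h) *\<^sub>R (T h g - g) - (1/h) *\<^sub>R (J h g - g)) \<longlongrightarrow> g1 - g1) (at_right 0)" by (rule tendsto_diff[OF 1 2])
    moreover have "(1/h) *\<^sub>R (T h g - g) - (1/h) *\<^sub>R (J h g - g) = (1/h) *\<^sub>R (T h g - J h g)" for h
      by (simp add: algebra_simps)
    ultimately have "((\<lambda>h. (1/h) *\<^sub>R (T h g - J h g)) \<longlongrightarrow> 0) (at_right 0)" by simp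
    then have "((\<lambda>h. t * M * norm ((1/h) *\<^sub>R (T h g - J h g))) \<longlongrightarrow> 0) (at_right 0)"
      by (intro tendsto_mult_right_zero tendsto_norm_zero)
    then have "(\<lambda>k. t * M * norm ((1 / (t / 2^k)) *\<^sub>R (T (t / 2^k) g - J (t / 2^k) g))) \<longlonglongrightarrow> 0"
      by (rule filterlim_compose[OF _ hlim])
    then show ?thesis by (rule Lim_null_comparison[OF always_eventually[OF allI[OF diff]]])
  qed
  \<comment> \<open>The scheme is known to converge to \<open>sg t f\<close> for every
    \<open>f\<close>, so it remains to identify two bounded linear maps that agree on a dense
    set.\<close>
  have "sg t f = T t f"
  proof -
    have coreq: "sg t g = T t g" if g: "(g, g1) \<in> A" for g g1
    proof -
      have "(\<lambda>k. T t g - (T t g - euler k t g)) \<longlonglongrightarrow> T t g - 0" by (intro tendsto_intros core[OF g])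
      then have "(\<lambda>k. euler k t g) \<longlonglongrightarrow> T t g" by simp
      then show ?thesis using LIMSEQ_unique[OF sg_lim[OF A_in(1)[OF g]]] t by simp
    qed
    have "norm (sg t f - T t f) < e" if e: "e > 0" for e
    proof -
      have M': "\<bar>M\<bar> + 1 > 0" by simp
      obtain g g1 where g: "(g, g1) \<in> A" "norm (f - g) < e / (\<bar>M\<bar> + 1)" using dense[OF f divide_pos_pos[OF e M']] by auto
      have gH: "g \<in> H" using A_in g by blast
      have fg: "f - g \<in> H" using H_diff f gH by simp
      have "sg t (f - g) = sg t f - sg t g" "T t (f - g) = T t f - T t g" using sg_minus T_minus f gH t by simp_all
      then have "sg t f - T t f = sg t (f - g) - T t (f - g)" using coreq[OF g(1)] by simp
      then have "norm (sg t f - T t f) \<le> norm (sg t (f - g)) + norm (T t (f - g))" using norm_triangle_ineq4 by metis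
      also have "\<dots> \<le> norm (f - g) + M * norm (f - g)" using sg_contraction[OF fg, of t] M[of t "f - g"] fg t by simp
      also have "\<dots> \<le> (\<bar>M\<bar> + 1) * norm (f - g)" by (simp add: algebra_simps mult_right_mono)
      also have "\<dots> < e" using g(2) M' by (simp add: field_simps)
      finally show ?thesis .
    qed
    from this[of "norm (sg t f - T t f)"] show ?thesis by (cases "sg t f = T t f") auto
  qed
  then show ?thesis using sg_lim[OF f, of t] t by simp
qed

end

subsection \<open>The Hilbert space of square integrable functions\<close>

lemma L2_measurable: "f \<in> L2 \<Omega> \<Longrightarrow> f \<in> borel_measurable (lebesgue_on \<Omega>)"
  and L2_square_integrable: "f \<in> L2 \<Omega> \<Longrightarrow> integrable (lebesgue_on \<Omega>) (\<lambda>x. (f x)\<^sup>2)"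
  by (auto simp: L2_def)

lemma L2_mult_integrable:
  assumes "f \<in> L2 \<Omega>" "g \<in> L2 \<Omega>" shows "integrable (lebesgue_on \<Omega>) (\<lambda>x. f x * g x)"
proof (rule Bochner_Integration.integrable_bound)
  show "integrable (lebesgue_on \<Omega>) (\<lambda>x. (f x)\<^sup>2 + (g x)\<^sup>2)" using assms by (auto simp: L2_def)
  show "(\<lambda>x. f x * g x) \<in> borel_measurable (lebesgue_on \<Omega>)" using assms by (auto simp: L2_def)
  show "AE x in lebesgue_on \<Omega>. norm (f x * g x) \<le> norm ((f x)\<^sup>2 + (g x)\<^sup>2)"
  proof (rule AE_I2)
    fix x
    have "0 \<le> (\<bar>f x\<bar> - \<bar>g x\<bar>)\<^sup>2" by simp
    then have "2 * (\<bar>f x\<bar> * \<bar>g x\<bar>) \<le> (f x)\<^sup>2 + (g x)\<^sup>2" unfolding power2_diff by simp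
    moreover have "0 \<le> \<bar>f x\<bar> * \<bar>g x\<bar>" by simp
    ultimately have "\<bar>f x\<bar> * \<bar>g x\<bar> \<le> (f x)\<^sup>2 + (g x)\<^sup>2" by linarith
    then show "norm (f x * g x) \<le> norm ((f x)\<^sup>2 + (g x)\<^sup>2)" by (simp add: abs_mult)
  qed
qed

lemma L2_zero [simp]: "(\<lambda>x. 0) \<in> L2 \<Omega>" by (simp add: L2_def)

lemma L2_lin: assumes "f \<in> L2 \<Omega>" "g \<in> L2 \<Omega>" shows "(\<lambda>x. c * f x + g x) \<in> L2 \<Omega>"
proof -
  have "(\<lambda>x. (c * f x + g x)\<^sup>2) = (\<lambda>x. c\<^sup>2 * (f x)\<^sup>2 + (2 * c) * (f x * g x) + (g x)\<^sup>2)"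
    by (auto simp: power2_eq_square algebra_simps)
  moreover have "integrable (lebesgue_on \<Omega>) (\<lambda>x. c\<^sup>2 * (f x)\<^sup>2 + (2 * c) * (f x * g x) + (g x)\<^sup>2)"
    using L2_mult_integrable[OF assms] assms by (auto simp: L2_def)
  ultimately show ?thesis using assms by (auto simp: L2_def)
qed

lemma L2_add: "f \<in> L2 \<Omega> \<Longrightarrow> g \<in> L2 \<Omega> \<Longrightarrow> (\<lambda>x. f x + g x) \<in> L2 \<Omega>"
  using L2_lin[of f \<Omega> g 1] by simp

lemma L2_scale: "f \<in> L2 \<Omega> \<Longrightarrow> (\<lambda>x. c * f x) \<in> L2 \<Omega>"
  using L2_lin[of f \<Omega> "\<lambda>x. 0" c] by simp

lemma L2_uminus: "f \<in> L2 \<Omega> \<Longrightarrow> (\<lambda>x. - f x) \<in> L2 \<Omega>"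
  using L2_scale[of f \<Omega> "-1"] by simp

lemma L2_diff: "f \<in> L2 \<Omega> \<Longrightarrow> g \<in> L2 \<Omega> \<Longrightarrow> (\<lambda>x. f x - g x) \<in> L2 \<Omega>"
  using L2_lin[of g \<Omega> f "-1"] by simp

lemma L2_cong_AE:
  assumes "f \<in> L2 \<Omega>" "AE x in lebesgue_on \<Omega>. f x = g x" "g \<in> borel_measurable (lebesgue_on \<Omega>)" shows "g \<in> L2 \<Omega>"
proof -
  have "integrable (lebesgue_on \<Omega>) (\<lambda>x. (f x)\<^sup>2) \<longleftrightarrow> integrable (lebesgue_on \<Omega>) (\<lambda>x. (g x)\<^sup>2)"
    using assms by (intro integrable_cong_AE) (auto simp: L2_def elim: eventually_mono)
  then show ?thesis using assms by (auto simp: L2_def)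
qed

lemma L2_inner_lin_left:
  assumes "f \<in> L2 \<Omega>" "g \<in> L2 \<Omega>" "h \<in> L2 \<Omega>"
  shows "L2_inner \<Omega> (\<lambda>x. c * f x + g x) h = c * L2_inner \<Omega> f h + L2_inner \<Omega> g h"
proof -
  have "L2_inner \<Omega> (\<lambda>x. c * f x + g x) h = (LINT x|lebesgue_on \<Omega>. c * (f x * h x) + g x * h x)"
    unfolding L2_inner_def by (simp add: algebra_simps)
  also have "\<dots> = c * L2_inner \<Omega> f h + L2_inner \<Omega> g h"
    unfolding L2_inner_def using L2_mult_integrable assms by (subst Bochner_Integration.integral_add) auto
  finally show ?thesis .
qed

lemma L2_inner_commute: "L2_inner \<Omega> f g = L2_inner \<Omega> g f"
  unfolding L2_inner_def by (simp add: mult.commute)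

lemma L2_inner_ge_0: "L2_inner \<Omega> f f \<ge> 0" unfolding L2_inner_def by simp

lemma L2_inner_cong_AE:
  assumes "f \<in> L2 \<Omega>" "g \<in> L2 \<Omega>" "f' \<in> L2 \<Omega>" "g' \<in> L2 \<Omega>"
    "AE x in lebesgue_on \<Omega>. f x = f' x" "AE x in lebesgue_on \<Omega>. g x = g' x"
  shows "L2_inner \<Omega> f g = L2_inner \<Omega> f' g'"
  unfolding L2_inner_def
  by (rule integral_cong_AE) (use assms in \<open>auto simp: L2_def elim: eventually_elim2\<close>)

lemma L2_inner_eq_0:
  assumes "f \<in> L2 \<Omega>" shows "L2_inner \<Omega> f f = 0 \<longleftrightarrow> (AE x in lebesgue_on \<Omega>. f x = 0)"
proof -
  have "L2_inner \<Omega> f f = 0 \<longleftrightarrow> (AE x in lebesgue_on \<Omega>. f x * f x = 0)"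
    unfolding L2_inner_def using L2_mult_integrable[OF assms assms] by (intro integral_nonneg_eq_0_iff_AE) auto
  then show ?thesis by simp
qed

lemma nn_integral_square: assumes "f \<in> L2 \<Omega>"
  shows "(\<integral>\<^sup>+x. ennreal ((f x)\<^sup>2) \<partial>lebesgue_on \<Omega>) = ennreal (L2_inner \<Omega> f f)"
  unfolding L2_inner_def using assms by (subst nn_integral_eq_integral) (auto simp: L2_def power2_eq_square)

text \<open>A type cannot depend on \<Omega>, so the quotient is taken once over the whole space.
  The relation is partial: functions outside \<open>L2 UNIV\<close> belong to no class.\<close>

definition l2_rel :: "('a::euclidean_space \<Rightarrow> real) \<Rightarrow> ('a \<Rightarrow> real) \<Rightarrow> bool" where
  "l2_rel f g \<longleftrightarrow> f \<in> L2 UNIV \<and> g \<in> L2 UNIV \<and> (AE x in lebesgue_on UNIV. f x = g x)"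

quotient_type (overloaded) 'a l2 = "'a::euclidean_space \<Rightarrow> real" / partial: l2_rel
proof (rule part_equivpI)
  show "\<exists>f. l2_rel f f" by (rule exI[of _ "\<lambda>x. 0"]) (simp add: l2_rel_def)
  show "symp l2_rel" by (auto intro!: sympI simp: l2_rel_def elim: eventually_mono)
  show "transp l2_rel" by (auto intro!: transpI simp: l2_rel_def elim: eventually_elim2)
qed

instantiation l2 :: (euclidean_space) real_inner
begin

lift_definition zero_l2 :: "'a l2" is "\<lambda>x. 0" by (simp add: l2_rel_def)
lift_definition plus_l2 :: "'a l2 \<Rightarrow> 'a l2 \<Rightarrow> 'a l2" is "\<lambda>f g x. f x + g x"
  by (auto simp: l2_rel_def L2_add elim: eventually_elim2)
lift_definition uminus_l2 :: "'a l2 \<Rightarrow> 'a l2" is "\<lambda>f x. - f x"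
  by (auto simp: l2_rel_def L2_uminus elim: eventually_mono)
lift_definition minus_l2 :: "'a l2 \<Rightarrow> 'a l2 \<Rightarrow> 'a l2" is "\<lambda>f g x. f x - g x"
  by (auto simp: l2_rel_def L2_diff elim: eventually_elim2)
lift_definition scaleR_l2 :: "real \<Rightarrow> 'a l2 \<Rightarrow> 'a l2" is "\<lambda>c f x. c * f x"
  by (auto simp: l2_rel_def L2_scale elim: eventually_mono)
lift_definition inner_l2 :: "'a l2 \<Rightarrow> 'a l2 \<Rightarrow> real" is "L2_inner UNIV"
  by (auto simp: l2_rel_def intro!: L2_inner_cong_AE)
definition norm_l2 :: "'a l2 \<Rightarrow> real" where "norm_l2 x = sqrt (x \<bullet> x)"
definition dist_l2 :: "'a l2 \<Rightarrow> 'a l2 \<Rightarrow> real" where "dist_l2 x y = norm (x - y)"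
definition sgn_l2 :: "'a l2 \<Rightarrow> 'a l2" where "sgn_l2 x = inverse (norm x) *\<^sub>R x"
definition uniformity_l2 :: "('a l2 \<times> 'a l2) filter" where
  "uniformity_l2 = (INF e\<in>{0<..}. principal {(x, y). dist x y < e})"
definition open_l2 :: "'a l2 set \<Rightarrow> bool" where
  "open_l2 U = (\<forall>x\<in>U. \<forall>\<^sub>F (x', y) in uniformity. x' = x \<longrightarrow> y \<in> U)"

instance
proof
  fix x y z :: "'a l2" and a b :: real
  show "x + y + z = x + (y + z)" by transfer (auto simp: l2_rel_def L2_add algebra_simps)
  show "x + y = y + x" by transfer (auto simp: l2_rel_def L2_add algebra_simps)
  show "0 + x = x" by transfer (auto simp: l2_rel_def)
  show "- x + x = 0" by transfer (auto simp: l2_rel_def)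
  show "x - y = x + - y" by transfer (auto simp: l2_rel_def L2_diff)
  show "a *\<^sub>R (x + y) = a *\<^sub>R x + a *\<^sub>R y" by transfer (auto simp: l2_rel_def L2_add L2_scale algebra_simps)
  show "(a + b) *\<^sub>R x = a *\<^sub>R x + b *\<^sub>R x" by transfer (auto simp: l2_rel_def L2_add L2_scale algebra_simps)
  show "a *\<^sub>R b *\<^sub>R x = (a * b) *\<^sub>R x" by transfer (auto simp: l2_rel_def L2_scale algebra_simps)
  show "1 *\<^sub>R x = x" by transfer (auto simp: l2_rel_def)
  show "x \<bullet> y = y \<bullet> x" by transfer (rule L2_inner_commute)
  show "(x + y) \<bullet> z = x \<bullet> z + y \<bullet> z" 
    by transfer (use L2_inner_lin_left[where c=1] in \<open>auto simp: l2_rel_def\<close>)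
  show "a *\<^sub>R x \<bullet> y = a * (x \<bullet> y)"
    by transfer (use L2_inner_lin_left[where g="\<lambda>x. 0"] in \<open>auto simp: l2_rel_def L2_inner_def\<close>)
  show "0 \<le> x \<bullet> x" by transfer (rule L2_inner_ge_0)
  show "x \<bullet> x = 0 \<longleftrightarrow> x = 0" by transfer (auto simp: l2_rel_def L2_inner_eq_0)
qed (simp_all add: norm_l2_def dist_l2_def sgn_l2_def uniformity_l2_def open_l2_def)

end

lemma nn_integral_square_rep:
  fixes x y :: "'a::euclidean_space l2"
  shows "(\<integral>\<^sup>+z. ennreal ((rep_l2 x z - rep_l2 y z)\<^sup>2) \<partial>lebesgue_on UNIV) = ennreal ((norm (x - y))\<^sup>2)"
proof -
  have r: "rep_l2 x \<in> L2 UNIV" "rep_l2 y \<in> L2 UNIV" for x y :: "'a l2"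
    using Quotient_rep_reflp[OF Quotient_l2] by (auto simp: l2_rel_def)
  have a: "x = abs_l2 (rep_l2 x)" for x :: "'a l2" using Quotient_abs_rep[OF Quotient_l2] by metis
  have "(norm (x - y))\<^sup>2 = (x - y) \<bullet> (x - y)" by (simp add: power2_norm_eq_inner)
  also have "\<dots> = L2_inner UNIV (\<lambda>z. rep_l2 x z - rep_l2 y z) (\<lambda>z. rep_l2 x z - rep_l2 y z)"
  proof -
    have "x - y = abs_l2 (\<lambda>z. rep_l2 x z - rep_l2 y z)"
      using minus_l2.abs_eq[of "rep_l2 x" "rep_l2 y"] r a[symmetric] by (simp add: l2_rel_def)
    moreover have "l2_rel (\<lambda>z. rep_l2 x z - rep_l2 y z) (\<lambda>z. rep_l2 x z - rep_l2 y z)"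
      using L2_diff[OF r(1) r(1)] by (simp add: l2_rel_def)
    ultimately show ?thesis by (simp only: inner_l2.abs_eq)
  qed
  finally show ?thesis using nn_integral_square[OF L2_diff[OF r]] by metis
qed

text \<open>The Riesz-Fischer theorem: a rapidly Cauchy subsequence converges almost everywhere, and
  Fatou's lemma turns the pointwise limit into a limit in norm.\<close>

instance l2 :: (euclidean_space) complete_space
proof
  fix X :: "nat \<Rightarrow> 'a l2" assume C: "Cauchy X"
  have r: "rep_l2 x \<in> L2 UNIV" for x :: "'a l2"
    using Quotient_rep_reflp[OF Quotient_l2] by (auto simp: l2_rel_def)
  have rm [measurable]: "rep_l2 x \<in> borel_measurable (lebesgue_on UNIV)" for x :: "'a l2" using r L2_measurable by blast
  have "\<forall>k. \<exists>N. \<forall>m\<ge>N. \<forall>n\<ge>N. norm (X m - X n) < (1/4)^k"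
    using C unfolding Cauchy_def dist_norm by (metis zero_less_power zero_less_divide_1_iff zero_less_numeral)
  then obtain N where N: "\<And>k m n. m \<ge> N k \<Longrightarrow> n \<ge> N k \<Longrightarrow> norm (X m - X n) < (1/4)^k" by metis
  \<comment> \<open>The sum puts the index at or beyond \<open>N k\<close>, and the summand
    \<open>k\<close> makes the sequence strictly increasing.\<close>
  define r' where "r' k = (\<Sum>i\<le>k. N i) + k" for k
  have r'N: "r' k \<ge> N k" for k unfolding r'_def using member_le_sum[of k "{..k}" N] by simp
  have r'm: "strict_mono r'" unfolding strict_mono_Suc_iff r'_def by simp
  define f where "f k = rep_l2 (X (r' k))" for k
  have fm [measurable]: "f k \<in> borel_measurable (lebesgue_on UNIV)" for k unfolding f_def by measurable
  have dist: "(\<integral>\<^sup>+z. ennreal ((f m z - f k z)\<^sup>2) \<partial>lebesgue_on UNIV) \<le> ennreal (((1/4)^k)\<^sup>2)" if "m \<ge> k" for m k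
  proof -
    have "r' m \<ge> N k" using r'N[of k] strict_mono_less_eq[OF r'm, of k m] that by simp
    then have "norm (X (r' m) - X (r' k)) \<le> (1/4)^k" using N[of k "r' m" "r' k"] r'N[of k] by simp
    then show ?thesis unfolding f_def nn_integral_square_rep by (intro ennreal_leI power_mono) auto
  qed
  \<comment> \<open>The weights \<open>4\<^sup>k\<close> give pointwise geometric decay of the differences without Minkowski's inequality.\<close>
  have fin: "(\<integral>\<^sup>+z. (\<Sum>k. ennreal (4^k * (f (Suc k) z - f k z)\<^sup>2)) \<partial>lebesgue_on UNIV) < \<infinity>"
  proof -
    have "(\<integral>\<^sup>+z. (\<Sum>k. ennreal (4^k * (f (Suc k) z - f k z)\<^sup>2)) \<partial>lebesgue_on UNIV) =
      (\<Sum>k. \<integral>\<^sup>+z. ennreal (4^k * (f (Suc k) z - f k z)\<^sup>2) \<partial>lebesgue_on UNIV)"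
      by (rule nn_integral_suminf) measurable
    also have "\<dots> \<le> (\<Sum>k. ennreal ((1/4)^k))"
    proof (rule suminf_le)
      fix k
      have "(\<integral>\<^sup>+z. ennreal (4^k * (f (Suc k) z - f k z)\<^sup>2) \<partial>lebesgue_on UNIV) =
        ennreal (4^k) * (\<integral>\<^sup>+z. ennreal ((f (Suc k) z - f k z)\<^sup>2) \<partial>lebesgue_on UNIV)"
        by (subst nn_integral_cmult[symmetric]) (auto simp: ennreal_mult')
      also have "\<dots> \<le> ennreal (4^k) * ennreal (((1/4)^k)\<^sup>2)" using dist[of k "Suc k"] by (intro mult_left_mono) auto
      also have "\<dots> = ennreal ((1/4)^k)"
        by (subst ennreal_mult'[symmetric]) (auto simp: power2_eq_square power_one_over)
      finally show "(\<integral>\<^sup>+z. ennreal (4^k * (f (Suc k) z - f k z)\<^sup>2) \<partial>lebesgue_on UNIV) \<le> ennreal ((1/4)^k)" .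
    qed auto
    also have "\<dots> = ennreal (\<Sum>k. (1/4)^k)" by (rule suminf_ennreal2) (auto intro!: summable_geometric)
    finally show ?thesis by (simp add: le_less_trans)
  qed
  have ex: "ennreal (enn2real x) = x" if "x \<noteq> \<infinity>" for x using that by (cases x) auto
  have "AE z in lebesgue_on UNIV. (\<Sum>k. ennreal (4^k * (f (Suc k) z - f k z)\<^sup>2)) \<noteq> \<infinity>"
  proof (rule nn_integral_noteq_infinite[OF _ less_imp_neq[OF fin]])
    have m: "(\<lambda>z. ennreal (4^k * (f (Suc k) z - f k z)\<^sup>2)) \<in> borel_measurable (lebesgue_on UNIV)" for k by measurable
    show "(\<lambda>z. \<Sum>k. ennreal (4^k * (f (Suc k) z - f k z)\<^sup>2)) \<in> borel_measurable (lebesgue_on UNIV)"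
      by (rule borel_measurable_suminf_order) (rule m)
  qed
  then have conv: "AE z in lebesgue_on UNIV. convergent (\<lambda>k. f k z)"
  proof eventually_elim
    case (elim z)
    define S where "S = (\<Sum>k. ennreal (4^k * (f (Suc k) z - f k z)\<^sup>2))"
    have "S \<noteq> \<infinity>" unfolding S_def by (rule elim)
    define s where "s = enn2real S"
    have s: "S = ennreal s" "s \<ge> 0" unfolding s_def using ex[OF \<open>S \<noteq> \<infinity>\<close>] by simp_all
    have b: "\<bar>f (Suc k) z - f k z\<bar> \<le> sqrt s * (1/2)^k" for k
    proof -
      have "ennreal (4^k * (f (Suc k) z - f k z)\<^sup>2) \<le> ennreal s"
      proof -
        have "(\<Sum>k\<in>{k}. ennreal (4^k * (f (Suc k) z - f k z)\<^sup>2)) \<le> S"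
          unfolding S_def by (rule sum_le_suminf) (auto intro: summableI)
        then show ?thesis unfolding s(1)[symmetric] by simp
      qed
      then have "4^k * (f (Suc k) z - f k z)\<^sup>2 \<le> s" using s(2) by simp
      moreover have "(2^k * \<bar>f (Suc k) z - f k z\<bar>)\<^sup>2 = 4^k * (f (Suc k) z - f k z)\<^sup>2"
      proof -
        have "((2::real)^k)\<^sup>2 = 4^k" by (simp add: power2_eq_square power_mult_distrib[symmetric])
        then show ?thesis by (simp add: power_mult_distrib)
      qed
      ultimately have "(2^k * \<bar>f (Suc k) z - f k z\<bar>)\<^sup>2 \<le> s" by simp
      then have "2^k * \<bar>f (Suc k) z - f k z\<bar> \<le> sqrt s" by (rule real_le_rsqrt)
      then show ?thesis by (simp add: field_simps power_one_over)
    qed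
    have "summable (\<lambda>k. f (Suc k) z - f k z)"
      by (rule summable_comparison_test'[where g="\<lambda>k. sqrt s * (1/2)^k" and N=0])
        (use b in \<open>auto intro!: summable_mult summable_geometric\<close>)
    then have "convergent (\<lambda>n. \<Sum>k<n. f (Suc k) z - f k z)" by (simp add: summable_iff_convergent)
    moreover have eq: "(\<lambda>n. f n z) = (\<lambda>n. (\<Sum>k<n. f (Suc k) z - f k z) + f 0 z)"
      by (rule ext) (simp add: sum_lessThan_telescope[of "\<lambda>k. f k z"])
    ultimately show ?case by (subst eq) (simp only: convergent_add_const_right_iff)
  qed
  define g where "g z = lim (\<lambda>k. f k z)" for z
  have gm [measurable]: "g \<in> borel_measurable (lebesgue_on UNIV)" unfolding g_def[abs_def] by (rule borel_measurable_lim_metric) measurable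
  have gl: "AE z in lebesgue_on UNIV. (\<lambda>k. f k z) \<longlonglongrightarrow> g z"
    using conv by eventually_elim (simp add: g_def convergent_LIMSEQ_iff)
  have fatou: "(\<integral>\<^sup>+z. ennreal ((g z - f k z)\<^sup>2) \<partial>lebesgue_on UNIV) \<le> ennreal (((1/4)^k)\<^sup>2)" for k
  proof -
    have "(\<integral>\<^sup>+z. ennreal ((g z - f k z)\<^sup>2) \<partial>lebesgue_on UNIV) = 
      (\<integral>\<^sup>+z. liminf (\<lambda>m. ennreal ((f m z - f k z)\<^sup>2)) \<partial>lebesgue_on UNIV)"
    proof (rule nn_integral_cong_AE, use gl in eventually_elim)
      case (elim z)
      have "(\<lambda>m. ennreal ((f m z - f k z)\<^sup>2)) \<longlonglongrightarrow> ennreal ((g z - f k z)\<^sup>2)"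
        by (intro tendsto_ennrealI tendsto_intros elim)
      from lim_imp_Liminf[OF trivial_limit_sequentially this] show ?case by (rule sym)
    qed
    also have "\<dots> \<le> liminf (\<lambda>m. \<integral>\<^sup>+z. ennreal ((f m z - f k z)\<^sup>2) \<partial>lebesgue_on UNIV)"
      by (rule nn_integral_liminf) measurable
    also have "\<dots> \<le> ennreal (((1/4)^k)\<^sup>2)"
      by (rule Liminf_le) (auto intro!: eventually_sequentiallyI[of k] dist)
    finally show ?thesis .
  qed
  have gf: "(\<lambda>z. g z - f k z) \<in> L2 UNIV" for k
  proof -
    have "integrable (lebesgue_on UNIV) (\<lambda>z. (g z - f k z)\<^sup>2)"
    proof (rule integrableI_nonneg)
      show "(\<integral>\<^sup>+z. ennreal ((g z - f k z)\<^sup>2) \<partial>lebesgue_on UNIV) < \<infinity>"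
        by (rule le_less_trans[OF fatou]) simp
    qed (use gm fm[of k] in \<open>auto intro!: borel_measurable_power borel_measurable_diff\<close>)
    then show ?thesis unfolding L2_def using gm fm[of k] by (simp add: borel_measurable_diff)
  qed
  have g: "g \<in> L2 UNIV" using L2_add[OF gf[of 0], of "f 0"] r unfolding f_def by simp
  have "(X \<circ> r') \<longlonglongrightarrow> abs_l2 g"
  proof (rule metric_LIMSEQ_I)
    fix e :: real assume "e > 0"
    obtain K where K: "(1/4::real)^K < e" using real_arch_pow_inv[of e "1/4"] \<open>e > 0\<close> by auto
    have "dist ((X \<circ> r') k) (abs_l2 g) < e" if "k \<ge> K" for k
    proof -
      have a: "X (r' k) = abs_l2 (f k)" unfolding f_def using Quotient_abs_rep[OF Quotient_l2] by metis
      have fk: "f k \<in> L2 UNIV" unfolding f_def by (rule r)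
      have n: "(norm (abs_l2 g - X (r' k)))\<^sup>2 = L2_inner UNIV (\<lambda>z. g z - f k z) (\<lambda>z. g z - f k z)"
      proof -
        have "abs_l2 g - X (r' k) = abs_l2 (\<lambda>z. g z - f k z)"
          unfolding a by (rule minus_l2.abs_eq) (use g fk in \<open>simp_all add: l2_rel_def\<close>)
        moreover have "l2_rel (\<lambda>z. g z - f k z) (\<lambda>z. g z - f k z)" using gf[of k] by (simp add: l2_rel_def)
        ultimately show ?thesis by (simp only: power2_norm_eq_inner inner_l2.abs_eq)
      qed
      have "ennreal ((norm (abs_l2 g - X (r' k)))\<^sup>2) \<le> ennreal (((1/4)^k)\<^sup>2)"
        unfolding n nn_integral_square[OF gf, symmetric] by (rule fatou)
      then have "(norm (abs_l2 g - X (r' k)))\<^sup>2 \<le> ((1/4)^k)\<^sup>2" by (subst (asm) ennreal_le_iff) simp_all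
      then have "norm (abs_l2 g - X (r' k)) \<le> (1/4)^k" by (rule power2_le_imp_le) simp
      also have "\<dots> \<le> (1/4)^K" using that by (intro power_decreasing) auto
      finally show ?thesis using K by (simp add: dist_norm norm_minus_commute)
    qed
    then show "\<exists>no. \<forall>n\<ge>no. dist ((X \<circ> r') n) (abs_l2 g) < e" by blast
  qed
  then show "convergent X" using Cauchy_converges_subseq[OF C r'm] convergentI by blast
qed

section \<open>Functions on \<Omega> as a closed subspace of \<open>l2\<close>\<close>

lemma L2_extend_iff:
  assumes "\<Omega> \<in> sets lebesgue"
  shows "(\<lambda>x. if x \<in> \<Omega> then f x else 0) \<in> L2 UNIV \<longleftrightarrow> f \<in> L2 \<Omega>"
proof -
  have "(\<lambda>x. (indicat_real \<Omega> x * f x)\<^sup>2) = (\<lambda>x. indicator \<Omega> x *\<^sub>R (f x)\<^sup>2)" by (auto simp: indicator_def)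
  moreover have "(\<lambda>x. if x \<in> \<Omega> then f x else 0) = (\<lambda>x. indicator \<Omega> x *\<^sub>R f x)" by (auto simp: indicator_def)
  ultimately show ?thesis unfolding L2_def using assms
    by (simp add: integrable_restrict_space borel_measurable_restrict_space_iff lebesgue_on_UNIV_eq)
qed

lemma L2_restrict: assumes "\<Omega> \<in> sets lebesgue" "f \<in> L2 UNIV" shows "f \<in> L2 \<Omega>"
proof -
  have f: "f \<in> borel_measurable lebesgue" "integrable lebesgue (\<lambda>x. (f x)\<^sup>2)"
    using assms(2) by (simp_all add: L2_def lebesgue_on_UNIV_eq)
  have "integrable lebesgue (\<lambda>x. indicator \<Omega> x *\<^sub>R (f x)\<^sup>2)"
    using assms(1) f(2) by (rule integrable_mult_indicator)
  then have "integrable (lebesgue_on \<Omega>) (\<lambda>x. (f x)\<^sup>2)" using assms(1) by (simp add: integrable_restrict_space)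
  then show ?thesis using f(1) by (simp add: L2_def measurable_restrict_space1)
qed

text \<open>The extension by zero makes the class independent of the values of \<open>f\<close> off
  \<Omega> and the embedding isometric on \<open>L2 \<Omega>\<close>.\<close>

definition l2_of :: "'a::euclidean_space set \<Rightarrow> ('a \<Rightarrow> real) \<Rightarrow> 'a l2" where
  "l2_of \<Omega> f = abs_l2 (\<lambda>x. if x \<in> \<Omega> then f x else 0)"

context
  fixes \<Omega> :: "'a::euclidean_space set" assumes meas: "\<Omega> \<in> sets lebesgue"
begin

lemma l2_of_lin:
  assumes "f \<in> L2 \<Omega>" "g \<in> L2 \<Omega>"
  shows "l2_of \<Omega> (\<lambda>x. c * f x + g x) = c *\<^sub>R l2_of \<Omega> f + l2_of \<Omega> g"
proof -
  let ?e = "\<lambda>f x. if x \<in> \<Omega> then f x else (0::real)"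
  have L: "?e f \<in> L2 UNIV" "?e g \<in> L2 UNIV" using assms L2_extend_iff[OF meas] by blast+
  have "c *\<^sub>R l2_of \<Omega> f + l2_of \<Omega> g = abs_l2 (\<lambda>x. c * ?e f x + ?e g x)"
    unfolding l2_of_def using L L2_scale[OF L(1), of c] by (simp add: scaleR_l2.abs_eq plus_l2.abs_eq l2_rel_def)
  also have "(\<lambda>x. c * ?e f x + ?e g x) = ?e (\<lambda>x. c * f x + g x)" by auto
  finally show ?thesis unfolding l2_of_def by simp
qed

lemma l2_of_diff:
  assumes "f \<in> L2 \<Omega>" "g \<in> L2 \<Omega>" shows "l2_of \<Omega> (\<lambda>x. f x - g x) = l2_of \<Omega> f - l2_of \<Omega> g"
  using l2_of_lin[OF assms(2,1), of "-1"] by simp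

lemma l2_of_scale:
  assumes "f \<in> L2 \<Omega>" shows "l2_of \<Omega> (\<lambda>x. c * f x) = c *\<^sub>R l2_of \<Omega> f"
proof -
  have "l2_of \<Omega> (\<lambda>x. 0) = 0" unfolding l2_of_def by (simp add: zero_l2_def)
  then show ?thesis using l2_of_lin[OF assms L2_zero, of c] by simp
qed

lemma inner_l2_of:
  assumes "f \<in> L2 \<Omega>" "g \<in> L2 \<Omega>" shows "l2_of \<Omega> f \<bullet> l2_of \<Omega> g = L2_inner \<Omega> f g"
proof -
  let ?e = "\<lambda>f x. if x \<in> \<Omega> then f x else (0::real)"
  have L: "?e f \<in> L2 UNIV" "?e g \<in> L2 UNIV" using assms L2_extend_iff[OF meas] by blast+
  have "l2_of \<Omega> f \<bullet> l2_of \<Omega> g = (LINT x|lebesgue_on UNIV. ?e f x * ?e g x)"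
    unfolding l2_of_def using L by (simp add: inner_l2.abs_eq l2_rel_def L2_inner_def)
  also have "(\<lambda>x. ?e f x * ?e g x) = (\<lambda>x. indicator \<Omega> x *\<^sub>R (f x * g x))" by (auto simp: indicator_def)
  finally show ?thesis unfolding L2_inner_def using meas by (simp add: integral_restrict_space lebesgue_on_UNIV_eq)
qed

lemma norm_l2_of: assumes "f \<in> L2 \<Omega>" shows "norm (l2_of \<Omega> f) = L2_norm \<Omega> f"
  unfolding norm_eq_sqrt_inner L2_norm_def using inner_l2_of assms by simp

lemma l2_of_eq_iff: assumes "f \<in> L2 \<Omega>" "g \<in> L2 \<Omega>"
  shows "l2_of \<Omega> f = l2_of \<Omega> g \<longleftrightarrow> (AE x in lebesgue_on \<Omega>. f x = g x)"
proof -
  have "l2_of \<Omega> f = l2_of \<Omega> g \<longleftrightarrow> norm (l2_of \<Omega> (\<lambda>x. f x - g x)) = 0" using l2_of_diff[OF assms] by simp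
  also have "\<dots> \<longleftrightarrow> (AE x in lebesgue_on \<Omega>. f x - g x = 0)"
    using L2_inner_eq_0[OF L2_diff[OF assms]] norm_l2_of[OF L2_diff[OF assms]] by (simp add: L2_norm_def)
  finally show ?thesis by simp
qed

lemma rep_l2_in: "rep_l2 F \<in> L2 \<Omega>"
  using Quotient_rep_reflp[OF Quotient_l2, of F] L2_restrict[OF meas] by (auto simp: l2_rel_def)

lemma l2_of_rep_l2_of: assumes "f \<in> L2 \<Omega>" shows "AE x in lebesgue_on \<Omega>. rep_l2 (l2_of \<Omega> f) x = f x"
proof -
  let ?e = "\<lambda>x. if x \<in> \<Omega> then f x else (0::real)"
  have "l2_rel ?e ?e" using L2_extend_iff[OF meas] assms by (simp add: l2_rel_def)
  then have "l2_rel (rep_l2 (abs_l2 ?e)) ?e" by (rule rep_abs_rsp_left[OF Quotient3_l2])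
  then have "AE x in lebesgue_on UNIV. rep_l2 (l2_of \<Omega> f) x = ?e x" unfolding l2_of_def l2_rel_def by blast
  then have "AE x in lebesgue. x \<in> \<Omega> \<longrightarrow> rep_l2 (l2_of \<Omega> f) x = f x"
    unfolding lebesgue_on_UNIV_eq by eventually_elim simp
  then show ?thesis using meas by (simp add: AE_restrict_space_iff)
qed

lemma l2_of_rep: assumes "F \<in> l2_of \<Omega> ` L2 \<Omega>" shows "l2_of \<Omega> (rep_l2 F) = F"
proof -
  obtain f where f: "f \<in> L2 \<Omega>" "F = l2_of \<Omega> f" using assms by blast
  then show ?thesis using l2_of_eq_iff[OF rep_l2_in f(1)] l2_of_rep_l2_of[OF f(1)] by simp
qed

lemma subspace_l2_of: "subspace (l2_of \<Omega> ` L2 \<Omega>)"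
  unfolding subspace_def
proof (intro conjI ballI allI)
  show "0 \<in> l2_of \<Omega> ` L2 \<Omega>" by (rule image_eqI[of _ _ "\<lambda>x. 0"]) (auto simp: l2_of_def zero_l2_def)
  show "x + y \<in> l2_of \<Omega> ` L2 \<Omega>" if xy: "x \<in> l2_of \<Omega> ` L2 \<Omega>" "y \<in> l2_of \<Omega> ` L2 \<Omega>" for x y
  proof -
    obtain f g where fg: "f \<in> L2 \<Omega>" "g \<in> L2 \<Omega>" "x = l2_of \<Omega> f" "y = l2_of \<Omega> g" using xy by blast
    have "x + y = l2_of \<Omega> (\<lambda>x. 1 * f x + g x)" unfolding l2_of_lin[OF fg(1,2)] fg(3,4) by simp
    then show ?thesis using L2_lin[OF fg(1,2), of 1] by (rule image_eqI)
  qed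
  show "c *\<^sub>R x \<in> l2_of \<Omega> ` L2 \<Omega>" if x: "x \<in> l2_of \<Omega> ` L2 \<Omega>" for x c
  proof -
    obtain f where f: "f \<in> L2 \<Omega>" "x = l2_of \<Omega> f" using x by blast
    have "c *\<^sub>R x = l2_of \<Omega> (\<lambda>x. c * f x)" unfolding l2_of_scale[OF f(1)] f(2) ..
    then show ?thesis using L2_scale[OF f(1)] by (rule image_eqI)
  qed
qed

text \<open>Restricting to \<Omega> and extending by zero again is a projection that does not
  increase distances. It fixes every member of the image, hence also the limit of a convergent
  sequence of members.\<close>

lemma complete_l2_of: "complete (l2_of \<Omega> ` L2 \<Omega>)"
proof -
  have contr: "norm (l2_of \<Omega> (rep_l2 F) - l2_of \<Omega> (rep_l2 G)) \<le> norm (F - G)" for F G :: "'a l2"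
  proof -
    have FG: "l2_of \<Omega> (rep_l2 F) - l2_of \<Omega> (rep_l2 G) = l2_of \<Omega> (\<lambda>x. rep_l2 F x - rep_l2 G x)"
      using l2_of_diff rep_l2_in by simp
    have "ennreal ((norm (l2_of \<Omega> (\<lambda>x. rep_l2 F x - rep_l2 G x)))\<^sup>2) = (\<integral>\<^sup>+x. ennreal ((rep_l2 F x - rep_l2 G x)\<^sup>2) \<partial>lebesgue_on \<Omega>)"
      using nn_integral_square[OF L2_diff[OF rep_l2_in rep_l2_in]] inner_l2_of[OF L2_diff L2_diff] rep_l2_in
      by (simp add: power2_norm_eq_inner)
    also have "\<dots> \<le> (\<integral>\<^sup>+x. ennreal ((rep_l2 F x - rep_l2 G x)\<^sup>2) \<partial>lebesgue_on UNIV)"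
      unfolding lebesgue_on_UNIV_eq using meas
      by (subst nn_integral_restrict_space) (auto intro!: nn_integral_mono simp: indicator_def)
    finally have "(norm (l2_of \<Omega> (\<lambda>x. rep_l2 F x - rep_l2 G x)))\<^sup>2 \<le> (norm (F - G))\<^sup>2"
      unfolding nn_integral_square_rep by (subst (asm) ennreal_le_iff) simp_all
    then show ?thesis unfolding FG by (rule power2_le_imp_le) simp
  qed
  have "closed (l2_of \<Omega> ` L2 \<Omega>)"
    unfolding closed_sequential_limits
  proof (intro allI impI, elim conjE)
    fix X F assume X: "\<forall>n. X n \<in> l2_of \<Omega> ` L2 \<Omega>" "X \<longlonglongrightarrow> F"
    have lim: "(\<lambda>n. norm (X n - F)) \<longlonglongrightarrow> 0" using X LIM_zero tendsto_norm_zero by blast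
    have le: "norm (X n - l2_of \<Omega> (rep_l2 F)) \<le> norm (X n - F)" for n
      using contr[of "X n" F] unfolding l2_of_rep[OF X(1)[THEN spec]] .
    have "(\<lambda>n. X n - l2_of \<Omega> (rep_l2 F)) \<longlonglongrightarrow> 0"
      by (rule Lim_null_comparison[OF always_eventually[OF allI[OF le]] lim])
    then have "X \<longlonglongrightarrow> l2_of \<Omega> (rep_l2 F)" by (rule LIM_zero_cancel)
    then have "F = l2_of \<Omega> (rep_l2 F)" using X LIMSEQ_unique by blast
    then show "F \<in> l2_of \<Omega> ` L2 \<Omega>" using rep_l2_in by blast
  qed
  then show ?thesis using complete_eq_closed by blast
qed

end

subsection \<open>Operators associated with forms\<close>

text \<open>Forms act on functions, not on classes, so they are only semidefinite. The same locale
  serves the energy forms, the \<open>L\<^sup>2\<close> product and the integrals over the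
  boundary.\<close>

locale semi_inner_space =
  fixes D :: "('x \<Rightarrow> real) set" and b :: "('x \<Rightarrow> real) \<Rightarrow> ('x \<Rightarrow> real) \<Rightarrow> real"
  assumes D_0: "(\<lambda>x. 0) \<in> D"
    and D_lin: "\<And>c f g. f \<in> D \<Longrightarrow> g \<in> D \<Longrightarrow> (\<lambda>x. c * f x + g x) \<in> D"
    and lin_left: "\<And>c f g h. f \<in> D \<Longrightarrow> g \<in> D \<Longrightarrow> h \<in> D \<Longrightarrow> b (\<lambda>x. c * f x + g x) h = c * b f h + b g h"
    and sym: "\<And>f g. f \<in> D \<Longrightarrow> g \<in> D \<Longrightarrow> b f g = b g f"
    and nonneg: "\<And>f. f \<in> D \<Longrightarrow> 0 \<le> b f f"
begin

lemma D_add: "f \<in> D \<Longrightarrow> g \<in> D \<Longrightarrow> (\<lambda>x. f x + g x) \<in> D" using D_lin[of f g 1] by simp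
lemma D_diff: "f \<in> D \<Longrightarrow> g \<in> D \<Longrightarrow> (\<lambda>x. f x - g x) \<in> D" using D_lin[of g f "-1"] by simp
lemma D_scale: "f \<in> D \<Longrightarrow> (\<lambda>x. c * f x) \<in> D" using D_lin[of f "\<lambda>x. 0" c] D_0 by simp

lemma lin_right: "f \<in> D \<Longrightarrow> g \<in> D \<Longrightarrow> h \<in> D \<Longrightarrow> b h (\<lambda>x. c * f x + g x) = c * b h f + b h g"
  using lin_left sym D_lin by simp

lemma square_lin:
  assumes "f \<in> D" "g \<in> D"
  shows "b (\<lambda>x. c * f x + g x) (\<lambda>x. c * f x + g x) = c\<^sup>2 * b f f + 2 * c * b f g + b g g"
proof -
  let ?h = "\<lambda>x. c * f x + g x"
  have "b ?h ?h = c * b f ?h + b g ?h" using lin_left D_lin assms by simp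
  also have "b f ?h = c * b f f + b f g" using lin_right assms by simp
  also have "b g ?h = c * b f g + b g g" using lin_right[of f g g] sym[of g f] assms by simp
  finally show ?thesis by (simp add: algebra_simps power2_eq_square)
qed

lemma square_diff:
  assumes "f \<in> D" "g \<in> D"
  shows "b (\<lambda>x. f x - g x) (\<lambda>x. f x - g x) = b f f - 2 * b f g + b g g"
  using square_lin[OF assms(2,1), of "-1"] sym[OF assms] by simp

lemma square_add:
  assumes "f \<in> D" "g \<in> D"
  shows "b (\<lambda>x. f x + g x) (\<lambda>x. f x + g x) = b f f + 2 * b f g + b g g"
  using square_lin[OF assms, of 1] by simp

lemma square_add_le:
  assumes "f \<in> D" "g \<in> D"
  shows "b (\<lambda>x. f x + g x) (\<lambda>x. f x + g x) \<le> 2 * b f f + 2 * b g g"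
  using square_add[OF assms] square_diff[OF assms] nonneg[OF D_diff[OF assms]] by simp

lemma square_scale: assumes "f \<in> D" shows "b (\<lambda>x. c * f x) (\<lambda>x. c * f x) = c\<^sup>2 * b f f"
proof -
  have 0: "b f (\<lambda>x. 0) = 0" if "f \<in> D" for f using lin_right[of "\<lambda>x. 0" "\<lambda>x. 0" f 1] D_0 that by simp
  show ?thesis using square_lin[OF assms D_0, of c] 0[OF assms] 0[OF D_0] by simp
qed

text \<open>\<open>D\<close> is not assumed complete for \<open>b\<close>, so the representing
  vector is replaced by a minimizing sequence of \<open>b v v - 2 * l v\<close>. The explicit rates
  record how far its members are from representing \<open>l\<close> and from each other; a limit is
  formed later, in \<open>L\<^sup>2\<close>.\<close>

lemma riesz:
  fixes l :: "('x \<Rightarrow> real) \<Rightarrow> real"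
  assumes l_lin: "\<And>c f g. f \<in> D \<Longrightarrow> g \<in> D \<Longrightarrow> l (\<lambda>x. c * f x + g x) = c * l f + l g"
    and l_bdd: "\<And>f. f \<in> D \<Longrightarrow> (l f)\<^sup>2 \<le> K * b f f"
  obtains x where "\<And>n. x n \<in> D" "\<And>n v. v \<in> D \<Longrightarrow> \<bar>b (x n) v - l v\<bar> \<le> sqrt (b v v) / real (Suc n)"
    "\<And>m n. b (\<lambda>z. x m z - x n z) (\<lambda>z. x m z - x n z) \<le> (1 / real (Suc m) + 1 / real (Suc n))\<^sup>2"
proof -
  define E where "E v = b v v - 2 * l v" for v
  \<comment> \<open>\<open>l v \<le> sqrt (k * b v v) \<le> (k + b v v) / 2\<close> bounds the
    functional below by \<open>- k\<close>. The maximum with \<open>0\<close> makes the inequality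
    of the means applicable.\<close>
  have lb: "E v \<ge> - max K 0" if v: "v \<in> D" for v
  proof -
    define k where "k = max K 0"
    have k: "K \<le> k" "0 \<le> k" unfolding k_def by auto
    have "(l v)\<^sup>2 \<le> k * b v v" using order_trans[OF l_bdd[OF v] mult_right_mono[OF k(1) nonneg[OF v]]] .
    then have "l v \<le> sqrt (k * b v v)" by (rule real_le_rsqrt)
    also have "\<dots> \<le> (k + b v v) / 2" by (rule arith_geo_mean_sqrt[OF k(2) nonneg[OF v]])
    finally show ?thesis unfolding E_def k_def[symmetric] by simp
  qed
  define m where "m = Inf (E ` D)"
  have bd: "bdd_below (E ` D)" using lb by (auto intro!: bdd_belowI)
  have m_le: "m \<le> E v" if "v \<in> D" for v unfolding m_def using bd that by (intro cInf_lower) auto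
  \<comment> \<open>The gap to the infimum is a square because the error in the variational equation
    is of the order of its root.\<close>
  have "\<exists>v\<in>D. E v < m + (1 / real (Suc n))\<^sup>2" for n
  proof -
    have "m < m + (1 / real (Suc n))\<^sup>2" by simp
    then show ?thesis unfolding m_def using cInf_lessD[of "E ` D"] D_0 by blast
  qed
  then obtain x where x: "\<And>n. x n \<in> D" "\<And>n. E (x n) < m + (1 / real (Suc n))\<^sup>2" by metis
  have q: "\<bar>b (x n) v - l v\<bar> \<le> sqrt (b v v) / real (Suc n)" if v: "v \<in> D" for n v
  proof -
    define e where "e = 1 / real (Suc n)"
    define q where "q = b (x n) v - l v"
    have e: "e > 0" unfolding e_def by simp
    \<comment> \<open>Adding \<open>t v\<close> to \<open>x n\<close> cannot lead below the infimum.
      The resulting quadratic in \<open>t\<close> is nonnegative everywhere, and its minimum yields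
      the estimate for \<open>q\<close>. Where \<open>b v v = 0\<close> it is affine in
      \<open>t\<close>, which forces \<open>q = 0\<close>.\<close>
    have ineq: "t\<^sup>2 * b v v + 2 * t * q + e\<^sup>2 \<ge> 0" for t
    proof -
      have "E (\<lambda>z. t * v z + x n z) = t\<^sup>2 * b v v + 2 * t * q + E (x n)"
        unfolding E_def q_def using square_lin[OF v x(1), of t n] l_lin[OF v x(1), of t n] sym[OF v x(1), of n] by (simp add: algebra_simps)
      then show ?thesis using m_le[OF D_lin[OF v x(1), of t n]] x(2)[of n] unfolding e_def by linarith
    qed
    have "q\<^sup>2 \<le> e\<^sup>2 * b v v"
    proof (cases "b v v = 0")
      case True
      have "q = 0"
      proof (rule ccontr)
        assume "q \<noteq> 0"
        then have "2 * (- (e\<^sup>2 / q)) * q + e\<^sup>2 < 0" using e by simp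
        then show False using ineq[of "- (e\<^sup>2 / q)"] True by simp
      qed
      then show ?thesis using True by simp
    next
      case False
      then have B: "b v v > 0" using nonneg[OF v] by simp
      have "(- q / b v v)\<^sup>2 * b v v + 2 * (- q / b v v) * q + e\<^sup>2 = e\<^sup>2 - q\<^sup>2 / b v v"
        using B by (simp add: power2_eq_square field_simps)
      then have "q\<^sup>2 / b v v \<le> e\<^sup>2" using ineq[of "- q / b v v"] by linarith
      then show ?thesis using B by (simp add: field_simps)
    qed
    then have "sqrt (q\<^sup>2) \<le> sqrt (e\<^sup>2 * b v v)" by (rule real_sqrt_le_mono)
    then show ?thesis using e unfolding q_def[symmetric] by (simp add: real_sqrt_mult e_def)
  qed
  \<comment> \<open>With \<open>v = x k - x n\<close>, both \<open>b (x k) v\<close> and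
    \<open>b (x n) v\<close> are close to the same number \<open>l v\<close>.\<close>
  have c: "b (\<lambda>z. x k z - x n z) (\<lambda>z. x k z - x n z) \<le> (1 / real (Suc k) + 1 / real (Suc n))\<^sup>2" for k n
  proof -
    define v where "v = (\<lambda>z. x k z - x n z)"
    have v: "v \<in> D" unfolding v_def using D_diff x by blast
    have "b v v = b (x k) v - b (x n) v"
      using lin_left[of "x n" "x k" v "-1"] x v unfolding v_def by simp
    also have "\<dots> \<le> \<bar>b (x k) v - l v\<bar> + \<bar>b (x n) v - l v\<bar>" by linarith
    also have "\<dots> \<le> sqrt (b v v) / real (Suc k) + sqrt (b v v) / real (Suc n)" using q[OF v] add_mono by blast
    also have "\<dots> = sqrt (b v v) * (1 / real (Suc k) + 1 / real (Suc n))" by (simp add: algebra_simps)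
    finally have 1: "sqrt (b v v) * sqrt (b v v) \<le> sqrt (b v v) * (1 / real (Suc k) + 1 / real (Suc n))" using nonneg[OF v] by simp
    have "sqrt (b v v) \<le> 1 / real (Suc k) + 1 / real (Suc n)"
    proof (cases "b v v = 0")
      case False
      then have "sqrt (b v v) > 0" using nonneg[OF v] by simp
      then show ?thesis using 1 mult_le_cancel_left_pos by blast
    qed simp
    then have "(sqrt (b v v))\<^sup>2 \<le> (1 / real (Suc k) + 1 / real (Suc n))\<^sup>2" using nonneg[OF v] by (intro power_mono) auto
    then show ?thesis using nonneg[OF v] unfolding v_def by simp
  qed
  show ?thesis using that x(1) q c by blast
qed

end

section \<open>The operator associated with the closure of a form\<close>

lemma semi_inner_space_L2: "semi_inner_space (L2 \<Omega>) (L2_inner \<Omega>)"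
  by unfold_locales ((rule L2_zero L2_lin L2_inner_lin_left L2_inner_commute L2_inner_ge_0; assumption)+)

lemma L2_norm_tendsto_iff:
  assumes "\<Omega> \<in> sets lebesgue" "\<And>n. f n \<in> L2 \<Omega>" "g \<in> L2 \<Omega>"
  shows "((\<lambda>n. L2_norm \<Omega> (\<lambda>x. f n x - g x)) \<longlongrightarrow> 0) F \<longleftrightarrow> ((\<lambda>n. l2_of \<Omega> (f n)) \<longlongrightarrow> l2_of \<Omega> g) F"
proof -
  have "L2_norm \<Omega> (\<lambda>x. f n x - g x) = norm (l2_of \<Omega> (f n) - l2_of \<Omega> g)" for n
    using norm_l2_of[OF assms(1) L2_diff[OF assms(2,3)]] l2_of_diff[OF assms(1,2,3)] by simp
  then show ?thesis by (simp add: tendsto_norm_zero_iff LIM_zero_iff)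
qed

text \<open>The Ritz functional of the equation \<open>u - s A u = f\<close> for the operator
  \<open>A\<close> of the form \<open>a\<close>.\<close>

definition energy :: "'a::euclidean_space set \<Rightarrow> (('a \<Rightarrow> real) \<Rightarrow> ('a \<Rightarrow> real) \<Rightarrow> real) \<Rightarrow> real \<Rightarrow> ('a \<Rightarrow> real) \<Rightarrow> ('a \<Rightarrow> real) \<Rightarrow> real" where
  "energy \<Omega> a s f v = s * a v v + L2_inner \<Omega> v v - 2 * L2_inner \<Omega> f v"

locale L2_form = semi_inner_space D a
  for D :: "('a::euclidean_space \<Rightarrow> real) set" and a +
  fixes \<Omega> :: "'a set"
  assumes meas: "\<Omega> \<in> sets lebesgue" and D_L2: "D \<subseteq> L2 \<Omega>"
    and D_dense: "\<And>f e. f \<in> L2 \<Omega> \<Longrightarrow> e > 0 \<Longrightarrow> \<exists>g\<in>D. L2_norm \<Omega> (\<lambda>x. f x - g x) < e"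
begin

lemma D_in: "f \<in> D \<Longrightarrow> f \<in> L2 \<Omega>" using D_L2 by blast

lemma closure_seqD:
  assumes "closure_seq \<Omega> D a us u"
  shows "u \<in> L2 \<Omega>" "us n \<in> D" "us n \<in> L2 \<Omega>" "(\<lambda>n. l2_of \<Omega> (us n)) \<longlonglongrightarrow> l2_of \<Omega> u"
  using assms L2_norm_tendsto_iff[OF meas, of us u] D_in unfolding closure_seq_def by blast+

lemma closure_seq_inner:
  assumes "closure_seq \<Omega> D a us u" "closure_seq \<Omega> D a vs v"
  shows "(\<lambda>n. L2_inner \<Omega> (us n) (vs n)) \<longlonglongrightarrow> L2_inner \<Omega> u v"
  using tendsto_inner[OF closure_seqD(4)[OF assms(1)] closure_seqD(4)[OF assms(2)]]
    inner_l2_of[OF meas] closure_seqD[OF assms(1)] closure_seqD[OF assms(2)] by simp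

lemma inner_tendsto:
  assumes "f \<in> L2 \<Omega>" "\<And>n. us n \<in> L2 \<Omega>" "u \<in> L2 \<Omega>" "(\<lambda>n. l2_of \<Omega> (us n)) \<longlonglongrightarrow> l2_of \<Omega> u"
  shows "(\<lambda>n. L2_inner \<Omega> f (us n)) \<longlonglongrightarrow> L2_inner \<Omega> f u"
  using tendsto_inner[OF tendsto_const assms(4), of "l2_of \<Omega> f"] inner_l2_of[OF meas] assms(1,2,3) by simp

lemma closure_seq_const: assumes "v \<in> D" shows "closure_seq \<Omega> D a (\<lambda>n. v) v"
proof -
  have "a (\<lambda>x. 0) (\<lambda>x. 0) = 0" using square_scale[OF D_0, of 0] by simp
  then show ?thesis unfolding closure_seq_def using assms D_in by (auto simp: L2_norm_def L2_inner_def)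
qed

lemma closure_seq_lin:
  assumes "closure_seq \<Omega> D a us u" "closure_seq \<Omega> D a vs v"
  shows "closure_seq \<Omega> D a (\<lambda>n x. c * us n x + vs n x) (\<lambda>x. c * u x + v x)"
  unfolding closure_seq_def
proof (intro conjI allI impI)
  note uD = closure_seqD[OF assms(1)] and vD = closure_seqD[OF assms(2)]
  show "(\<lambda>x. c * u x + v x) \<in> L2 \<Omega>" using L2_lin uD vD by blast
  show D: "(\<lambda>x. c * us n x + vs n x) \<in> D" for n using D_lin uD vD by blast
  have "(\<lambda>n. l2_of \<Omega> (\<lambda>x. c * us n x + vs n x)) \<longlonglongrightarrow> l2_of \<Omega> (\<lambda>x. c * u x + v x)"
    unfolding l2_of_lin[OF meas uD(3) vD(3)] l2_of_lin[OF meas uD(1) vD(1)] by (intro tendsto_intros uD(4) vD(4))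
  then show "(\<lambda>n. L2_norm \<Omega> (\<lambda>x. c * us n x + vs n x - (c * u x + v x))) \<longlonglongrightarrow> 0"
    using L2_norm_tendsto_iff[OF meas, of "\<lambda>n x. c * us n x + vs n x" "\<lambda>x. c * u x + v x"]
      L2_lin[OF uD(3) vD(3)] L2_lin[OF uD(1) vD(1)] by simp
  fix e :: real assume e: "e > 0"
  let ?e = "e / (2 * (c\<^sup>2 + 1))"
  have c: "c\<^sup>2 + 1 > 0" by (simp add: add_nonneg_pos)
  have e': "?e > 0" using e c by simp
  obtain M where M: "\<And>m n. m \<ge> M \<Longrightarrow> n \<ge> M \<Longrightarrow> a (\<lambda>x. us m x - us n x) (\<lambda>x. us m x - us n x) < ?e"
    using assms(1) e' unfolding closure_seq_def by blast
  obtain N where N: "\<And>m n. m \<ge> N \<Longrightarrow> n \<ge> N \<Longrightarrow> a (\<lambda>x. vs m x - vs n x) (\<lambda>x. vs m x - vs n x) < ?e"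
    using assms(2) e' unfolding closure_seq_def by blast
  have "a (\<lambda>x. c * us m x + vs m x - (c * us n x + vs n x)) (\<lambda>x. c * us m x + vs m x - (c * us n x + vs n x)) < e"
    if "m \<ge> max M N" "n \<ge> max M N" for m n
  proof -
    define p where "p = (\<lambda>x. us m x - us n x)"
    define q where "q = (\<lambda>x. vs m x - vs n x)"
    have pq: "p \<in> D" "q \<in> D" unfolding p_def q_def using D_diff uD vD by blast+
    have "(\<lambda>x. c * us m x + vs m x - (c * us n x + vs n x)) = (\<lambda>x. (\<lambda>x. c * p x) x + q x)"
      unfolding p_def q_def by (auto simp: algebra_simps)
    then have "a (\<lambda>x. c * us m x + vs m x - (c * us n x + vs n x)) (\<lambda>x. c * us m x + vs m x - (c * us n x + vs n x))
      \<le> 2 * (c\<^sup>2 * a p p) + 2 * a q q"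
      using square_add_le[OF D_scale[OF pq(1), of c] pq(2)] square_scale[OF pq(1), of c] by simp
    also have "\<dots> < 2 * (c\<^sup>2 * ?e) + 2 * ?e"
    proof -
      have "a p p < ?e" "a q q < ?e" using M[of m n] N[of m n] that unfolding p_def q_def by auto
      then have "c\<^sup>2 * a p p \<le> c\<^sup>2 * ?e" by (intro mult_left_mono) auto
      then show ?thesis using \<open>a q q < ?e\<close> by linarith
    qed
    also have "\<dots> = (2 * (c\<^sup>2 + 1)) * ?e" by (simp only: distrib_left distrib_right mult.assoc mult_1_left)
    also have "\<dots> = e" using c by simp
    finally show ?thesis .
  qed
  then show "\<exists>M. \<forall>m\<ge>M. \<forall>n\<ge>M. a (\<lambda>x. c * us m x + vs m x - (c * us n x + vs n x)) (\<lambda>x. c * us m x + vs m x - (c * us n x + vs n x)) < e"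
    by blast
qed

lemma closure_seq_bounded:
  assumes "closure_seq \<Omega> D a us u" shows "\<exists>B M. \<forall>n\<ge>M. a (us n) (us n) \<le> B"
proof -
  note uD = closure_seqD[OF assms]
  obtain M where M: "\<And>m n. m \<ge> M \<Longrightarrow> n \<ge> M \<Longrightarrow> a (\<lambda>x. us m x - us n x) (\<lambda>x. us m x - us n x) < 1"
    using assms zero_less_one unfolding closure_seq_def by blast
  have "a (us n) (us n) \<le> 2 * 1 + 2 * a (us M) (us M)" if "n \<ge> M" for n
    using square_add_le[OF D_diff[OF uD(2) uD(2)] uD(2), of n M M] M[of n M] that by simp
  then show ?thesis by blast
qed

abbreviation "Op \<equiv> closure_operator \<Omega> D a"

lemma OpI:
  assumes "w \<in> L2 \<Omega>" "closure_seq \<Omega> D a us u"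
    "\<And>p ps. closure_seq \<Omega> D a ps p \<Longrightarrow> (\<lambda>n. a (us n) (ps n)) \<longlonglongrightarrow> - L2_inner \<Omega> w p"
  shows "(u, w) \<in> Op"
  unfolding closure_operator_def by (simp only: mem_Collect_eq split_conv) (intro conjI exI[of _ us] allI impI assms)

lemma OpE:
  assumes "(u, w) \<in> Op"
  obtains us where "closure_seq \<Omega> D a us u"
    "\<And>p ps. closure_seq \<Omega> D a ps p \<Longrightarrow> (\<lambda>n. a (us n) (ps n)) \<longlonglongrightarrow> - L2_inner \<Omega> w p"
  using assms unfolding closure_operator_def by auto

lemma Op_L2: assumes "(u, w) \<in> Op" shows "u \<in> L2 \<Omega>" "w \<in> L2 \<Omega>"
proof -
  show "u \<in> L2 \<Omega>" using OpE[OF assms] closure_seqD(1) by metis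
  show "w \<in> L2 \<Omega>" using assms unfolding closure_operator_def by simp
qed

lemma Op_lin: assumes "(u, w) \<in> Op" "(u', w') \<in> Op" shows "(\<lambda>x. c * u x + u' x, \<lambda>x. c * w x + w' x) \<in> Op"
proof -
  obtain us where us: "closure_seq \<Omega> D a us u"
    "\<And>p ps. closure_seq \<Omega> D a ps p \<Longrightarrow> (\<lambda>n. a (us n) (ps n)) \<longlonglongrightarrow> - L2_inner \<Omega> w p"
    using assms(1) unfolding closure_operator_def by auto
  obtain us' where us': "closure_seq \<Omega> D a us' u'"
    "\<And>p ps. closure_seq \<Omega> D a ps p \<Longrightarrow> (\<lambda>n. a (us' n) (ps n)) \<longlonglongrightarrow> - L2_inner \<Omega> w' p"
    using assms(2) unfolding closure_operator_def by auto
  have "(\<lambda>n. a (\<lambda>x. c * us n x + us' n x) (ps n)) \<longlonglongrightarrow> - L2_inner \<Omega> (\<lambda>x. c * w x + w' x) p"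
    if p: "closure_seq \<Omega> D a ps p" for p ps
  proof -
    have "(\<lambda>n. c * a (us n) (ps n) + a (us' n) (ps n)) \<longlonglongrightarrow> c * - L2_inner \<Omega> w p + - L2_inner \<Omega> w' p"
      by (intro tendsto_intros us us' p)
    then show ?thesis using L2_inner_lin_left[OF Op_L2(2)[OF assms(1)] Op_L2(2)[OF assms(2)] closure_seqD(1)[OF p]]
      lin_left[OF closure_seqD(2)[OF us(1)] closure_seqD(2)[OF us'(1)] closure_seqD(2)[OF p]] by simp
  qed
  then show ?thesis
    by (rule OpI[OF L2_lin[OF Op_L2(2)[OF assms(1)] Op_L2(2)[OF assms(2)]] closure_seq_lin[OF us(1) us'(1)]])
qed

text \<open>The operator is a set of pairs of representatives. Its independence of the
  representatives is what allows \<open>graph_iff\<close> to return from classes to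
  functions.\<close>

lemma Op_cong:
  assumes "(u, w) \<in> Op" "u' \<in> L2 \<Omega>" "w' \<in> L2 \<Omega>"
    "AE x in lebesgue_on \<Omega>. u x = u' x" "AE x in lebesgue_on \<Omega>. w x = w' x"
  shows "(u', w') \<in> Op"
proof -
  obtain us where us: "closure_seq \<Omega> D a us u"
    "\<And>p ps. closure_seq \<Omega> D a ps p \<Longrightarrow> (\<lambda>n. a (us n) (ps n)) \<longlonglongrightarrow> - L2_inner \<Omega> w p"
    using assms(1) unfolding closure_operator_def by auto
  have "l2_of \<Omega> u = l2_of \<Omega> u'" using l2_of_eq_iff[OF meas] Op_L2[OF assms(1)] assms by blast
  then have "closure_seq \<Omega> D a us u'"
    using us(1) closure_seqD[OF us(1)] L2_norm_tendsto_iff[OF meas, of us u'] assms(2) unfolding closure_seq_def by simp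
  moreover have "L2_inner \<Omega> w p = L2_inner \<Omega> w' p" if "p \<in> L2 \<Omega>" for p
    using Op_L2[OF assms(1)] assms that by (intro L2_inner_cong_AE) auto
  ultimately show ?thesis using us(2) closure_seqD(1) by (intro OpI[OF assms(3)]) simp_all
qed

text \<open>Completing the square: \<open>energy v + (f, u)\<close> is the limit of the nonnegative
  numbers \<open>s a(us n - v, us n - v) + (us n - v, us n - v)\<close>. The definition of the
  operator is used with \<open>us\<close> itself and with the constant sequence \<open>v\<close> as
  approximating sequences.\<close>

lemma energy_eq:
  assumes uw: "(u, w) \<in> Op" and s: "s > 0" and f: "f \<in> L2 \<Omega>" "AE x in lebesgue_on \<Omega>. u x - s * w x = f x"
  obtains us where "\<And>n. us n \<in> D" "(\<lambda>n. l2_of \<Omega> (us n)) \<longlonglongrightarrow> l2_of \<Omega> u"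
    "(\<lambda>n. energy \<Omega> a s f (us n)) \<longlonglongrightarrow> - L2_inner \<Omega> f u" "\<And>v. v \<in> D \<Longrightarrow> - L2_inner \<Omega> f u \<le> energy \<Omega> a s f v"
    "L2_inner \<Omega> u u \<le> L2_inner \<Omega> f u"
proof -
  obtain us where us: "closure_seq \<Omega> D a us u"
    "\<And>p ps. closure_seq \<Omega> D a ps p \<Longrightarrow> (\<lambda>n. a (us n) (ps n)) \<longlonglongrightarrow> - L2_inner \<Omega> w p"
    using uw unfolding closure_operator_def by auto
  note uD = closure_seqD[OF us(1)] and uL = Op_L2[OF uw]
  have fi: "L2_inner \<Omega> f p = L2_inner \<Omega> u p - s * L2_inner \<Omega> w p" if p: "p \<in> L2 \<Omega>" for p
  proof -
    have "(\<lambda>x. (-s) * w x + u x) \<in> L2 \<Omega>" using L2_lin uL by blast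
    then have "L2_inner \<Omega> f p = L2_inner \<Omega> (\<lambda>x. (-s) * w x + u x) p"
      using f p by (intro L2_inner_cong_AE) (auto elim: eventually_mono)
    then show ?thesis using L2_inner_lin_left[OF uL(2,1) p, of "-s"] by simp
  qed
  have lim: "(\<lambda>n. energy \<Omega> a s f (us n)) \<longlonglongrightarrow> - L2_inner \<Omega> f u"
  proof -
    have "(\<lambda>n. energy \<Omega> a s f (us n)) \<longlonglongrightarrow> s * - L2_inner \<Omega> w u + L2_inner \<Omega> u u - 2 * L2_inner \<Omega> f u"
      unfolding energy_def by (intro tendsto_intros us closure_seq_inner inner_tendsto f uD)
    then show ?thesis using fi[OF uL(1)] by simp
  qed
  have ge: "- L2_inner \<Omega> f u \<le> energy \<Omega> a s f v" if v: "v \<in> D" for v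
  proof -
    note vL = D_in[OF v]
    have "(\<lambda>n. energy \<Omega> a s f v + 2 * L2_inner \<Omega> f v - 2 * (s * a (us n) v + L2_inner \<Omega> (us n) v) + energy \<Omega> a s f (us n) + 2 * L2_inner \<Omega> f (us n))
      \<longlonglongrightarrow> energy \<Omega> a s f v + 2 * L2_inner \<Omega> f v - 2 * (s * - L2_inner \<Omega> w v + L2_inner \<Omega> u v) + - L2_inner \<Omega> f u + 2 * L2_inner \<Omega> f u"
      by (intro tendsto_intros us lim closure_seq_inner closure_seq_const v inner_tendsto f uD)
    moreover have "energy \<Omega> a s f v + 2 * L2_inner \<Omega> f v - 2 * (s * a (us n) v + L2_inner \<Omega> (us n) v) + energy \<Omega> a s f (us n) + 2 * L2_inner \<Omega> f (us n) \<ge> 0" for n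
    proof -
      have "0 \<le> s * a (\<lambda>x. us n x - v x) (\<lambda>x. us n x - v x)" using nonneg D_diff uD v s by simp
      moreover have "0 \<le> L2_inner \<Omega> (\<lambda>x. us n x - v x) (\<lambda>x. us n x - v x)" by (rule L2_inner_ge_0)
      moreover have "L2_inner \<Omega> (\<lambda>x. us n x - v x) (\<lambda>x. us n x - v x) = L2_inner \<Omega> (us n) (us n) - 2 * L2_inner \<Omega> (us n) v + L2_inner \<Omega> v v"
        by (rule semi_inner_space.square_diff[OF semi_inner_space_L2 uD(3) vL])
      ultimately show ?thesis using square_diff[OF uD(2) v] unfolding energy_def by (simp add: algebra_simps)
    qed
    ultimately have "0 \<le> energy \<Omega> a s f v + 2 * L2_inner \<Omega> f v - 2 * (s * - L2_inner \<Omega> w v + L2_inner \<Omega> u v) + - L2_inner \<Omega> f u + 2 * L2_inner \<Omega> f u"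
      by (intro LIMSEQ_le_const) auto
    then show ?thesis using fi[OF vL] by simp
  qed
  \<comment> \<open>The nonnegative form term is dropped from the energy, whose limit along
    \<open>us\<close> is \<open>- (f, u)\<close>.\<close>
  have "L2_inner \<Omega> u u - 2 * L2_inner \<Omega> f u \<le> - L2_inner \<Omega> f u"
  proof (rule LIMSEQ_le)
    show "(\<lambda>n. L2_inner \<Omega> (us n) (us n) - 2 * L2_inner \<Omega> f (us n)) \<longlonglongrightarrow> L2_inner \<Omega> u u - 2 * L2_inner \<Omega> f u"
      by (intro tendsto_intros closure_seq_inner us inner_tendsto f uD)
    show "\<exists>N. \<forall>n\<ge>N. L2_inner \<Omega> (us n) (us n) - 2 * L2_inner \<Omega> f (us n) \<le> energy \<Omega> a s f (us n)"
      unfolding energy_def using nonneg[OF uD(2)] s by auto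
  qed (rule lim)
  then show ?thesis by (intro that[OF uD(2) uD(4) lim ge]) simp_all
qed

text \<open>By the parallelogram identity the distance of \<open>v n\<close> and \<open>us n\<close>
  is controlled by their energies and that of their midpoint, which cannot be below
  \<open>- (f, u)\<close>. Only an upper bound \<open>c n\<close> for the energies is assumed, since
  for truncated functions nothing better is at hand.\<close>

lemma minimizing:
  assumes uw: "(u, w) \<in> Op" and s: "s > 0" and f: "f \<in> L2 \<Omega>" "AE x in lebesgue_on \<Omega>. u x - s * w x = f x"
    and v: "\<And>n. v n \<in> D" "\<And>n. energy \<Omega> a s f (v n) \<le> c n" "c \<longlonglongrightarrow> - L2_inner \<Omega> f u"
  shows "(\<lambda>n. l2_of \<Omega> (v n)) \<longlonglongrightarrow> l2_of \<Omega> u"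
proof -
  obtain us where us: "\<And>n. us n \<in> D" "(\<lambda>n. l2_of \<Omega> (us n)) \<longlonglongrightarrow> l2_of \<Omega> u"
    "(\<lambda>n. energy \<Omega> a s f (us n)) \<longlonglongrightarrow> - L2_inner \<Omega> f u" "\<And>v. v \<in> D \<Longrightarrow> - L2_inner \<Omega> f u \<le> energy \<Omega> a s f v"
    using energy_eq[OF uw s f] by metis
  have b: "(norm (l2_of \<Omega> (v n) - l2_of \<Omega> (us n)))\<^sup>2 \<le> 2 * c n + 2 * energy \<Omega> a s f (us n) + 4 * L2_inner \<Omega> f u" for n
  proof -
    let ?z = "\<lambda>x. v n x + us n x"
    define F where "F = l2_of \<Omega> f"
    define V where "V = l2_of \<Omega> (v n)"
    define U where "U = l2_of \<Omega> (us n)"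
    have L: "v n \<in> L2 \<Omega>" "us n \<in> L2 \<Omega>" using v us D_in by blast+
    have z: "?z \<in> D" "(\<lambda>x. 1/2 * ?z x) \<in> D" using D_add[OF v(1) us(1)] D_scale by blast+
    have Z: "l2_of \<Omega> (\<lambda>x. 1/2 * ?z x) = (1/2) *\<^sub>R (V + U)"
      using l2_of_lin[OF meas L, of 1] l2_of_scale[OF meas D_in[OF z(1)], of "1/2"] unfolding V_def U_def by simp
    have e: "energy \<Omega> a s f g = s * a g g + l2_of \<Omega> g \<bullet> l2_of \<Omega> g - 2 * (F \<bullet> l2_of \<Omega> g)" if "g \<in> D" for g
      unfolding energy_def F_def using inner_l2_of[OF meas] D_in[OF that] f by simp
    define P Q R where "P = s * a (v n) (v n)" and "Q = s * a (v n) (us n)" and "R = s * a (us n) (us n)"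
    have "energy \<Omega> a s f (\<lambda>x. 1/2 * ?z x) = (1/4) * (P + 2 * Q + R) + (1/4) * (V \<bullet> V + 2 * (V \<bullet> U) + U \<bullet> U) - (F \<bullet> V + F \<bullet> U)"
      unfolding e[OF z(2)] Z square_scale[OF z(1)] square_add[OF v(1) us(1)] P_def Q_def R_def
      by (simp add: inner_add inner_commute power2_eq_square algebra_simps)
    then have "- L2_inner \<Omega> f u \<le> (1/4) * (P + 2 * Q + R) + (1/4) * (V \<bullet> V + 2 * (V \<bullet> U) + U \<bullet> U) - (F \<bullet> V + F \<bullet> U)"
      using us(4)[OF z(2)] by simp
    moreover have "0 \<le> P - 2 * Q + R"
    proof -
      have "0 \<le> s * a (\<lambda>x. v n x - us n x) (\<lambda>x. v n x - us n x)"
        using s by (intro mult_nonneg_nonneg nonneg D_diff v us) auto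
      then show ?thesis unfolding square_diff[OF v(1) us(1)] P_def Q_def R_def by (simp add: algebra_simps)
    qed
    moreover have "(norm (V - U))\<^sup>2 = V \<bullet> V - 2 * (V \<bullet> U) + U \<bullet> U" by (simp add: power2_norm_eq_inner inner_diff inner_commute)
    moreover have "P + V \<bullet> V - 2 * (F \<bullet> V) \<le> c n" using v(2)[of n] e[OF v(1)] unfolding V_def P_def by simp
    moreover have "energy \<Omega> a s f (us n) = R + U \<bullet> U - 2 * (F \<bullet> U)" using e[OF us(1)] unfolding U_def R_def by simp
    moreover have "N \<le> 2 * c + 2 * E + 4 * I"
      if "- I \<le> (1/4) * (P + 2 * Q + R) + (1/4) * (VV + 2 * VU + UU) - (FV + FU)" "0 \<le> P - 2 * Q + R"
        "N = VV - 2 * VU + UU" "P + VV - 2 * FV \<le> c" "E = R + UU - 2 * FU"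
      for I P Q R VV VU UU FV FU N c E :: real
      using that by (simp add: field_simps)
    ultimately have "(norm (V - U))\<^sup>2 \<le> 2 * c n + 2 * energy \<Omega> a s f (us n) + 4 * L2_inner \<Omega> f u" by blast
    then show ?thesis unfolding V_def U_def .
  qed
  have "(\<lambda>n. (norm (l2_of \<Omega> (v n) - l2_of \<Omega> (us n)))\<^sup>2) \<longlonglongrightarrow> 0"
  proof (rule tendsto_sandwich[OF _ _ tendsto_const])
    have "(\<lambda>n. 2 * c n + 2 * energy \<Omega> a s f (us n) + 4 * L2_inner \<Omega> f u) \<longlonglongrightarrow> 2 * - L2_inner \<Omega> f u + 2 * - L2_inner \<Omega> f u + 4 * L2_inner \<Omega> f u"
      by (intro tendsto_intros v us)
    then show "(\<lambda>n. 2 * c n + 2 * energy \<Omega> a s f (us n) + 4 * L2_inner \<Omega> f u) \<longlonglongrightarrow> 0" by simp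
  qed (use b in auto)
  then have "(\<lambda>n. sqrt ((norm (l2_of \<Omega> (v n) - l2_of \<Omega> (us n)))\<^sup>2)) \<longlonglongrightarrow> sqrt 0" by (rule tendsto_real_sqrt)
  then have "(\<lambda>n. l2_of \<Omega> (v n) - l2_of \<Omega> (us n)) \<longlonglongrightarrow> 0" by (simp add: tendsto_norm_zero_iff)
  then have "(\<lambda>n. (l2_of \<Omega> (v n) - l2_of \<Omega> (us n)) + l2_of \<Omega> (us n)) \<longlonglongrightarrow> 0 + l2_of \<Omega> u" by (intro tendsto_intros us)
  then show ?thesis by simp
qed

text \<open>The sequence of \<open>riesz\<close> for the sum of \<open>s a\<close> and the
  \<open>L\<^sup>2\<close> product, and for the functional given by \<open>f\<close>, is Cauchy for
  the form and in \<open>L\<^sup>2\<close>. Defining \<open>w\<close> by \<open>u - s w = f\<close>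
  makes the equation hold at every point; that \<open>w\<close> is the image of \<open>u\<close>
  then follows from the approximate variational equation.\<close>

lemma Op_range:
  assumes f: "f \<in> L2 \<Omega>" and s: "s > 0" shows "\<exists>u w. (u, w) \<in> Op \<and> (\<forall>x. u x - s * w x = f x)"
proof -
  define b where "b u v = s * a u v + L2_inner \<Omega> u v" for u v
  interpret B: semi_inner_space D b
  proof
    fix c f g h assume fgh: "f \<in> D" "g \<in> D" "h \<in> D"
    show "b (\<lambda>x. c * f x + g x) h = c * b f h + b g h"
      unfolding b_def lin_left[OF fgh] L2_inner_lin_left[OF fgh[THEN D_in]] by (simp add: algebra_simps)
  next
    fix f g assume "f \<in> D" "g \<in> D"
    then show "b f g = b g f" unfolding b_def using sym L2_inner_commute by metis
  next
    fix f assume "f \<in> D" then show "0 \<le> b f f"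
      unfolding b_def using s by (intro add_nonneg_nonneg mult_nonneg_nonneg nonneg L2_inner_ge_0) auto
  qed (use D_0 D_lin in auto)
  have bL: "L2_inner \<Omega> v v \<le> b v v" and ba: "s * a v v \<le> b v v" if "v \<in> D" for v
    unfolding b_def using nonneg[OF that] s L2_inner_ge_0 by auto
  obtain x where x: "\<And>n. x n \<in> D" "\<And>n v. v \<in> D \<Longrightarrow> \<bar>b (x n) v - L2_inner \<Omega> f v\<bar> \<le> sqrt (b v v) / real (Suc n)"
    "\<And>m n. b (\<lambda>z. x m z - x n z) (\<lambda>z. x m z - x n z) \<le> (1 / real (Suc m) + 1 / real (Suc n))\<^sup>2"
  proof (rule B.riesz[of "L2_inner \<Omega> f" "L2_inner \<Omega> f f"])
    show "L2_inner \<Omega> f (\<lambda>x. c * g x + h x) = c * L2_inner \<Omega> f g + L2_inner \<Omega> f h" if "g \<in> D" "h \<in> D" for c g h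
      using L2_inner_lin_left[OF D_in D_in f] that L2_inner_commute by metis
    fix v assume v: "v \<in> D"
    have "(L2_inner \<Omega> f v)\<^sup>2 \<le> L2_inner \<Omega> f f * L2_inner \<Omega> v v"
      using Cauchy_Schwarz_ineq[of "l2_of \<Omega> f" "l2_of \<Omega> v"] inner_l2_of[OF meas] f D_in[OF v] by simp
    also have "\<dots> \<le> L2_inner \<Omega> f f * b v v" using bL[OF v] L2_inner_ge_0 by (intro mult_left_mono)
    finally show "(L2_inner \<Omega> f v)\<^sup>2 \<le> L2_inner \<Omega> f f * b v v" .
  qed blast
  have small: "\<exists>M. \<forall>m\<ge>M. \<forall>n\<ge>M. b (\<lambda>z. x m z - x n z) (\<lambda>z. x m z - x n z) < e" if e: "e > 0" for e
  proof -
    obtain M where M: "inverse (real (Suc M)) < sqrt e / 2" using reals_Archimedean[of "sqrt e / 2"] e by auto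
    have "b (\<lambda>z. x m z - x n z) (\<lambda>z. x m z - x n z) < e" if "m \<ge> M" "n \<ge> M" for m n
    proof -
      have "1 / real (Suc m) \<le> inverse (real (Suc M))" "1 / real (Suc n) \<le> inverse (real (Suc M))"
        using that by (auto simp: inverse_eq_divide intro!: divide_left_mono)
      then have "1 / real (Suc m) + 1 / real (Suc n) < sqrt e" using M by linarith
      then have "(1 / real (Suc m) + 1 / real (Suc n))\<^sup>2 < (sqrt e)\<^sup>2" by (intro power_strict_mono) (auto simp: add_nonneg_nonneg)
      then show ?thesis using x(3)[of m n] e by simp
    qed
    then show ?thesis by blast
  qed
  have xC: "Cauchy (\<lambda>n. l2_of \<Omega> (x n))"
  proof (rule metric_CauchyI)
    fix e :: real assume e: "e > 0"
    obtain M where M: "\<And>m n. m \<ge> M \<Longrightarrow> n \<ge> M \<Longrightarrow> b (\<lambda>z. x m z - x n z) (\<lambda>z. x m z - x n z) < e\<^sup>2" using small[of "e\<^sup>2"] e by auto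
    have "dist (l2_of \<Omega> (x m)) (l2_of \<Omega> (x n)) < e" if "m \<ge> M" "n \<ge> M" for m n
    proof -
      have d: "(\<lambda>z. x m z - x n z) \<in> D" using D_diff x by blast
      have "(dist (l2_of \<Omega> (x m)) (l2_of \<Omega> (x n)))\<^sup>2 = L2_inner \<Omega> (\<lambda>z. x m z - x n z) (\<lambda>z. x m z - x n z)"
        using inner_l2_of[OF meas D_in[OF d] D_in[OF d]] l2_of_diff[OF meas D_in[OF x(1)] D_in[OF x(1)]] by (simp add: dist_norm power2_norm_eq_inner)
      also have "\<dots> < e\<^sup>2" using bL[OF d] M[OF that] by linarith
      finally show ?thesis using e by (simp add: power_less_imp_less_base)
    qed
    then show "\<exists>M. \<forall>m\<ge>M. \<forall>n\<ge>M. dist (l2_of \<Omega> (x m)) (l2_of \<Omega> (x n)) < e" by blast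
  qed
  have xin: "\<forall>n. l2_of \<Omega> (x n) \<in> l2_of \<Omega> ` L2 \<Omega>" using D_in[OF x(1)] by simp
  obtain U where U: "U \<in> l2_of \<Omega> ` L2 \<Omega>" "(\<lambda>n. l2_of \<Omega> (x n)) \<longlonglongrightarrow> U"
    by (rule completeE[OF complete_l2_of[OF meas] xin xC])
  obtain u where u: "u \<in> L2 \<Omega>" "(\<lambda>n. l2_of \<Omega> (x n)) \<longlonglongrightarrow> l2_of \<Omega> u" using U by auto
  define w where "w = (\<lambda>z. (1/s) * (u z - f z))"
  have w: "w \<in> L2 \<Omega>" unfolding w_def using L2_scale L2_diff u f by blast
  have cs: "closure_seq \<Omega> D a x u"
    unfolding closure_seq_def
  proof (intro conjI allI impI)
    show "(\<lambda>n. L2_norm \<Omega> (\<lambda>z. x n z - u z)) \<longlonglongrightarrow> 0" using L2_norm_tendsto_iff[OF meas, of x u] u x D_in by blast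
    fix e :: real assume e: "e > 0"
    obtain M where M: "\<And>m n. m \<ge> M \<Longrightarrow> n \<ge> M \<Longrightarrow> b (\<lambda>z. x m z - x n z) (\<lambda>z. x m z - x n z) < s * e" using small[of "s * e"] e s by auto
    have "a (\<lambda>z. x m z - x n z) (\<lambda>z. x m z - x n z) < e" if "m \<ge> M" "n \<ge> M" for m n
    proof -
      have "s * a (\<lambda>z. x m z - x n z) (\<lambda>z. x m z - x n z) < s * e"
        using ba[OF D_diff[OF x(1) x(1)], of m n] M[OF that] by linarith
      then show ?thesis using s by simp
    qed
    then show "\<exists>M. \<forall>m\<ge>M. \<forall>n\<ge>M. a (\<lambda>z. x m z - x n z) (\<lambda>z. x m z - x n z) < e" by blast
  qed (use u x in auto)
  have "(\<lambda>n. a (x n) (ps n)) \<longlonglongrightarrow> - L2_inner \<Omega> w p" if p: "closure_seq \<Omega> D a ps p" for p ps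
  proof -
    note pD = closure_seqD[OF p]
    \<comment> \<open>The defect of \<open>x n\<close> is measured by
      \<open>b (ps n) (ps n)\<close>, which stays bounded because \<open>ps\<close> is Cauchy for
      the form, while the factor \<open>1 / real (Suc n)\<close> tends to \<open>0\<close>.\<close>
    obtain B M where B: "\<And>n. n \<ge> M \<Longrightarrow> a (ps n) (ps n) \<le> B" using closure_seq_bounded[OF p] by blast
    have "(\<lambda>n. b (x n) (ps n) - L2_inner \<Omega> f (ps n)) \<longlonglongrightarrow> 0"
    proof (rule Lim_null_comparison)
      show "\<forall>\<^sub>F n in sequentially. norm (b (x n) (ps n) - L2_inner \<Omega> f (ps n)) \<le> sqrt (s * B + L2_inner \<Omega> (ps n) (ps n)) * inverse (real (Suc n))"
      proof (rule eventually_sequentiallyI[of M])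
        fix n assume "n \<ge> M"
        then have "b (ps n) (ps n) \<le> s * B + L2_inner \<Omega> (ps n) (ps n)" unfolding b_def using B s by simp
        then have "sqrt (b (ps n) (ps n)) / real (Suc n) \<le> sqrt (s * B + L2_inner \<Omega> (ps n) (ps n)) / real (Suc n)"
          by (intro divide_right_mono real_sqrt_le_mono) auto
        then show "norm (b (x n) (ps n) - L2_inner \<Omega> f (ps n)) \<le> sqrt (s * B + L2_inner \<Omega> (ps n) (ps n)) * inverse (real (Suc n))"
          using x(2)[OF pD(2), of n n] unfolding real_norm_def divide_inverse by linarith
      qed
      have "(\<lambda>n. sqrt (s * B + L2_inner \<Omega> (ps n) (ps n)) * inverse (real (Suc n))) \<longlonglongrightarrow> sqrt (s * B + L2_inner \<Omega> p p) * 0"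
        by (intro tendsto_intros LIMSEQ_inverse_real_of_nat closure_seq_inner p)
      then show "(\<lambda>n. sqrt (s * B + L2_inner \<Omega> (ps n) (ps n)) * inverse (real (Suc n))) \<longlonglongrightarrow> 0" by simp
    qed
    then have "(\<lambda>n. (1/s) * ((b (x n) (ps n) - L2_inner \<Omega> f (ps n)) + L2_inner \<Omega> f (ps n) - L2_inner \<Omega> (x n) (ps n))) \<longlonglongrightarrow>
      (1/s) * (0 + L2_inner \<Omega> f p - L2_inner \<Omega> u p)"
      by (intro tendsto_intros closure_seq_inner cs p inner_tendsto f pD)
    moreover have "(1/s) * ((b (x n) (ps n) - L2_inner \<Omega> f (ps n)) + L2_inner \<Omega> f (ps n) - L2_inner \<Omega> (x n) (ps n)) = a (x n) (ps n)" for n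
      unfolding b_def using s by simp
    moreover have "(1/s) * (0 + L2_inner \<Omega> f p - L2_inner \<Omega> u p) = - L2_inner \<Omega> w p"
    proof -
      have "L2_inner \<Omega> w p = (1/s) * L2_inner \<Omega> (\<lambda>z. u z - f z) p"
        unfolding w_def L2_inner_def by (simp add: mult.assoc)
      also have "L2_inner \<Omega> (\<lambda>z. u z - f z) p = L2_inner \<Omega> u p - L2_inner \<Omega> f p"
        using L2_inner_lin_left[OF f u(1) pD(1), of "-1"] by simp
      finally show ?thesis by (simp add: algebra_simps)
    qed
    ultimately show ?thesis by simp
  qed
  then have "(u, w) \<in> Op" by (rule OpI[OF w cs])
  moreover have "u x - s * w x = f x" for x unfolding w_def using s by simp
  ultimately show ?thesis by blast
qed

lemma Op_dissipative: assumes "(u, w) \<in> Op" shows "L2_inner \<Omega> w u \<le> 0"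
proof -
  obtain us where us: "closure_seq \<Omega> D a us u" "(\<lambda>n. a (us n) (us n)) \<longlonglongrightarrow> - L2_inner \<Omega> w u"
    using OpE[OF assms] by metis
  have "0 \<le> - L2_inner \<Omega> w u" by (rule LIMSEQ_le_const[OF us(2)]) (use nonneg closure_seqD(2)[OF us(1)] in auto)
  then show ?thesis by simp
qed

text \<open>A member \<open>g\<close> of the form domain need not lie in the operator domain, but
  its resolvents do, and \<open>energy_eq\<close> with \<open>f = v = g\<close> bounds the squared
  distance of \<open>g\<close> and \<open>u\<close> by \<open>s * a g g\<close>. This dictates
  \<open>s\<close>; the summand \<open>1\<close> in its denominator covers
  \<open>a g g = 0\<close>.\<close>

lemma Op_dense:
  assumes f: "f \<in> L2 \<Omega>" and e: "e > 0" shows "\<exists>(u, w)\<in>Op. norm (l2_of \<Omega> f - l2_of \<Omega> u) < e"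
proof -
  obtain g where g: "g \<in> D" "L2_norm \<Omega> (\<lambda>x. f x - g x) < e/2" using D_dense[OF f, of "e/2"] e by auto
  define s where "s = (e/2)\<^sup>2 / (a g g + 1)"
  have ag: "a g g + 1 > 0" using nonneg[OF g(1)] by simp
  have s: "s > 0" unfolding s_def using e ag by simp
  note gL = D_in[OF g(1)]
  obtain u w where uw: "(u, w) \<in> Op" "\<And>x. u x - s * w x = g x" using Op_range[OF gL s] by blast
  note uL = Op_L2[OF uw(1)]
  have m: "- L2_inner \<Omega> g u \<le> energy \<Omega> a s g g" and n: "L2_inner \<Omega> u u \<le> L2_inner \<Omega> g u"
    using energy_eq[OF uw(1) s gL AE_I2[OF uw(2)]] g(1) by metis+
  have "(norm (l2_of \<Omega> g - l2_of \<Omega> u))\<^sup>2 = L2_inner \<Omega> g g - 2 * L2_inner \<Omega> g u + L2_inner \<Omega> u u"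
    using inner_l2_of[OF meas] gL uL by (simp add: power2_norm_eq_inner inner_diff inner_commute)
  also have "\<dots> \<le> s * a g g" using m n unfolding energy_def by linarith
  also have "\<dots> < s * (a g g + 1)" using s by simp
  also have "\<dots> = (e/2)\<^sup>2" unfolding s_def using ag by simp
  finally have "(norm (l2_of \<Omega> g - l2_of \<Omega> u))\<^sup>2 < (e/2)\<^sup>2" .
  then have "norm (l2_of \<Omega> g - l2_of \<Omega> u) < e/2" by (rule power_less_imp_less_base) (use e in simp)
  moreover have "norm (l2_of \<Omega> f - l2_of \<Omega> g) < e/2" using g(2) norm_l2_of[OF meas L2_diff[OF f gL]] l2_of_diff[OF meas f gL] by simp
  moreover have "norm (l2_of \<Omega> f - l2_of \<Omega> u) \<le> norm (l2_of \<Omega> f - l2_of \<Omega> g) + norm (l2_of \<Omega> g - l2_of \<Omega> u)"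
    using norm_triangle_ineq[of "l2_of \<Omega> f - l2_of \<Omega> g" "l2_of \<Omega> g - l2_of \<Omega> u"] by simp
  ultimately have "norm (l2_of \<Omega> f - l2_of \<Omega> u) < e" by linarith
  then show ?thesis using uw(1) by blast
qed

definition graph :: "('a l2 \<times> 'a l2) set" where "graph = (\<lambda>(u, w). (l2_of \<Omega> u, l2_of \<Omega> w)) ` Op"

lemma graph_iff: assumes "u \<in> L2 \<Omega>" "w \<in> L2 \<Omega>" shows "(l2_of \<Omega> u, l2_of \<Omega> w) \<in> graph \<longleftrightarrow> (u, w) \<in> Op"
proof
  assume "(l2_of \<Omega> u, l2_of \<Omega> w) \<in> graph"
  then obtain u' w' where u': "(u', w') \<in> Op" "l2_of \<Omega> u' = l2_of \<Omega> u" "l2_of \<Omega> w' = l2_of \<Omega> w" unfolding graph_def by auto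
  then show "(u, w) \<in> Op" using Op_cong[OF u'(1) assms] l2_of_eq_iff[OF meas] Op_L2[OF u'(1)] assms by blast
next
  assume "(u, w) \<in> Op" then show "(l2_of \<Omega> u, l2_of \<Omega> w) \<in> graph" unfolding graph_def by force
qed

sublocale m_dissipative "l2_of \<Omega> ` L2 \<Omega>" graph
proof
  show "subspace (l2_of \<Omega> ` L2 \<Omega>)" by (rule subspace_l2_of[OF meas])
  show "complete (l2_of \<Omega> ` L2 \<Omega>)" by (rule complete_l2_of[OF meas])
  show "graph \<subseteq> l2_of \<Omega> ` L2 \<Omega> \<times> l2_of \<Omega> ` L2 \<Omega>" unfolding graph_def using Op_L2 by auto
  have lin: "c *\<^sub>R p + q \<in> graph" if pq: "p \<in> graph" "q \<in> graph" for c p q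
  proof -
    obtain u w u' w' where uw: "(u, w) \<in> Op" "(u', w') \<in> Op" "p = (l2_of \<Omega> u, l2_of \<Omega> w)" "q = (l2_of \<Omega> u', l2_of \<Omega> w')"
      using pq unfolding graph_def by auto
    have "c *\<^sub>R p + q = (l2_of \<Omega> (\<lambda>x. c * u x + u' x), l2_of \<Omega> (\<lambda>x. c * w x + w' x))"
      using uw l2_of_lin[OF meas] Op_L2 by simp
    moreover have "\<dots> \<in> graph" using Op_lin[OF uw(1,2)] unfolding graph_def by force
    ultimately show ?thesis by simp
  qed
  obtain u w where "(u, w) \<in> Op" using Op_range[OF L2_zero zero_less_one] by blast
  then have ne: "(l2_of \<Omega> u, l2_of \<Omega> w) \<in> graph" unfolding graph_def by force
  have "0 \<in> graph" using lin[OF ne ne, of "-1"] by (simp add: zero_prod_def)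
  then show "subspace graph" unfolding subspace_def using lin[where c=1] lin[of _ 0] by auto
  show "norm p \<le> norm (p - s *\<^sub>R q)" if pq: "(p, q) \<in> graph" "s > 0" for p q s
  proof -
    obtain u w where uw: "(u, w) \<in> Op" "p = l2_of \<Omega> u" "q = l2_of \<Omega> w" using pq unfolding graph_def by auto
    have "p \<bullet> q \<le> 0"
      using Op_dissipative[OF uw(1)] L2_inner_commute[of \<Omega> w u] inner_l2_of[OF meas Op_L2[OF uw(1)]] uw(2,3) by simp
    then have "s * (p \<bullet> q) \<le> 0" using that by (simp add: mult_le_0_iff)
    then have "p \<bullet> p \<le> p \<bullet> (p - s *\<^sub>R q)" by (simp add: inner_diff)
    also have "\<dots> \<le> norm p * norm (p - s *\<^sub>R q)" by (rule norm_cauchy_schwarz)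
    finally have "norm p * norm p \<le> norm p * norm (p - s *\<^sub>R q)" by (simp add: power2_norm_eq_inner[symmetric] power2_eq_square)
    then show ?thesis by (cases "p = 0") auto
  qed
  show "\<exists>u w. (u, w) \<in> graph \<and> u - s *\<^sub>R w = F" if F: "F \<in> l2_of \<Omega> ` L2 \<Omega>" "s > 0" for F s
  proof -
    obtain f where f: "f \<in> L2 \<Omega>" "F = l2_of \<Omega> f" using F by blast
    obtain u w where uw: "(u, w) \<in> Op" "\<And>x. u x - s * w x = f x" using Op_range[OF f(1) F(2)] by blast
    have "F = l2_of \<Omega> (\<lambda>x. (-s) * w x + u x)" unfolding f(2) using uw(2) by (intro arg_cong[of _ _ "l2_of \<Omega>"]) (auto simp: fun_eq_iff algebra_simps)
    then have "l2_of \<Omega> u - s *\<^sub>R l2_of \<Omega> w = F" using l2_of_lin[OF meas Op_L2(2,1)[OF uw(1)], of "-s"] by simp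
    then show ?thesis using uw(1) unfolding graph_def by force
  qed
  show "\<exists>(u, w)\<in>graph. norm (F - u) < e" if "F \<in> l2_of \<Omega> ` L2 \<Omega>" "e > 0" for F e
    using that Op_dense unfolding graph_def by fastforce
qed

end

subsection \<open>Mollifiers\<close>

lemma Ck_SucI:
  assumes "\<And>x. (f has_derivative f' x) (at x)" "\<And>b. b \<in> Basis \<Longrightarrow> Ck k (\<lambda>x. f' x b)"
  shows "Ck (Suc k) f"
proof -
  have "frechet_derivative f (at x) = f' x" for x using frechet_derivative_at[OF assms(1)] by simp
  then show ?thesis using assms by (auto simp: differentiable_def)
qed

lemma Ck_SucD:
  assumes "Ck (Suc k) f"
  shows "(f has_derivative frechet_derivative f (at x)) (at x)" "\<And>b. b \<in> Basis \<Longrightarrow> Ck k (\<lambda>x. frechet_derivative f (at x) b)"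
  using assms frechet_derivative_works by auto

lemma Ck_pred: "Ck (Suc k) f \<Longrightarrow> Ck k f"
proof (induction k arbitrary: f)
  case 0
  then show ?case using has_derivative_continuous[OF Ck_SucD(1)[OF 0]] by (simp add: continuous_on_eq_continuous_at)
next
  case (Suc k)
  show ?case by (rule Ck_SucI[OF Ck_SucD(1)[OF Suc.prems]]) (use Suc.IH Ck_SucD(2)[OF Suc.prems] in blast)
qed

lemma Ck_continuous: "Ck k f \<Longrightarrow> continuous_on UNIV f"
  by (induction k) (use Ck_pred in auto)

lemma Ck_const: "Ck k (\<lambda>x. c)"
proof (induction k arbitrary: c)
  case (Suc k)
  show ?case by (rule Ck_SucI[OF has_derivative_const]) (rule Suc)
qed simp

lemma Ck_inner: "Ck k (\<lambda>x. x \<bullet> b)"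
proof (cases k)
  case (Suc n)
  have "Ck (Suc n) (\<lambda>x. x \<bullet> b)"
    by (rule Ck_SucI[where f'="\<lambda>x h. h \<bullet> b"]) (auto intro!: derivative_eq_intros Ck_const)
  then show ?thesis using Suc by simp
qed (auto intro!: continuous_intros)

lemma Ck_add: "Ck k f \<Longrightarrow> Ck k g \<Longrightarrow> Ck k (\<lambda>x. f x + g x)"
proof (induction k arbitrary: f g)
  case 0 then show ?case by (auto intro!: continuous_intros)
next
  case (Suc k)
  show ?case
    by (rule Ck_SucI[OF has_derivative_add[OF Ck_SucD(1)[OF Suc.prems(1)] Ck_SucD(1)[OF Suc.prems(2)]]])
      (intro Suc.IH Ck_SucD(2)[OF Suc.prems(1)] Ck_SucD(2)[OF Suc.prems(2)])
qed

lemma Ck_mult: "Ck k f \<Longrightarrow> Ck k g \<Longrightarrow> Ck k (\<lambda>x. f x * g x)"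
proof (induction k arbitrary: f g)
  case 0 then show ?case by (auto intro!: continuous_intros)
next
  case (Suc k)
  show ?case
    by (rule Ck_SucI[OF has_derivative_mult[OF Ck_SucD(1)[OF Suc.prems(1)] Ck_SucD(1)[OF Suc.prems(2)]]])
      (intro Ck_add Suc.IH Ck_pred[OF Suc.prems(1)] Ck_pred[OF Suc.prems(2)]
        Ck_SucD(2)[OF Suc.prems(1)] Ck_SucD(2)[OF Suc.prems(2)])
qed

lemma Ck_sum: "finite I \<Longrightarrow> (\<And>i. i \<in> I \<Longrightarrow> Ck k (f i)) \<Longrightarrow> Ck k (\<lambda>x. \<Sum>i\<in>I. f i x)"
  by (induction I rule: finite_induct) (auto intro!: Ck_const Ck_add)

text \<open>\<open>S\<close> is a family of functions of one variable that is closed under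
  differentiation, which is easier to exhibit than all derivatives of a single function. It is
  applied with \<open>S = range flat\<close>.\<close>

lemma Ck_compose:
  fixes q :: "'a::euclidean_space \<Rightarrow> real" and S :: "(real \<Rightarrow> real) set"
  assumes S: "\<And>F. F \<in> S \<Longrightarrow> \<exists>F'\<in>S. \<forall>t. (F has_real_derivative F' t) (at t)" and q: "\<And>k. Ck k q"
  shows "F \<in> S \<Longrightarrow> Ck k (\<lambda>x. F (q x))"
proof (induction k arbitrary: F)
  case 0
  obtain F' where "\<forall>t. (F has_real_derivative F' t) (at t)" using S[OF 0] by blast
  then have "continuous_on UNIV F" by (auto intro!: continuous_at_imp_continuous_on DERIV_isCont)
  then have "continuous_on UNIV (\<lambda>x. F (q x))" using Ck_continuous[OF q] by (rule continuous_on_compose2) auto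
  then show ?case by simp
next
  case (Suc k)
  obtain F' where F': "F' \<in> S" "\<And>t. (F has_real_derivative F' t) (at t)" using S[OF Suc.prems] by blast
  show ?case
  proof (rule Ck_SucI)
    show "((\<lambda>x. F (q x)) has_derivative (\<lambda>h. F' (q x) * frechet_derivative q (at x) h)) (at x)" for x
      using has_derivative_compose[OF Ck_SucD(1)[OF q] F'(2)[unfolded has_field_derivative_def]] by simp
    show "Ck k (\<lambda>x. F' (q x) * frechet_derivative q (at x) b)" if "b \<in> Basis" for b
      by (intro Ck_mult Suc.IH F' Ck_SucD(2)[OF q that])
  qed
qed

text \<open>The family \<open>p(1/t) exp(-1/t)\<close>, extended by zero, that arises from
  differentiating \<open>exp(-1/t)\<close>; a derivative replaces \<open>p\<close> by
  \<open>X^2 (p - p')\<close>.\<close>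

definition flat :: "real poly \<Rightarrow> real \<Rightarrow> real" where
  "flat p t = (if t > 0 then poly p (inverse t) * exp (- inverse t) else 0)"

lemma poly_exp_tendsto: "((\<lambda>y. poly p y * exp (- y)) \<longlongrightarrow> 0) at_top" for p :: "real poly"
proof -
  have "((\<lambda>y. \<Sum>i\<le>degree p. coeff p i * (y ^ i / exp y)) \<longlongrightarrow> (\<Sum>i\<le>degree p. coeff p i * 0)) at_top"
    by (intro tendsto_intros tendsto_power_div_exp_0)
  then show ?thesis by (simp add: poly_altdef exp_minus sum_distrib_right divide_inverse mult.assoc)
qed

lemma flat_deriv: "(flat p has_real_derivative flat ([:0, 0, 1:] * (p - pderiv p)) t) (at t)"
proof -
  consider "t > 0" | "t < 0" | "t = 0" by linarith
  then show ?thesis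
  proof cases
    case 1
    have A: "((\<lambda>t. poly p (inverse t) * exp (- inverse t)) has_real_derivative flat ([:0, 0, 1:] * (p - pderiv p)) t) (at t)"
      using 1 by (auto intro!: derivative_eq_intros simp: flat_def power2_eq_square algebra_simps)
    have B: "\<forall>\<^sub>F x in nhds t. flat p x = poly p (inverse x) * exp (- inverse x)"
      unfolding eventually_nhds using 1 by (intro exI[of _ "{0<..}"]) (auto simp: flat_def)
    show ?thesis using DERIV_cong_ev[OF refl B refl] A by blast
  next
    case 2
    have A: "((\<lambda>t. 0) has_real_derivative flat ([:0, 0, 1:] * (p - pderiv p)) t) (at t)" using 2 by (simp add: flat_def)
    have B: "\<forall>\<^sub>F x in nhds t. flat p x = 0"
      unfolding eventually_nhds using 2 by (intro exI[of _ "{..<0}"]) (auto simp: flat_def)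
    show ?thesis using DERIV_cong_ev[OF refl B refl] A by blast
  next
    case 3
    \<comment> \<open>At \<open>0\<close> the two sides are treated separately. On the right,
      division by \<open>h\<close> multiplies \<open>p(1/h)\<close> by \<open>1/h\<close>, hence the
      polynomial \<open>[:0, 1:] * p\<close>, and the exponential wins.\<close>
    have "((\<lambda>h. (flat p (0 + h) - flat p 0) / h) \<longlongrightarrow> 0) (at 0)"
    proof (rule filterlim_split_at)
      have "((\<lambda>h. 0) \<longlongrightarrow> (0::real)) (at_left 0)" by simp
      moreover have "\<forall>\<^sub>F h in at_left 0. 0 = (flat p (0 + h) - flat p 0) / h"
        unfolding eventually_at_left_field by (intro exI[of _ "-1"]) (auto simp: flat_def)
      ultimately show "((\<lambda>h. (flat p (0 + h) - flat p 0) / h) \<longlongrightarrow> 0) (at_left 0)" by (rule Lim_transform_eventually)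
      have "((\<lambda>h. poly ([:0, 1:] * p) (inverse h) * exp (- inverse h)) \<longlongrightarrow> 0) (at_right 0)"
        by (rule filterlim_compose[OF poly_exp_tendsto filterlim_inverse_at_top_right])
      moreover have "\<forall>\<^sub>F h in at_right 0. poly ([:0, 1:] * p) (inverse h) * exp (- inverse h) = (flat p (0 + h) - flat p 0) / h"
        unfolding eventually_at_right_field by (intro exI[of _ 1]) (auto simp: flat_def field_simps)
      ultimately show "((\<lambda>h. (flat p (0 + h) - flat p 0) / h) \<longlongrightarrow> 0) (at_right 0)" by (rule Lim_transform_eventually)
    qed
    then show ?thesis unfolding 3 DERIV_def by (simp add: flat_def)
  qed
qed

section \<open>Bump functions and mollifiers\<close>

definition bump :: "real \<Rightarrow> 'a::euclidean_space \<Rightarrow> real" where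
  "bump e x = flat 1 (e\<^sup>2 - x \<bullet> x)"

lemma bump_Ck: "Ck k (bump e :: 'a::euclidean_space \<Rightarrow> real)"
proof -
  have "Ck k (\<lambda>x::'a. (\<Sum>b\<in>Basis. (x \<bullet> b) * (x \<bullet> b)))" for k by (intro Ck_sum Ck_mult Ck_inner) auto
  then have x: "Ck k (\<lambda>x::'a. x \<bullet> x)" for k by (simp add: euclidean_inner[symmetric])
  have q: "Ck k (\<lambda>x::'a. e\<^sup>2 - x \<bullet> x)" for k
    using Ck_add[OF Ck_const[of k "e\<^sup>2"] Ck_mult[OF Ck_const[of k "-1"] x[of k]]] by simp
  have "Ck k (\<lambda>x::'a. flat 1 (e\<^sup>2 - x \<bullet> x))"
    by (rule Ck_compose[where S="range flat", OF _ q]) (use flat_deriv in blast)+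
  then show ?thesis unfolding bump_def[abs_def] .
qed

lemma bump_nonneg: "0 \<le> bump e x" by (simp add: bump_def flat_def)

lemma bump_eq_0: assumes "e > 0" "norm x \<ge> e" shows "bump e x = 0"
proof -
  have "e\<^sup>2 \<le> x \<bullet> x" using assms power_mono[of e "norm x" 2] by (simp add: power2_norm_eq_inner)
  then show ?thesis by (simp add: bump_def flat_def)
qed

lemma bump_pos: assumes "norm x < e" shows "bump e x > 0"
proof -
  have "(norm x)\<^sup>2 < e\<^sup>2" using assms by (intro power_strict_mono) auto
  then show ?thesis by (simp add: bump_def flat_def power2_norm_eq_inner)
qed

lemma bump_continuous: "continuous_on S (bump e :: 'a::euclidean_space \<Rightarrow> real)"
  using Ck_continuous[OF bump_Ck] continuous_on_subset by blast

lemma bump_minus: "bump e (x - y) = bump e (y - (x::'a::euclidean_space))"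
proof -
  have "bump e (- z) = bump e z" for z :: 'a by (simp add: bump_def)
  from this[of "y - x"] show ?thesis by simp
qed

lemma integrable_continuous_compact_support:
  fixes f :: "'a::euclidean_space \<Rightarrow> real"
  assumes "continuous_on UNIV f" "compact K" "\<And>x. x \<notin> K \<Longrightarrow> f x = 0"
  shows "integrable lborel f"
proof -
  have "integrable lborel (\<lambda>x. indicator K x *\<^sub>R f x)"
    by (rule borel_integrable_compact) (use assms continuous_on_subset in blast)+
  moreover have "(\<lambda>x. indicator K x *\<^sub>R f x) = f" using assms(3) by (auto simp: indicator_def fun_eq_iff)
  ultimately show ?thesis by simp
qed

definition bump_mass :: "'a::euclidean_space itself \<Rightarrow> real \<Rightarrow> real" where
  "bump_mass TYPE('a) e = (LINT x|lborel. bump e (x::'a))"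

lemma bump_integrable: "e > 0 \<Longrightarrow> integrable lborel (bump e :: 'a::euclidean_space \<Rightarrow> real)"
  by (rule integrable_continuous_compact_support[OF bump_continuous, of "cball 0 e"]) (auto intro: bump_eq_0)

lemma bump_mass_pos: assumes e: "e > 0" shows "bump_mass TYPE('a::euclidean_space) e > 0"
proof -
  have "bump_mass TYPE('a) e \<noteq> 0"
  proof
    assume "bump_mass TYPE('a) e = 0"
    then have "AE x in lborel. bump e (x::'a) = 0"
      unfolding bump_mass_def using integral_nonneg_eq_0_iff_AE[OF bump_integrable[OF e]] bump_nonneg by auto
    then have "AE x in lborel. x \<notin> ball (0::'a) e" by eventually_elim (use bump_pos in fastforce)
    then have "emeasure lborel (ball (0::'a) e) = 0" using AE_iff_null_sets[of "ball (0::'a) e" lborel] by (auto simp: null_setsD1)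
    then show False using open_not_negligible[of "ball (0::'a) e"] e by (auto simp: negligible_iff_null_sets null_sets_def)
  qed
  moreover have "bump_mass TYPE('a) e \<ge> 0" unfolding bump_mass_def by (intro Bochner_Integration.integral_nonneg bump_nonneg)
  ultimately show ?thesis by simp
qed

definition moll :: "real \<Rightarrow> 'a::euclidean_space \<Rightarrow> real" where
  "moll e x = bump e x / bump_mass TYPE('a) e"

lemma moll_Ck: "Ck k (moll e)"
  using Ck_mult[OF bump_Ck Ck_const, of k e] unfolding moll_def[abs_def] divide_inverse .

lemma moll_nonneg: "e > 0 \<Longrightarrow> 0 \<le> moll e (x::'a::euclidean_space)"
  using bump_mass_pos[of e, where 'a='a] bump_nonneg[of e x] by (simp add: moll_def)

lemma moll_eq_0: "e > 0 \<Longrightarrow> norm x \<ge> e \<Longrightarrow> moll e x = 0" by (simp add: moll_def bump_eq_0)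

lemma moll_continuous: "continuous_on S (moll e)" using Ck_continuous[OF moll_Ck] continuous_on_subset by blast

lemma moll_minus: "moll e (x - y) = moll e (y - x)" by (simp add: moll_def bump_minus)

lemma moll_integrable: "e > 0 \<Longrightarrow> integrable lborel (moll e)"
  unfolding moll_def[abs_def] using bump_integrable by auto

lemma moll_integral: "e > 0 \<Longrightarrow> (LINT x|lborel. moll e (x::'a::euclidean_space)) = 1"
  using bump_mass_pos[of e, where 'a='a] unfolding moll_def bump_mass_def by simp

text \<open>Both variables occur: integration in \<open>y\<close> for the convolution at a point,
  integration in \<open>x\<close> when Fubini's theorem is applied to it.\<close>

lemma moll_shift: fixes x y :: "'a::euclidean_space" assumes "e > 0"
  shows "integrable lborel (\<lambda>y. moll e (x - y))" "(LINT y|lborel. moll e (x - y)) = 1"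
    "integrable lborel (\<lambda>x. moll e (x - y))" "(LINT x|lborel. moll e (x - y)) = 1"
proof -
  have m: "moll e \<in> borel_measurable borel" by (rule borel_measurable_continuous_onI[OF moll_continuous])
  show 3: "integrable lborel (\<lambda>x. moll e (x - y))" for y :: 'a
  proof -
    have "integrable (distr lborel borel ((+) (- y))) (moll e)" using moll_integrable[OF assms] by (simp add: lborel_distr_plus)
    then have "integrable lborel (\<lambda>x. moll e (- y + x))" by (subst (asm) integrable_distr_eq) (auto simp: m)
    then show ?thesis by simp
  qed
  show 4: "(LINT x|lborel. moll e (x - y)) = 1" for y :: 'a
  proof -
    have "(LINT x|distr lborel borel ((+) (- y)). moll e x) = 1" using moll_integral[OF assms, where 'a='a] by (simp add: lborel_distr_plus)
    then have "(LINT x|lborel. moll e (- y + x)) = 1" by (subst (asm) integral_distr) (auto simp: m)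
    then show ?thesis by simp
  qed
  show "integrable lborel (\<lambda>y. moll e (x - y))" using 3[of x] by (simp add: moll_minus[of e x])
  show "(LINT y|lborel. moll e (x - y)) = 1" using 4[of x] by (simp add: moll_minus[of e x])
qed

text \<open>Convolution over a box, so that the Leibniz rule for the gauge integral applies.\<close>

definition conv :: "'a::euclidean_space \<Rightarrow> 'a \<Rightarrow> ('a \<Rightarrow> real) \<Rightarrow> ('a \<Rightarrow> real) \<Rightarrow> 'a \<Rightarrow> real" where
  "conv a b \<rho> w x = integral (cbox a b) (\<lambda>y. \<rho> (x - y) * w y)"

text \<open>All derivatives fall on the kernel, so \<open>w\<close> need only be continuous.
  \<open>R\<close> is the derivative of the kernel as an element of the space of bounded linear
  maps, the form in which the Leibniz rule takes it; its continuity is read off from the partial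
  derivatives.\<close>

lemma conv_has_derivative:
  fixes \<rho> w :: "'a::euclidean_space \<Rightarrow> real"
  assumes r: "Ck (Suc 0) \<rho>" and w: "continuous_on UNIV w"
  shows "(conv a b \<rho> w has_derivative (\<lambda>h. conv a b (\<lambda>z. frechet_derivative \<rho> (at z) h) w x)) (at x)"
proof -
  define R where "R z = Blinfun (frechet_derivative \<rho> (at z))" for z
  have bl: "bounded_linear (frechet_derivative \<rho> (at z))" for z using Ck_SucD(1)[OF r] has_derivative_bounded_linear by blast
  have R: "blinfun_apply (R z) = frechet_derivative \<rho> (at z)" for z unfolding R_def using bl by (rule bounded_linear_Blinfun_apply)
  have Rc: "continuous_on UNIV R"
    by (rule continuous_on_blinfun_componentwise) (use Ck_SucD(2)[OF r] in \<open>simp add: R\<close>)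
  define fx where "fx x t = w t *\<^sub>R R (x - t)" for x t
  have rc: "continuous_on UNIV \<rho>" using Ck_continuous[OF r] .
  have fxc: "continuous_on S (\<lambda>(x, t). fx x t)" for S
    unfolding fx_def split_beta
    by (intro continuous_on_scaleR continuous_on_compose2[OF w] continuous_on_compose2[OF Rc] continuous_intros) auto
  have fxc': "continuous_on S (fx x)" for S x
    unfolding fx_def
    by (intro continuous_on_scaleR continuous_on_compose2[OF w] continuous_on_compose2[OF Rc] continuous_intros) auto
  have "((\<lambda>x. integral (cbox a b) (\<lambda>y. \<rho> (x - y) * w y)) has_derivative integral (cbox a b) (fx x)) (at x within UNIV)"
  proof (rule leibniz_rule)
    fix x t
    have "((\<lambda>x. \<rho> (x - t)) has_derivative (\<lambda>h. frechet_derivative \<rho> (at (x - t)) h)) (at x)"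
      by (rule has_derivative_compose[OF _ Ck_SucD(1)[OF r]]) (auto intro!: derivative_eq_intros)
    then have "((\<lambda>x. \<rho> (x - t) * w t) has_derivative (\<lambda>h. frechet_derivative \<rho> (at (x - t)) h * w t)) (at x)"
      by (rule has_derivative_mult_left)
    then show "((\<lambda>x. \<rho> (x - t) * w t) has_derivative blinfun_apply (fx x t)) (at x within UNIV)"
      unfolding fx_def by (simp add: R scaleR_blinfun.rep_eq mult.commute)
  next
    show "(\<lambda>y. \<rho> (x - y) * w y) integrable_on cbox a b" for x
      by (intro integrable_continuous continuous_on_mult continuous_on_compose2[OF rc] continuous_on_compose2[OF w] continuous_intros) auto
  qed (use fxc in auto)
  moreover have "blinfun_apply (integral (cbox a b) (fx x)) = (\<lambda>h. conv a b (\<lambda>z. frechet_derivative \<rho> (at z) h) w x)"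
  proof
    fix h
    have "blinfun_apply (integral (cbox a b) (fx x)) h = integral (cbox a b) (\<lambda>t. blinfun_apply (fx x t) h)"
      by (rule blinfun_apply_integral[OF integrable_continuous[OF fxc']])
    then show "blinfun_apply (integral (cbox a b) (fx x)) h = conv a b (\<lambda>z. frechet_derivative \<rho> (at z) h) w x"
      unfolding fx_def conv_def by (simp add: R scaleR_blinfun.rep_eq mult.commute)
  qed
  ultimately show ?thesis unfolding conv_def[abs_def] by simp
qed

text \<open>The induction generalizes over the kernel, because a derivative of the convolution is a
  convolution with another smooth kernel.\<close>

lemma conv_Ck:
  assumes w: "continuous_on UNIV w" shows "(\<And>k. Ck k \<rho>) \<Longrightarrow> Ck k (conv a b \<rho> w)"
proof (induction k arbitrary: \<rho>)
  case 0
  show ?case using has_derivative_continuous[OF conv_has_derivative[OF 0 w]] by (simp add: continuous_on_eq_continuous_at)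
next
  case (Suc k)
  show ?case
    by (rule Ck_SucI[OF conv_has_derivative[OF Suc.prems w]]) (rule Suc.IH, rule Ck_SucD(2)[OF Suc.prems])
qed

lemma frechet_derivative_conv:
  assumes "\<And>k. Ck k \<rho>" "continuous_on UNIV w"
  shows "frechet_derivative (conv a b \<rho> w) (at x) h = conv a b (\<lambda>z. frechet_derivative \<rho> (at z) h) w x"
  using frechet_derivative_at[OF conv_has_derivative[OF assms(1,2)]] by metis

text \<open>As soon as the box contains the support of the integrand, the gauge integral over the
  box is a Lebesgue integral over the whole space, where translations and Fubini's theorem are
  available.\<close>

lemma conv_lebesgue:
  fixes \<rho> w :: "'a::euclidean_space \<Rightarrow> real"
  assumes r: "continuous_on UNIV \<rho>" and w: "continuous_on UNIV w"
    and 0: "\<And>y. y \<notin> cbox a b \<Longrightarrow> \<rho> (x - y) * w y = 0"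
  shows "integrable lborel (\<lambda>y. \<rho> (x - y) * w y)" "conv a b \<rho> w x = (LINT y|lborel. \<rho> (x - y) * w y)"
proof -
  have c: "continuous_on UNIV (\<lambda>y. \<rho> (x - y) * w y)"
    by (intro continuous_on_mult continuous_on_compose2[OF r] w continuous_intros) auto
  show i: "integrable lborel (\<lambda>y. \<rho> (x - y) * w y)" by (rule integrable_continuous_compact_support[OF c compact_cbox 0])
  have "(LINT y|lborel. \<rho> (x - y) * w y) = integral UNIV (\<lambda>y. \<rho> (x - y) * w y)" using integral_lborel[OF i] by simp
  also have "\<dots> = integral UNIV (\<lambda>y. if y \<in> cbox a b then \<rho> (x - y) * w y else 0)" by (rule integral_cong) (use 0 in auto)
  also have "\<dots> = conv a b \<rho> w x" unfolding conv_def by (rule integral_restrict_UNIV)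
  finally show "conv a b \<rho> w x = (LINT y|lborel. \<rho> (x - y) * w y)" by simp
qed

text \<open>As the kernel has mass \<open>1\<close>, the difference is an average of
  \<open>w y - w x\<close> over the ball.\<close>

lemma conv_moll_close:
  fixes w :: "'a::euclidean_space \<Rightarrow> real"
  assumes w: "continuous_on UNIV w" and e: "e > 0" and sub: "cball x e \<subseteq> cbox a b"
    and close: "\<And>y. dist x y \<le> e \<Longrightarrow> \<bar>w y - w x\<bar> \<le> d"
  shows "\<bar>conv a b (moll e) w x - w x\<bar> \<le> d"
proof -
  have z: "moll e (x - y) = 0" if "y \<notin> cball x e" for y using that e by (intro moll_eq_0) (auto simp: dist_norm)
  have zz: "moll e (x - y) * w y = 0" if "y \<notin> cbox a b" for y
  proof -
    have "y \<notin> cball x e" using sub that by blast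
    then show ?thesis using z by simp
  qed
  note 1 = conv_lebesgue[OF moll_continuous w zz]
  have 2: "integrable lborel (\<lambda>y. moll e (x - y) * w x)" using moll_shift(1)[OF e, of x] by simp
  have "conv a b (moll e) w x - w x = (LINT y|lborel. moll e (x - y) * w y) - (LINT y|lborel. moll e (x - y) * w x)"
    using 1(2) moll_shift(2)[OF e, of x] by simp
  also have "\<dots> = (LINT y|lborel. moll e (x - y) * w y - moll e (x - y) * w x)" using 1(1) 2 by simp
  finally have "\<bar>conv a b (moll e) w x - w x\<bar> \<le> (LINT y|lborel. norm (moll e (x - y) * w y - moll e (x - y) * w x))"
    using integral_norm_bound[of lborel "\<lambda>y. moll e (x - y) * w y - moll e (x - y) * w x"] by simp
  also have "\<dots> \<le> (LINT y|lborel. moll e (x - y) * d)"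
  proof (rule integral_mono)
    show "integrable lborel (\<lambda>y. norm (moll e (x - y) * w y - moll e (x - y) * w x))" using 1(1) 2 by auto
    show "integrable lborel (\<lambda>y. moll e (x - y) * d)" using moll_shift(1)[OF e, of x] by simp
    show "norm (moll e (x - y) * w y - moll e (x - y) * w x) \<le> moll e (x - y) * d" for y
    proof (cases "y \<in> cball x e")
      case True
      then have "\<bar>w y - w x\<bar> \<le> d" using close by simp
      then have "moll e (x - y) * \<bar>w y - w x\<bar> \<le> moll e (x - y) * d" using moll_nonneg[OF e] by (intro mult_left_mono)
      moreover have "norm (moll e (x - y) * w y - moll e (x - y) * w x) = moll e (x - y) * \<bar>w y - w x\<bar>"
        using moll_nonneg[OF e, of "x - y"] by (simp add: abs_mult right_diff_distrib[symmetric])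
      ultimately show ?thesis by simp
    qed (simp add: z)
  qed
  also have "\<dots> = d" using moll_shift(2)[OF e, of x] by simp
  finally show ?thesis .
qed

subsection \<open>Density of the test functions\<close>

lemma closed_support_eq_0:
  fixes f :: "'a::euclidean_space \<Rightarrow> real"
  assumes "closed K" "\<And>x. x \<notin> K \<Longrightarrow> f x = 0" "x \<notin> K"
  shows "(f has_derivative (\<lambda>h. 0)) (at x)"
proof (rule has_derivative_transform_within_open[OF has_derivative_const])
  show "open (- K)" "x \<in> - K" using assms by auto
  show "0 = f y" if "y \<in> - K" for y using assms that by auto
qed

lemma frechet_derivative_closed_support:
  fixes f :: "'a::euclidean_space \<Rightarrow> real"
  assumes "closed K" "\<And>x. x \<notin> K \<Longrightarrow> f x = 0" "x \<notin> K"
  shows "frechet_derivative f (at x) h = 0"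
proof -
  have eq: "(\<lambda>h. 0) = frechet_derivative f (at x)" by (rule frechet_derivative_at[OF closed_support_eq_0[OF assms]])
  show ?thesis unfolding eq[symmetric] by simp
qed

lemma test_functionsI:
  assumes "\<And>k. Ck k \<phi>" "compact K" "K \<subseteq> \<Omega>" "\<And>x. x \<notin> K \<Longrightarrow> \<phi> x = 0"
  shows "\<phi> \<in> test_functions \<Omega>"
  using assms unfolding test_functions_def by auto

lemma test_functionsE:
  assumes "\<phi> \<in> test_functions \<Omega>"
  obtains K where "\<And>k. Ck k \<phi>" "compact K" "K \<subseteq> \<Omega>" "\<And>x. x \<notin> K \<Longrightarrow> \<phi> x = 0"
  using assms unfolding test_functions_def by auto

lemma test_functions_zero: "(\<lambda>x. 0) \<in> test_functions \<Omega>"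
  by (rule test_functionsI[of _ "{}"]) (auto intro: Ck_const)

lemma test_functions_lin:
  assumes "\<phi> \<in> test_functions \<Omega>" "\<psi> \<in> test_functions \<Omega>" shows "(\<lambda>x. c * \<phi> x + \<psi> x) \<in> test_functions \<Omega>"
proof -
  obtain K where K: "\<And>k. Ck k \<phi>" "compact K" "K \<subseteq> \<Omega>" "\<And>x. x \<notin> K \<Longrightarrow> \<phi> x = 0" by (rule test_functionsE[OF assms(1)]) blast
  obtain L where L: "\<And>k. Ck k \<psi>" "compact L" "L \<subseteq> \<Omega>" "\<And>x. x \<notin> L \<Longrightarrow> \<psi> x = 0" by (rule test_functionsE[OF assms(2)]) blast
  show ?thesis
  proof (rule test_functionsI[of _ "K \<union> L"])
    show "Ck k (\<lambda>x. c * \<phi> x + \<psi> x)" for k by (intro Ck_add Ck_mult Ck_const K(1) L(1))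
  qed (use K L in auto)
qed

lemma l2_of_tendsto_dominated:
  assumes meas: "\<Omega> \<in> sets lebesgue" and f: "\<And>n. f n \<in> L2 \<Omega>" "g \<in> L2 \<Omega>" and B: "B \<in> L2 \<Omega>"
    and bound: "\<And>n. AE x in lebesgue_on \<Omega>. \<bar>f n x - g x\<bar> \<le> B x"
    and lim: "AE x in lebesgue_on \<Omega>. (\<lambda>n. f n x) \<longlonglongrightarrow> g x"
  shows "(\<lambda>n. l2_of \<Omega> (f n)) \<longlonglongrightarrow> l2_of \<Omega> g"
proof -
  have "(\<lambda>n. LINT x|lebesgue_on \<Omega>. (f n x - g x)\<^sup>2) \<longlonglongrightarrow> (LINT x|lebesgue_on \<Omega>. 0)"
  proof (rule integral_dominated_convergence)
    show "integrable (lebesgue_on \<Omega>) (\<lambda>x. (B x)\<^sup>2)" by (rule L2_square_integrable[OF B])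
    show "(\<lambda>x. (f n x - g x)\<^sup>2) \<in> borel_measurable (lebesgue_on \<Omega>)" for n
      using L2_measurable[OF L2_diff[OF f(1) f(2), of n]] by (rule borel_measurable_power)
    show "AE x in lebesgue_on \<Omega>. norm ((f n x - g x)\<^sup>2) \<le> (B x)\<^sup>2" for n
      using bound[of n] by eventually_elim (simp add: power2_le_iff_abs_le abs_le_square_iff[symmetric])
    show "AE x in lebesgue_on \<Omega>. (\<lambda>n. (f n x - g x)\<^sup>2) \<longlonglongrightarrow> 0"
      using lim
    proof eventually_elim
      case (elim x)
      have "(\<lambda>n. (f n x - g x)\<^sup>2) \<longlonglongrightarrow> (g x - g x)\<^sup>2" by (intro tendsto_intros elim)
      then show ?case by simp
    qed
  qed simp
  then have "(\<lambda>n. sqrt (LINT x|lebesgue_on \<Omega>. (f n x - g x)\<^sup>2)) \<longlonglongrightarrow> sqrt 0" by (intro tendsto_real_sqrt) simp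
  then have "(\<lambda>n. L2_norm \<Omega> (\<lambda>x. f n x - g x)) \<longlonglongrightarrow> 0"
    by (simp add: L2_norm_def L2_inner_def power2_eq_square)
  then show ?thesis using L2_norm_tendsto_iff[OF meas, of f g] f by simp
qed

lemma compact_nbhd:
  fixes K :: "'a::euclidean_space set"
  assumes "compact K" shows "compact {x. \<exists>y\<in>K. dist x y \<le> e}"
proof -
  have "{x. \<exists>y\<in>K. dist x y \<le> e} = {x + y | x y. x \<in> K \<and> y \<in> cball 0 e}"
  proof (intro set_eqI iffI)
    fix x assume "x \<in> {x. \<exists>y\<in>K. dist x y \<le> e}"
    then obtain y where "y \<in> K" "dist x y \<le> e" by blast
    then have "x = y + (x - y) \<and> y \<in> K \<and> x - y \<in> cball 0 e" by (simp add: dist_norm norm_minus_commute)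
    then show "x \<in> {x + y | x y. x \<in> K \<and> y \<in> cball 0 e}" by blast
  next
    fix x assume "x \<in> {x + y | x y. x \<in> K \<and> y \<in> cball 0 e}"
    then obtain k y where "x = k + y" "k \<in> K" "y \<in> cball 0 e" by blast
    then show "x \<in> {x. \<exists>y\<in>K. dist x y \<le> e}" by (auto simp: dist_norm intro!: bexI[of _ k])
  qed
  then show ?thesis using compact_sums[OF assms compact_cball[of 0 e]] by simp
qed

section \<open>Approximation by test functions on a bounded open set\<close>

locale bounded_domain =
  fixes \<Omega> :: "'a::euclidean_space set"
  assumes open_\<Omega>: "open \<Omega>" and bounded_\<Omega>: "bounded \<Omega>"
begin

lemma meas: "\<Omega> \<in> sets lebesgue" using open_\<Omega> by (simp add: borel_open)

lemma finite_measure: "finite_measure (lebesgue_on \<Omega>)"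
  by (rule finite_measure_lebesgue_on[OF lmeasurable_open[OF bounded_\<Omega> open_\<Omega>]])

lemma bounded_L2:
  assumes "f \<in> borel_measurable (lebesgue_on \<Omega>)" "\<And>x. x \<in> \<Omega> \<Longrightarrow> \<bar>f x\<bar> \<le> B" shows "f \<in> L2 \<Omega>"
proof -
  have "integrable (lebesgue_on \<Omega>) (\<lambda>x. (f x)\<^sup>2)"
  proof (rule finite_measure.integrable_const_bound[OF finite_measure])
    show "AE x in lebesgue_on \<Omega>. norm ((f x)\<^sup>2) \<le> B\<^sup>2"
    proof (rule AE_I2)
      fix x assume "x \<in> space (lebesgue_on \<Omega>)"
      then have "\<bar>f x\<bar> \<le> B" using assms(2) by simp
      then have "\<bar>f x\<bar>\<^sup>2 \<le> B\<^sup>2" by (rule power_mono) simp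
      then show "norm ((f x)\<^sup>2) \<le> B\<^sup>2" by simp
    qed
  qed (use assms(1) in \<open>rule borel_measurable_power\<close>)
  then show ?thesis using assms(1) by (simp add: L2_def)
qed

lemma continuous_measurable: "continuous_on \<Omega> f \<Longrightarrow> f \<in> borel_measurable (lebesgue_on \<Omega>)"
  by (rule continuous_imp_measurable_on_sets_lebesgue[OF _ meas])

lemma continuous_closure_L2:
  fixes f :: "'a \<Rightarrow> real" assumes "continuous_on (closure \<Omega>) f" shows "f \<in> L2 \<Omega>"
proof -
  have c: "compact (f ` closure \<Omega>)" by (rule compact_continuous_image[OF assms]) (use bounded_\<Omega> in simp)
  obtain B where B: "\<And>x. x \<in> closure \<Omega> \<Longrightarrow> norm (f x) \<le> B" using compact_imp_bounded[OF c] unfolding bounded_iff by auto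
  show ?thesis
  proof (rule bounded_L2)
    show "f \<in> borel_measurable (lebesgue_on \<Omega>)"
      by (rule continuous_measurable[OF continuous_on_subset[OF assms closure_subset]])
    show "\<bar>f x\<bar> \<le> B" if "x \<in> \<Omega>" for x using B[of x] closure_subset that by auto
  qed
qed

lemma continuous_L2: fixes f :: "'a \<Rightarrow> real" shows "continuous_on UNIV f \<Longrightarrow> f \<in> L2 \<Omega>"
  by (rule continuous_closure_L2) (rule continuous_on_subset, auto)

lemma test_L2: "\<phi> \<in> test_functions \<Omega> \<Longrightarrow> \<phi> \<in> L2 \<Omega>"
  by (rule continuous_L2) (auto elim!: test_functionsE intro: Ck_continuous[of 0])

text \<open>The margin of width \<open>1\<close> lets one box serve the convolutions of all radii up
  to \<open>1\<close>.\<close>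

lemma box_ex: obtains a b where "\<And>x e. x \<in> \<Omega> \<Longrightarrow> e \<le> 1 \<Longrightarrow> cball x e \<subseteq> cbox a b" "\<Omega> \<subseteq> cbox a b"
proof -
  obtain r where r: "\<And>x. x \<in> \<Omega> \<Longrightarrow> norm x \<le> r" using bounded_\<Omega> unfolding bounded_iff by blast
  obtain a where a: "cball (0::'a) (r + 1) \<subseteq> cbox (-a) a" by (rule bounded_subset_cbox_symmetric[OF bounded_cball])
  have c: "cball x e \<subseteq> cbox (-a) a" if "x \<in> \<Omega>" "e \<le> 1" for x e
  proof
    fix y assume y: "y \<in> cball x e"
    have "norm x \<le> r" by (rule r[OF that(1)])
    then have "norm y \<le> r + 1" using y that(2) norm_triangle_sub[of y x] by (simp add: dist_norm norm_minus_commute)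
    then show "y \<in> cbox (-a) a" using a by auto
  qed
  moreover have "\<Omega> \<subseteq> cbox (-a) a" using c[of _ 0] by force
  ultimately show thesis using that by blast
qed

lemma support_nbhd:
  assumes "compact K" "K \<subseteq> \<Omega>"
  obtains d where "d > 0" "d \<le> 1" "\<And>x y. x \<in> K \<Longrightarrow> dist x y \<le> d \<Longrightarrow> y \<in> \<Omega>"
proof -
  obtain d where d: "d > 0" "(\<Union>x\<in>K. ball x d) \<subseteq> \<Omega>" using compact_subset_open_imp_ball_epsilon_subset[OF assms(1) open_\<Omega> assms(2)] by blast
  show thesis
  proof (rule that[of "min (d/2) 1"])
    show "y \<in> \<Omega>" if "x \<in> K" "dist x y \<le> min (d/2) 1" for x y
    proof -
      have "y \<in> ball x d" using that d(1) by simp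
      then show ?thesis using d(2) that by blast
    qed
  qed (use d in auto)
qed

lemma conv_moll_test:
  assumes w: "continuous_on UNIV w" "compact K" "\<And>x. x \<notin> K \<Longrightarrow> w x = 0" and e: "e > 0"
    and sub: "\<And>x y. x \<in> K \<Longrightarrow> dist x y \<le> e \<Longrightarrow> y \<in> \<Omega>"
  shows "conv a b (moll e) w \<in> test_functions \<Omega>"
    and "\<And>x. \<not> (\<exists>y\<in>K. dist x y \<le> e) \<Longrightarrow> conv a b (moll e) w x = 0"
proof -
  show 0: "conv a b (moll e) w x = 0" if "\<not> (\<exists>y\<in>K. dist x y \<le> e)" for x
  proof -
    have "moll e (x - y) * w y = 0" for y
    proof (cases "y \<in> K")
      case True
      then have "e \<le> norm (x - y)" using that by (auto simp: dist_norm)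
      from moll_eq_0[OF e this] show ?thesis by simp
    qed (simp add: w)
    then have "(\<lambda>y. moll e (x - y) * w y) = (\<lambda>y. 0)" by (rule ext)
    then show ?thesis unfolding conv_def by simp
  qed
  show "conv a b (moll e) w \<in> test_functions \<Omega>"
  proof (rule test_functionsI[OF _ compact_nbhd[OF w(2), of e]])
    show "Ck k (conv a b (moll e) w)" for k by (rule conv_Ck[OF w(1) moll_Ck])
    show "{x. \<exists>y\<in>K. dist x y \<le> e} \<subseteq> \<Omega>" using sub by (auto simp: dist_commute)
  qed (use 0 in auto)
qed

text \<open>The second point may leave \<Omega>, but both lie in the compact box of
  \<open>box_ex\<close>, on which \<open>w\<close> is uniformly continuous.\<close>

lemma uniformly_close:
  fixes w :: "'a \<Rightarrow> real"
  assumes w: "continuous_on UNIV w" and d: "d > 0"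
  obtains e0 where "e0 > 0" "e0 \<le> 1" "\<And>x y. x \<in> \<Omega> \<Longrightarrow> dist x y \<le> e0 \<Longrightarrow> \<bar>w y - w x\<bar> \<le> d"
proof -
  obtain a b where ab: "\<And>x e. x \<in> \<Omega> \<Longrightarrow> e \<le> 1 \<Longrightarrow> cball x e \<subseteq> cbox a b" "\<Omega> \<subseteq> cbox a b" by (rule box_ex) blast
  have "uniformly_continuous_on (cbox a b) w"
    by (rule compact_uniformly_continuous[OF continuous_on_subset[OF w] compact_cbox]) simp
  then obtain r where r: "r > 0" "\<And>x y. x \<in> cbox a b \<Longrightarrow> y \<in> cbox a b \<Longrightarrow> dist y x < r \<Longrightarrow> dist (w y) (w x) < d"
    using d unfolding uniformly_continuous_on_def by blast
  show thesis
  proof (rule that[of "min (r/2) 1"])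
    show "\<bar>w y - w x\<bar> \<le> d" if "x \<in> \<Omega>" "dist x y \<le> min (r/2) 1" for x y
    proof -
      have "y \<in> cbox a b" using ab(1)[OF that(1), of 1] that(2) by auto
      moreover have "x \<in> cbox a b" using ab(2) that by auto
      moreover have "dist y x < r" using that r(1) by (simp add: dist_commute)
      ultimately show ?thesis using r(2)[of x y] by (simp add: dist_real_def)
    qed
  qed (use r in auto)
qed

lemma l2_of_uniform_limit:
  assumes f: "\<And>n. f n \<in> L2 \<Omega>" "g \<in> L2 \<Omega>" and c: "\<And>n x. x \<in> \<Omega> \<Longrightarrow> \<bar>f n x - g x\<bar> \<le> 1 / real (Suc n)"
  shows "(\<lambda>n. l2_of \<Omega> (f n)) \<longlonglongrightarrow> l2_of \<Omega> g"
proof (rule l2_of_tendsto_dominated[OF meas f])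
  show "(\<lambda>x. 1) \<in> L2 \<Omega>" by (rule continuous_L2) simp
  have "\<bar>f n x - g x\<bar> \<le> 1" if "x \<in> \<Omega>" for n x
    by (rule order_trans[OF c[OF that]]) simp
  then show "AE x in lebesgue_on \<Omega>. \<bar>f n x - g x\<bar> \<le> 1" for n by (intro AE_I2) simp
  have "(\<lambda>n. f n x) \<longlonglongrightarrow> g x" if "x \<in> \<Omega>" for x
  proof -
    have "(\<lambda>n. f n x - g x) \<longlonglongrightarrow> 0"
    proof (rule Lim_null_comparison[OF always_eventually[OF allI]])
      show "norm (f n x - g x) \<le> inverse (real (Suc n))" for n using c[OF that, of n] by (simp add: inverse_eq_divide)
      show "(\<lambda>n. inverse (real (Suc n))) \<longlonglongrightarrow> 0" by (rule LIMSEQ_inverse_real_of_nat)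
    qed
    then show ?thesis by (rule LIM_zero_cancel)
  qed
  then show "AE x in lebesgue_on \<Omega>. (\<lambda>n. f n x) \<longlonglongrightarrow> g x" by (intro AE_I2) simp
qed

lemma closure_test_continuous:
  assumes w: "continuous_on UNIV w" "compact K" "K \<subseteq> \<Omega>" "\<And>x. x \<notin> K \<Longrightarrow> w x = 0"
  shows "l2_of \<Omega> w \<in> closure (l2_of \<Omega> ` test_functions \<Omega>)"
proof -
  obtain a b where ab: "\<And>x e. x \<in> \<Omega> \<Longrightarrow> e \<le> 1 \<Longrightarrow> cball x e \<subseteq> cbox a b" "\<Omega> \<subseteq> cbox a b" by (rule box_ex) blast
  obtain d where d: "d > 0" "d \<le> 1" "\<And>x y. x \<in> K \<Longrightarrow> dist x y \<le> d \<Longrightarrow> y \<in> \<Omega>" using support_nbhd[OF w(2,3)] by blast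
  have "\<exists>\<phi>\<in>test_functions \<Omega>. \<forall>x\<in>\<Omega>. \<bar>\<phi> x - w x\<bar> \<le> 1 / real (Suc n)" for n
  proof -
    obtain e0 where e0: "e0 > 0" "e0 \<le> 1" "\<And>x y. x \<in> \<Omega> \<Longrightarrow> dist x y \<le> e0 \<Longrightarrow> \<bar>w y - w x\<bar> \<le> 1 / real (Suc n)"
      using uniformly_close[OF w(1), of "1 / real (Suc n)"] by (metis of_nat_0_less_iff zero_less_Suc zero_less_divide_1_iff)
    define e where "e = min d e0"
    have e: "e > 0" "e \<le> d" "e \<le> e0" "e \<le> 1" unfolding e_def using d e0 by auto
    have "conv a b (moll e) w \<in> test_functions \<Omega>"
      by (rule conv_moll_test(1)[OF w(1,2,4) e(1)]) (use d(3) e(2) in \<open>auto intro: order_trans\<close>)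
    moreover have "\<bar>conv a b (moll e) w x - w x\<bar> \<le> 1 / real (Suc n)" if "x \<in> \<Omega>" for x
      by (rule conv_moll_close[OF w(1) e(1) ab(1)[OF that e(4)]]) (use e0(3)[OF that] e(3) in auto)
    ultimately show ?thesis by blast
  qed
  then obtain \<phi> where \<phi>: "\<And>n. \<phi> n \<in> test_functions \<Omega>" "\<And>n x. x \<in> \<Omega> \<Longrightarrow> \<bar>\<phi> n x - w x\<bar> \<le> 1 / real (Suc n)" by metis
  have "(\<lambda>n. l2_of \<Omega> (\<phi> n)) \<longlonglongrightarrow> l2_of \<Omega> w"
    by (rule l2_of_uniform_limit[OF test_L2[OF \<phi>(1)] continuous_L2[OF w(1)] \<phi>(2)])
  then show ?thesis unfolding closure_sequential using \<phi>(1) by (intro exI[of _ "\<lambda>n. l2_of \<Omega> (\<phi> n)"]) simp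
qed

text \<open>Clipping the values of \<open>f\<close> to \<open>[- m, m]\<close> with
  \<open>cl\<close> and cutting off near the boundary with \<open>ct\<close> produces bounded
  functions supported in a compact part of \<Omega> that converge to \<open>f\<close>. The same
  operations on continuous \<open>g n\<close> that converge to \<open>f\<close> almost everywhere
  give continuous functions of compact support, to which mollification applies.\<close>

lemma closure_test: assumes f: "f \<in> L2 \<Omega>" shows "l2_of \<Omega> f \<in> closure (l2_of \<Omega> ` test_functions \<Omega>)"
proof -
  let ?M = "closure (l2_of \<Omega> ` test_functions \<Omega>)"
  \<comment> \<open>A bounded set is not the whole space. Otherwise
    \<open>infdist x (- \<Omega>)\<close> would be the default value \<open>0\<close>, and the
    cut-off would vanish everywhere.\<close>
  have ne: "- \<Omega> \<noteq> {}"
  proof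
    assume "- \<Omega> = {}"
    then have "\<Omega> = UNIV" by auto
    then show False using bounded_\<Omega> not_bounded_UNIV by simp
  qed
  have "(\<lambda>x. if x \<in> \<Omega> then f x else 0) \<in> borel_measurable lebesgue"
    using L2_extend_iff[OF meas] f by (auto simp: L2_def lebesgue_on_UNIV_eq)
  from lebesgue_measurable_imp_measurable_on[OF this meas] obtain N g where N: "negligible N"
    and g: "\<And>n. continuous_on UNIV (g n)"
    and gl: "\<And>x. x \<notin> N \<Longrightarrow> (\<lambda>n. g n x) \<longlonglongrightarrow> (if x \<in> \<Omega> then (if x \<in> \<Omega> then f x else 0) else 0)"
    unfolding measurable_on_def by blast
  have NS: "AE x in lebesgue_on \<Omega>. x \<notin> N"
  proof -
    have "AE x in lebesgue. x \<notin> N" using N AE_not_in negligible_iff_null_sets by blast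
    then have "AE x in lebesgue. x \<in> \<Omega> \<longrightarrow> x \<notin> N" by eventually_elim simp
    then show ?thesis using meas by (simp add: AE_restrict_space_iff)
  qed
  have AEg: "AE x in lebesgue_on \<Omega>. (\<lambda>n. g n x) \<longlonglongrightarrow> f x"
  proof -
    have "AE x in lebesgue_on \<Omega>. x \<in> \<Omega>" using AE_space[of "lebesgue_on \<Omega>"] by simp
    with NS show ?thesis by eventually_elim (use gl in force)
  qed
  \<comment> \<open>For positive \<open>m\<close> this is \<open>0\<close> where the distance to the
    complement is at most \<open>1 / m\<close> and \<open>1\<close> where it is at least
    \<open>2 / m\<close>. The support is enclosed with \<open>Suc m\<close> in place of
    \<open>m\<close>, which avoids division by zero.\<close>
  define ct where "ct m x = min 1 (max 0 (real m * infdist x (- \<Omega>) - 1))" for m :: nat and x :: 'a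
  define cl where "cl m t = max (- real m) (min (real m) t)" for m :: nat and t :: real
  have ct01: "0 \<le> ct m x" "ct m x \<le> 1" for m x unfolding ct_def by auto
  have ctc: "continuous_on S (ct m)" for S m unfolding ct_def[abs_def] by (intro continuous_intros)
  have clb: "\<bar>cl m t\<bar> \<le> real m" "\<bar>cl m t\<bar> \<le> \<bar>t\<bar>" for m t unfolding cl_def by auto
  have clc: "continuous_on S (cl m)" for S m unfolding cl_def[abs_def] by (intro continuous_intros)
  have supp: "compact {x. infdist x (- \<Omega>) \<ge> 1 / real (Suc m)}" "{x. infdist x (- \<Omega>) \<ge> 1 / real (Suc m)} \<subseteq> \<Omega>" for m
  proof -
    show s: "{x. infdist x (- \<Omega>) \<ge> 1 / real (Suc m)} \<subseteq> \<Omega>"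
    proof (rule subsetI, rule ccontr)
      fix x assume x: "x \<in> {x. infdist x (- \<Omega>) \<ge> 1 / real (Suc m)}" "x \<notin> \<Omega>"
      then have "infdist x (- \<Omega>) = 0" by simp
      then have "1 / real (Suc m) \<le> 0" using x(1) by simp
      then show False by simp
    qed
    have "closed {x. infdist x (- \<Omega>) \<ge> 1 / real (Suc m)}" by (intro closed_Collect_le continuous_intros)
    moreover have "bounded {x. infdist x (- \<Omega>) \<ge> 1 / real (Suc m)}" using bounded_subset[OF bounded_\<Omega> s] .
    ultimately show "compact {x. infdist x (- \<Omega>) \<ge> 1 / real (Suc m)}" by (simp add: compact_eq_bounded_closed)
  qed
  have ct0: "ct m x = 0" if "x \<notin> {x. infdist x (- \<Omega>) \<ge> 1 / real (Suc m)}" for m x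
  proof -
    have "infdist x (- \<Omega>) * real (Suc m) < 1" using that by (simp add: field_simps)
    then have "real m * infdist x (- \<Omega>) \<le> 1" using infdist_nonneg[of x "- \<Omega>"] by (simp add: algebra_simps)
    then show ?thesis unfolding ct_def by simp
  qed
  have wM: "l2_of \<Omega> (\<lambda>x. cl m (g n x) * ct m x) \<in> ?M" for m n
  proof (rule closure_test_continuous[OF _ supp(1)[of m] supp(2)])
    show "continuous_on UNIV (\<lambda>x. cl m (g n x) * ct m x)"
      by (intro continuous_on_mult ctc continuous_on_compose2[OF clc g]) auto
  qed (use ct0 in auto)
  have gm: "(\<lambda>x. cl m (g n x) * ct m x) \<in> L2 \<Omega>" for m n
    by (rule continuous_L2) (intro continuous_on_mult ctc continuous_on_compose2[OF clc g], auto)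
  have clm: "cl m \<in> borel_measurable borel" for m by (rule borel_measurable_continuous_onI[OF clc])
  have fmm: "(\<lambda>x. cl m (f x) * ct m x) \<in> borel_measurable (lebesgue_on \<Omega>)" for m
    by (intro borel_measurable_times measurable_compose[OF L2_measurable[OF f] clm] continuous_measurable ctc)
  have prod: "\<bar>cl m t * ct m x\<bar> \<le> real m" "\<bar>cl m t * ct m x\<bar> \<le> \<bar>t\<bar>" for m t x
  proof -
    have "\<bar>cl m t * ct m x\<bar> \<le> \<bar>cl m t\<bar>" unfolding abs_mult using ct01[of m x] by (intro mult_left_le) auto
    then show "\<bar>cl m t * ct m x\<bar> \<le> real m" "\<bar>cl m t * ct m x\<bar> \<le> \<bar>t\<bar>" using clb[of m t] by linarith+
  qed
  have fm: "(\<lambda>x. cl m (f x) * ct m x) \<in> L2 \<Omega>" for m by (rule bounded_L2[OF fmm]) (rule prod(1))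
  have closed: "closed ?M" by simp
  have fmM: "l2_of \<Omega> (\<lambda>x. cl m (f x) * ct m x) \<in> ?M" for m
  proof (rule closed_sequentially[OF closed wM])
    show "(\<lambda>n. l2_of \<Omega> (\<lambda>x. cl m (g n x) * ct m x)) \<longlonglongrightarrow> l2_of \<Omega> (\<lambda>x. cl m (f x) * ct m x)"
    proof (rule l2_of_tendsto_dominated[OF meas gm fm])
      show "(\<lambda>x. 2 * real m) \<in> L2 \<Omega>" by (rule continuous_L2) simp
      show "AE x in lebesgue_on \<Omega>. \<bar>cl m (g n x) * ct m x - cl m (f x) * ct m x\<bar> \<le> 2 * real m" for n
      proof (rule AE_I2)
        fix x
        show "\<bar>cl m (g n x) * ct m x - cl m (f x) * ct m x\<bar> \<le> 2 * real m"
          using prod(1)[of m "g n x" x] prod(1)[of m "f x" x] by linarith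
      qed
      show "AE x in lebesgue_on \<Omega>. (\<lambda>n. cl m (g n x) * ct m x) \<longlonglongrightarrow> cl m (f x) * ct m x"
        using AEg
      proof eventually_elim
        case (elim x)
        show ?case unfolding cl_def by (intro tendsto_intros elim)
      qed
    qed
  qed
  show ?thesis
  proof (rule closed_sequentially[OF closed fmM])
    show "(\<lambda>m. l2_of \<Omega> (\<lambda>x. cl m (f x) * ct m x)) \<longlonglongrightarrow> l2_of \<Omega> f"
    proof (rule l2_of_tendsto_dominated[OF meas fm f])
      have "(\<lambda>x. \<bar>f x\<bar>) \<in> L2 \<Omega>" using f by (auto simp: L2_def intro: borel_measurable_abs)
      then show "(\<lambda>x. 2 * \<bar>f x\<bar>) \<in> L2 \<Omega>" by (rule L2_scale)
      show "AE x in lebesgue_on \<Omega>. \<bar>cl m (f x) * ct m x - f x\<bar> \<le> 2 * \<bar>f x\<bar>" for m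
      proof (rule AE_I2)
        fix x
        show "\<bar>cl m (f x) * ct m x - f x\<bar> \<le> 2 * \<bar>f x\<bar>" using prod(2)[of m "f x" x] by linarith
      qed
      have "(\<lambda>m. cl m (f x) * ct m x) \<longlonglongrightarrow> f x" if x: "x \<in> \<Omega>" for x
      proof -
        have "infdist x (- \<Omega>) > 0" using infdist_pos_not_in_closed[of "- \<Omega>" x] open_\<Omega> ne x by auto
        then obtain m1 :: nat where m1: "2 / infdist x (- \<Omega>) \<le> real m1" using real_arch_simple by blast
        obtain m2 :: nat where m2: "\<bar>f x\<bar> \<le> real m2" using real_arch_simple by blast
        have "cl m (f x) * ct m x = f x" if m: "m \<ge> max m1 m2" for m
        proof -
          have "2 / infdist x (- \<Omega>) \<le> real m" using m1 m by (meson max.bounded_iff of_nat_le_iff order_trans)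
          then have "ct m x = 1" unfolding ct_def using \<open>infdist x (- \<Omega>) > 0\<close> by (simp add: field_simps)
          moreover have "\<bar>f x\<bar> \<le> real m" using m2 m by (meson max.bounded_iff of_nat_le_iff order_trans)
          ultimately show ?thesis unfolding cl_def by auto
        qed
        then have "\<forall>\<^sub>F m in sequentially. f x = cl m (f x) * ct m x" unfolding eventually_sequentially by metis
        then show ?thesis by (rule Lim_transform_eventually[OF tendsto_const])
      qed
      then show "AE x in lebesgue_on \<Omega>. (\<lambda>m. cl m (f x) * ct m x) \<longlonglongrightarrow> f x" by (intro AE_I2) simp
    qed
  qed
qed

lemma test_dense: assumes f: "f \<in> L2 \<Omega>" and e: "e > 0" shows "\<exists>\<phi>\<in>test_functions \<Omega>. L2_norm \<Omega> (\<lambda>x. f x - \<phi> x) < e"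
proof -
  obtain \<phi> where \<phi>: "\<phi> \<in> test_functions \<Omega>" "dist (l2_of \<Omega> \<phi>) (l2_of \<Omega> f) < e"
    using closure_test[OF f] e unfolding closure_approachable by blast
  have "L2_norm \<Omega> (\<lambda>x. f x - \<phi> x) = norm (l2_of \<Omega> f - l2_of \<Omega> \<phi>)"
    using norm_l2_of[OF meas L2_diff[OF f test_L2[OF \<phi>(1)]]] l2_of_diff[OF meas f test_L2[OF \<phi>(1)]] by simp
  then show ?thesis using \<phi> by (intro bexI[of _ \<phi>]) (simp_all add: dist_norm norm_minus_commute)
qed

text \<open>The fundamental lemma of the calculus of variations: by density \<open>f\<close> is the
  limit of functions to which it is orthogonal, hence orthogonal to itself.\<close>

lemma orthogonal_test:
  assumes f: "f \<in> L2 \<Omega>" and z: "\<And>\<phi>. \<phi> \<in> test_functions \<Omega> \<Longrightarrow> L2_inner \<Omega> f \<phi> = 0"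
  shows "AE x in lebesgue_on \<Omega>. f x = 0"
proof -
  obtain F where F: "\<And>n. F n \<in> l2_of \<Omega> ` test_functions \<Omega>" "F \<longlonglongrightarrow> l2_of \<Omega> f"
    using closure_test[OF f] unfolding closure_sequential by blast
  have z0: "l2_of \<Omega> f \<bullet> F n = 0" for n using F(1)[of n] z inner_l2_of[OF meas f test_L2] by auto
  have "(\<lambda>n. l2_of \<Omega> f \<bullet> F n) \<longlonglongrightarrow> l2_of \<Omega> f \<bullet> l2_of \<Omega> f" by (intro tendsto_intros F(2))
  then have "(\<lambda>n. 0) \<longlonglongrightarrow> L2_inner \<Omega> f f" unfolding z0 inner_l2_of[OF meas f f] .
  then have "L2_inner \<Omega> f f = 0" by (rule LIMSEQ_unique[OF _ tendsto_const])
  then show ?thesis using L2_inner_eq_0[OF f] by simp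
qed

end

subsection \<open>Weak gradients\<close>

lemma lborel_shift:
  fixes h :: "'a::euclidean_space \<Rightarrow> real"
  assumes "integrable lborel h"
  shows "integrable lborel (\<lambda>x. h (x + c))" "(LINT x|lborel. h (x + c)) = (LINT x|lborel. h x)"
proof -
  have m: "h \<in> borel_measurable borel" using borel_measurable_integrable[OF assms] by simp
  have "integrable (distr lborel borel ((+) c)) h" using assms by (simp add: lborel_distr_plus)
  then have "integrable lborel (\<lambda>x. h (c + x))" by (subst (asm) integrable_distr_eq) (auto simp: m)
  then show "integrable lborel (\<lambda>x. h (x + c))" by (simp add: add.commute)
  have "(LINT x|distr lborel borel ((+) c). h x) = (LINT x|lborel. h (c + x))" by (subst integral_distr) (auto simp: m)
  then show "(LINT x|lborel. h (x + c)) = (LINT x|lborel. h x)" by (simp add: lborel_distr_plus add.commute)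
qed

lemma directional_derivative:
  fixes h :: "'a::euclidean_space \<Rightarrow> real"
  assumes "Ck (Suc 0) h"
  shows "((\<lambda>t. h (x + t *\<^sub>R b)) has_real_derivative frechet_derivative h (at (x + t *\<^sub>R b)) b) (at t)"
proof -
  have "((\<lambda>t. h (x + t *\<^sub>R b)) has_derivative (\<lambda>s. frechet_derivative h (at (x + t *\<^sub>R b)) (s *\<^sub>R b))) (at t)"
    by (rule has_derivative_compose[OF _ Ck_SucD(1)[OF assms]]) (auto intro!: derivative_eq_intros)
  moreover have "linear (frechet_derivative h (at y))" for y
    using Ck_SucD(1)[OF assms] by (rule has_derivative_linear)
  then have "frechet_derivative h (at y) (s *\<^sub>R b) = frechet_derivative h (at y) b * s" for y s
    by (simp add: linear_scale mult.commute)
  ultimately show ?thesis unfolding has_field_derivative_def by simp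
qed

text \<open>By translation invariance the integral of every difference quotient vanishes. The
  quotients converge to the derivative, and the mean value theorem dominates them.\<close>

lemma integral_frechet_derivative_0:
  fixes h :: "'a::euclidean_space \<Rightarrow> real"
  assumes h: "Ck (Suc 0) h" and K: "compact K" "\<And>x. x \<notin> K \<Longrightarrow> h x = 0" and b: "b \<in> Basis"
  shows "(LINT x|lborel. frechet_derivative h (at x) b) = 0"
proof -
  define D where "D x = frechet_derivative h (at x) b" for x
  have Dc: "continuous_on UNIV D" unfolding D_def[abs_def] using Ck_SucD(2)[OF h b] by simp
  have D0: "D x = 0" if "x \<notin> K" for x
    unfolding D_def by (rule frechet_derivative_closed_support[OF compact_imp_closed[OF K(1)] K(2) that])
  have hc: "continuous_on UNIV h" by (rule Ck_continuous[OF h])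
  have hi: "integrable lborel h" by (rule integrable_continuous_compact_support[OF hc K])
  obtain B0 where B0: "\<And>x. x \<in> K \<Longrightarrow> \<bar>D x\<bar> \<le> B0"
    using compact_imp_bounded[OF compact_continuous_image[OF continuous_on_subset[OF Dc] K(1)]] unfolding bounded_iff by auto
  define B where "B = max B0 0"
  have B: "\<bar>D x\<bar> \<le> B" "B \<ge> 0" for x unfolding B_def using B0[of x] D0[of x] by (cases "x \<in> K"; force)+
  define s where "s n = 1 / real (Suc n)" for n
  have s: "s n > 0" "s n \<le> 1" for n unfolding s_def by auto
  define dn where "dn n x = (h (x + s n *\<^sub>R b) - h x) / s n" for n x
  \<comment> \<open>The step lengths are at most \<open>1\<close>, so this neighbourhood contains
    the supports of all difference quotients.\<close>
  define K' where "K' = {x. \<exists>y\<in>K. dist x y \<le> 1}"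
  have K': "compact K'" unfolding K'_def by (rule compact_nbhd[OF K(1)])
  have int0: "(LINT x|lborel. dn n x) = 0" for n
  proof -
    have "(LINT x|lborel. dn n x) = ((LINT x|lborel. h (x + s n *\<^sub>R b)) - (LINT x|lborel. h x)) / s n"
      unfolding dn_def using lborel_shift(1)[OF hi] hi by simp
    then show ?thesis using lborel_shift(2)[OF hi] by simp
  qed
  have "(\<lambda>n. LINT x|lborel. dn n x) \<longlonglongrightarrow> (LINT x|lborel. D x)"
  proof (rule integral_dominated_convergence[where w="\<lambda>x. indicator K' x *\<^sub>R B"])
    show "D \<in> borel_measurable lborel" using borel_measurable_continuous_onI[OF Dc] by simp
    show "dn n \<in> borel_measurable lborel" for n
    proof -
      have "continuous_on UNIV (dn n)"
        unfolding dn_def[abs_def] using s[of n] by (intro continuous_intros continuous_on_compose2[OF hc]) auto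
      then show ?thesis using borel_measurable_continuous_onI by simp
    qed
    show "integrable lborel (\<lambda>x. indicator K' x *\<^sub>R B)" by (rule borel_integrable_compact[OF K']) simp
    show "AE x in lborel. (\<lambda>n. dn n x) \<longlonglongrightarrow> D x"
    proof (rule AE_I2)
      fix x
      have "((\<lambda>k. (h (x + (0 + k) *\<^sub>R b) - h (x + 0 *\<^sub>R b)) / k) \<longlongrightarrow> D x) (at 0)"
        using directional_derivative[OF h, of x b 0] unfolding DERIV_def D_def by simp
      moreover have "filterlim s (at 0) sequentially"
      proof -
        have "s \<longlonglongrightarrow> 0" using LIMSEQ_inverse_real_of_nat unfolding s_def[abs_def] by (simp add: inverse_eq_divide)
        then show ?thesis using s(1) by (intro filterlim_atI) (auto simp: less_imp_neq[symmetric])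
      qed
      ultimately have "(\<lambda>n. (h (x + (0 + s n) *\<^sub>R b) - h (x + 0 *\<^sub>R b)) / s n) \<longlonglongrightarrow> D x" by (rule filterlim_compose)
      then show "(\<lambda>n. dn n x) \<longlonglongrightarrow> D x" unfolding dn_def by simp
    qed
    show "AE x in lborel. norm (dn n x) \<le> indicator K' x *\<^sub>R B" for n
    proof (rule AE_I2)
      fix x
      show "norm (dn n x) \<le> indicator K' x *\<^sub>R B"
      proof (cases "x \<in> K'")
        case True
        have "((\<lambda>t. h (x + t *\<^sub>R b)) has_real_derivative D (x + t *\<^sub>R b)) (at t)" for t
          unfolding D_def by (rule directional_derivative[OF h])
        from MVT2[OF s(1)[of n], of "\<lambda>t. h (x + t *\<^sub>R b)" "\<lambda>t. D (x + t *\<^sub>R b)", OF this]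
        obtain z where "h (x + s n *\<^sub>R b) - h (x + 0 *\<^sub>R b) = (s n - 0) * D (x + z *\<^sub>R b)" by blast
        then have "dn n x = D (x + z *\<^sub>R b)" unfolding dn_def using s(1)[of n] by simp
        then show ?thesis using True B(1)[of "x + z *\<^sub>R b"] by simp
      next
        case False
        have "x \<notin> K" using False unfolding K'_def by auto
        moreover have "x + s n *\<^sub>R b \<notin> K"
        proof
          assume "x + s n *\<^sub>R b \<in> K"
          moreover have "dist x (x + s n *\<^sub>R b) \<le> 1" using b s[of n] by (simp add: dist_norm)
          ultimately show False using False unfolding K'_def by blast
        qed
        ultimately show ?thesis using False K(2) unfolding dn_def by simp
      qed
    qed
  qed
  then have "(\<lambda>n. 0) \<longlonglongrightarrow> (LINT x|lborel. D x)" unfolding int0 .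
  then show ?thesis unfolding D_def using LIMSEQ_unique[OF tendsto_const] by metis
qed

lemma integration_by_parts:
  fixes v \<phi> :: "'a::euclidean_space \<Rightarrow> real"
  assumes v: "Ck (Suc 0) v" and p: "Ck (Suc 0) \<phi>" "compact K" "\<And>x. x \<notin> K \<Longrightarrow> \<phi> x = 0" and b: "b \<in> Basis"
  shows "integrable lborel (\<lambda>x. v x * frechet_derivative \<phi> (at x) b)"
    "integrable lborel (\<lambda>x. frechet_derivative v (at x) b * \<phi> x)"
    "(LINT x|lborel. v x * frechet_derivative \<phi> (at x) b) = - (LINT x|lborel. frechet_derivative v (at x) b * \<phi> x)"
proof -
  note vc = Ck_continuous[OF v] and pc = Ck_continuous[OF p(1)]
  have dv: "continuous_on UNIV (\<lambda>x. frechet_derivative v (at x) b)" and dp: "continuous_on UNIV (\<lambda>x. frechet_derivative \<phi> (at x) b)"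
    using Ck_SucD(2)[OF v b] Ck_SucD(2)[OF p(1) b] by auto
  have d0: "frechet_derivative \<phi> (at x) b = 0" if "x \<notin> K" for x
    by (rule frechet_derivative_closed_support[OF compact_imp_closed[OF p(2)] p(3) that])
  show 1: "integrable lborel (\<lambda>x. v x * frechet_derivative \<phi> (at x) b)"
    by (rule integrable_continuous_compact_support[OF continuous_on_mult[OF vc dp] p(2)]) (simp add: d0)
  show 2: "integrable lborel (\<lambda>x. frechet_derivative v (at x) b * \<phi> x)"
    by (rule integrable_continuous_compact_support[OF continuous_on_mult[OF dv pc] p(2)]) (simp add: p(3))
  have "((\<lambda>x. v x * \<phi> x) has_derivative (\<lambda>h. v x * frechet_derivative \<phi> (at x) h + frechet_derivative v (at x) h * \<phi> x)) (at x)" for x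
    by (rule has_derivative_mult[OF Ck_SucD(1)[OF v] Ck_SucD(1)[OF p(1)]])
  from frechet_derivative_at[OF this, symmetric]
  have fd: "frechet_derivative (\<lambda>x. v x * \<phi> x) (at x) b = v x * frechet_derivative \<phi> (at x) b + frechet_derivative v (at x) b * \<phi> x" for x
    by simp
  have "(LINT x|lborel. frechet_derivative (\<lambda>x. v x * \<phi> x) (at x) b) = 0"
    by (rule integral_frechet_derivative_0[OF Ck_mult[OF v p(1)] p(2) _ b]) (simp add: p(3))
  then show "(LINT x|lborel. v x * frechet_derivative \<phi> (at x) b) = - (LINT x|lborel. frechet_derivative v (at x) b * \<phi> x)"
    unfolding fd using 1 2 by simp
qed

text \<open>The absolute value is replaced by the smooth function \<open>sqrt (v\<^sup>2 + d\<^sup>2)\<close> and \<open>d\<close> tends to \<open>0\<close>.\<close>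

lemma abs_derivative_bound:
  fixes v \<phi> :: "'a::euclidean_space \<Rightarrow> real"
  assumes v: "Ck (Suc 0) v" and p: "Ck (Suc 0) \<phi>" "compact K" "\<And>x. x \<notin> K \<Longrightarrow> \<phi> x = 0" and b: "b \<in> Basis"
  shows "\<bar>LINT x|lborel. \<bar>v x\<bar> * frechet_derivative \<phi> (at x) b\<bar> \<le> (LINT x|lborel. \<bar>frechet_derivative v (at x) b\<bar> * \<bar>\<phi> x\<bar>)"
proof -
  note vc = Ck_continuous[OF v] and pc = Ck_continuous[OF p(1)]
  have dp: "continuous_on UNIV (\<lambda>x. frechet_derivative \<phi> (at x) b)" using Ck_SucD(2)[OF p(1) b] by auto
  have d0: "frechet_derivative \<phi> (at x) b = 0" if "x \<notin> K" for x
    by (rule frechet_derivative_closed_support[OF compact_imp_closed[OF p(2)] p(3) that])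
  have dpi: "integrable lborel (\<lambda>x. \<bar>frechet_derivative \<phi> (at x) b\<bar>)"
    by (rule integrable_continuous_compact_support[OF continuous_on_rabs[OF dp] p(2)]) (simp add: d0)
  have ai: "integrable lborel (\<lambda>x. \<bar>v x\<bar> * frechet_derivative \<phi> (at x) b)"
    by (rule integrable_continuous_compact_support[OF continuous_on_mult[OF continuous_on_rabs[OF vc] dp] p(2)]) (simp add: d0)
  have ri: "integrable lborel (\<lambda>x. \<bar>frechet_derivative v (at x) b\<bar> * \<bar>\<phi> x\<bar>)"
    using integrable_abs[OF integration_by_parts(2)[OF v p b]] by (simp add: abs_mult)
  let ?R = "LINT x|lborel. \<bar>frechet_derivative v (at x) b\<bar> * \<bar>\<phi> x\<bar>"
  let ?C = "LINT x|lborel. \<bar>frechet_derivative \<phi> (at x) b\<bar>"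
  have key: "\<bar>LINT x|lborel. \<bar>v x\<bar> * frechet_derivative \<phi> (at x) b\<bar> \<le> ?R + d * ?C" if d: "d > 0" for d
  proof -
    define F where "F x = sqrt ((v x)\<^sup>2 + d\<^sup>2)" for x
    have pos: "(v x)\<^sup>2 + d\<^sup>2 > 0" for x using d by (simp add: add_nonneg_pos)
    have Fpos: "F x > 0" for x unfolding F_def using pos by simp
    have Fge: "\<bar>v x\<bar> \<le> F x" "F x \<le> \<bar>v x\<bar> + d" for x
    proof -
      show "\<bar>v x\<bar> \<le> F x" unfolding F_def by (rule real_le_rsqrt) simp
      show "F x \<le> \<bar>v x\<bar> + d" unfolding F_def using d by (intro real_le_lsqrt) (auto simp: power2_sum)
    qed
    have Fder: "(F has_derivative (\<lambda>h. frechet_derivative v (at x) h * (v x / F x))) (at x)" for x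
    proof -
      have "((\<lambda>t. sqrt (t\<^sup>2 + d\<^sup>2)) has_real_derivative (v x / F x)) (at (v x))"
        unfolding F_def using pos[of x] by (auto intro!: derivative_eq_intros simp: field_simps)
      from has_derivative_compose[OF Ck_SucD(1)[OF v] this[unfolded has_field_derivative_def]]
      show ?thesis unfolding F_def[abs_def] by (simp add: mult.commute)
    qed
    have Fc: "continuous_on UNIV F" unfolding F_def[abs_def] by (intro continuous_intros vc)
    have FC: "Ck (Suc 0) F"
    proof (rule Ck_SucI[OF Fder])
      fix b' :: 'a assume "b' \<in> Basis"
      then have "continuous_on UNIV (\<lambda>x. frechet_derivative v (at x) b')" using Ck_SucD(2)[OF v] by simp
      moreover have "F x \<noteq> 0" for x using Fpos[of x] by simp
      ultimately show "Ck 0 (\<lambda>x. frechet_derivative v (at x) b' * (v x / F x))"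
        using vc Fc by (auto intro!: continuous_intros)
    qed
    have fdF: "frechet_derivative F (at x) h = frechet_derivative v (at x) h * (v x / F x)" for x h
      using frechet_derivative_at[OF Fder, symmetric] by simp
    note ibp = integration_by_parts[OF FC p b]
    have "\<bar>LINT x|lborel. F x * frechet_derivative \<phi> (at x) b\<bar> \<le> ?R"
    proof -
      have "\<bar>LINT x|lborel. frechet_derivative F (at x) b * \<phi> x\<bar> \<le> (LINT x|lborel. \<bar>frechet_derivative F (at x) b * \<phi> x\<bar>)"
        by (rule integral_abs_bound)
      also have "\<dots> \<le> ?R"
      proof (rule integral_mono[OF integrable_abs[OF ibp(2)] ri])
        fix x
        \<comment> \<open>The derivative of \<open>F\<close> is that of \<open>v\<close> times
          \<open>v / F\<close>, a factor of modulus at most \<open>1\<close>, so the bound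
          \<open>?R\<close> does not depend on \<open>d\<close>.\<close>
        have "\<bar>v x / F x\<bar> \<le> 1" using Fge(1)[of x] Fpos[of x] by (simp add: abs_divide)
        then have "\<bar>frechet_derivative v (at x) b\<bar> * \<bar>v x / F x\<bar> \<le> \<bar>frechet_derivative v (at x) b\<bar> * 1" by (intro mult_left_mono) auto
        then have "\<bar>frechet_derivative F (at x) b\<bar> \<le> \<bar>frechet_derivative v (at x) b\<bar>" unfolding fdF abs_mult by simp
        then show "\<bar>frechet_derivative F (at x) b * \<phi> x\<bar> \<le> \<bar>frechet_derivative v (at x) b\<bar> * \<bar>\<phi> x\<bar>"
          unfolding abs_mult by (intro mult_right_mono) auto
      qed
      finally show ?thesis using ibp(3) by simp
    qed
    moreover have "\<bar>(LINT x|lborel. \<bar>v x\<bar> * frechet_derivative \<phi> (at x) b) - (LINT x|lborel. F x * frechet_derivative \<phi> (at x) b)\<bar> \<le> d * ?C"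
    proof -
      have "(LINT x|lborel. \<bar>v x\<bar> * frechet_derivative \<phi> (at x) b) - (LINT x|lborel. F x * frechet_derivative \<phi> (at x) b)
        = (LINT x|lborel. \<bar>v x\<bar> * frechet_derivative \<phi> (at x) b - F x * frechet_derivative \<phi> (at x) b)"
        using ai ibp(1) by simp
      also have "\<bar>\<dots>\<bar> \<le> (LINT x|lborel. \<bar>\<bar>v x\<bar> * frechet_derivative \<phi> (at x) b - F x * frechet_derivative \<phi> (at x) b\<bar>)"
        by (rule integral_abs_bound)
      also have "\<dots> \<le> (LINT x|lborel. d * \<bar>frechet_derivative \<phi> (at x) b\<bar>)"
      proof (rule integral_mono)
        show "integrable lborel (\<lambda>x. \<bar>\<bar>v x\<bar> * frechet_derivative \<phi> (at x) b - F x * frechet_derivative \<phi> (at x) b\<bar>)"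
          by (intro integrable_abs Bochner_Integration.integrable_diff ai ibp(1))
        show "integrable lborel (\<lambda>x. d * \<bar>frechet_derivative \<phi> (at x) b\<bar>)" using dpi by simp
        fix x
        have "\<bar>\<bar>v x\<bar> - F x\<bar> \<le> d" using Fge[of x] by linarith
        then have "\<bar>\<bar>v x\<bar> - F x\<bar> * \<bar>frechet_derivative \<phi> (at x) b\<bar> \<le> d * \<bar>frechet_derivative \<phi> (at x) b\<bar>" by (intro mult_right_mono) auto
        then show "\<bar>\<bar>v x\<bar> * frechet_derivative \<phi> (at x) b - F x * frechet_derivative \<phi> (at x) b\<bar> \<le> d * \<bar>frechet_derivative \<phi> (at x) b\<bar>"
          unfolding left_diff_distrib[symmetric] abs_mult .
      qed
      finally show ?thesis by simp
    qed
    ultimately show ?thesis by linarith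
  qed
  show ?thesis
  proof (rule field_le_epsilon)
    fix e :: real assume e: "e > 0"
    have C: "?C \<ge> 0" by simp
    have gen: "e / (c + 1) * c \<le> e" if "c \<ge> 0" for c :: real using e that by (simp add: field_simps)
    have "e / (?C + 1) * ?C \<le> e" by (rule gen[OF C])
    moreover have "e / (?C + 1) > 0" using e C by (intro divide_pos_pos) linarith+
    ultimately show "\<bar>LINT x|lborel. \<bar>v x\<bar> * frechet_derivative \<phi> (at x) b\<bar> \<le> ?R + e" using key[of "e / (?C + 1)"] by linarith
  qed
qed

lemma moll_bounded: assumes "e > 0" shows "\<exists>C. \<forall>z::'a::euclidean_space. moll e z \<le> C"
proof (intro exI allI)
  fix z :: 'a
  have "bump e z \<le> 1" unfolding bump_def flat_def by simp
  then show "moll e z \<le> 1 / bump_mass TYPE('a) e" unfolding moll_def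
    using bump_mass_pos[OF assms, where 'a='a] by (intro divide_right_mono) auto
qed

lemma Ck_reflect: "Ck k f \<Longrightarrow> Ck k (\<lambda>y. f (x - y))"
proof (induction k arbitrary: f)
  case 0
  then show ?case by (auto intro!: continuous_on_compose2[of UNIV f] continuous_intros)
next
  case (Suc k)
  show ?case
  proof (rule Ck_SucI)
    show "((\<lambda>y. f (x - y)) has_derivative (\<lambda>h. - frechet_derivative f (at (x - y)) h)) (at y)" for y
    proof -
      have "((\<lambda>y. f (x - y)) has_derivative (\<lambda>h. frechet_derivative f (at (x - y)) (- h))) (at y)"
        by (rule has_derivative_compose[OF _ Ck_SucD(1)[OF Suc.prems]]) (auto intro!: derivative_eq_intros)
      moreover have "linear (frechet_derivative f (at (x - y)))" using Ck_SucD(1)[OF Suc.prems] by (rule has_derivative_linear)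
      ultimately show ?thesis by (simp add: linear_neg)
    qed
    show "Ck k (\<lambda>y. - frechet_derivative f (at (x - y)) b)" if "b \<in> Basis" for b
      using Ck_mult[OF Ck_const[of k "-1"] Suc.IH[OF Ck_SucD(2)[OF Suc.prems that]]] by simp
  qed
qed

lemma frechet_derivative_reflect:
  assumes "Ck (Suc 0) f"
  shows "frechet_derivative (\<lambda>y. f (x - y)) (at y) h = - frechet_derivative f (at (x - y)) h"
proof -
  have "((\<lambda>y. f (x - y)) has_derivative (\<lambda>h. frechet_derivative f (at (x - y)) (- h))) (at y)"
    by (rule has_derivative_compose[OF _ Ck_SucD(1)[OF assms]]) (auto intro!: derivative_eq_intros)
  from frechet_derivative_at[OF this, symmetric]
  have "frechet_derivative (\<lambda>y. f (x - y)) (at y) h = frechet_derivative f (at (x - y)) (- h)" by simp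
  moreover have "linear (frechet_derivative f (at (x - y)))" using Ck_SucD(1)[OF assms] by (rule has_derivative_linear)
  ultimately show ?thesis by (simp add: linear_neg)
qed

text \<open>The variance of \<open>G\<close> under the probability density \<open>m\<close> is
  nonnegative.\<close>

lemma weighted_Jensen:
  fixes m G :: "'a::euclidean_space \<Rightarrow> real"
  assumes m: "\<And>y. 0 \<le> m y" "integrable lborel m" "(LINT y|lborel. m y) = 1"
    and G: "integrable lborel (\<lambda>y. m y * G y)" "integrable lborel (\<lambda>y. m y * (G y)\<^sup>2)"
  shows "(LINT y|lborel. m y * G y)\<^sup>2 \<le> (LINT y|lborel. m y * (G y)\<^sup>2)"
proof -
  define c where "c = (LINT y|lborel. m y * G y)"
  have "0 \<le> (LINT y|lborel. m y * (G y - c)\<^sup>2)" by (intro Bochner_Integration.integral_nonneg) (simp add: m)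
  also have "(\<lambda>y. m y * (G y - c)\<^sup>2) = (\<lambda>y. m y * (G y)\<^sup>2 - (2 * c) * (m y * G y) + c\<^sup>2 * m y)"
    by (auto simp: power2_eq_square algebra_simps)
  also have "(LINT y|lborel. m y * (G y)\<^sup>2 - (2 * c) * (m y * G y) + c\<^sup>2 * m y)
    = (LINT y|lborel. m y * (G y)\<^sup>2) - (2 * c) * c + c\<^sup>2 * 1"
    using m G unfolding c_def by simp
  finally show ?thesis unfolding c_def[symmetric] by (simp add: power2_eq_square)
qed

section \<open>Weak gradients and the Dirichlet form on \<Omega>\<close>

context bounded_domain
begin

lemma integral_on_domain:
  fixes F :: "'a \<Rightarrow> real"
  assumes "F \<in> borel_measurable borel" "\<And>x. x \<notin> \<Omega> \<Longrightarrow> F x = 0"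
  shows "(LINT x|lebesgue_on \<Omega>. F x) = (LINT x|lborel. F x)"
proof -
  have "(LINT x|lebesgue_on \<Omega>. F x) = (LINT x|lebesgue. indicator \<Omega> x *\<^sub>R F x)" using meas by (simp add: integral_restrict_space)
  also have "(\<lambda>x. indicator \<Omega> x *\<^sub>R F x) = F" using assms(2) by (auto simp: indicator_def fun_eq_iff)
  also have "(LINT x|lebesgue. F x) = (LINT x|lborel. F x)" using assms(1) by (intro integral_completion) simp
  finally show ?thesis .
qed

lemma test_derivative:
  assumes "\<phi> \<in> test_functions \<Omega>" "b \<in> Basis"
  shows "(\<lambda>x. frechet_derivative \<phi> (at x) b) \<in> test_functions \<Omega>"
proof -
  obtain K where K: "\<And>k. Ck k \<phi>" "compact K" "K \<subseteq> \<Omega>" "\<And>x. x \<notin> K \<Longrightarrow> \<phi> x = 0" by (rule test_functionsE[OF assms(1)]) blast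
  show ?thesis
    by (rule test_functionsI[OF Ck_SucD(2)[OF K(1) assms(2)] K(2,3)])
      (rule frechet_derivative_closed_support[OF compact_imp_closed[OF K(2)] K(4)])
qed

lemma weak_gradient_L2:
  assumes "weak_gradient \<Omega> u g" shows "(\<lambda>x. g x \<bullet> b) \<in> L2 \<Omega>"
proof -
  have m: "(\<lambda>x. g x \<bullet> b) \<in> borel_measurable (lebesgue_on \<Omega>)"
    using assms unfolding weak_gradient_def by (intro borel_measurable_inner) auto
  have "integrable (lebesgue_on \<Omega>) (\<lambda>x. (norm b)\<^sup>2 * (norm (g x))\<^sup>2)" using assms unfolding weak_gradient_def by simp
  then have "integrable (lebesgue_on \<Omega>) (\<lambda>x. (g x \<bullet> b)\<^sup>2)"
  proof (rule Bochner_Integration.integrable_bound)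
    show "(\<lambda>x. (g x \<bullet> b)\<^sup>2) \<in> borel_measurable (lebesgue_on \<Omega>)" using m by (rule borel_measurable_power)
    show "AE x in lebesgue_on \<Omega>. norm ((g x \<bullet> b)\<^sup>2) \<le> norm ((norm b)\<^sup>2 * (norm (g x))\<^sup>2)"
    proof (rule AE_I2)
      fix x
      have "\<bar>g x \<bullet> b\<bar>\<^sup>2 \<le> (norm (g x) * norm b)\<^sup>2" using Cauchy_Schwarz_ineq2 by (intro power_mono) auto
      then show "norm ((g x \<bullet> b)\<^sup>2) \<le> norm ((norm b)\<^sup>2 * (norm (g x))\<^sup>2)" by (simp add: power_mult_distrib mult.commute)
    qed
  qed
  then show ?thesis using m by (simp add: L2_def)
qed

lemma weak_gradientD:
  assumes "weak_gradient \<Omega> u g" "\<phi> \<in> test_functions \<Omega>" "b \<in> Basis"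
  shows "L2_inner \<Omega> u (\<lambda>x. frechet_derivative \<phi> (at x) b) = - L2_inner \<Omega> (\<lambda>x. g x \<bullet> b) \<phi>"
  using assms unfolding weak_gradient_def L2_inner_def by blast

lemma weak_gradientI:
  assumes G: "\<And>b. b \<in> Basis \<Longrightarrow> G b \<in> L2 \<Omega>"
    and w: "\<And>\<phi> b. \<phi> \<in> test_functions \<Omega> \<Longrightarrow> b \<in> Basis \<Longrightarrow>
      L2_inner \<Omega> u (\<lambda>x. frechet_derivative \<phi> (at x) b) = - L2_inner \<Omega> (G b) \<phi>"
  shows "weak_gradient \<Omega> u (\<lambda>x. \<Sum>b\<in>Basis. G b x *\<^sub>R b)"
proof -
  have n: "(norm (\<Sum>b\<in>Basis. G b x *\<^sub>R b))\<^sup>2 = (\<Sum>b\<in>Basis. (G b x)\<^sup>2)" for x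
    unfolding power2_norm_eq_inner by (subst euclidean_inner) (simp add: power2_eq_square)
  have "(\<lambda>x. \<Sum>b\<in>Basis. G b x *\<^sub>R b) \<in> borel_measurable (lebesgue_on \<Omega>)"
    by (intro borel_measurable_sum borel_measurable_scaleR borel_measurable_const L2_measurable G)
  moreover have "integrable (lebesgue_on \<Omega>) (\<lambda>x. (norm (\<Sum>b\<in>Basis. G b x *\<^sub>R b))\<^sup>2)"
    unfolding n by (intro Bochner_Integration.integrable_sum L2_square_integrable G)
  moreover have "(LINT x|lebesgue_on \<Omega>. u x * frechet_derivative \<phi> (at x) b)
    = - (LINT x|lebesgue_on \<Omega>. ((\<Sum>b\<in>Basis. G b x *\<^sub>R b) \<bullet> b) * \<phi> x)" if "\<phi> \<in> test_functions \<Omega>" "b \<in> Basis" for \<phi> b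
    using w[OF that] that unfolding L2_inner_def by simp
  ultimately show ?thesis unfolding weak_gradient_def by blast
qed

lemma test_weak_gradient:
  assumes "\<phi> \<in> test_functions \<Omega>" shows "weak_gradient \<Omega> \<phi> (\<lambda>x. \<Sum>b\<in>Basis. frechet_derivative \<phi> (at x) b *\<^sub>R b)"
proof (rule weak_gradientI)
  show "(\<lambda>x. frechet_derivative \<phi> (at x) b) \<in> L2 \<Omega>" if "b \<in> Basis" for b using test_L2 test_derivative assms that by blast
  fix \<psi> b assume \<psi>: "\<psi> \<in> test_functions \<Omega>" and b: "b \<in> (Basis :: 'a set)"
  obtain L where L: "\<And>k. Ck k \<phi>" "compact L" "L \<subseteq> \<Omega>" "\<And>x. x \<notin> L \<Longrightarrow> \<phi> x = 0" by (rule test_functionsE[OF assms]) blast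
  obtain K where K: "\<And>k. Ck k \<psi>" "compact K" "K \<subseteq> \<Omega>" "\<And>x. x \<notin> K \<Longrightarrow> \<psi> x = 0" by (rule test_functionsE[OF \<psi>]) blast
  have l: "L2_inner \<Omega> \<phi> (\<lambda>x. frechet_derivative \<psi> (at x) b) = (LINT x|lborel. \<phi> x * frechet_derivative \<psi> (at x) b)"
    unfolding L2_inner_def
  proof (rule integral_on_domain)
    show "(\<lambda>x. \<phi> x * frechet_derivative \<psi> (at x) b) \<in> borel_measurable borel"
      by (intro borel_measurable_continuous_onI continuous_on_mult Ck_continuous[OF L(1)[of 0]] Ck_continuous[OF Ck_SucD(2)[OF K(1) b, of 0]])
  qed (use L in auto)
  have r: "L2_inner \<Omega> (\<lambda>x. frechet_derivative \<phi> (at x) b) \<psi> = (LINT x|lborel. frechet_derivative \<phi> (at x) b * \<psi> x)"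
    unfolding L2_inner_def
  proof (rule integral_on_domain)
    show "(\<lambda>x. frechet_derivative \<phi> (at x) b * \<psi> x) \<in> borel_measurable borel"
      by (intro borel_measurable_continuous_onI continuous_on_mult Ck_continuous[OF K(1)[of 0]] Ck_continuous[OF Ck_SucD(2)[OF L(1) b, of 0]])
  qed (use K in auto)
  show "L2_inner \<Omega> \<phi> (\<lambda>x. frechet_derivative \<psi> (at x) b) = - L2_inner \<Omega> (\<lambda>x. frechet_derivative \<phi> (at x) b) \<psi>"
    unfolding l r by (rule integration_by_parts(3)[OF L(1) K(1,2,4) b])
qed

lemma weak_gradient_unique:
  assumes "weak_gradient \<Omega> u g" "weak_gradient \<Omega> u h" shows "AE x in lebesgue_on \<Omega>. g x \<bullet> b = h x \<bullet> b"
proof -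
  have B: "AE x in lebesgue_on \<Omega>. g x \<bullet> b = h x \<bullet> b" if b: "b \<in> Basis" for b
  proof -
    note gL = weak_gradient_L2[OF assms(1), of b] and hL = weak_gradient_L2[OF assms(2), of b]
    have "AE x in lebesgue_on \<Omega>. g x \<bullet> b - h x \<bullet> b = 0"
    proof (rule orthogonal_test[OF L2_diff[OF gL hL]])
      fix \<phi> assume \<phi>: "\<phi> \<in> test_functions \<Omega>"
      have "L2_inner \<Omega> (\<lambda>x. (-1) * (h x \<bullet> b) + g x \<bullet> b) \<phi> = (-1) * L2_inner \<Omega> (\<lambda>x. h x \<bullet> b) \<phi> + L2_inner \<Omega> (\<lambda>x. g x \<bullet> b) \<phi>"
        by (rule L2_inner_lin_left[OF hL gL test_L2[OF \<phi>]])
      then show "L2_inner \<Omega> (\<lambda>x. g x \<bullet> b - h x \<bullet> b) \<phi> = 0"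
        using weak_gradientD[OF assms(1) \<phi> b] weak_gradientD[OF assms(2) \<phi> b] by simp
    qed
    then show ?thesis by eventually_elim simp
  qed
  have "AE x in lebesgue_on \<Omega>. \<forall>b\<in>Basis. g x \<bullet> b = h x \<bullet> b"
    by (rule AE_finite_allI[OF finite_Basis]) (erule B)
  then show ?thesis
  proof (rule AE_mp, intro AE_I2 impI)
    fix x assume "\<forall>b\<in>Basis. g x \<bullet> b = h x \<bullet> b"
    then have "g x = h x" by (simp add: euclidean_eq_iff[of "g x"])
    then show "g x \<bullet> b = h x \<bullet> b" by (rule arg_cong)
  qed
qed

lemma grad_weak: assumes "weak_gradient \<Omega> u g" shows "weak_gradient \<Omega> u (grad \<Omega> u)"
  unfolding grad_def using assms by (rule someI[of "weak_gradient \<Omega> u" g])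

text \<open>\<open>grad\<close> is a choice among the weak gradients; this lemma allows any weak
  gradient at hand to be used. The sum over coordinates reduces the form to products in
  \<open>L2 \<Omega>\<close>.\<close>

lemma dirichlet_eq:
  assumes "weak_gradient \<Omega> u g" "weak_gradient \<Omega> v h"
  shows "dirichlet_form \<Omega> u v = (\<Sum>b\<in>Basis. L2_inner \<Omega> (\<lambda>x. g x \<bullet> b) (\<lambda>x. h x \<bullet> b))"
proof -
  note u = grad_weak[OF assms(1)] and v = grad_weak[OF assms(2)]
  have "dirichlet_form \<Omega> u v = (LINT x|lebesgue_on \<Omega>. (\<Sum>b\<in>Basis. (grad \<Omega> u x \<bullet> b) * (grad \<Omega> v x \<bullet> b)))"
    unfolding dirichlet_form_def by (rule Bochner_Integration.integral_cong[OF refl euclidean_inner])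
  also have "\<dots> = (\<Sum>b\<in>Basis. L2_inner \<Omega> (\<lambda>x. grad \<Omega> u x \<bullet> b) (\<lambda>x. grad \<Omega> v x \<bullet> b))"
    unfolding L2_inner_def by (rule Bochner_Integration.integral_sum) (rule L2_mult_integrable[OF weak_gradient_L2[OF u] weak_gradient_L2[OF v]])
  also have "\<dots> = (\<Sum>b\<in>Basis. L2_inner \<Omega> (\<lambda>x. g x \<bullet> b) (\<lambda>x. h x \<bullet> b))"
    by (intro sum.cong refl L2_inner_cong_AE weak_gradient_L2[OF u] weak_gradient_L2[OF v]
        weak_gradient_L2[OF assms(1)] weak_gradient_L2[OF assms(2)] weak_gradient_unique[OF u assms(1)] weak_gradient_unique[OF v assms(2)])
  finally show ?thesis .
qed

lemma weak_gradient_lin: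
  assumes "u \<in> L2 \<Omega>" "v \<in> L2 \<Omega>" "weak_gradient \<Omega> u g" "weak_gradient \<Omega> v h"
  shows "weak_gradient \<Omega> (\<lambda>x. c * u x + v x) (\<lambda>x. \<Sum>b\<in>Basis. (c * (g x \<bullet> b) + h x \<bullet> b) *\<^sub>R b)"
proof (rule weak_gradientI[where G="\<lambda>b x. c * (g x \<bullet> b) + h x \<bullet> b"])
  show "(\<lambda>x. c * (g x \<bullet> b) + h x \<bullet> b) \<in> L2 \<Omega>" for b
    by (rule L2_lin[OF weak_gradient_L2[OF assms(3)] weak_gradient_L2[OF assms(4)]])
  fix \<phi> b assume \<phi>: "\<phi> \<in> test_functions \<Omega>" and b: "b \<in> (Basis :: 'a set)"
  show "L2_inner \<Omega> (\<lambda>x. c * u x + v x) (\<lambda>x. frechet_derivative \<phi> (at x) b) = - L2_inner \<Omega> (\<lambda>x. c * (g x \<bullet> b) + h x \<bullet> b) \<phi>"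
    unfolding L2_inner_lin_left[OF assms(1,2) test_L2[OF test_derivative[OF \<phi> b]]]
      L2_inner_lin_left[OF weak_gradient_L2[OF assms(3)] weak_gradient_L2[OF assms(4)] test_L2[OF \<phi>]]
      weak_gradientD[OF assms(3) \<phi> b] weak_gradientD[OF assms(4) \<phi> b] by simp
qed

lemma H1D: assumes "u \<in> H1 \<Omega>" shows "u \<in> L2 \<Omega>" "weak_gradient \<Omega> u (grad \<Omega> u)"
  using assms grad_weak unfolding H1_def by auto

lemma H1_lin: assumes "u \<in> H1 \<Omega>" "v \<in> H1 \<Omega>" shows "(\<lambda>x. c * u x + v x) \<in> H1 \<Omega>"
  using L2_lin[OF H1D(1)[OF assms(1)] H1D(1)[OF assms(2)]]
    weak_gradient_lin[OF H1D(1)[OF assms(1)] H1D(1)[OF assms(2)] H1D(2)[OF assms(1)] H1D(2)[OF assms(2)]]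
  unfolding H1_def by blast

lemma semi_inner_space_H1: "semi_inner_space (H1 \<Omega>) (dirichlet_form \<Omega>)"
proof
  show "(\<lambda>x. 0) \<in> H1 \<Omega>" unfolding H1_def using test_weak_gradient[OF test_functions_zero] by auto
  fix f g h :: "'a \<Rightarrow> real" and c
  assume f: "f \<in> H1 \<Omega>"
  show "0 \<le> dirichlet_form \<Omega> f f" unfolding dirichlet_form_def by simp
  assume g: "g \<in> H1 \<Omega>"
  show "dirichlet_form \<Omega> f g = dirichlet_form \<Omega> g f" unfolding dirichlet_form_def by (simp add: inner_commute)
  show "(\<lambda>x. c * f x + g x) \<in> H1 \<Omega>" by (rule H1_lin[OF f g])
  assume h: "h \<in> H1 \<Omega>"
  have "dirichlet_form \<Omega> (\<lambda>x. c * f x + g x) h = (\<Sum>b\<in>Basis. L2_inner \<Omega> (\<lambda>x. c * (grad \<Omega> f x \<bullet> b) + grad \<Omega> g x \<bullet> b) (\<lambda>x. grad \<Omega> h x \<bullet> b))"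
    using dirichlet_eq[OF weak_gradient_lin[OF H1D(1)[OF f] H1D(1)[OF g] H1D(2)[OF f] H1D(2)[OF g], of c] H1D(2)[OF h]] by simp
  also have "\<dots> = c * dirichlet_form \<Omega> f h + dirichlet_form \<Omega> g h"
    unfolding dirichlet_eq[OF H1D(2)[OF f] H1D(2)[OF h]] dirichlet_eq[OF H1D(2)[OF g] H1D(2)[OF h]]
      L2_inner_lin_left[OF weak_gradient_L2[OF H1D(2)[OF f]] weak_gradient_L2[OF H1D(2)[OF g]] weak_gradient_L2[OF H1D(2)[OF h]]]
    by (simp add: sum.distrib sum_distrib_left)
  finally show "dirichlet_form \<Omega> (\<lambda>x. c * f x + g x) h = c * dirichlet_form \<Omega> f h + dirichlet_form \<Omega> g h" .
qed

lemma test_H1: "\<phi> \<in> test_functions \<Omega> \<Longrightarrow> \<phi> \<in> H1 \<Omega>"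
  unfolding H1_def using test_L2 test_weak_gradient by blast

lemma weak_gradient_cong:
  assumes "u \<in> L2 \<Omega>" "AE x in lebesgue_on \<Omega>. u x = v x" "v \<in> L2 \<Omega>"
  shows "weak_gradient \<Omega> u = weak_gradient \<Omega> v"
proof -
  have e: "L2_inner \<Omega> u (\<lambda>x. frechet_derivative \<phi> (at x) b) = L2_inner \<Omega> v (\<lambda>x. frechet_derivative \<phi> (at x) b)"
    if "\<phi> \<in> test_functions \<Omega>" "b \<in> Basis" for \<phi> b
    using assms test_L2[OF test_derivative[OF that]] by (intro L2_inner_cong_AE) auto
  show ?thesis
    by (rule ext) (simp add: weak_gradient_def e[unfolded L2_inner_def] cong: ball_cong)
qed

text \<open>Functions are defined on the whole space and are changed off \<Omega> below, by
  extension from the closure and by setting a minimum to \<open>0\<close>. Since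
  \<open>weak_gradient \<Omega> u\<close> and \<open>weak_gradient \<Omega> v\<close> are the same
  predicate, even the chosen gradients coincide literally.\<close>

lemma H1_cong:
  assumes "u \<in> H1 \<Omega>" "\<And>x. x \<in> \<Omega> \<Longrightarrow> u x = v x"
  shows "v \<in> H1 \<Omega>" "dirichlet_form \<Omega> v w = dirichlet_form \<Omega> u w" "dirichlet_form \<Omega> w v = dirichlet_form \<Omega> w u"
    "L2_inner \<Omega> v w = L2_inner \<Omega> u w" "L2_inner \<Omega> w v = L2_inner \<Omega> w u" "l2_of \<Omega> v = l2_of \<Omega> u"
proof -
  have ae: "AE x in lebesgue_on \<Omega>. u x = v x" by (rule AE_I2) (use assms(2) in simp)
  have "v \<in> borel_measurable (lebesgue_on \<Omega>)"
    using L2_measurable[OF H1D(1)[OF assms(1)]] assms(2) by (subst measurable_cong[of _ v u]) auto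
  then have v: "v \<in> L2 \<Omega>" using L2_cong_AE[OF H1D(1)[OF assms(1)] ae] by simp
  note w = weak_gradient_cong[OF H1D(1)[OF assms(1)] ae v]
  show "v \<in> H1 \<Omega>" using v assms(1) w unfolding H1_def by simp
  have "grad \<Omega> v = grad \<Omega> u" unfolding grad_def w ..
  then show "dirichlet_form \<Omega> v w = dirichlet_form \<Omega> u w" "dirichlet_form \<Omega> w v = dirichlet_form \<Omega> w u"
    unfolding dirichlet_form_def by simp_all
  show "L2_inner \<Omega> v w = L2_inner \<Omega> u w" "L2_inner \<Omega> w v = L2_inner \<Omega> w u"
    unfolding L2_inner_def by (rule Bochner_Integration.integral_cong; use assms(2) in simp)+
  show "l2_of \<Omega> v = l2_of \<Omega> u" using l2_of_eq_iff[OF meas v H1D(1)[OF assms(1)]] ae by (simp add: eq_commute)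
qed

text \<open>This is how a weak derivative is obtained from an estimate alone: applied to the
  functional that sends \<phi> to minus the product of \<open>w\<close> with a derivative of \<phi>,
  it yields that weak derivative of \<open>w\<close>, with its squared norm bounded by
  \<open>M\<close>. The representing function is the \<open>L\<^sup>2\<close> limit of the sequence
  of \<open>riesz\<close>.\<close>

lemma functional_representation:
  assumes lin: "\<And>c \<phi> \<psi>. \<phi> \<in> test_functions \<Omega> \<Longrightarrow> \<psi> \<in> test_functions \<Omega> \<Longrightarrow> l (\<lambda>x. c * \<phi> x + \<psi> x) = c * l \<phi> + l \<psi>"
    and bdd: "\<And>\<phi>. \<phi> \<in> test_functions \<Omega> \<Longrightarrow> (l \<phi>)\<^sup>2 \<le> M * L2_inner \<Omega> \<phi> \<phi>" and M: "M \<ge> 0"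
  shows "\<exists>h\<in>L2 \<Omega>. (\<forall>\<phi>\<in>test_functions \<Omega>. L2_inner \<Omega> h \<phi> = l \<phi>) \<and> L2_inner \<Omega> h h \<le> M"
proof -
  interpret T: semi_inner_space "test_functions \<Omega>" "L2_inner \<Omega>"
    by unfold_locales (auto intro!: test_functions_zero test_functions_lin L2_inner_lin_left test_L2 L2_inner_commute L2_inner_ge_0)
  obtain x where x: "\<And>n. x n \<in> test_functions \<Omega>"
    "\<And>n v. v \<in> test_functions \<Omega> \<Longrightarrow> \<bar>L2_inner \<Omega> (x n) v - l v\<bar> \<le> sqrt (L2_inner \<Omega> v v) / real (Suc n)"
    "\<And>m n. L2_inner \<Omega> (\<lambda>z. x m z - x n z) (\<lambda>z. x m z - x n z) \<le> (1 / real (Suc m) + 1 / real (Suc n))\<^sup>2"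
    by (rule T.riesz[of l M, OF lin bdd]) blast+
  have nd: "norm (l2_of \<Omega> (x m) - l2_of \<Omega> (x n)) \<le> 1 / real (Suc m) + 1 / real (Suc n)" for m n
  proof (rule power2_le_imp_le)
    have "(norm (l2_of \<Omega> (x m) - l2_of \<Omega> (x n)))\<^sup>2 = L2_inner \<Omega> (\<lambda>z. x m z - x n z) (\<lambda>z. x m z - x n z)"
      unfolding power2_norm_eq_inner l2_of_diff[OF meas test_L2[OF x(1)] test_L2[OF x(1)], symmetric]
      by (rule inner_l2_of[OF meas]) (intro L2_diff test_L2 x(1))+
    then show "(norm (l2_of \<Omega> (x m) - l2_of \<Omega> (x n)))\<^sup>2 \<le> (1 / real (Suc m) + 1 / real (Suc n))\<^sup>2" using x(3)[of m n] by simp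
  qed simp
  have xC: "Cauchy (\<lambda>n. l2_of \<Omega> (x n))"
  proof (rule metric_CauchyI)
    fix e :: real assume e: "e > 0"
    obtain N where N: "inverse (real (Suc N)) < e / 2" using reals_Archimedean[of "e/2"] e by auto
    have "dist (l2_of \<Omega> (x m)) (l2_of \<Omega> (x n)) < e" if "m \<ge> N" "n \<ge> N" for m n
    proof -
      have "1 / real (Suc m) \<le> inverse (real (Suc N))" "1 / real (Suc n) \<le> inverse (real (Suc N))"
        using that by (auto simp: inverse_eq_divide intro!: divide_left_mono)
      then show ?thesis using nd[of m n] N unfolding dist_norm by linarith
    qed
    then show "\<exists>M. \<forall>m\<ge>M. \<forall>n\<ge>M. dist (l2_of \<Omega> (x m)) (l2_of \<Omega> (x n)) < e" by blast
  qed
  have xin: "\<forall>n. l2_of \<Omega> (x n) \<in> l2_of \<Omega> ` L2 \<Omega>" using test_L2[OF x(1)] by simp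
  obtain U where U: "U \<in> l2_of \<Omega> ` L2 \<Omega>" "(\<lambda>n. l2_of \<Omega> (x n)) \<longlonglongrightarrow> U"
    by (rule completeE[OF complete_l2_of[OF meas] xin xC])
  obtain h where h: "h \<in> L2 \<Omega>" "(\<lambda>n. l2_of \<Omega> (x n)) \<longlonglongrightarrow> l2_of \<Omega> h" using U by auto
  have hl: "L2_inner \<Omega> h v = l v" if v: "v \<in> test_functions \<Omega>" for v
  proof -
    have "(\<lambda>n. l2_of \<Omega> (x n) \<bullet> l2_of \<Omega> v) \<longlonglongrightarrow> l2_of \<Omega> h \<bullet> l2_of \<Omega> v" by (intro tendsto_intros h(2))
    then have 1: "(\<lambda>n. L2_inner \<Omega> (x n) v) \<longlonglongrightarrow> L2_inner \<Omega> h v"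
      unfolding inner_l2_of[OF meas test_L2[OF x(1)] test_L2[OF v]] inner_l2_of[OF meas h(1) test_L2[OF v]] .
    have "(\<lambda>n. L2_inner \<Omega> (x n) v - l v) \<longlonglongrightarrow> 0"
    proof (rule Lim_null_comparison[OF always_eventually[OF allI]])
      show "norm (L2_inner \<Omega> (x n) v - l v) \<le> sqrt (L2_inner \<Omega> v v) * inverse (real (Suc n))" for n
        using x(2)[OF v, of n] by (simp add: divide_inverse)
      show "(\<lambda>n. sqrt (L2_inner \<Omega> v v) * inverse (real (Suc n))) \<longlonglongrightarrow> 0"
        by (rule tendsto_mult_right_zero[OF LIMSEQ_inverse_real_of_nat])
    qed
    then have "(\<lambda>n. L2_inner \<Omega> (x n) v) \<longlonglongrightarrow> l v" by (rule LIM_zero_cancel)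
    then show ?thesis by (rule LIMSEQ_unique[OF 1])
  qed
  \<comment> \<open>The bound for \<open>l\<close> is evaluated at \<open>x n\<close>, which tends
    to \<open>h\<close>, and there \<open>l\<close> is the product with \<open>h\<close>.\<close>
  have "(L2_inner \<Omega> h h)\<^sup>2 \<le> M * L2_inner \<Omega> h h"
  proof (rule LIMSEQ_le)
    have "(\<lambda>n. (l2_of \<Omega> h \<bullet> l2_of \<Omega> (x n))\<^sup>2) \<longlonglongrightarrow> (l2_of \<Omega> h \<bullet> l2_of \<Omega> h)\<^sup>2" by (intro tendsto_intros h(2))
    then show "(\<lambda>n. (L2_inner \<Omega> h (x n))\<^sup>2) \<longlonglongrightarrow> (L2_inner \<Omega> h h)\<^sup>2"
      unfolding inner_l2_of[OF meas h(1) test_L2[OF x(1)]] inner_l2_of[OF meas h(1) h(1)] .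
    have "(\<lambda>n. M * (l2_of \<Omega> (x n) \<bullet> l2_of \<Omega> (x n))) \<longlonglongrightarrow> M * (l2_of \<Omega> h \<bullet> l2_of \<Omega> h)" by (intro tendsto_intros h(2))
    then show "(\<lambda>n. M * L2_inner \<Omega> (x n) (x n)) \<longlonglongrightarrow> M * L2_inner \<Omega> h h"
      unfolding inner_l2_of[OF meas test_L2[OF x(1)] test_L2[OF x(1)]] inner_l2_of[OF meas h(1) h(1)] .
    show "\<exists>N. \<forall>n\<ge>N. (L2_inner \<Omega> h (x n))\<^sup>2 \<le> M * L2_inner \<Omega> (x n) (x n)" using bdd[OF x(1)] hl[OF x(1)] by simp
  qed
  then have "L2_inner \<Omega> h h * L2_inner \<Omega> h h \<le> M * L2_inner \<Omega> h h" by (simp add: power2_eq_square)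
  then have "L2_inner \<Omega> h h \<le> M" using L2_inner_ge_0[of \<Omega> h] M by (cases "L2_inner \<Omega> h h = 0") (auto simp: mult_le_cancel_right)
  then show ?thesis using h(1) hl by blast
qed

end

subsection \<open>Mollification of weakly differentiable functions\<close>

context bounded_domain
begin

text \<open>If the ball of radius \<open>e\<close> about \<open>x\<close> lies in \<Omega>, the
  kernel \<open>moll e (x - y)\<close> is a test function of \<open>y\<close>, and the definition of
  the weak gradient moves the derivative from the kernel to \<open>u\<close>. The minus signs of the
  reflection and of the integration by parts cancel.\<close>

lemma mollified_gradient:
  assumes u: "continuous_on UNIV u" and wg: "weak_gradient \<Omega> u g" and e: "e > 0"
    and x: "cball x e \<subseteq> \<Omega>" and box: "\<Omega> \<subseteq> cbox a c" and b: "b \<in> Basis"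
  shows "frechet_derivative (conv a c (moll e) u) (at x) b = L2_inner \<Omega> (\<lambda>y. g y \<bullet> b) (\<lambda>y. moll e (x - y))"
proof -
  define \<rho> where "\<rho> z = frechet_derivative (moll e) (at z) b" for z
  have rc: "continuous_on UNIV \<rho>" unfolding \<rho>_def[abs_def] by (rule Ck_continuous[OF Ck_SucD(2)[OF moll_Ck[of "Suc 0"] b]])
  have r0: "\<rho> (x - y) = 0" if "y \<notin> cball x e" for y
    unfolding \<rho>_def
  proof (rule frechet_derivative_closed_support[of "cball 0 e"])
    show "moll e z = 0" if "z \<notin> cball 0 e" for z using that by (intro moll_eq_0[OF e]) auto
    show "x - y \<notin> cball 0 e" using that by (simp add: dist_norm norm_minus_commute)
  qed simp
  have r1: "\<rho> (x - y) = 0" if "y \<notin> \<Omega>" for y by (rule r0) (use x that in blast)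
  have p: "(\<lambda>y. moll e (x - y)) \<in> test_functions \<Omega>"
  proof (rule test_functionsI[OF Ck_reflect[OF moll_Ck] compact_cball x])
    show "moll e (x - y) = 0" if "y \<notin> cball x e" for y using that by (intro moll_eq_0[OF e]) (simp add: dist_norm)
  qed
  have fd: "frechet_derivative (\<lambda>y. moll e (x - y)) (at y) b = - \<rho> (x - y)" for y
    unfolding \<rho>_def by (rule frechet_derivative_reflect[OF moll_Ck])
  have "frechet_derivative (conv a c (moll e) u) (at x) b = conv a c \<rho> u x"
    unfolding \<rho>_def by (rule frechet_derivative_conv[OF moll_Ck u])
  also have "\<dots> = (LINT y|lborel. \<rho> (x - y) * u y)"
  proof (rule conv_lebesgue(2)[OF rc u])
    fix y assume "y \<notin> cbox a c"
    then have "y \<notin> \<Omega>" using box by blast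
    then show "\<rho> (x - y) * u y = 0" using r1 by simp
  qed
  also have "\<dots> = (LINT y|lebesgue_on \<Omega>. \<rho> (x - y) * u y)"
  proof (rule integral_on_domain[symmetric])
    show "(\<lambda>y. \<rho> (x - y) * u y) \<in> borel_measurable borel"
      by (intro borel_measurable_continuous_onI continuous_on_mult u continuous_on_compose2[OF rc] continuous_intros) auto
    show "\<rho> (x - y) * u y = 0" if "y \<notin> \<Omega>" for y using r1[OF that] by simp
  qed
  also have "\<dots> = - L2_inner \<Omega> u (\<lambda>y. frechet_derivative (\<lambda>y. moll e (x - y)) (at y) b)"
    unfolding L2_inner_def fd by (simp add: mult.commute)
  also have "\<dots> = L2_inner \<Omega> (\<lambda>y. g y \<bullet> b) (\<lambda>y. moll e (x - y))" using weak_gradientD[OF wg p b] by simp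
  finally show ?thesis .
qed

lemma L2_restrict_set:
  assumes f: "f \<in> L2 \<Omega>" and S: "S \<in> sets borel" shows "(\<lambda>x. if x \<in> S then f x else 0) \<in> L2 \<Omega>"
proof -
  have "S \<in> sets lebesgue" using S by simp
  then have "S \<inter> \<Omega> \<in> sets lebesgue" using meas by (rule sets.Int)
  then have "S \<inter> space (lebesgue_on \<Omega>) \<in> sets (lebesgue_on \<Omega>)"
    using meas by (simp add: sets_restrict_space_iff)
  then have m: "(\<lambda>x. if x \<in> S then f x else 0) \<in> borel_measurable (lebesgue_on \<Omega>)"
    using L2_measurable[OF f] by (intro measurable_If_set) auto
  have "integrable (lebesgue_on \<Omega>) (\<lambda>x. (if x \<in> S then f x else 0)\<^sup>2)"
    by (rule Bochner_Integration.integrable_bound[OF L2_square_integrable[OF f] borel_measurable_power[OF m]]) (auto intro!: AE_I2)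
  then show ?thesis using m by (simp add: L2_def)
qed

text \<open>Members of \<open>L2 \<Omega>\<close> are only Lebesgue measurable, while Fubini's
  theorem for \<open>lborel\<close> asks for joint Borel measurability; \<open>G\<close> is a Borel
  representative of the extension of \<open>f\<close> by zero.\<close>

lemma L2_borel_representative:
  assumes f: "f \<in> L2 \<Omega>"
  obtains G where "G \<in> borel_measurable borel" "integrable lborel (\<lambda>y. (G y)\<^sup>2)"
    "(\<integral>\<^sup>+y. ennreal ((G y)\<^sup>2) \<partial>lborel) = ennreal (L2_inner \<Omega> f f)"
    "\<And>m. m \<in> borel_measurable borel \<Longrightarrow> (LINT y|lborel. m y * G y) = L2_inner \<Omega> f m"
proof -
  define F where "F y = (if y \<in> \<Omega> then f y else 0)" for y
  have F: "F \<in> L2 UNIV" unfolding F_def[abs_def] using L2_extend_iff[OF meas] f by blast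
  have Fm: "F \<in> borel_measurable lebesgue" and Fi: "integrable lebesgue (\<lambda>y. (F y)\<^sup>2)"
    using F by (simp_all add: L2_def lebesgue_on_UNIV_eq)
  obtain G where G: "G \<in> borel_measurable lborel" "AE y in lborel. F y = G y"
    using completion_ex_borel_measurable_real[OF Fm] by blast
  have ae: "AE y in lebesgue. F y = G y" using G(2) by (rule AE_completion)
  have Gb: "G \<in> borel_measurable borel" using G(1) by simp
  have Gl: "G \<in> borel_measurable lebesgue" using G(1) by (rule measurable_completion)
  have "integrable lebesgue (\<lambda>y. (G y)\<^sup>2)"
  proof (rule integrable_cong_AE_imp[OF Fi])
    show "(\<lambda>y. (G y)\<^sup>2) \<in> borel_measurable lebesgue" using Gl by (rule borel_measurable_power)
    show "AE y in lebesgue. (F y)\<^sup>2 = (G y)\<^sup>2" using ae by eventually_elim simp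
  qed
  moreover have G2: "(\<lambda>y. (G y)\<^sup>2) \<in> borel_measurable lborel" using G(1) by (rule borel_measurable_power)
  ultimately have Gi: "integrable lborel (\<lambda>y. (G y)\<^sup>2)" using integrable_completion[OF G2] by simp
  have FF: "(\<lambda>y. (F y)\<^sup>2) = (\<lambda>y. indicator \<Omega> y *\<^sub>R (f y * f y))" unfolding F_def by (auto simp: indicator_def power2_eq_square)
  have "(\<integral>\<^sup>+y. ennreal ((G y)\<^sup>2) \<partial>lborel) = ennreal (LINT y|lborel. (G y)\<^sup>2)"
    by (rule nn_integral_eq_integral[OF Gi]) simp
  also have "(LINT y|lborel. (G y)\<^sup>2) = (LINT y|lebesgue. (G y)\<^sup>2)" using integral_completion[OF G2] by simp
  also have "\<dots> = (LINT y|lebesgue. (F y)\<^sup>2)"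
  proof (rule integral_cong_AE)
    show "(\<lambda>y. (G y)\<^sup>2) \<in> borel_measurable lebesgue" using Gl by (rule borel_measurable_power)
    show "(\<lambda>y. (F y)\<^sup>2) \<in> borel_measurable lebesgue" using Fm by (rule borel_measurable_power)
    show "AE y in lebesgue. (G y)\<^sup>2 = (F y)\<^sup>2" using ae by eventually_elim simp
  qed
  also have "\<dots> = L2_inner \<Omega> f f" unfolding FF L2_inner_def using meas by (simp add: integral_restrict_space)
  finally have 1: "(\<integral>\<^sup>+y. ennreal ((G y)\<^sup>2) \<partial>lborel) = ennreal (L2_inner \<Omega> f f)" .
  have 2: "(LINT y|lborel. m y * G y) = L2_inner \<Omega> f m" if m: "m \<in> borel_measurable borel" for m
  proof -
    have mG: "(\<lambda>y. m y * G y) \<in> borel_measurable lborel" using m Gb by simp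
    have ml: "m \<in> borel_measurable lebesgue" using m by (intro measurable_completion) simp
    have "(LINT y|lborel. m y * G y) = (LINT y|lebesgue. m y * G y)" using integral_completion[OF mG] by simp
    also have "\<dots> = (LINT y|lebesgue. m y * F y)"
    proof (rule integral_cong_AE)
      show "(\<lambda>y. m y * G y) \<in> borel_measurable lebesgue" using ml Gl by (rule borel_measurable_times)
      show "(\<lambda>y. m y * F y) \<in> borel_measurable lebesgue" using ml Fm by (rule borel_measurable_times)
      show "AE y in lebesgue. m y * G y = m y * F y" using ae by eventually_elim simp
    qed
    also have "(\<lambda>y. m y * F y) = (\<lambda>y. indicator \<Omega> y *\<^sub>R (f y * m y))" unfolding F_def by (auto simp: indicator_def)
    finally show ?thesis unfolding L2_inner_def using meas by (simp add: integral_restrict_space)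
  qed
  show thesis by (rule that[OF Gb Gi 1 2])
qed

text \<open>Averaging does not increase the \<open>L\<^sup>2\<close> norm: Jensen's inequality at
  each point, and Fubini's theorem with a kernel of mass \<open>1\<close> in the other variable.
  \<open>P\<close> is cut off to \<open>S\<close>, because where the ball leaves \<Omega> the
  derivative of the convolution need not be an average of the weak gradient.\<close>

lemma mollified_gradient_bound:
  assumes u: "continuous_on UNIV u" and wg: "weak_gradient \<Omega> u g" and e: "e > 0"
    and S: "S \<in> sets borel" "\<And>x. x \<in> S \<Longrightarrow> cball x e \<subseteq> \<Omega>" and box: "\<Omega> \<subseteq> cbox a c" and b: "b \<in> Basis"
  defines "P \<equiv> (\<lambda>x. if x \<in> S then frechet_derivative (conv a c (moll e) u) (at x) b else 0)"
  shows "P \<in> L2 \<Omega>" "L2_inner \<Omega> P P \<le> L2_inner \<Omega> (\<lambda>y. g y \<bullet> b) (\<lambda>y. g y \<bullet> b)"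
proof -
  have "Ck (Suc 0) (conv a c (moll e) u)" by (rule conv_Ck[OF u moll_Ck])
  then have "continuous_on UNIV (\<lambda>x. frechet_derivative (conv a c (moll e) u) (at x) b)"
    by (rule Ck_continuous[OF Ck_SucD(2)[OF _ b]])
  then show P: "P \<in> L2 \<Omega>" unfolding P_def by (rule L2_restrict_set[OF continuous_L2 S(1)])
  obtain G where G: "G \<in> borel_measurable borel" "integrable lborel (\<lambda>y. (G y)\<^sup>2)"
    "(\<integral>\<^sup>+y. ennreal ((G y)\<^sup>2) \<partial>lborel) = ennreal (L2_inner \<Omega> (\<lambda>y. g y \<bullet> b) (\<lambda>y. g y \<bullet> b))"
    "\<And>m. m \<in> borel_measurable borel \<Longrightarrow> (LINT y|lborel. m y * G y) = L2_inner \<Omega> (\<lambda>y. g y \<bullet> b) m"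
    by (rule L2_borel_representative[OF weak_gradient_L2[OF wg, of b]]) blast
  have Mm [measurable]: "moll e \<in> borel_measurable borel" by (rule borel_measurable_continuous_onI[OF moll_continuous])
  note [measurable] = G(1)
  obtain C where C: "\<And>z::'a. moll e z \<le> C" using moll_bounded[OF e] by blast
  have mx: "(\<lambda>y. moll e (x - y)) \<in> borel_measurable borel" for x by measurable
  have i2: "integrable lborel (\<lambda>y. moll e (x - y) * (G y)\<^sup>2)" for x
  proof (rule Bochner_Integration.integrable_bound)
    show "integrable lborel (\<lambda>y. C * (G y)\<^sup>2)" using G(2) by simp
    show "(\<lambda>y. moll e (x - y) * (G y)\<^sup>2) \<in> borel_measurable lborel" by measurable
    show "AE y in lborel. norm (moll e (x - y) * (G y)\<^sup>2) \<le> norm (C * (G y)\<^sup>2)"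
    proof (rule AE_I2)
      fix y
      have "\<bar>moll e (x - y)\<bar> \<le> \<bar>C\<bar>" using C[of "x - y"] moll_nonneg[OF e, of "x - y"] by linarith
      then show "norm (moll e (x - y) * (G y)\<^sup>2) \<le> norm (C * (G y)\<^sup>2)" by (simp add: abs_mult mult_right_mono)
    qed
  qed
  have i1: "integrable lborel (\<lambda>y. moll e (x - y) * G y)" for x
  proof (rule Bochner_Integration.integrable_bound)
    show "integrable lborel (\<lambda>y. moll e (x - y) + moll e (x - y) * (G y)\<^sup>2)" using i2[of x] moll_shift(1)[OF e, of x] by simp
    show "(\<lambda>y. moll e (x - y) * G y) \<in> borel_measurable lborel" by measurable
    show "AE y in lborel. norm (moll e (x - y) * G y) \<le> norm (moll e (x - y) + moll e (x - y) * (G y)\<^sup>2)"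
    proof (rule AE_I2)
      fix y
      have "\<bar>G y\<bar> \<le> 1 + (G y)\<^sup>2"
      proof -
        have "0 \<le> (\<bar>G y\<bar> - 1/2)\<^sup>2" by simp
        then show ?thesis by (simp add: power2_eq_square algebra_simps)
      qed
      then have "moll e (x - y) * \<bar>G y\<bar> \<le> moll e (x - y) * (1 + (G y)\<^sup>2)" using moll_nonneg[OF e] by (intro mult_left_mono)
      moreover have "0 \<le> moll e (x - y) * (G y)\<^sup>2" "0 \<le> moll e (x - y)" using moll_nonneg[OF e, of "x - y"] by auto
      ultimately show "norm (moll e (x - y) * G y) \<le> norm (moll e (x - y) + moll e (x - y) * (G y)\<^sup>2)"
        by (simp add: abs_mult algebra_simps)
    qed
  qed
  \<comment> \<open>As an integral with values in \<open>ennreal\<close>, \<open>Q\<close> allows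
    the order of integration to be exchanged without a proof of joint integrability.\<close>
  define Q where "Q x = (\<integral>\<^sup>+y. ennreal (moll e (x - y) * (G y)\<^sup>2) \<partial>lborel)" for x
  have PQ: "ennreal ((P x)\<^sup>2) \<le> Q x" for x
  proof (cases "x \<in> S")
    case True
    have "P x = (LINT y|lborel. moll e (x - y) * G y)"
      unfolding P_def using True mollified_gradient[OF u wg e S(2)[OF True] box b] G(4)[OF mx[of x]] by simp
    then have "(P x)\<^sup>2 \<le> (LINT y|lborel. moll e (x - y) * (G y)\<^sup>2)"
      using weighted_Jensen[OF moll_nonneg[OF e] moll_shift(1,2)[OF e] i1 i2, of x] by simp
    then have "ennreal ((P x)\<^sup>2) \<le> ennreal (LINT y|lborel. moll e (x - y) * (G y)\<^sup>2)" by (rule ennreal_leI)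
    also have "\<dots> = Q x" unfolding Q_def
      by (rule nn_integral_eq_integral[symmetric, OF i2]) (simp add: moll_nonneg[OF e])
    finally show ?thesis .
  qed (simp add: P_def)
  have Qm: "Q \<in> borel_measurable borel" unfolding Q_def[abs_def] by measurable
  have "ennreal (L2_inner \<Omega> P P) = (\<integral>\<^sup>+x. ennreal ((P x)\<^sup>2) \<partial>lebesgue_on \<Omega>)" using nn_integral_square[OF P] by simp
  also have "\<dots> \<le> (\<integral>\<^sup>+x. Q x \<partial>lebesgue_on \<Omega>)" by (rule nn_integral_mono) (rule PQ)
  also have "\<dots> \<le> (\<integral>\<^sup>+x. Q x \<partial>lebesgue)"
    using meas by (subst nn_integral_restrict_space) (auto intro!: nn_integral_mono simp: indicator_def)
  also have "\<dots> = (\<integral>\<^sup>+x. Q x \<partial>lborel)" by (rule nn_integral_completion)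
  also have "\<dots> = (\<integral>\<^sup>+y. \<integral>\<^sup>+x. ennreal (moll e (x - y) * (G y)\<^sup>2) \<partial>lborel \<partial>lborel)"
    unfolding Q_def by (rule lborel_pair.Fubini'[symmetric]) measurable
  also have "\<dots> = (\<integral>\<^sup>+y. ennreal ((G y)\<^sup>2) \<partial>lborel)"
  proof (rule nn_integral_cong)
    fix y
    have "(\<integral>\<^sup>+x. ennreal (moll e (x - y) * (G y)\<^sup>2) \<partial>lborel) = ennreal (LINT x|lborel. moll e (x - y) * (G y)\<^sup>2)"
      using moll_shift(3)[OF e, of y] by (intro nn_integral_eq_integral) (auto simp: moll_nonneg[OF e])
    also have "(LINT x|lborel. moll e (x - y) * (G y)\<^sup>2) = (G y)\<^sup>2" using moll_shift(4)[OF e, of y] by simp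
    finally show "(\<integral>\<^sup>+x. ennreal (moll e (x - y) * (G y)\<^sup>2) \<partial>lborel) = ennreal ((G y)\<^sup>2)" .
  qed
  also have "\<dots> = ennreal (L2_inner \<Omega> (\<lambda>y. g y \<bullet> b) (\<lambda>y. g y \<bullet> b))" by (rule G(3))
  finally show "L2_inner \<Omega> P P \<le> L2_inner \<Omega> (\<lambda>y. g y \<bullet> b) (\<lambda>y. g y \<bullet> b)"
    by (subst (asm) ennreal_le_iff) (auto simp: L2_inner_ge_0)
qed

lemma L2_Cauchy_Schwarz:
  assumes "f \<in> L2 \<Omega>" "g \<in> L2 \<Omega>" shows "(L2_inner \<Omega> f g)\<^sup>2 \<le> L2_inner \<Omega> f f * L2_inner \<Omega> g g"
  using Cauchy_Schwarz_ineq[of "l2_of \<Omega> f" "l2_of \<Omega> g"]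
  unfolding inner_l2_of[OF meas assms] inner_l2_of[OF meas assms(1,1)] inner_l2_of[OF meas assms(2,2)] .

lemma L2_abs: "f \<in> L2 \<Omega> \<Longrightarrow> (\<lambda>x. \<bar>f x\<bar>) \<in> L2 \<Omega>"
  by (auto simp: L2_def intro: borel_measurable_abs)

section \<open>Absolute values, and test functions of controlled energy\<close>

lemma mollify:
  assumes u: "continuous_on UNIV u" and d: "d > 0" and n: "\<eta> > 0"
  obtains e a c where "e > 0" "e \<le> d" "\<Omega> \<subseteq> cbox a c"
    "\<And>x. x \<in> \<Omega> \<Longrightarrow> \<bar>conv a c (moll e) u x - u x\<bar> \<le> \<eta>"
proof -
  obtain a c where ab: "\<And>x e. x \<in> \<Omega> \<Longrightarrow> e \<le> 1 \<Longrightarrow> cball x e \<subseteq> cbox a c" "\<Omega> \<subseteq> cbox a c" by (rule box_ex) blast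
  obtain e0 where e0: "e0 > 0" "e0 \<le> 1" "\<And>x y. x \<in> \<Omega> \<Longrightarrow> dist x y \<le> e0 \<Longrightarrow> \<bar>u y - u x\<bar> \<le> \<eta>"
    by (rule uniformly_close[OF u n]) blast
  show thesis
  proof (rule that[of "min d e0"])
    show "\<bar>conv a c (moll (min d e0)) u x - u x\<bar> \<le> \<eta>" if "x \<in> \<Omega>" for x
      by (rule conv_moll_close[OF u]) (use e0 d ab(1)[OF that] e0(3)[OF that] in auto)
  qed (use d e0 ab in auto)
qed

text \<open>For a mollification \<open>v\<close> of \<open>u\<close> the bound follows from
  \<open>abs_derivative_bound\<close>, the Cauchy-Schwarz inequality and
  \<open>mollified_gradient_bound\<close> on the support of \<phi>. It does not depend on the
  radius, and the mollifications converge uniformly on \<Omega>, so it passes to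
  \<open>u\<close>.\<close>

lemma abs_weak_bound:
  assumes u: "continuous_on UNIV u" and wg: "weak_gradient \<Omega> u g"
    and p: "\<phi> \<in> test_functions \<Omega>" and b: "b \<in> Basis"
  shows "(L2_inner \<Omega> (\<lambda>x. \<bar>u x\<bar>) (\<lambda>x. frechet_derivative \<phi> (at x) b))\<^sup>2
    \<le> L2_inner \<Omega> (\<lambda>y. g y \<bullet> b) (\<lambda>y. g y \<bullet> b) * L2_inner \<Omega> \<phi> \<phi>"
proof -
  obtain K where K: "\<And>k. Ck k \<phi>" "compact K" "K \<subseteq> \<Omega>" "\<And>x. x \<notin> K \<Longrightarrow> \<phi> x = 0" by (rule test_functionsE[OF p]) blast
  obtain d where d: "d > 0" "d \<le> 1" "\<And>x y. x \<in> K \<Longrightarrow> dist x y \<le> d \<Longrightarrow> y \<in> \<Omega>" by (rule support_nbhd[OF K(2,3)]) blast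
  have dp: "(\<lambda>x. frechet_derivative \<phi> (at x) b) \<in> test_functions \<Omega>" by (rule test_derivative[OF p b])
  have dpc: "continuous_on UNIV (\<lambda>x. frechet_derivative \<phi> (at x) b)" by (rule Ck_continuous[OF Ck_SucD(2)[OF K(1) b, of 0]])
  have dp0: "frechet_derivative \<phi> (at x) b = 0" if "x \<notin> K" for x
    by (rule frechet_derivative_closed_support[OF compact_imp_closed[OF K(2)] K(4) that])
  have "\<exists>v. continuous_on UNIV v \<and> (\<forall>x\<in>\<Omega>. \<bar>v x - u x\<bar> \<le> 1 / real (Suc n)) \<and>
    (L2_inner \<Omega> (\<lambda>x. \<bar>v x\<bar>) (\<lambda>x. frechet_derivative \<phi> (at x) b))\<^sup>2 \<le> L2_inner \<Omega> (\<lambda>y. g y \<bullet> b) (\<lambda>y. g y \<bullet> b) * L2_inner \<Omega> \<phi> \<phi>" for n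
  proof -
    have n: "1 / real (Suc n) > 0" by simp
    obtain e a c where e: "e > 0" "e \<le> d" "\<Omega> \<subseteq> cbox a c"
      "\<And>x. x \<in> \<Omega> \<Longrightarrow> \<bar>conv a c (moll e) u x - u x\<bar> \<le> 1 / real (Suc n)"
      by (rule mollify[OF u d(1) n]) blast
    define v where "v = conv a c (moll e) u"
    have vC: "Ck k v" for k unfolding v_def by (rule conv_Ck[OF u moll_Ck])
    have vc: "continuous_on UNIV v" by (rule Ck_continuous[OF vC[of 0]])
    define P where "P x = (if x \<in> K then frechet_derivative v (at x) b else 0)" for x
    have Kb: "K \<in> sets borel" using compact_imp_closed[OF K(2)] by simp
    have KO: "cball x e \<subseteq> \<Omega>" if "x \<in> K" for x using d(3)[OF that] e(2) by auto
    note P = mollified_gradient_bound[OF u wg e(1) Kb KO e(3) b, folded v_def, folded P_def]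
    have "L2_inner \<Omega> (\<lambda>x. \<bar>v x\<bar>) (\<lambda>x. frechet_derivative \<phi> (at x) b) = (LINT x|lborel. \<bar>v x\<bar> * frechet_derivative \<phi> (at x) b)"
      unfolding L2_inner_def
    proof (rule integral_on_domain)
      show "(\<lambda>x. \<bar>v x\<bar> * frechet_derivative \<phi> (at x) b) \<in> borel_measurable borel"
        by (intro borel_measurable_continuous_onI continuous_on_mult continuous_on_rabs vc dpc)
    qed (use dp0 K(3) in auto)
    then have "\<bar>L2_inner \<Omega> (\<lambda>x. \<bar>v x\<bar>) (\<lambda>x. frechet_derivative \<phi> (at x) b)\<bar> \<le> (LINT x|lborel. \<bar>frechet_derivative v (at x) b\<bar> * \<bar>\<phi> x\<bar>)"
      using abs_derivative_bound[OF vC K(1,2,4) b] by simp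
    also have "\<dots> = (LINT x|lebesgue_on \<Omega>. \<bar>frechet_derivative v (at x) b\<bar> * \<bar>\<phi> x\<bar>)"
    proof (rule integral_on_domain[symmetric])
      show "(\<lambda>x. \<bar>frechet_derivative v (at x) b\<bar> * \<bar>\<phi> x\<bar>) \<in> borel_measurable borel"
        by (intro borel_measurable_continuous_onI continuous_on_mult continuous_on_rabs
            Ck_continuous[OF K(1)[of 0]] Ck_continuous[OF Ck_SucD(2)[OF vC b, of 0]])
    qed (use K(3,4) in auto)
    also have "\<dots> = L2_inner \<Omega> (\<lambda>x. \<bar>P x\<bar>) (\<lambda>x. \<bar>\<phi> x\<bar>)"
      unfolding L2_inner_def by (rule Bochner_Integration.integral_cong) (auto simp: P_def K(4))
    finally have "\<bar>L2_inner \<Omega> (\<lambda>x. \<bar>v x\<bar>) (\<lambda>x. frechet_derivative \<phi> (at x) b)\<bar>\<^sup>2 \<le> (L2_inner \<Omega> (\<lambda>x. \<bar>P x\<bar>) (\<lambda>x. \<bar>\<phi> x\<bar>))\<^sup>2"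
      by (rule power_mono) simp
    also have "\<dots> \<le> L2_inner \<Omega> (\<lambda>x. \<bar>P x\<bar>) (\<lambda>x. \<bar>P x\<bar>) * L2_inner \<Omega> (\<lambda>x. \<bar>\<phi> x\<bar>) (\<lambda>x. \<bar>\<phi> x\<bar>)"
      by (rule L2_Cauchy_Schwarz[OF L2_abs[OF P(1)] L2_abs[OF test_L2[OF p]]])
    also have "\<dots> = L2_inner \<Omega> P P * L2_inner \<Omega> \<phi> \<phi>" unfolding L2_inner_def by simp
    also have "\<dots> \<le> L2_inner \<Omega> (\<lambda>y. g y \<bullet> b) (\<lambda>y. g y \<bullet> b) * L2_inner \<Omega> \<phi> \<phi>"
      by (rule mult_right_mono[OF P(2) L2_inner_ge_0])
    finally have "(L2_inner \<Omega> (\<lambda>x. \<bar>v x\<bar>) (\<lambda>x. frechet_derivative \<phi> (at x) b))\<^sup>2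
      \<le> L2_inner \<Omega> (\<lambda>y. g y \<bullet> b) (\<lambda>y. g y \<bullet> b) * L2_inner \<Omega> \<phi> \<phi>" by simp
    then show ?thesis using vc e(4) unfolding v_def by blast
  qed
  then obtain v where v: "\<And>n. continuous_on UNIV (v n)" "\<And>n x. x \<in> \<Omega> \<Longrightarrow> \<bar>v n x - u x\<bar> \<le> 1 / real (Suc n)"
    "\<And>n. (L2_inner \<Omega> (\<lambda>x. \<bar>v n x\<bar>) (\<lambda>x. frechet_derivative \<phi> (at x) b))\<^sup>2 \<le> L2_inner \<Omega> (\<lambda>y. g y \<bullet> b) (\<lambda>y. g y \<bullet> b) * L2_inner \<Omega> \<phi> \<phi>"
    by metis
  have vL: "(\<lambda>x. \<bar>v n x\<bar>) \<in> L2 \<Omega>" for n by (rule L2_abs[OF continuous_L2[OF v(1)]])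
  have uL: "(\<lambda>x. \<bar>u x\<bar>) \<in> L2 \<Omega>" by (rule L2_abs[OF continuous_L2[OF u]])
  have lim: "(\<lambda>n. l2_of \<Omega> (\<lambda>x. \<bar>v n x\<bar>)) \<longlonglongrightarrow> l2_of \<Omega> (\<lambda>x. \<bar>u x\<bar>)"
  proof (rule l2_of_uniform_limit[OF vL uL])
    show "\<bar>\<bar>v n x\<bar> - \<bar>u x\<bar>\<bar> \<le> 1 / real (Suc n)" if "x \<in> \<Omega>" for n x using v(2)[OF that, of n] by linarith
  qed
  have "(\<lambda>n. (l2_of \<Omega> (\<lambda>x. \<bar>v n x\<bar>) \<bullet> l2_of \<Omega> (\<lambda>x. frechet_derivative \<phi> (at x) b))\<^sup>2)
    \<longlonglongrightarrow> (l2_of \<Omega> (\<lambda>x. \<bar>u x\<bar>) \<bullet> l2_of \<Omega> (\<lambda>x. frechet_derivative \<phi> (at x) b))\<^sup>2"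
    by (intro tendsto_intros lim)
  then have "(\<lambda>n. (L2_inner \<Omega> (\<lambda>x. \<bar>v n x\<bar>) (\<lambda>x. frechet_derivative \<phi> (at x) b))\<^sup>2)
    \<longlonglongrightarrow> (L2_inner \<Omega> (\<lambda>x. \<bar>u x\<bar>) (\<lambda>x. frechet_derivative \<phi> (at x) b))\<^sup>2"
    unfolding inner_l2_of[OF meas vL test_L2[OF dp]] inner_l2_of[OF meas uL test_L2[OF dp]] .
  then show ?thesis by (rule LIMSEQ_le_const2) (use v(3) in blast)
qed

text \<open>Each partial derivative of the absolute value is produced by
  \<open>functional_representation\<close>, with the squared norm of the corresponding derivative of
  \<open>u\<close> as the bound \<open>M\<close>. Summing these bounds gives the inequality of the
  forms; the derivative itself is never identified.\<close>

lemma abs_H1: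
  assumes u: "u \<in> H1 \<Omega>" "continuous_on (closure \<Omega>) u"
  shows "(\<lambda>x. \<bar>u x\<bar>) \<in> H1 \<Omega>" "dirichlet_form \<Omega> (\<lambda>x. \<bar>u x\<bar>) (\<lambda>x. \<bar>u x\<bar>) \<le> dirichlet_form \<Omega> u u"
proof -
  \<comment> \<open>Convolution is set up for functions that are continuous on the whole space;
    Tietze's theorem provides one without changing \<open>u\<close> on the closure of
    \<Omega>.\<close>
  obtain w where w: "continuous_on UNIV w" "\<And>x. x \<in> closure \<Omega> \<Longrightarrow> w x = u x"
    by (rule Tietze_unbounded[OF u(2), of UNIV]) auto
  have uw: "u x = w x" if "x \<in> \<Omega>" for x using w(2)[of x] closure_subset[of \<Omega>] that by auto
  note W = H1_cong[OF u(1) uw]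
  define g where "g = grad \<Omega> w"
  have wg: "weak_gradient \<Omega> w g" unfolding g_def using H1D(2)[OF W(1)] by simp
  have wL: "(\<lambda>x. \<bar>w x\<bar>) \<in> L2 \<Omega>" by (rule L2_abs[OF continuous_L2[OF w(1)]])
  have "\<exists>h\<in>L2 \<Omega>. (\<forall>\<phi>\<in>test_functions \<Omega>. L2_inner \<Omega> h \<phi> = - L2_inner \<Omega> (\<lambda>x. \<bar>w x\<bar>) (\<lambda>x. frechet_derivative \<phi> (at x) b)) \<and>
      L2_inner \<Omega> h h \<le> L2_inner \<Omega> (\<lambda>y. g y \<bullet> b) (\<lambda>y. g y \<bullet> b)" if b: "b \<in> Basis" for b
  proof (rule functional_representation)
    fix c \<phi> \<psi> assume p: "\<phi> \<in> test_functions \<Omega>" "\<psi> \<in> test_functions \<Omega>"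
    obtain K where K: "\<And>k. Ck k \<phi>" by (rule test_functionsE[OF p(1)]) blast
    obtain L where L: "\<And>k. Ck k \<psi>" by (rule test_functionsE[OF p(2)]) blast
    have "frechet_derivative (\<lambda>x. c * \<phi> x + \<psi> x) (at x) b = c * frechet_derivative \<phi> (at x) b + frechet_derivative \<psi> (at x) b" for x
    proof -
      have "((\<lambda>x. c * \<phi> x + \<psi> x) has_derivative (\<lambda>h. c * frechet_derivative \<phi> (at x) h + frechet_derivative \<psi> (at x) h)) (at x)"
        by (intro has_derivative_add has_derivative_mult_right Ck_SucD(1)[OF K] Ck_SucD(1)[OF L])
      from frechet_derivative_at[OF this, symmetric] show ?thesis by simp
    qed
    then show "- L2_inner \<Omega> (\<lambda>x. \<bar>w x\<bar>) (\<lambda>x. frechet_derivative (\<lambda>x. c * \<phi> x + \<psi> x) (at x) b)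
      = c * - L2_inner \<Omega> (\<lambda>x. \<bar>w x\<bar>) (\<lambda>x. frechet_derivative \<phi> (at x) b) + - L2_inner \<Omega> (\<lambda>x. \<bar>w x\<bar>) (\<lambda>x. frechet_derivative \<psi> (at x) b)"
      using semi_inner_space.lin_right[OF semi_inner_space_L2 test_L2[OF test_derivative[OF p(1) b]] test_L2[OF test_derivative[OF p(2) b]] wL, of c]
      by simp
  next
    fix \<phi> assume p: "\<phi> \<in> test_functions \<Omega>"
    show "(- L2_inner \<Omega> (\<lambda>x. \<bar>w x\<bar>) (\<lambda>x. frechet_derivative \<phi> (at x) b))\<^sup>2 \<le> L2_inner \<Omega> (\<lambda>y. g y \<bullet> b) (\<lambda>y. g y \<bullet> b) * L2_inner \<Omega> \<phi> \<phi>"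
      using abs_weak_bound[OF w(1) wg p b] by simp
  qed (rule L2_inner_ge_0)
  then obtain G where G: "\<And>b. b \<in> Basis \<Longrightarrow> G b \<in> L2 \<Omega>"
    "\<And>b \<phi>. b \<in> Basis \<Longrightarrow> \<phi> \<in> test_functions \<Omega> \<Longrightarrow> L2_inner \<Omega> (G b) \<phi> = - L2_inner \<Omega> (\<lambda>x. \<bar>w x\<bar>) (\<lambda>x. frechet_derivative \<phi> (at x) b)"
    "\<And>b. b \<in> Basis \<Longrightarrow> L2_inner \<Omega> (G b) (G b) \<le> L2_inner \<Omega> (\<lambda>y. g y \<bullet> b) (\<lambda>y. g y \<bullet> b)" by metis
  have Gw: "weak_gradient \<Omega> (\<lambda>x. \<bar>w x\<bar>) (\<lambda>x. \<Sum>b\<in>Basis. G b x *\<^sub>R b)"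
    by (rule weak_gradientI[OF G(1)]) (simp_all add: G(2))
  have aH: "(\<lambda>x. \<bar>w x\<bar>) \<in> H1 \<Omega>" unfolding H1_def using wL Gw by blast
  have "dirichlet_form \<Omega> (\<lambda>x. \<bar>w x\<bar>) (\<lambda>x. \<bar>w x\<bar>) = (\<Sum>b\<in>Basis. L2_inner \<Omega> (G b) (G b))"
    using dirichlet_eq[OF Gw Gw] by simp
  also have "\<dots> \<le> dirichlet_form \<Omega> w w" unfolding dirichlet_eq[OF wg wg] by (rule sum_mono) (rule G(3))
  also have "\<dots> = dirichlet_form \<Omega> u u" by (simp add: W(2,3))
  finally have le: "dirichlet_form \<Omega> (\<lambda>x. \<bar>w x\<bar>) (\<lambda>x. \<bar>w x\<bar>) \<le> dirichlet_form \<Omega> u u" .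
  have "\<bar>w x\<bar> = \<bar>u x\<bar>" if "x \<in> \<Omega>" for x using uw[OF that] by simp
  note A = H1_cong[OF aH this]
  show "(\<lambda>x. \<bar>u x\<bar>) \<in> H1 \<Omega>" by (rule A(1))
  show "dirichlet_form \<Omega> (\<lambda>x. \<bar>u x\<bar>) (\<lambda>x. \<bar>u x\<bar>) \<le> dirichlet_form \<Omega> u u" using le by (simp add: A(2,3))
qed

text \<open>As \<open>w\<close> vanishes near the boundary, its mollification is a test function,
  and on its support the derivative is an average of the weak gradient of \<open>w\<close>. Hence
  the form does not increase at all.\<close>

lemma test_approximation:
  assumes w: "continuous_on UNIV w" "w \<in> H1 \<Omega>" and K: "compact K" "K \<subseteq> \<Omega>" "\<And>x. x \<notin> K \<Longrightarrow> w x = 0" and n: "\<eta> > 0"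
  shows "\<exists>\<phi>\<in>test_functions \<Omega>. dirichlet_form \<Omega> \<phi> \<phi> \<le> dirichlet_form \<Omega> w w \<and> (\<forall>x\<in>\<Omega>. \<bar>\<phi> x - w x\<bar> \<le> \<eta>)"
proof -
  obtain d where d: "d > 0" "d \<le> 1" "\<And>x y. x \<in> K \<Longrightarrow> dist x y \<le> d \<Longrightarrow> y \<in> \<Omega>" by (rule support_nbhd[OF K(1,2)]) blast
  \<comment> \<open>Half of \<open>d\<close>, because \<phi> vanishes off the
    \<open>e\<close>-neighbourhood \<open>S\<close> of \<open>K\<close>, and the balls of radius
    \<open>e\<close> about points of \<open>S\<close> must still lie in \<Omega>.\<close>
  have d2: "d / 2 > 0" using d by simp
  obtain e a c where e: "e > 0" "e \<le> d / 2" "\<Omega> \<subseteq> cbox a c"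
    "\<And>x. x \<in> \<Omega> \<Longrightarrow> \<bar>conv a c (moll e) w x - w x\<bar> \<le> \<eta>"
    by (rule mollify[OF w(1) d2 n]) blast
  define \<phi> where "\<phi> = conv a c (moll e) w"
  have sub: "y \<in> \<Omega>" if "x \<in> K" "dist x y \<le> e" for x y using d(3)[OF that(1), of y] that(2) e d by simp
  note t = conv_moll_test[OF w(1) K(1,3) e(1) sub, where a=a and b=c, folded \<phi>_def]
  have \<phi>T: "\<phi> \<in> test_functions \<Omega>" by (rule t(1))
  define S where "S = {x. \<exists>y\<in>K. dist x y \<le> e}"
  have Sc: "closed S" unfolding S_def by (rule compact_imp_closed[OF compact_nbhd[OF K(1)]])
  have Sb: "S \<in> sets borel" using Sc by simp
  have SO: "cball x e \<subseteq> \<Omega>" if xS: "x \<in> S" for x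
  proof
    fix z assume "z \<in> cball x e"
    moreover obtain y where y: "y \<in> K" "dist x y \<le> e" using xS unfolding S_def by blast
    ultimately have "dist y z \<le> d" using e(2) dist_triangle[of y z x] by (simp add: dist_commute)
    then show "z \<in> \<Omega>" by (rule d(3)[OF y(1)])
  qed
  define g where "g = grad \<Omega> w"
  have wg: "weak_gradient \<Omega> w g" unfolding g_def by (rule H1D(2)[OF w(2)])
  have le: "L2_inner \<Omega> (\<lambda>x. frechet_derivative \<phi> (at x) b) (\<lambda>x. frechet_derivative \<phi> (at x) b) \<le> L2_inner \<Omega> (\<lambda>y. g y \<bullet> b) (\<lambda>y. g y \<bullet> b)"
    if b: "b \<in> Basis" for b
  proof -
    have "frechet_derivative \<phi> (at x) b = (if x \<in> S then frechet_derivative \<phi> (at x) b else 0)" for x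
      using frechet_derivative_closed_support[OF Sc, of \<phi> x b] t(2) unfolding S_def by auto
    then have "(\<lambda>x. frechet_derivative \<phi> (at x) b) = (\<lambda>x. if x \<in> S then frechet_derivative \<phi> (at x) b else 0)" by (rule ext)
    then show ?thesis using mollified_gradient_bound(2)[OF w(1) wg e(1) Sb SO e(3) b, folded \<phi>_def] by simp
  qed
  have "dirichlet_form \<Omega> \<phi> \<phi> = (\<Sum>b\<in>Basis. L2_inner \<Omega> (\<lambda>x. frechet_derivative \<phi> (at x) b) (\<lambda>x. frechet_derivative \<phi> (at x) b))"
    unfolding dirichlet_eq[OF test_weak_gradient[OF \<phi>T] test_weak_gradient[OF \<phi>T]] by simp
  also have "\<dots> \<le> dirichlet_form \<Omega> w w" unfolding dirichlet_eq[OF wg wg] by (rule sum_mono) (rule le)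
  finally show ?thesis using \<phi>T e(4) unfolding \<phi>_def by blast
qed

end

subsection \<open>Semigroups on square integrable functions\<close>

context L2_form
begin

text \<open>This makes the choice in \<open>semigroup_exp\<close> meaningful. The semigroup
  \<open>sg\<close> on classes is turned into one on functions by \<open>rep_l2\<close>.\<close>

lemma C0_semigroup_exists: "\<exists>T. C0_semigroup \<Omega> T \<and> generator \<Omega> T = Op"
proof -
  define T where "T t f = rep_l2 (sg t (l2_of \<Omega> f))" for t f
  have lH: "l2_of \<Omega> f \<in> l2_of \<Omega> ` L2 \<Omega>" if "f \<in> L2 \<Omega>" for f using that by blast
  have TL: "T t f \<in> L2 \<Omega>" for t f unfolding T_def by (rule rep_l2_in[OF meas])
  have lT: "l2_of \<Omega> (T t f) = sg t (l2_of \<Omega> f)" if "f \<in> L2 \<Omega>" "t \<ge> 0" for t f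
    unfolding T_def by (rule l2_of_rep[OF meas sg_in[OF lH[OF that(1)] that(2)]])
  have C: "C0_semigroup \<Omega> T"
    unfolding C0_semigroup_def
  proof (intro conjI allI impI ballI)
    fix t :: real assume t: "t \<ge> 0"
    show "bounded_operator \<Omega> (T t)"
      unfolding bounded_operator_def
    proof (intro conjI allI ballI)
      fix c f g assume f: "f \<in> L2 \<Omega>" and g: "g \<in> L2 \<Omega>"
      have "l2_of \<Omega> (T t (\<lambda>y. c * f y + g y)) = l2_of \<Omega> (\<lambda>x. c * T t f x + T t g x)"
        unfolding l2_of_lin[OF meas TL TL] lT[OF f t] lT[OF g t] lT[OF L2_lin[OF f g] t] l2_of_lin[OF meas f g]
        by (rule sg_lin[OF lH[OF f] lH[OF g] t])
      then show "AE x in lebesgue_on \<Omega>. T t (\<lambda>y. c * f y + g y) x = c * T t f x + T t g x"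
        using l2_of_eq_iff[OF meas TL L2_lin[OF TL TL]] by simp
    next
      have "L2_norm \<Omega> (T t f) \<le> 1 * L2_norm \<Omega> f" if f: "f \<in> L2 \<Omega>" for f
        unfolding norm_l2_of[OF meas TL, symmetric] norm_l2_of[OF meas f, symmetric] lT[OF f t]
        using sg_contraction[OF lH[OF f] t] by simp
      then show "\<exists>C. \<forall>f\<in>L2 \<Omega>. L2_norm \<Omega> (T t f) \<le> C * L2_norm \<Omega> f" by blast
    qed (rule TL)
  next
    fix f assume f: "f \<in> L2 \<Omega>"
    have "l2_of \<Omega> (T 0 f) = l2_of \<Omega> f" using lT[OF f] sg_0[OF lH[OF f]] by simp
    then show "AE x in lebesgue_on \<Omega>. T 0 f x = f x" using l2_of_eq_iff[OF meas TL f] by simp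
    have "((\<lambda>t. l2_of \<Omega> (T t f)) \<longlongrightarrow> l2_of \<Omega> f) (at_right 0)"
    proof (rule Lim_transform_eventually[OF sg_continuous[OF lH[OF f]]])
      show "\<forall>\<^sub>F t in at_right 0. sg t (l2_of \<Omega> f) = l2_of \<Omega> (T t f)"
        unfolding eventually_at_right_field using lT[OF f] by (intro exI[of _ 1]) simp
    qed
    moreover have "L2_norm \<Omega> (\<lambda>x. T t f x - f x) = norm (l2_of \<Omega> (T t f) - l2_of \<Omega> f)" for t
      using norm_l2_of[OF meas L2_diff[OF TL f]] l2_of_diff[OF meas TL f] by simp
    ultimately show "((\<lambda>t. L2_norm \<Omega> (\<lambda>x. T t f x - f x)) \<longlongrightarrow> 0) (at_right 0)"
      by (simp add: tendsto_norm_zero_iff LIM_zero_iff)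
  next
    fix s t :: real and f assume s: "s \<ge> 0" and t: "t \<ge> 0" and f: "f \<in> L2 \<Omega>"
    have "l2_of \<Omega> (T (s + t) f) = l2_of \<Omega> (T s (T t f))"
      using lT[OF f, of "s + t"] lT[OF TL s] lT[OF f t] sg_semigroup[OF lH[OF f] s t] s t by simp
    then show "AE x in lebesgue_on \<Omega>. T (s + t) f x = T s (T t f) x" using l2_of_eq_iff[OF meas TL TL] by simp
  qed
  have "(u, w) \<in> generator \<Omega> T \<longleftrightarrow> (u, w) \<in> Op" for u w
  proof (cases "u \<in> L2 \<Omega> \<and> w \<in> L2 \<Omega>")
    case True
    then have u: "u \<in> L2 \<Omega>" and w: "w \<in> L2 \<Omega>" by auto
    have e: "L2_norm \<Omega> (\<lambda>x. (T t u x - u x) / t - w x) = norm ((1/t) *\<^sub>R (sg t (l2_of \<Omega> u) - l2_of \<Omega> u) - l2_of \<Omega> w)" if t: "t > 0" for t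
    proof -
      have d: "(\<lambda>x. T t u x - u x) \<in> L2 \<Omega>" by (rule L2_diff[OF TL u])
      have "(\<lambda>x. (T t u x - u x) / t - w x) = (\<lambda>x. (1/t) * (T t u x - u x) - w x)" by simp
      then show ?thesis
        using norm_l2_of[OF meas L2_diff[OF L2_scale[OF d] w], of "1/t"] l2_of_diff[OF meas L2_scale[OF d] w, of "1/t"]
          l2_of_scale[OF meas d, of "1/t"] l2_of_diff[OF meas TL u, of t u] lT[OF u, of t] t by simp
    qed
    have ev: "\<forall>\<^sub>F t in at_right 0. L2_norm \<Omega> (\<lambda>x. (T t u x - u x) / t - w x) = norm ((1/t) *\<^sub>R (sg t (l2_of \<Omega> u) - l2_of \<Omega> u) - l2_of \<Omega> w)"
      unfolding eventually_at_right_field using e by (intro exI[of _ 1]) simp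
    have "(u, w) \<in> generator \<Omega> T \<longleftrightarrow> ((\<lambda>t. L2_norm \<Omega> (\<lambda>x. (T t u x - u x) / t - w x)) \<longlongrightarrow> 0) (at_right 0)"
      unfolding generator_def using u w by simp
    also have "\<dots> \<longleftrightarrow> ((\<lambda>t. norm ((1/t) *\<^sub>R (sg t (l2_of \<Omega> u) - l2_of \<Omega> u) - l2_of \<Omega> w)) \<longlongrightarrow> 0) (at_right 0)"
      by (rule tendsto_cong[OF ev])
    also have "\<dots> \<longleftrightarrow> ((\<lambda>t. (1/t) *\<^sub>R (sg t (l2_of \<Omega> u) - l2_of \<Omega> u)) \<longlongrightarrow> l2_of \<Omega> w) (at_right 0)"
      unfolding tendsto_norm_zero_iff LIM_zero_iff ..
    also have "\<dots> \<longleftrightarrow> (u, w) \<in> Op" unfolding sg_generator[OF lH[OF u] lH[OF w]] by (rule graph_iff[OF u w])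
    finally show ?thesis .
  next
    case False
    then show ?thesis using Op_L2[of u w] unfolding generator_def by auto
  qed
  then have "generator \<Omega> T = Op" by auto
  then show ?thesis using C by blast
qed

text \<open>Stated for every semigroup with the given generator, as the one chosen by
  \<open>semigroup_exp\<close> is not known to come from \<open>sg\<close>. The semigroup is carried
  over to classes, where \<open>generated_semigroup\<close> applies.\<close>

lemma C0_semigroup_euler:
  assumes C: "C0_semigroup \<Omega> T" and gen: "generator \<Omega> T = Op" and f: "f \<in> L2 \<Omega>" and t: "t \<ge> 0"
  shows "(\<lambda>k. euler k t (l2_of \<Omega> f)) \<longlonglongrightarrow> l2_of \<Omega> (T t f)"
proof -
  have bo: "bounded_operator \<Omega> (T t)" if "t \<ge> 0" for t using C that unfolding C0_semigroup_def by blast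
  have TL: "T t f \<in> L2 \<Omega>" if "t \<ge> 0" "f \<in> L2 \<Omega>" for t f
    using bo[OF that(1)] that(2) unfolding bounded_operator_def by blast
  have Tlin: "AE x in lebesgue_on \<Omega>. T t (\<lambda>y. c * f y + g y) x = c * T t f x + T t g x"
    if "t \<ge> 0" "f \<in> L2 \<Omega>" "g \<in> L2 \<Omega>" for t c f g
    using bo[OF that(1)] that(2,3) unfolding bounded_operator_def by blast
  have llin: "l2_of \<Omega> (T t (\<lambda>y. c * f y + g y)) = c *\<^sub>R l2_of \<Omega> (T t f) + l2_of \<Omega> (T t g)"
    if "t \<ge> 0" "f \<in> L2 \<Omega>" "g \<in> L2 \<Omega>" for t c f g
    unfolding l2_of_lin[OF meas TL[OF that(1,2)] TL[OF that(1,3)], symmetric]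
    by (rule l2_of_eq_iff[OF meas TL[OF that(1) L2_lin[OF that(2,3)]] L2_lin[OF TL[OF that(1,2)] TL[OF that(1,3)]], THEN iffD2, OF Tlin[OF that]])
  have Tb: "\<exists>C. \<forall>f\<in>L2 \<Omega>. norm (l2_of \<Omega> (T t f)) \<le> C * norm (l2_of \<Omega> f)" if t: "t \<ge> 0" for t
  proof -
    obtain B where B: "\<forall>f\<in>L2 \<Omega>. L2_norm \<Omega> (T t f) \<le> B * L2_norm \<Omega> f"
      using bo[OF t] unfolding bounded_operator_def by blast
    have "norm (l2_of \<Omega> (T t f)) \<le> B * norm (l2_of \<Omega> f)" if f: "f \<in> L2 \<Omega>" for f
      unfolding norm_l2_of[OF meas f] norm_l2_of[OF meas TL[OF t f]] using B f by blast
    then show ?thesis by blast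
  qed
  \<comment> \<open>Linearity up to null sets and boundedness suffice: for \<open>f\<close> and
    \<open>g\<close> in the same class the image of \<open>g - f\<close> has norm at most
    \<open>B * 0\<close>.\<close>
  have Tcong: "l2_of \<Omega> (T t f) = l2_of \<Omega> (T t g)" if h: "t \<ge> 0" "f \<in> L2 \<Omega>" "g \<in> L2 \<Omega>" "l2_of \<Omega> f = l2_of \<Omega> g" for t f g
  proof -
    obtain B where B: "\<forall>f\<in>L2 \<Omega>. norm (l2_of \<Omega> (T t f)) \<le> B * norm (l2_of \<Omega> f)" using Tb[OF h(1)] by blast
    have "norm (l2_of \<Omega> (T t (\<lambda>y. (-1) * f y + g y))) \<le> B * norm (l2_of \<Omega> (\<lambda>y. (-1) * f y + g y))"
      by (rule bspec[OF B L2_lin[OF h(2,3)]])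
    then show ?thesis unfolding llin[OF h(1,2,3)] l2_of_lin[OF meas h(2,3)] using h(4) by simp
  qed
  define S where "S t F = l2_of \<Omega> (T t (rep_l2 F))" for t F
  have SL: "S t (l2_of \<Omega> f) = l2_of \<Omega> (T t f)" if "t \<ge> 0" "f \<in> L2 \<Omega>" for t f
    unfolding S_def
    by (rule Tcong[OF that(1) rep_l2_in[OF meas] that(2)], rule l2_of_rep[OF meas]) (use that in blast)
  interpret G: generated_semigroup "l2_of \<Omega> ` L2 \<Omega>" graph S
  proof unfold_locales
    fix t :: real and F assume t: "t \<ge> 0" and F: "F \<in> l2_of \<Omega> ` L2 \<Omega>"
    obtain f where f: "f \<in> L2 \<Omega>" "F = l2_of \<Omega> f" using F by blast
    show "S t F \<in> l2_of \<Omega> ` L2 \<Omega>" unfolding f(2) SL[OF t f(1)] using TL[OF t f(1)] by blast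
    fix c G assume G: "G \<in> l2_of \<Omega> ` L2 \<Omega>"
    obtain g where g: "g \<in> L2 \<Omega>" "G = l2_of \<Omega> g" using G by blast
    show "S t (c *\<^sub>R F + G) = c *\<^sub>R S t F + S t G"
      unfolding f(2) g(2) l2_of_lin[OF meas f(1) g(1), symmetric] SL[OF t L2_lin[OF f(1) g(1)]] SL[OF t f(1)] SL[OF t g(1)]
      by (rule llin[OF t f(1) g(1)])
  next
    fix t :: real assume t: "t \<ge> 0"
    obtain B where "\<forall>f\<in>L2 \<Omega>. norm (l2_of \<Omega> (T t f)) \<le> B * norm (l2_of \<Omega> f)" using Tb[OF t] by blast
    then show "\<exists>C. \<forall>F\<in>l2_of \<Omega> ` L2 \<Omega>. norm (S t F) \<le> C * norm F" using SL[OF t] by (intro exI[of _ B]) auto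
  next
    fix F assume F: "F \<in> l2_of \<Omega> ` L2 \<Omega>"
    obtain f where f: "f \<in> L2 \<Omega>" "F = l2_of \<Omega> f" using F by blast
    have "AE x in lebesgue_on \<Omega>. T 0 f x = f x" using C f(1) unfolding C0_semigroup_def by blast
    then have "l2_of \<Omega> (T 0 f) = l2_of \<Omega> f" using l2_of_eq_iff[OF meas TL[OF order_refl f(1)] f(1)] by simp
    then show "S 0 F = F" using SL[OF order_refl f(1)] f(2) by simp
    have "((\<lambda>t. L2_norm \<Omega> (\<lambda>x. T t f x - f x)) \<longlongrightarrow> 0) (at_right 0)" using C f(1) unfolding C0_semigroup_def by blast
    moreover have "\<forall>\<^sub>F t in at_right 0. L2_norm \<Omega> (\<lambda>x. T t f x - f x) = norm (S t F - F)"
    proof -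
      have "L2_norm \<Omega> (\<lambda>x. T t f x - f x) = norm (S t F - F)" if "t > 0" for t
        using norm_l2_of[OF meas L2_diff[OF TL f(1)], of t f] l2_of_diff[OF meas TL f(1), of t f] SL[of t f] f that by simp
      then show ?thesis unfolding eventually_at_right_field by (intro exI[of _ 1]) simp
    qed
    ultimately have "((\<lambda>t. norm (S t F - F)) \<longlongrightarrow> 0) (at_right 0)" by (rule Lim_transform_eventually)
    then show "((\<lambda>t. S t F) \<longlongrightarrow> F) (at_right 0)" unfolding tendsto_norm_zero_iff LIM_zero_iff .
  next
    fix s t :: real and F assume s: "s \<ge> 0" and t: "t \<ge> 0" and F: "F \<in> l2_of \<Omega> ` L2 \<Omega>"
    obtain f where f: "f \<in> L2 \<Omega>" "F = l2_of \<Omega> f" using F by blast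
    have st: "s + t \<ge> 0" using s t by simp
    have "AE x in lebesgue_on \<Omega>. T (s + t) f x = T s (T t f) x" using C s t f(1) unfolding C0_semigroup_def by blast
    then have "l2_of \<Omega> (T (s + t) f) = l2_of \<Omega> (T s (T t f))" using l2_of_eq_iff[OF meas TL[OF st f(1)] TL[OF s TL[OF t f(1)]]] by simp
    then show "S (s + t) F = S s (S t F)" unfolding f(2) SL[OF st f(1)] SL[OF t f(1)] SL[OF s TL[OF t f(1)]] .
  next
    fix U W assume U: "U \<in> l2_of \<Omega> ` L2 \<Omega>" and W: "W \<in> l2_of \<Omega> ` L2 \<Omega>"
    obtain u where u: "u \<in> L2 \<Omega>" "U = l2_of \<Omega> u" using U by blast
    obtain w where w: "w \<in> L2 \<Omega>" "W = l2_of \<Omega> w" using W by blast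
    have e: "norm ((1/t) *\<^sub>R (S t U - U) - W) = L2_norm \<Omega> (\<lambda>x. (T t u x - u x) / t - w x)" if t: "t > 0" for t
    proof -
      have t0: "t \<ge> 0" using t by simp
      have d: "(\<lambda>x. T t u x - u x) \<in> L2 \<Omega>" by (rule L2_diff[OF TL[OF t0 u(1)] u(1)])
      have "(\<lambda>x. (T t u x - u x) / t - w x) = (\<lambda>x. (1/t) * (T t u x - u x) - w x)" by simp
      then show ?thesis
        using norm_l2_of[OF meas L2_diff[OF L2_scale[OF d] w(1)], of "1/t"] l2_of_diff[OF meas L2_scale[OF d] w(1), of "1/t"]
          l2_of_scale[OF meas d, of "1/t"] l2_of_diff[OF meas TL[OF t0 u(1)] u(1)] SL[OF t0 u(1)] u(2) w(2) by simp
    qed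
    have ev: "\<forall>\<^sub>F t in at_right 0. norm ((1/t) *\<^sub>R (S t U - U) - W) = L2_norm \<Omega> (\<lambda>x. (T t u x - u x) / t - w x)"
      unfolding eventually_at_right_field using e by (intro exI[of _ 1]) simp
    have "((\<lambda>t. (1/t) *\<^sub>R (S t U - U)) \<longlongrightarrow> W) (at_right 0) \<longleftrightarrow> ((\<lambda>t. norm ((1/t) *\<^sub>R (S t U - U) - W)) \<longlongrightarrow> 0) (at_right 0)"
      unfolding tendsto_norm_zero_iff LIM_zero_iff ..
    also have "\<dots> \<longleftrightarrow> ((\<lambda>t. L2_norm \<Omega> (\<lambda>x. (T t u x - u x) / t - w x)) \<longlongrightarrow> 0) (at_right 0)"
      by (rule tendsto_cong[OF ev])
    also have "\<dots> \<longleftrightarrow> (u, w) \<in> generator \<Omega> T" unfolding generator_def using u(1) w(1) by simp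
    also have "\<dots> \<longleftrightarrow> (U, W) \<in> graph" unfolding gen u(2) w(2) by (rule graph_iff[OF u(1) w(1), symmetric])
    finally show "((\<lambda>t. (1/t) *\<^sub>R (S t U - U)) \<longlongrightarrow> W) (at_right 0) \<longleftrightarrow> (U, W) \<in> graph" .
  qed
  have "(\<lambda>k. euler k t (l2_of \<Omega> f)) \<longlonglongrightarrow> S t (l2_of \<Omega> f)" by (rule G.euler_tendsto) (use f t in auto)
  then show ?thesis unfolding SL[OF t f] .
qed

lemma resolvent: assumes f: "f \<in> L2 \<Omega>" and s: "s > 0"
  obtains u w where "(u, w) \<in> Op" "\<And>x. u x - s * w x = f x" "J s (l2_of \<Omega> f) = l2_of \<Omega> u"
proof -
  obtain u w where uw: "(u, w) \<in> Op" "\<And>x. u x - s * w x = f x" using Op_range[OF f s] by blast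
  note uL = Op_L2[OF uw(1)]
  have "(l2_of \<Omega> u, l2_of \<Omega> w) \<in> graph" using graph_iff[OF uL] uw(1) by simp
  moreover have "l2_of \<Omega> u - s *\<^sub>R l2_of \<Omega> w = l2_of \<Omega> f"
  proof -
    have "(\<lambda>x. (- s) * w x + u x) = f" using uw(2) by (auto simp: fun_eq_iff algebra_simps)
    then show ?thesis using l2_of_lin[OF meas uL(2,1), of "-s"] by simp
  qed
  ultimately have "J s (l2_of \<Omega> f) = l2_of \<Omega> u" by (rule J_eqI[OF _ s])
  then show thesis by (rule that[OF uw])
qed

end

text \<open>Testing with the negative part \<open>m\<close> of \<open>g\<close> gives
  \<open>0 \<le> (g, m) = - (m, m)\<close>, so \<open>m\<close> vanishes almost everywhere.\<close>

lemma L2_lim_nonneg: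
  assumes meas: "\<Omega> \<in> sets lebesgue" and h: "\<And>n. h n \<in> L2 \<Omega>" "g \<in> L2 \<Omega>" and lim: "(\<lambda>n. l2_of \<Omega> (h n)) \<longlonglongrightarrow> l2_of \<Omega> g"
    and nn: "\<And>n. AE x in lebesgue_on \<Omega>. 0 \<le> h n x"
  shows "AE x in lebesgue_on \<Omega>. 0 \<le> g x"
proof -
  define m where "m x = max 0 (- g x)" for x
  have mm: "m \<in> borel_measurable (lebesgue_on \<Omega>)" unfolding m_def[abs_def]
    by (intro borel_measurable_max borel_measurable_const borel_measurable_uminus L2_measurable[OF h(2)])
  have "integrable (lebesgue_on \<Omega>) (\<lambda>x. (m x)\<^sup>2)"
  proof (rule Bochner_Integration.integrable_bound[OF L2_square_integrable[OF h(2)] borel_measurable_power[OF mm]])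
    show "AE x in lebesgue_on \<Omega>. norm ((m x)\<^sup>2) \<le> norm ((g x)\<^sup>2)" unfolding m_def by (rule AE_I2) (auto simp: max_def)
  qed
  then have m: "m \<in> L2 \<Omega>" using mm by (simp add: L2_def)
  have "(\<lambda>n. l2_of \<Omega> (h n) \<bullet> l2_of \<Omega> m) \<longlonglongrightarrow> l2_of \<Omega> g \<bullet> l2_of \<Omega> m" by (intro tendsto_intros lim)
  then have "(\<lambda>n. L2_inner \<Omega> (h n) m) \<longlonglongrightarrow> L2_inner \<Omega> g m"
    unfolding inner_l2_of[OF meas h(1) m] inner_l2_of[OF meas h(2) m] .
  moreover have "0 \<le> L2_inner \<Omega> (h n) m" for n
    unfolding L2_inner_def
  proof (rule integral_nonneg_AE)
    show "AE x in lebesgue_on \<Omega>. 0 \<le> h n x * m x" using nn[of n] by eventually_elim (simp add: m_def)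
  qed
  ultimately have "0 \<le> L2_inner \<Omega> g m" by (intro LIMSEQ_le_const) auto
  also have "L2_inner \<Omega> g m = - L2_inner \<Omega> m m"
  proof -
    have "(\<lambda>x. g x * m x) = (\<lambda>x. - (m x * m x))" unfolding m_def by (auto simp: max_def)
    then show ?thesis unfolding L2_inner_def by simp
  qed
  finally have "L2_inner \<Omega> m m = 0" using L2_inner_ge_0[of \<Omega> m] by simp
  then have "AE x in lebesgue_on \<Omega>. m x = 0" using L2_inner_eq_0[OF m] by simp
  then show ?thesis by eventually_elim (auto simp: m_def max_def split: if_splits)
qed

section \<open>The Dirichlet Laplacian as the operator of a form on test functions\<close>

context bounded_domain
begin

sublocale H1: semi_inner_space "H1 \<Omega>" "dirichlet_form \<Omega>" by (rule semi_inner_space_H1)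

text \<open>The domain is the set of test functions and not \<open>H10 \<Omega>\<close>, so that
  both Laplacians become instances of \<open>closure_operator\<close>.\<close>

lemma L2_form_dirichlet: "L2_form (test_functions \<Omega>) (dirichlet_form \<Omega>) \<Omega>"
proof unfold_locales
  show "test_functions \<Omega> \<subseteq> L2 \<Omega>" using test_L2 by blast
  show "\<exists>g\<in>test_functions \<Omega>. L2_norm \<Omega> (\<lambda>x. f x - g x) < e" if "f \<in> L2 \<Omega>" "e > 0" for f e by (rule test_dense[OF that])
  show "dirichlet_form \<Omega> (\<lambda>x. c * f x + g x) h = c * dirichlet_form \<Omega> f h + dirichlet_form \<Omega> g h"
    if "f \<in> test_functions \<Omega>" "g \<in> test_functions \<Omega>" "h \<in> test_functions \<Omega>" for c f g h
    by (rule H1.lin_left[OF that[THEN test_H1]])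
  show "dirichlet_form \<Omega> f g = dirichlet_form \<Omega> g f" if "f \<in> test_functions \<Omega>" "g \<in> test_functions \<Omega>" for f g
    by (rule H1.sym[OF that[THEN test_H1]])
  show "0 \<le> dirichlet_form \<Omega> f f" if "f \<in> test_functions \<Omega>" for f by (rule H1.nonneg[OF test_H1[OF that]])
qed (auto intro: test_functions_zero test_functions_lin meas)

lemma dirichlet_diff:
  assumes u: "u \<in> H1 \<Omega>" "weak_gradient \<Omega> u g" and v: "v \<in> H1 \<Omega>" "weak_gradient \<Omega> v h"
  shows "dirichlet_form \<Omega> (\<lambda>x. u x - v x) (\<lambda>x. u x - v x) = (\<Sum>b\<in>Basis. (norm (l2_of \<Omega> (\<lambda>x. g x \<bullet> b) - l2_of \<Omega> (\<lambda>x. h x \<bullet> b)))\<^sup>2)"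
proof -
  have e: "dirichlet_form \<Omega> p q = (\<Sum>b\<in>Basis. l2_of \<Omega> (\<lambda>x. g' x \<bullet> b) \<bullet> l2_of \<Omega> (\<lambda>x. h' x \<bullet> b))"
    if "weak_gradient \<Omega> p g'" "weak_gradient \<Omega> q h'" for p q g' h'
    unfolding dirichlet_eq[OF that] inner_l2_of[OF meas weak_gradient_L2[OF that(1)] weak_gradient_L2[OF that(2)]] ..
  show ?thesis
    unfolding H1.square_diff[OF u(1) v(1)] e[OF u(2) u(2)] e[OF u(2) v(2)] e[OF v(2) v(2)]
    by (simp add: power2_norm_eq_inner inner_diff inner_commute sum.distrib sum_subtractf sum_distrib_left algebra_simps)
qed

lemma dirichlet_tendsto:
  assumes us: "\<And>n. us n \<in> H1 \<Omega>" "u \<in> H1 \<Omega>" "(\<lambda>n. dirichlet_form \<Omega> (\<lambda>x. us n x - u x) (\<lambda>x. us n x - u x)) \<longlonglongrightarrow> 0"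
    and vs: "\<And>n. vs n \<in> H1 \<Omega>" "v \<in> H1 \<Omega>" "(\<lambda>n. dirichlet_form \<Omega> (\<lambda>x. vs n x - v x) (\<lambda>x. vs n x - v x)) \<longlonglongrightarrow> 0"
  shows "(\<lambda>n. dirichlet_form \<Omega> (us n) (vs n)) \<longlonglongrightarrow> dirichlet_form \<Omega> u v"
proof -
  have comp: "(\<lambda>n. l2_of \<Omega> (\<lambda>x. grad \<Omega> (ws n) x \<bullet> b)) \<longlonglongrightarrow> l2_of \<Omega> (\<lambda>x. grad \<Omega> w x \<bullet> b)"
    if ws: "\<And>n. ws n \<in> H1 \<Omega>" "w \<in> H1 \<Omega>" "(\<lambda>n. dirichlet_form \<Omega> (\<lambda>x. ws n x - w x) (\<lambda>x. ws n x - w x)) \<longlonglongrightarrow> 0"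
      and b: "b \<in> Basis" for ws w b
  proof -
    have le: "(norm (l2_of \<Omega> (\<lambda>x. grad \<Omega> (ws n) x \<bullet> b) - l2_of \<Omega> (\<lambda>x. grad \<Omega> w x \<bullet> b)))\<^sup>2
      \<le> dirichlet_form \<Omega> (\<lambda>x. ws n x - w x) (\<lambda>x. ws n x - w x)" for n
      unfolding dirichlet_diff[OF ws(1) H1D(2)[OF ws(1)] ws(2) H1D(2)[OF ws(2)]]
      using b by (intro member_le_sum[of b Basis "\<lambda>b. (norm (l2_of \<Omega> (\<lambda>x. grad \<Omega> (ws n) x \<bullet> b) - l2_of \<Omega> (\<lambda>x. grad \<Omega> w x \<bullet> b)))\<^sup>2"]) auto
    have "(\<lambda>n. (norm (l2_of \<Omega> (\<lambda>x. grad \<Omega> (ws n) x \<bullet> b) - l2_of \<Omega> (\<lambda>x. grad \<Omega> w x \<bullet> b)))\<^sup>2) \<longlonglongrightarrow> 0"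
      by (rule tendsto_sandwich[OF _ _ tendsto_const ws(3)]) (use le in auto)
    then have "(\<lambda>n. sqrt ((norm (l2_of \<Omega> (\<lambda>x. grad \<Omega> (ws n) x \<bullet> b) - l2_of \<Omega> (\<lambda>x. grad \<Omega> w x \<bullet> b)))\<^sup>2)) \<longlonglongrightarrow> sqrt 0"
      by (rule tendsto_real_sqrt)
    then show ?thesis by (simp add: tendsto_norm_zero_iff LIM_zero_iff)
  qed
  have e: "dirichlet_form \<Omega> p q = (\<Sum>b\<in>Basis. l2_of \<Omega> (\<lambda>x. grad \<Omega> p x \<bullet> b) \<bullet> l2_of \<Omega> (\<lambda>x. grad \<Omega> q x \<bullet> b))"
    if "p \<in> H1 \<Omega>" "q \<in> H1 \<Omega>" for p q
    unfolding dirichlet_eq[OF that[THEN H1D(2)]]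
      inner_l2_of[OF meas weak_gradient_L2[OF H1D(2)[OF that(1)]] weak_gradient_L2[OF H1D(2)[OF that(2)]]] ..
  show ?thesis unfolding e[OF us(1) vs(1)] e[OF us(2) vs(2)]
    by (intro tendsto_sum tendsto_inner comp us vs)
qed

text \<open>Membership of the limit in \<open>H1 \<Omega>\<close> is the point: the partial
  derivatives of a sequence that is Cauchy for the form converge in \<open>L\<^sup>2\<close>, and
  the defining identity of the weak gradient passes to the limit, so these limits are the weak
  derivatives of \<open>u\<close>.\<close>

lemma closure_seq_test_iff:
  "closure_seq \<Omega> (test_functions \<Omega>) (dirichlet_form \<Omega>) us u \<longleftrightarrow>
    u \<in> H1 \<Omega> \<and> (\<forall>n. us n \<in> test_functions \<Omega>) \<and> (\<lambda>n. H1_norm \<Omega> (\<lambda>x. us n x - u x)) \<longlonglongrightarrow> 0"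
proof
  interpret L2_form "test_functions \<Omega>" "dirichlet_form \<Omega>" \<Omega> by (rule L2_form_dirichlet)
  assume cs: "closure_seq \<Omega> (test_functions \<Omega>) (dirichlet_form \<Omega>) us u"
  note uD = closure_seqD[OF cs]
  have usH: "us n \<in> H1 \<Omega>" for n by (rule test_H1[OF uD(2)])
  have "\<exists>G\<in>L2 \<Omega>. (\<lambda>n. l2_of \<Omega> (\<lambda>x. grad \<Omega> (us n) x \<bullet> b)) \<longlonglongrightarrow> l2_of \<Omega> G" if b: "b \<in> Basis" for b
  proof -
    have gL: "(\<lambda>x. grad \<Omega> (us n) x \<bullet> b) \<in> L2 \<Omega>" for n by (rule weak_gradient_L2[OF H1D(2)[OF usH]])
    have C: "Cauchy (\<lambda>n. l2_of \<Omega> (\<lambda>x. grad \<Omega> (us n) x \<bullet> b))"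
    proof (rule metric_CauchyI)
      fix e :: real assume e: "e > 0"
      then obtain M where M: "\<And>m n. m \<ge> M \<Longrightarrow> n \<ge> M \<Longrightarrow> dirichlet_form \<Omega> (\<lambda>x. us m x - us n x) (\<lambda>x. us m x - us n x) < e\<^sup>2"
        using cs unfolding closure_seq_def by (metis zero_less_power)
      have "dist (l2_of \<Omega> (\<lambda>x. grad \<Omega> (us m) x \<bullet> b)) (l2_of \<Omega> (\<lambda>x. grad \<Omega> (us n) x \<bullet> b)) < e" if "m \<ge> M" "n \<ge> M" for m n
      proof -
        have "(norm (l2_of \<Omega> (\<lambda>x. grad \<Omega> (us m) x \<bullet> b) - l2_of \<Omega> (\<lambda>x. grad \<Omega> (us n) x \<bullet> b)))\<^sup>2
          \<le> dirichlet_form \<Omega> (\<lambda>x. us m x - us n x) (\<lambda>x. us m x - us n x)"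
          unfolding dirichlet_diff[OF usH H1D(2)[OF usH] usH H1D(2)[OF usH]]
          using b by (intro member_le_sum[of b Basis "\<lambda>b. (norm (l2_of \<Omega> (\<lambda>x. grad \<Omega> (us m) x \<bullet> b) - l2_of \<Omega> (\<lambda>x. grad \<Omega> (us n) x \<bullet> b)))\<^sup>2"]) auto
        also have "\<dots> < e\<^sup>2" by (rule M[OF that])
        finally show ?thesis unfolding dist_norm by (rule power_less_imp_less_base) (use e in simp)
      qed
      then show "\<exists>M. \<forall>m\<ge>M. \<forall>n\<ge>M. dist (l2_of \<Omega> (\<lambda>x. grad \<Omega> (us m) x \<bullet> b)) (l2_of \<Omega> (\<lambda>x. grad \<Omega> (us n) x \<bullet> b)) < e" by blast
    qed
    have "\<forall>n. l2_of \<Omega> (\<lambda>x. grad \<Omega> (us n) x \<bullet> b) \<in> l2_of \<Omega> ` L2 \<Omega>" using gL by blast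
    then obtain L where "L \<in> l2_of \<Omega> ` L2 \<Omega>" "(\<lambda>n. l2_of \<Omega> (\<lambda>x. grad \<Omega> (us n) x \<bullet> b)) \<longlonglongrightarrow> L"
      by (rule completeE[OF complete_l2_of[OF meas] _ C])
    then show ?thesis by auto
  qed
  then obtain G where G: "\<And>b. b \<in> Basis \<Longrightarrow> G b \<in> L2 \<Omega>"
    "\<And>b. b \<in> Basis \<Longrightarrow> (\<lambda>n. l2_of \<Omega> (\<lambda>x. grad \<Omega> (us n) x \<bullet> b)) \<longlonglongrightarrow> l2_of \<Omega> (G b)" by metis
  have wg: "weak_gradient \<Omega> u (\<lambda>x. \<Sum>b\<in>Basis. G b x *\<^sub>R b)"
  proof (rule weak_gradientI[OF G(1)])
    fix \<phi> b assume p: "\<phi> \<in> test_functions \<Omega>" and b: "b \<in> (Basis :: 'a set)"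
    note dL = test_L2[OF test_derivative[OF p b]]
    have "(\<lambda>n. l2_of \<Omega> (us n) \<bullet> l2_of \<Omega> (\<lambda>x. frechet_derivative \<phi> (at x) b)) \<longlonglongrightarrow> l2_of \<Omega> u \<bullet> l2_of \<Omega> (\<lambda>x. frechet_derivative \<phi> (at x) b)"
      by (intro tendsto_intros uD(4))
    then have 1: "(\<lambda>n. - L2_inner \<Omega> (\<lambda>x. grad \<Omega> (us n) x \<bullet> b) \<phi>) \<longlonglongrightarrow> L2_inner \<Omega> u (\<lambda>x. frechet_derivative \<phi> (at x) b)"
      unfolding inner_l2_of[OF meas uD(3) dL] inner_l2_of[OF meas uD(1) dL] weak_gradientD[OF H1D(2)[OF usH] p b] .
    have "(\<lambda>n. - (l2_of \<Omega> (\<lambda>x. grad \<Omega> (us n) x \<bullet> b) \<bullet> l2_of \<Omega> \<phi>)) \<longlonglongrightarrow> - (l2_of \<Omega> (G b) \<bullet> l2_of \<Omega> \<phi>)"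
      by (intro tendsto_intros G(2)[OF b])
    then have 2: "(\<lambda>n. - L2_inner \<Omega> (\<lambda>x. grad \<Omega> (us n) x \<bullet> b) \<phi>) \<longlonglongrightarrow> - L2_inner \<Omega> (G b) \<phi>"
      unfolding inner_l2_of[OF meas weak_gradient_L2[OF H1D(2)[OF usH]] test_L2[OF p]] inner_l2_of[OF meas G(1)[OF b] test_L2[OF p]] .
    show "L2_inner \<Omega> u (\<lambda>x. frechet_derivative \<phi> (at x) b) = - L2_inner \<Omega> (G b) \<phi>" by (rule LIMSEQ_unique[OF 1 2])
  qed
  have uH: "u \<in> H1 \<Omega>" unfolding H1_def using uD(1) wg by blast
  have "(\<lambda>n. \<Sum>b\<in>Basis. (norm (l2_of \<Omega> (\<lambda>x. grad \<Omega> (us n) x \<bullet> b) - l2_of \<Omega> (G b)))\<^sup>2) \<longlonglongrightarrow> (\<Sum>b\<in>(Basis::'a set). (norm (l2_of \<Omega> (G b) - l2_of \<Omega> (G b)))\<^sup>2)"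
    by (intro tendsto_intros G(2))
  moreover have "dirichlet_form \<Omega> (\<lambda>x. us n x - u x) (\<lambda>x. us n x - u x) = (\<Sum>b\<in>Basis. (norm (l2_of \<Omega> (\<lambda>x. grad \<Omega> (us n) x \<bullet> b) - l2_of \<Omega> (G b)))\<^sup>2)" for n
    unfolding dirichlet_diff[OF usH H1D(2)[OF usH] uH wg] by (intro sum.cong) simp_all
  ultimately have d0: "(\<lambda>n. dirichlet_form \<Omega> (\<lambda>x. us n x - u x) (\<lambda>x. us n x - u x)) \<longlonglongrightarrow> 0" by simp
  have "(\<lambda>n. (L2_norm \<Omega> (\<lambda>x. us n x - u x))\<^sup>2) \<longlonglongrightarrow> 0\<^sup>2" using cs unfolding closure_seq_def by (intro tendsto_intros) auto
  then have "(\<lambda>n. L2_inner \<Omega> (\<lambda>x. us n x - u x) (\<lambda>x. us n x - u x)) \<longlonglongrightarrow> 0" by (simp add: L2_norm_def L2_inner_ge_0)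
  then have "(\<lambda>n. sqrt (L2_inner \<Omega> (\<lambda>x. us n x - u x) (\<lambda>x. us n x - u x) + dirichlet_form \<Omega> (\<lambda>x. us n x - u x) (\<lambda>x. us n x - u x))) \<longlonglongrightarrow> sqrt (0 + 0)"
    by (intro tendsto_intros d0)
  then have "(\<lambda>n. H1_norm \<Omega> (\<lambda>x. us n x - u x)) \<longlonglongrightarrow> 0" unfolding H1_norm_def by simp
  then show "u \<in> H1 \<Omega> \<and> (\<forall>n. us n \<in> test_functions \<Omega>) \<and> (\<lambda>n. H1_norm \<Omega> (\<lambda>x. us n x - u x)) \<longlonglongrightarrow> 0" using uH uD(2) by blast
next
  assume A: "u \<in> H1 \<Omega> \<and> (\<forall>n. us n \<in> test_functions \<Omega>) \<and> (\<lambda>n. H1_norm \<Omega> (\<lambda>x. us n x - u x)) \<longlonglongrightarrow> 0"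
  then have u: "u \<in> H1 \<Omega>" and us: "\<And>n. us n \<in> test_functions \<Omega>" and lim: "(\<lambda>n. H1_norm \<Omega> (\<lambda>x. us n x - u x)) \<longlonglongrightarrow> 0" by auto
  have usH: "us n \<in> H1 \<Omega>" for n by (rule test_H1[OF us])
  define d where "d n = dirichlet_form \<Omega> (\<lambda>x. us n x - u x) (\<lambda>x. us n x - u x)" for n
  have dn: "0 \<le> d n" for n unfolding d_def by (rule H1.nonneg[OF H1.D_diff[OF usH u]])
  have h: "(\<lambda>n. (H1_norm \<Omega> (\<lambda>x. us n x - u x))\<^sup>2) \<longlonglongrightarrow> 0\<^sup>2" by (intro tendsto_intros lim)
  have sq: "(H1_norm \<Omega> (\<lambda>x. us n x - u x))\<^sup>2 = L2_inner \<Omega> (\<lambda>x. us n x - u x) (\<lambda>x. us n x - u x) + d n" for n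
    unfolding H1_norm_def d_def[symmetric] using L2_inner_ge_0[of \<Omega> "\<lambda>x. us n x - u x"] dn[of n] by simp
  have h': "(\<lambda>n. L2_inner \<Omega> (\<lambda>x. us n x - u x) (\<lambda>x. us n x - u x) + d n) \<longlonglongrightarrow> 0" using h unfolding sq by simp
  have L0: "0 \<le> L2_inner \<Omega> (\<lambda>x. us n x - u x) (\<lambda>x. us n x - u x)" for n by (rule L2_inner_ge_0)
  have d0: "d \<longlonglongrightarrow> 0"
    by (rule tendsto_sandwich[OF _ _ tendsto_const h']; intro always_eventually allI; use dn L0 in simp)
  have "(\<lambda>n. L2_inner \<Omega> (\<lambda>x. us n x - u x) (\<lambda>x. us n x - u x)) \<longlonglongrightarrow> 0"
    by (rule tendsto_sandwich[OF _ _ tendsto_const h']; intro always_eventually allI; use dn L0 in simp)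
  then have "(\<lambda>n. sqrt (L2_inner \<Omega> (\<lambda>x. us n x - u x) (\<lambda>x. us n x - u x))) \<longlonglongrightarrow> sqrt 0" by (rule tendsto_real_sqrt)
  then have l0: "(\<lambda>n. L2_norm \<Omega> (\<lambda>x. us n x - u x)) \<longlonglongrightarrow> 0" unfolding L2_norm_def by simp
  have C: "\<exists>M. \<forall>m\<ge>M. \<forall>n\<ge>M. dirichlet_form \<Omega> (\<lambda>x. us m x - us n x) (\<lambda>x. us m x - us n x) < e" if e: "e > 0" for e
  proof -
    have e4: "0 < e / 4" using e by simp
    obtain M where M: "\<And>n. n \<ge> M \<Longrightarrow> d n < e / 4"
      using order_tendstoD(2)[OF d0 e4] unfolding eventually_sequentially by blast
    have "dirichlet_form \<Omega> (\<lambda>x. us m x - us n x) (\<lambda>x. us m x - us n x) < e" if "m \<ge> M" "n \<ge> M" for m n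
    proof -
      define p where "p k = (\<lambda>x. us k x - u x)" for k
      have p: "p k \<in> H1 \<Omega>" for k unfolding p_def by (rule H1.D_diff[OF usH u])
      have "(\<lambda>x. us m x - us n x) = (\<lambda>x. p m x - p n x)" unfolding p_def by auto
      then have "dirichlet_form \<Omega> (\<lambda>x. us m x - us n x) (\<lambda>x. us m x - us n x) = d m - 2 * dirichlet_form \<Omega> (p m) (p n) + d n"
        using H1.square_diff[OF p p, of m n] unfolding d_def p_def by simp
      also have "\<dots> \<le> 2 * d m + 2 * d n"
        using H1.square_add[OF p p, of m n] H1.nonneg[OF H1.D_add[OF p p], of m n] unfolding d_def p_def by linarith
      finally show ?thesis using M[OF that(1)] M[OF that(2)] by linarith
    qed
    then show ?thesis by blast
  qed
  show "closure_seq \<Omega> (test_functions \<Omega>) (dirichlet_form \<Omega>) us u"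
    unfolding closure_seq_def using H1D(1)[OF u] us l0 C by blast
qed

lemma closure_seq_dirichlet_tendsto:
  assumes "closure_seq \<Omega> (test_functions \<Omega>) (dirichlet_form \<Omega>) us u" "closure_seq \<Omega> (test_functions \<Omega>) (dirichlet_form \<Omega>) vs v"
  shows "(\<lambda>n. dirichlet_form \<Omega> (us n) (vs n)) \<longlonglongrightarrow> dirichlet_form \<Omega> u v"
proof -
  have d0: "(\<lambda>n. dirichlet_form \<Omega> (\<lambda>x. ws n x - w x) (\<lambda>x. ws n x - w x)) \<longlonglongrightarrow> 0" "w \<in> H1 \<Omega>" "\<And>n. ws n \<in> H1 \<Omega>"
    if cs: "closure_seq \<Omega> (test_functions \<Omega>) (dirichlet_form \<Omega>) ws w" for ws w
  proof -
    have w: "w \<in> H1 \<Omega>" and wsT: "\<And>n. ws n \<in> test_functions \<Omega>" and lim: "(\<lambda>n. H1_norm \<Omega> (\<lambda>x. ws n x - w x)) \<longlonglongrightarrow> 0"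
      using cs closure_seq_test_iff by auto
    show "w \<in> H1 \<Omega>" by (rule w)
    show ws: "ws n \<in> H1 \<Omega>" for n by (rule test_H1[OF wsT])
    have nn: "0 \<le> dirichlet_form \<Omega> (\<lambda>x. ws n x - w x) (\<lambda>x. ws n x - w x)" for n by (rule H1.nonneg[OF H1.D_diff[OF ws w]])
    have "(\<lambda>n. (H1_norm \<Omega> (\<lambda>x. ws n x - w x))\<^sup>2) \<longlonglongrightarrow> 0\<^sup>2" by (intro tendsto_intros lim)
    then have h: "(\<lambda>n. (H1_norm \<Omega> (\<lambda>x. ws n x - w x))\<^sup>2) \<longlonglongrightarrow> 0" by simp
    have le: "dirichlet_form \<Omega> (\<lambda>x. ws n x - w x) (\<lambda>x. ws n x - w x) \<le> (H1_norm \<Omega> (\<lambda>x. ws n x - w x))\<^sup>2" for n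
      unfolding H1_norm_def using nn[of n] L2_inner_ge_0[of \<Omega> "\<lambda>x. ws n x - w x"] by simp
    show "(\<lambda>n. dirichlet_form \<Omega> (\<lambda>x. ws n x - w x) (\<lambda>x. ws n x - w x)) \<longlonglongrightarrow> 0"
      by (rule tendsto_sandwich[OF _ _ tendsto_const h]) (use nn le in auto)
  qed
  show ?thesis by (rule dirichlet_tendsto[OF d0(3)[OF assms(1)] d0(2)[OF assms(1)] d0(1)[OF assms(1)] d0(3)[OF assms(2)] d0(2)[OF assms(2)] d0(1)[OF assms(2)]])
qed

lemma H10_iff: "u \<in> H10 \<Omega> \<longleftrightarrow> (\<exists>us. closure_seq \<Omega> (test_functions \<Omega>) (dirichlet_form \<Omega>) us u)"
  unfolding H10_def H1_closure_def closure_seq_test_iff by blast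

text \<open>\<open>closure_operator\<close> asks for limits along all approximating sequences. The
  Dirichlet form is continuous along them, so the limits are its values on
  \<open>H10 \<Omega>\<close>.\<close>

lemma dirichlet_laplacian_eq: "dirichlet_laplacian \<Omega> = closure_operator \<Omega> (test_functions \<Omega>) (dirichlet_form \<Omega>)"
proof -
  interpret L2_form "test_functions \<Omega>" "dirichlet_form \<Omega>" \<Omega> by (rule L2_form_dirichlet)
  have "(u, w) \<in> dirichlet_laplacian \<Omega> \<longleftrightarrow> (u, w) \<in> Op" for u w
  proof
    assume "(u, w) \<in> dirichlet_laplacian \<Omega>"
    then have u: "u \<in> H10 \<Omega>" and w: "w \<in> L2 \<Omega>" and eq: "\<And>\<phi>. \<phi> \<in> H10 \<Omega> \<Longrightarrow> dirichlet_form \<Omega> u \<phi> = - L2_inner \<Omega> w \<phi>"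
      unfolding dirichlet_laplacian_def by auto
    obtain us where us: "closure_seq \<Omega> (test_functions \<Omega>) (dirichlet_form \<Omega>) us u" using u H10_iff by blast
    show "(u, w) \<in> Op"
    proof (rule OpI[OF w us])
      fix p ps assume ps: "closure_seq \<Omega> (test_functions \<Omega>) (dirichlet_form \<Omega>) ps p"
      then have "p \<in> H10 \<Omega>" using H10_iff by blast
      then show "(\<lambda>n. dirichlet_form \<Omega> (us n) (ps n)) \<longlonglongrightarrow> - L2_inner \<Omega> w p"
        using closure_seq_dirichlet_tendsto[OF us ps] eq by simp
    qed
  next
    assume uw: "(u, w) \<in> Op"
    obtain us where us: "closure_seq \<Omega> (test_functions \<Omega>) (dirichlet_form \<Omega>) us u"
      "\<And>p ps. closure_seq \<Omega> (test_functions \<Omega>) (dirichlet_form \<Omega>) ps p \<Longrightarrow> (\<lambda>n. dirichlet_form \<Omega> (us n) (ps n)) \<longlonglongrightarrow> - L2_inner \<Omega> w p"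
      using uw unfolding closure_operator_def by auto
    have "u \<in> H10 \<Omega>" using us(1) H10_iff by blast
    moreover have "dirichlet_form \<Omega> u p = - L2_inner \<Omega> w p" if p: "p \<in> H10 \<Omega>" for p
    proof -
      obtain ps where ps: "closure_seq \<Omega> (test_functions \<Omega>) (dirichlet_form \<Omega>) ps p" using p H10_iff by blast
      show ?thesis by (rule LIMSEQ_unique[OF closure_seq_dirichlet_tendsto[OF us(1) ps] us(2)[OF ps]])
    qed
    ultimately show "(u, w) \<in> dirichlet_laplacian \<Omega>" unfolding dirichlet_laplacian_def using Op_L2[OF uw] by auto
  qed
  then show ?thesis by auto
qed

text \<open>A continuous function with compact support in \<Omega> is in general no test function.
  Mollification does not increase its Dirichlet form, and the remaining terms of the energy are
  continuous in \<open>L\<^sup>2\<close>, which accounts for the error \<eta>.\<close>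

lemma core_energy:
  assumes w: "continuous_on UNIV w" "w \<in> H1 \<Omega>" and K: "compact K" "K \<subseteq> \<Omega>" "\<And>x. x \<notin> K \<Longrightarrow> w x = 0"
    and f: "f \<in> L2 \<Omega>" and s: "s > 0" and n: "\<eta> > 0"
  shows "\<exists>\<phi>\<in>test_functions \<Omega>. energy \<Omega> (dirichlet_form \<Omega>) s f \<phi> \<le> energy \<Omega> (dirichlet_form \<Omega>) s f w + \<eta> \<and>
    norm (l2_of \<Omega> \<phi> - l2_of \<Omega> w) \<le> \<eta>"
proof -
  have "\<exists>\<phi>\<in>test_functions \<Omega>. dirichlet_form \<Omega> \<phi> \<phi> \<le> dirichlet_form \<Omega> w w \<and> (\<forall>x\<in>\<Omega>. \<bar>\<phi> x - w x\<bar> \<le> 1 / real (Suc k))" for k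
    by (rule test_approximation[OF w K]) simp_all
  then obtain p where p: "\<And>k. p k \<in> test_functions \<Omega>" "\<And>k. dirichlet_form \<Omega> (p k) (p k) \<le> dirichlet_form \<Omega> w w"
    "\<And>k x. x \<in> \<Omega> \<Longrightarrow> \<bar>p k x - w x\<bar> \<le> 1 / real (Suc k)" by metis
  have wL: "w \<in> L2 \<Omega>" by (rule continuous_L2[OF w(1)])
  have lim: "(\<lambda>k. l2_of \<Omega> (p k)) \<longlonglongrightarrow> l2_of \<Omega> w" by (rule l2_of_uniform_limit[OF test_L2[OF p(1)] wL p(3)])
  have "(\<lambda>k. s * dirichlet_form \<Omega> w w + l2_of \<Omega> (p k) \<bullet> l2_of \<Omega> (p k) - 2 * (l2_of \<Omega> f \<bullet> l2_of \<Omega> (p k)))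
    \<longlonglongrightarrow> s * dirichlet_form \<Omega> w w + l2_of \<Omega> w \<bullet> l2_of \<Omega> w - 2 * (l2_of \<Omega> f \<bullet> l2_of \<Omega> w)"
    by (intro tendsto_intros lim)
  then have L: "(\<lambda>k. s * dirichlet_form \<Omega> w w + L2_inner \<Omega> (p k) (p k) - 2 * L2_inner \<Omega> f (p k)) \<longlonglongrightarrow> energy \<Omega> (dirichlet_form \<Omega>) s f w"
    unfolding inner_l2_of[OF meas test_L2[OF p(1)] test_L2[OF p(1)]] inner_l2_of[OF meas wL wL] inner_l2_of[OF meas f test_L2[OF p(1)]]
      inner_l2_of[OF meas f wL] energy_def .
  have "\<forall>\<^sub>F k in sequentially. s * dirichlet_form \<Omega> w w + L2_inner \<Omega> (p k) (p k) - 2 * L2_inner \<Omega> f (p k) < energy \<Omega> (dirichlet_form \<Omega>) s f w + \<eta>"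
    by (rule order_tendstoD(2)[OF L]) (use n in simp)
  moreover have "\<forall>\<^sub>F k in sequentially. dist (l2_of \<Omega> (p k)) (l2_of \<Omega> w) < \<eta>" by (rule tendstoD[OF lim n])
  ultimately have "\<forall>\<^sub>F k in sequentially. energy \<Omega> (dirichlet_form \<Omega>) s f (p k) \<le> energy \<Omega> (dirichlet_form \<Omega>) s f w + \<eta> \<and>
    norm (l2_of \<Omega> (p k) - l2_of \<Omega> w) \<le> \<eta>"
  proof eventually_elim
    case (elim k)
    have "s * dirichlet_form \<Omega> (p k) (p k) \<le> s * dirichlet_form \<Omega> w w" using p(2) s by (intro mult_left_mono) auto
    then show ?case using elim unfolding energy_def dist_norm by linarith
  qed
  then obtain k where "energy \<Omega> (dirichlet_form \<Omega>) s f (p k) \<le> energy \<Omega> (dirichlet_form \<Omega>) s f w + \<eta> \<and>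
    norm (l2_of \<Omega> (p k) - l2_of \<Omega> w) \<le> \<eta>" using eventually_happens trivial_limit_sequentially by blast
  then show ?thesis using p(1) by blast
qed

end

subsection \<open>The form with boundary terms\<close>

lemma square_integrable_mult:
  fixes f g :: "'a \<Rightarrow> real"
  assumes "f \<in> borel_measurable M" "g \<in> borel_measurable M" "integrable M (\<lambda>x. (f x)\<^sup>2)" "integrable M (\<lambda>x. (g x)\<^sup>2)"
  shows "integrable M (\<lambda>x. f x * g x)"
proof (rule Bochner_Integration.integrable_bound[OF Bochner_Integration.integrable_add[OF assms(3,4)]])
  show "(\<lambda>x. f x * g x) \<in> borel_measurable M" by (rule borel_measurable_times[OF assms(1,2)])
  have "\<bar>a * b\<bar> \<le> a\<^sup>2 + b\<^sup>2" for a b :: real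
  proof -
    have "2 * (\<bar>a\<bar> * \<bar>b\<bar>) \<le> a\<^sup>2 + b\<^sup>2" using sum_squares_bound[of "\<bar>a\<bar>" "\<bar>b\<bar>"] by simp
    moreover have "0 \<le> \<bar>a\<bar> * \<bar>b\<bar>" by simp
    ultimately show ?thesis unfolding abs_mult by linarith
  qed
  then show "AE x in M. norm (f x * g x) \<le> norm ((f x)\<^sup>2 + (g x)\<^sup>2)" by simp
qed

lemma semi_inner_space_square_integrable:
  "semi_inner_space {f \<in> borel_measurable M. integrable M (\<lambda>x. (f x)\<^sup>2)} (\<lambda>f g. LINT x|M. f x * g x)"
proof
  fix c and f g h :: "'a \<Rightarrow> real"
  assume f: "f \<in> {f \<in> borel_measurable M. integrable M (\<lambda>x. (f x)\<^sup>2)}"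
  show "0 \<le> (LINT x|M. f x * f x)" by simp
  assume g: "g \<in> {f \<in> borel_measurable M. integrable M (\<lambda>x. (f x)\<^sup>2)}"
  show "(LINT x|M. f x * g x) = (LINT x|M. g x * f x)" by (simp add: mult.commute)
  have e: "(\<lambda>x. (c * f x + g x)\<^sup>2) = (\<lambda>x. c\<^sup>2 * (f x)\<^sup>2 + (2 * c) * (f x * g x) + (g x)\<^sup>2)"
    by (auto simp: power2_eq_square algebra_simps)
  have "integrable M (\<lambda>x. f x * g x)" using f g by (intro square_integrable_mult) auto
  then have "integrable M (\<lambda>x. (c * f x + g x)\<^sup>2)" unfolding e
    using f g by (intro Bochner_Integration.integrable_add integrable_mult_right) auto
  then show "(\<lambda>x. c * f x + g x) \<in> {f \<in> borel_measurable M. integrable M (\<lambda>x. (f x)\<^sup>2)}" using f g by auto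
  assume h: "h \<in> {f \<in> borel_measurable M. integrable M (\<lambda>x. (f x)\<^sup>2)}"
  have "integrable M (\<lambda>x. f x * h x)" "integrable M (\<lambda>x. g x * h x)" using f g h by (auto intro: square_integrable_mult)
  then have "(LINT x|M. c * (f x * h x) + g x * h x) = c * (LINT x|M. f x * h x) + (LINT x|M. g x * h x)" by simp
  then show "(LINT x|M. (c * f x + g x) * h x) = c * (LINT x|M. f x * h x) + (LINT x|M. g x * h x)"
    by (simp add: distrib_right mult.assoc)
qed simp

locale boundary_measures = bounded_domain \<Omega>
  for \<Omega> :: "'a::euclidean_space set" +
  fixes \<kappa> :: "'a measure" and \<theta> :: "('a \<times> 'a) measure"
  assumes \<kappa>: "borel_measure_on (frontier \<Omega>) \<kappa>" and \<theta>: "borel_measure_on (off_diagonal (frontier \<Omega>)) \<theta>"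
begin

definition jump :: "('a \<Rightarrow> real) \<Rightarrow> 'a \<times> 'a \<Rightarrow> real" where "jump u z = u (fst z) - u (snd z)"

definition S\<kappa> where "S\<kappa> = {f \<in> borel_measurable \<kappa>. integrable \<kappa> (\<lambda>x. (f x)\<^sup>2)}"
definition S\<theta> where "S\<theta> = {f \<in> borel_measurable \<theta>. integrable \<theta> (\<lambda>z. (f z)\<^sup>2)}"

interpretation K: semi_inner_space S\<kappa> "\<lambda>f g. LINT x|\<kappa>. f x * g x"
  unfolding S\<kappa>_def by (rule semi_inner_space_square_integrable)

interpretation T: semi_inner_space S\<theta> "\<lambda>f g. LINT x|\<theta>. f x * g x"
  unfolding S\<theta>_def by (rule semi_inner_space_square_integrable)

lemma space_\<kappa>: "space \<kappa> = frontier \<Omega>"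
  using sets_eq_imp_space_eq[OF \<kappa>[unfolded borel_measure_on_def]] by (simp add: space_restrict_space)

lemma space_\<theta>: "space \<theta> = off_diagonal (frontier \<Omega>)"
  using sets_eq_imp_space_eq[OF \<theta>[unfolded borel_measure_on_def]] by (simp add: space_restrict_space)

lemma frontier_closure: "x \<in> frontier \<Omega> \<Longrightarrow> x \<in> closure \<Omega>" by (simp add: frontier_def)

lemma frontier_disjoint: "x \<in> frontier \<Omega> \<Longrightarrow> x \<notin> \<Omega>" using open_\<Omega> by (simp add: frontier_def interior_open)

lemma trace_measurable:
  assumes "continuous_on (closure \<Omega>) u" shows "u \<in> borel_measurable \<kappa>"
proof -
  have "u \<in> borel_measurable (restrict_space borel (frontier \<Omega>))"
    by (rule borel_measurable_continuous_on_restrict[OF continuous_on_subset[OF assms]]) (use frontier_closure in blast)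
  then show ?thesis using measurable_cong_sets[OF \<kappa>[unfolded borel_measure_on_def] refl] by blast
qed

lemma jump_measurable:
  assumes u: "continuous_on (closure \<Omega>) u" shows "jump u \<in> borel_measurable \<theta>"
proof -
  have s: "fst ` off_diagonal (frontier \<Omega>) \<subseteq> closure \<Omega>" "snd ` off_diagonal (frontier \<Omega>) \<subseteq> closure \<Omega>"
    using frontier_closure by (auto simp: off_diagonal_def)
  have "continuous_on (off_diagonal (frontier \<Omega>)) (jump u)" unfolding jump_def
    by (intro continuous_on_diff continuous_on_compose2[OF u _ s(1)] continuous_on_compose2[OF u _ s(2)] continuous_on_fst continuous_on_snd continuous_on_id)
  then have "jump u \<in> borel_measurable (restrict_space borel (off_diagonal (frontier \<Omega>)))"
    by (rule borel_measurable_continuous_on_restrict)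
  then show ?thesis using measurable_cong_sets[OF \<theta>[unfolded borel_measure_on_def] refl] by blast
qed

text \<open>The closure of the bounded set \<Omega> is compact, so \<open>Cc\<close> amounts to
  continuity up to the boundary.\<close>

lemma E_domain_iff:
  "u \<in> E_domain \<Omega> \<kappa> \<theta> \<longleftrightarrow> u \<in> H1 \<Omega> \<and> continuous_on (closure \<Omega>) u \<and> u \<in> S\<kappa> \<and> jump u \<in> S\<theta>"
proof (cases "continuous_on (closure \<Omega>) u")
  case True
  have c: "u \<in> Cc (closure \<Omega>)" unfolding Cc_def using True bounded_\<Omega> by (auto intro!: exI[of _ "closure \<Omega>"])
  note m = trace_measurable[OF True] jump_measurable[OF True]
  have "u \<in> S\<kappa> \<longleftrightarrow> (\<integral>\<^sup>+x. ennreal ((u x)\<^sup>2) \<partial>\<kappa>) < \<infinity>" unfolding S\<kappa>_def integrable_iff_bounded using m(1) by simp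
  moreover have "jump u \<in> S\<theta> \<longleftrightarrow> (\<integral>\<^sup>+z. ennreal ((u (fst z) - u (snd z))\<^sup>2) \<partial>\<theta>) < \<infinity>"
    unfolding S\<theta>_def integrable_iff_bounded using m(2) borel_measurable_power[OF m(2), of 2] by (simp add: jump_def)
  ultimately show ?thesis unfolding E_domain_def using True c by (simp add: infinity_ennreal_def)
qed (simp add: E_domain_def Cc_def)

lemma E_domainD:
  assumes "u \<in> E_domain \<Omega> \<kappa> \<theta>"
  shows "u \<in> H1 \<Omega>" "continuous_on (closure \<Omega>) u" "u \<in> S\<kappa>" "jump u \<in> S\<theta>" "u \<in> L2 \<Omega>"
  using assms continuous_closure_L2 unfolding E_domain_iff by blast+

lemma E_form_eq: "E_form \<Omega> \<kappa> \<theta> u v = dirichlet_form \<Omega> u v + (LINT x|\<kappa>. u x * v x) + (LINT z|\<theta>. jump u z * jump v z)"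
  unfolding E_form_def jump_def ..

lemma jump_lin: "jump (\<lambda>x. c * u x + v x) = (\<lambda>z. c * jump u z + jump v z)"
  by (rule ext) (simp add: jump_def algebra_simps)

lemma test_continuous: assumes "\<phi> \<in> test_functions \<Omega>" shows "continuous_on UNIV \<phi>"
  using Ck_continuous[of 0 \<phi>] assms unfolding test_functions_def by blast

text \<open>Test functions vanish on the boundary, so both boundary integrals are zero for arbitrary
  measures. This is also the source of the density of the form domain.\<close>

lemma test_E_domain: assumes \<phi>: "\<phi> \<in> test_functions \<Omega>" shows "\<phi> \<in> E_domain \<Omega> \<kappa> \<theta>"
proof -
  obtain K where K: "K \<subseteq> \<Omega>" "\<And>x. x \<notin> K \<Longrightarrow> \<phi> x = 0" by (rule test_functionsE[OF \<phi>]) blast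
  have z: "\<phi> x = 0" if "x \<in> frontier \<Omega>" for x using K frontier_disjoint[OF that] by blast
  have c: "continuous_on (closure \<Omega>) \<phi>" by (rule continuous_on_subset[OF test_continuous[OF \<phi>]]) simp
  have "integrable \<kappa> (\<lambda>x. (\<phi> x)\<^sup>2) \<longleftrightarrow> integrable \<kappa> (\<lambda>x. 0 :: real)"
    by (rule Bochner_Integration.integrable_cong[OF refl]) (simp add: space_\<kappa> z)
  then have 1: "\<phi> \<in> S\<kappa>" unfolding S\<kappa>_def using trace_measurable[OF c] by simp
  have "integrable \<theta> (\<lambda>x. (jump \<phi> x)\<^sup>2) \<longleftrightarrow> integrable \<theta> (\<lambda>x. 0 :: real)"
    by (rule Bochner_Integration.integrable_cong[OF refl]) (auto simp: space_\<theta> off_diagonal_def jump_def z)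
  then have "jump \<phi> \<in> S\<theta>" unfolding S\<theta>_def using jump_measurable[OF c] by simp
  then show ?thesis unfolding E_domain_iff using test_H1[OF \<phi>] c 1 by blast
qed

lemma E_domain_lin:
  assumes u: "u \<in> E_domain \<Omega> \<kappa> \<theta>" and v: "v \<in> E_domain \<Omega> \<kappa> \<theta>" shows "(\<lambda>x. c * u x + v x) \<in> E_domain \<Omega> \<kappa> \<theta>"
proof -
  note u = E_domainD[OF u] and v = E_domainD[OF v]
  have "continuous_on (closure \<Omega>) (\<lambda>x. c * u x + v x)" by (intro continuous_intros u v)
  then show ?thesis unfolding E_domain_iff jump_lin using H1_lin[OF u(1) v(1)] K.D_lin[OF u(3) v(3)] T.D_lin[OF u(4) v(4)] by blast
qed

lemma L2_form_E: "L2_form (E_domain \<Omega> \<kappa> \<theta>) (E_form \<Omega> \<kappa> \<theta>) \<Omega>"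
proof unfold_locales
  show "(\<lambda>x. 0) \<in> E_domain \<Omega> \<kappa> \<theta>" by (rule test_E_domain[OF test_functions_zero])
  show "\<Omega> \<in> sets lebesgue" by (rule meas)
  show "E_domain \<Omega> \<kappa> \<theta> \<subseteq> L2 \<Omega>" using E_domainD(5) by blast
  show "\<exists>g\<in>E_domain \<Omega> \<kappa> \<theta>. L2_norm \<Omega> (\<lambda>x. f x - g x) < e" if "f \<in> L2 \<Omega>" "e > 0" for f e
    using test_dense[OF that] test_E_domain by blast
  fix c and f g h :: "'a \<Rightarrow> real"
  assume f: "f \<in> E_domain \<Omega> \<kappa> \<theta>"
  note f' = E_domainD[OF f]
  show "0 \<le> E_form \<Omega> \<kappa> \<theta> f f" unfolding E_form_eq
    using H1.nonneg[OF f'(1)] K.nonneg[OF f'(3)] T.nonneg[OF f'(4)] by linarith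
  assume g: "g \<in> E_domain \<Omega> \<kappa> \<theta>"
  note g' = E_domainD[OF g]
  show "(\<lambda>x. c * f x + g x) \<in> E_domain \<Omega> \<kappa> \<theta>" by (rule E_domain_lin[OF f g])
  show "E_form \<Omega> \<kappa> \<theta> f g = E_form \<Omega> \<kappa> \<theta> g f" unfolding E_form_eq
    using H1.sym[OF f'(1) g'(1)] K.sym[OF f'(3) g'(3)] T.sym[OF f'(4) g'(4)] by linarith
  assume h: "h \<in> E_domain \<Omega> \<kappa> \<theta>"
  note h' = E_domainD[OF h]
  show "E_form \<Omega> \<kappa> \<theta> (\<lambda>x. c * f x + g x) h = c * E_form \<Omega> \<kappa> \<theta> f h + E_form \<Omega> \<kappa> \<theta> g h"
    unfolding E_form_eq jump_lin H1.lin_left[OF f'(1) g'(1) h'(1)] K.lin_left[OF f'(3) g'(3) h'(3)] T.lin_left[OF f'(4) g'(4) h'(4)]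
    by (simp add: distrib_left)
qed

sublocale B: L2_form "E_domain \<Omega> \<kappa> \<theta>" "E_form \<Omega> \<kappa> \<theta>" \<Omega> by (rule L2_form_E)

text \<open>The Dirichlet part is \<open>abs_H1\<close>, the integral over \<kappa> does not change,
  and the jumps shrink by the reverse triangle inequality.\<close>

lemma E_abs:
  assumes "u \<in> E_domain \<Omega> \<kappa> \<theta>"
  shows "(\<lambda>x. \<bar>u x\<bar>) \<in> E_domain \<Omega> \<kappa> \<theta>" "E_form \<Omega> \<kappa> \<theta> (\<lambda>x. \<bar>u x\<bar>) (\<lambda>x. \<bar>u x\<bar>) \<le> E_form \<Omega> \<kappa> \<theta> u u"
proof -
  note u = E_domainD[OF assms] and h = abs_H1[OF E_domainD(1,2)[OF assms]]
  have c: "continuous_on (closure \<Omega>) (\<lambda>x. \<bar>u x\<bar>)" by (rule continuous_on_rabs[OF u(2)])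
  have le: "(jump (\<lambda>x. \<bar>u x\<bar>) z)\<^sup>2 \<le> (jump u z)\<^sup>2" for z
    unfolding jump_def abs_le_square_iff[symmetric] by linarith
  have i: "integrable \<theta> (\<lambda>z. (jump u z)\<^sup>2)" using u(4) unfolding S\<theta>_def by simp
  have j: "integrable \<theta> (\<lambda>z. (jump (\<lambda>x. \<bar>u x\<bar>) z)\<^sup>2)"
    by (rule Bochner_Integration.integrable_bound[OF i borel_measurable_power[OF jump_measurable[OF c]]]) (use le in simp)
  have "(\<lambda>x. \<bar>u x\<bar>) \<in> S\<kappa>" using u(3) trace_measurable[OF c] unfolding S\<kappa>_def by simp
  moreover have "jump (\<lambda>x. \<bar>u x\<bar>) \<in> S\<theta>" using j jump_measurable[OF c] unfolding S\<theta>_def by simp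
  ultimately show "(\<lambda>x. \<bar>u x\<bar>) \<in> E_domain \<Omega> \<kappa> \<theta>" unfolding E_domain_iff using h(1) c by blast
  have "(LINT z|\<theta>. (jump (\<lambda>x. \<bar>u x\<bar>) z)\<^sup>2) \<le> (LINT z|\<theta>. (jump u z)\<^sup>2)" by (rule integral_mono[OF j i le])
  then have "(LINT z|\<theta>. jump (\<lambda>x. \<bar>u x\<bar>) z * jump (\<lambda>x. \<bar>u x\<bar>) z) \<le> (LINT z|\<theta>. jump u z * jump u z)"
    by (simp add: power2_eq_square)
  then show "E_form \<Omega> \<kappa> \<theta> (\<lambda>x. \<bar>u x\<bar>) (\<lambda>x. \<bar>u x\<bar>) \<le> E_form \<Omega> \<kappa> \<theta> u u" unfolding E_form_eq using h(2) by simp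
qed

end

section \<open>Comparison of the resolvents\<close>

context bounded_domain
begin

sublocale D: L2_form "test_functions \<Omega>" "dirichlet_form \<Omega>" \<Omega> by (rule L2_form_dirichlet)

text \<open>The sign of \<open>f\<close> matters for the linear term, where it gives
  \<open>(f, u) \<le> (f, \<bar>u\<bar>)\<close>; the quadratic terms do not increase.\<close>

lemma energy_abs_le:
  assumes u: "u \<in> L2 \<Omega>" and f: "f \<in> L2 \<Omega>" "AE x in lebesgue_on \<Omega>. 0 \<le> f x" and s: "s > 0"
    and a: "a (\<lambda>x. \<bar>u x\<bar>) (\<lambda>x. \<bar>u x\<bar>) \<le> a u u"
  shows "energy \<Omega> a s f (\<lambda>x. \<bar>u x\<bar>) \<le> energy \<Omega> a s f u"
proof -
  have "L2_inner \<Omega> f u \<le> L2_inner \<Omega> f (\<lambda>x. \<bar>u x\<bar>)"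
    unfolding L2_inner_def
  proof (rule integral_mono_AE[OF L2_mult_integrable[OF f(1) u] L2_mult_integrable[OF f(1) L2_abs[OF u]]])
    show "AE x in lebesgue_on \<Omega>. f x * u x \<le> f x * \<bar>u x\<bar>" using f(2) by eventually_elim (simp add: mult_left_mono)
  qed
  moreover have "L2_inner \<Omega> (\<lambda>x. \<bar>u x\<bar>) (\<lambda>x. \<bar>u x\<bar>) = L2_inner \<Omega> u u" unfolding L2_inner_def by simp
  moreover have "s * a (\<lambda>x. \<bar>u x\<bar>) (\<lambda>x. \<bar>u x\<bar>) \<le> s * a u u" using a s by (intro mult_left_mono) auto
  ultimately show ?thesis unfolding energy_def by linarith
qed

text \<open>Absolute values and minima leave the test functions, so \<open>D.minimizing\<close> does
  not apply to them directly. \<open>core_energy\<close> supplies test functions of hardly larger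
  energy at distance at most \<open>1 / (n + 1)\<close>, and these converge to
  \<open>u\<close>.\<close>

lemma core_minimizing:
  assumes uw: "(u, z) \<in> D.Op" and s: "s > 0" and f: "f \<in> L2 \<Omega>" "AE x in lebesgue_on \<Omega>. u x - s * z x = f x"
    and w: "\<And>n. continuous_on UNIV (w n)" "\<And>n. w n \<in> H1 \<Omega>" "\<And>n. \<exists>K. compact K \<and> K \<subseteq> \<Omega> \<and> (\<forall>x. x \<notin> K \<longrightarrow> w n x = 0)"
    and c: "\<And>n. energy \<Omega> (dirichlet_form \<Omega>) s f (w n) \<le> c n" "c \<longlonglongrightarrow> - L2_inner \<Omega> f u"
  shows "(\<lambda>n. l2_of \<Omega> (w n)) \<longlonglongrightarrow> l2_of \<Omega> u"
proof -
  have "\<exists>\<phi>\<in>test_functions \<Omega>. energy \<Omega> (dirichlet_form \<Omega>) s f \<phi> \<le> energy \<Omega> (dirichlet_form \<Omega>) s f (w n) + inverse (real (Suc n)) \<and>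
    norm (l2_of \<Omega> \<phi> - l2_of \<Omega> (w n)) \<le> inverse (real (Suc n))" for n
  proof -
    obtain K where K: "compact K" "K \<subseteq> \<Omega>" "\<forall>x. x \<notin> K \<longrightarrow> w n x = 0" using w(3) by blast
    show ?thesis by (rule core_energy[OF w(1,2) K(1,2) _ f(1) s]) (use K(3) in auto)
  qed
  then obtain p where p: "\<And>n. p n \<in> test_functions \<Omega>"
    "\<And>n. energy \<Omega> (dirichlet_form \<Omega>) s f (p n) \<le> energy \<Omega> (dirichlet_form \<Omega>) s f (w n) + inverse (real (Suc n))"
    "\<And>n. norm (l2_of \<Omega> (p n) - l2_of \<Omega> (w n)) \<le> inverse (real (Suc n))" by metis
  have "(\<lambda>n. c n + inverse (real (Suc n))) \<longlonglongrightarrow> - L2_inner \<Omega> f u + 0"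
    by (rule tendsto_add[OF c(2) LIMSEQ_inverse_real_of_nat])
  then have c': "(\<lambda>n. c n + inverse (real (Suc n))) \<longlonglongrightarrow> - L2_inner \<Omega> f u" by simp
  have le: "energy \<Omega> (dirichlet_form \<Omega>) s f (p n) \<le> c n + inverse (real (Suc n))" for n using p(2)[of n] c(1)[of n] by linarith
  have l: "(\<lambda>n. l2_of \<Omega> (p n)) \<longlonglongrightarrow> l2_of \<Omega> u" by (rule D.minimizing[OF uw s f p(1) le c'])
  have "(\<lambda>n. l2_of \<Omega> (p n) - l2_of \<Omega> (w n)) \<longlonglongrightarrow> 0"
    by (rule Lim_null_comparison[OF always_eventually[OF allI] LIMSEQ_inverse_real_of_nat]) (rule p(3))
  from tendsto_diff[OF l this] show ?thesis by simp
qed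

lemma dirichlet_resolvent_nonneg:
  assumes uz: "(u, z) \<in> D.Op" and s: "s > 0" and f: "f \<in> L2 \<Omega>" "AE x in lebesgue_on \<Omega>. u x - s * z x = f x"
    and nn: "AE x in lebesgue_on \<Omega>. 0 \<le> f x"
  shows "AE x in lebesgue_on \<Omega>. 0 \<le> u x"
proof -
  obtain us where us: "\<And>n. us n \<in> test_functions \<Omega>" "(\<lambda>n. energy \<Omega> (dirichlet_form \<Omega>) s f (us n)) \<longlonglongrightarrow> - L2_inner \<Omega> f u"
    by (rule D.energy_eq[OF uz s f]) blast
  have cu: "continuous_on UNIV (us n)" for n using Ck_continuous[of 0 "us n"] us(1)[of n] unfolding test_functions_def by blast
  note A = abs_H1[OF test_H1[OF us(1)] continuous_on_subset[OF cu subset_UNIV]]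
  have K: "\<exists>K. compact K \<and> K \<subseteq> \<Omega> \<and> (\<forall>x. x \<notin> K \<longrightarrow> \<bar>us n x\<bar> = 0)" for n using us(1)[of n] unfolding test_functions_def by auto
  have le: "energy \<Omega> (dirichlet_form \<Omega>) s f (\<lambda>x. \<bar>us n x\<bar>) \<le> energy \<Omega> (dirichlet_form \<Omega>) s f (us n)" for n
    by (rule energy_abs_le[OF test_L2[OF us(1)] f(1) nn s]) (rule A(2))
  have lim: "(\<lambda>n. l2_of \<Omega> (\<lambda>x. \<bar>us n x\<bar>)) \<longlonglongrightarrow> l2_of \<Omega> u"
    by (rule core_minimizing[OF uz s f continuous_on_rabs[OF cu] A(1) K le us(2)])
  show ?thesis by (rule L2_lim_nonneg[OF meas L2_abs[OF test_L2[OF us(1)]] D.Op_L2(1)[OF uz] lim]) simp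
qed

end

context boundary_measures
begin

text \<open>Here the absolute value stays in the form domain, so \<open>B.minimizing\<close> applies
  at once. The nonnegative sequence is part of the conclusion because the truncation works with
  values at points, which the limit does not have.\<close>

lemma boundary_resolvent_nonneg:
  assumes vz: "(v, z) \<in> B.Op" and s: "s > 0" and f: "f \<in> L2 \<Omega>" "AE x in lebesgue_on \<Omega>. v x - s * z x = f x"
    and nn: "AE x in lebesgue_on \<Omega>. 0 \<le> f x"
  shows "\<exists>vs. (\<forall>n. vs n \<in> E_domain \<Omega> \<kappa> \<theta> \<and> (\<forall>x. 0 \<le> vs n x)) \<and> (\<lambda>n. l2_of \<Omega> (vs n)) \<longlonglongrightarrow> l2_of \<Omega> v \<and>
    (\<lambda>n. energy \<Omega> (E_form \<Omega> \<kappa> \<theta>) s f (vs n)) \<longlonglongrightarrow> - L2_inner \<Omega> f v" and "AE x in lebesgue_on \<Omega>. 0 \<le> v x"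
proof -
  obtain vs where vs: "\<And>n. vs n \<in> E_domain \<Omega> \<kappa> \<theta>" "(\<lambda>n. energy \<Omega> (E_form \<Omega> \<kappa> \<theta>) s f (vs n)) \<longlonglongrightarrow> - L2_inner \<Omega> f v"
    "\<And>v'. v' \<in> E_domain \<Omega> \<kappa> \<theta> \<Longrightarrow> - L2_inner \<Omega> f v \<le> energy \<Omega> (E_form \<Omega> \<kappa> \<theta>) s f v'"
    by (rule B.energy_eq[OF vz s f]) blast
  note A = E_abs[OF vs(1)]
  have le: "energy \<Omega> (E_form \<Omega> \<kappa> \<theta>) s f (\<lambda>x. \<bar>vs n x\<bar>) \<le> energy \<Omega> (E_form \<Omega> \<kappa> \<theta>) s f (vs n)" for n
    by (rule energy_abs_le[OF E_domainD(5)[OF vs(1)] f(1) nn s]) (rule A(2))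
  have lim: "(\<lambda>n. l2_of \<Omega> (\<lambda>x. \<bar>vs n x\<bar>)) \<longlonglongrightarrow> l2_of \<Omega> v"
    by (rule B.minimizing[OF vz s f A(1) le vs(2)])
  have "(\<lambda>n. energy \<Omega> (E_form \<Omega> \<kappa> \<theta>) s f (\<lambda>x. \<bar>vs n x\<bar>)) \<longlonglongrightarrow> - L2_inner \<Omega> f v"
    by (rule tendsto_sandwich[OF _ _ tendsto_const vs(2)]) (use le vs(3)[OF A(1)] in auto)
  then show "\<exists>vs. (\<forall>n. vs n \<in> E_domain \<Omega> \<kappa> \<theta> \<and> (\<forall>x. 0 \<le> vs n x)) \<and> (\<lambda>n. l2_of \<Omega> (vs n)) \<longlonglongrightarrow> l2_of \<Omega> v \<and>
    (\<lambda>n. energy \<Omega> (E_form \<Omega> \<kappa> \<theta>) s f (vs n)) \<longlonglongrightarrow> - L2_inner \<Omega> f v"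
    using A(1) lim by (intro exI[of _ "\<lambda>n x. \<bar>vs n x\<bar>"]) simp
  show "AE x in lebesgue_on \<Omega>. 0 \<le> v x"
    by (rule L2_lim_nonneg[OF meas L2_abs[OF E_domainD(5)[OF vs(1)]] B.Op_L2(1)[OF vz] lim]) simp
qed

text \<open>
  \<open>m\<close> and \<open>M\<close> are \<open>(p - q) / 2\<close> and \<open>(p + q) / 2\<close> for \<open>p = \<phi> + v\<close> and \<open>q = \<bar>\<phi> - v\<bar>\<close>, and \<open>M\<close> agrees
  with \<open>v\<close> on the boundary, so that the boundary terms cancel.
\<close>

lemma truncation:
  assumes \<phi>: "\<phi> \<in> test_functions \<Omega>" and v: "v \<in> E_domain \<Omega> \<kappa> \<theta>" "\<And>x. 0 \<le> v x" and f: "f \<in> L2 \<Omega>"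
  defines "m \<equiv> (\<lambda>x. if x \<in> \<Omega> then min (\<phi> x) (v x) else 0)" and "M \<equiv> (\<lambda>x. max (\<phi> x) (v x))"
  shows "continuous_on UNIV m" "m \<in> H1 \<Omega>" "\<exists>K. compact K \<and> K \<subseteq> \<Omega> \<and> (\<forall>x. x \<notin> K \<longrightarrow> m x = 0)"
    "M \<in> E_domain \<Omega> \<kappa> \<theta>"
    "energy \<Omega> (dirichlet_form \<Omega>) s f m + energy \<Omega> (E_form \<Omega> \<kappa> \<theta>) s f M
      = s * (dirichlet_form \<Omega> m m + dirichlet_form \<Omega> M M - dirichlet_form \<Omega> \<phi> \<phi> - dirichlet_form \<Omega> v v)
        + energy \<Omega> (dirichlet_form \<Omega>) s f \<phi> + energy \<Omega> (E_form \<Omega> \<kappa> \<theta>) s f v"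
    "dirichlet_form \<Omega> m m + dirichlet_form \<Omega> M M \<le> dirichlet_form \<Omega> \<phi> \<phi> + dirichlet_form \<Omega> v v"
proof -
  obtain K where K: "compact K" "K \<subseteq> \<Omega>" "\<And>x. x \<notin> K \<Longrightarrow> \<phi> x = 0" by (rule test_functionsE[OF \<phi>]) blast
  note v' = E_domainD[OF v(1)] and \<phi>H = test_H1[OF \<phi>]
  have vO: "continuous_on \<Omega> v" by (rule continuous_on_subset[OF v'(2) closure_subset])
  \<comment> \<open>This is a use of \<open>0 \<le> v x\<close>: off \<open>K\<close> the minimum of
    \<open>0\<close> and \<open>v x\<close> is \<open>0\<close>, so \<open>m\<close> inherits the
    compact support of \<phi>.\<close>
  have z: "m x = 0" if "x \<notin> K" for x using K(3)[OF that] v(2)[of x] by (simp add: m_def)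
  show "\<exists>K. compact K \<and> K \<subseteq> \<Omega> \<and> (\<forall>x. x \<notin> K \<longrightarrow> m x = 0)" using K(1,2) z by blast
  have "continuous_on \<Omega> (\<lambda>x. min (\<phi> x) (v x))"
    by (intro continuous_on_min vO continuous_on_subset[OF test_continuous[OF \<phi>]] subset_UNIV)
  then have 1: "continuous_on \<Omega> m" by (rule continuous_on_eq) (simp add: m_def)
  \<comment> \<open>\<open>v\<close> is known to be continuous only on the closure of \<Omega>, so
    the continuity of \<open>m\<close> is patched together from the open sets \<Omega> and
    \<open>- K\<close>, which cover the space.\<close>
  have 2: "continuous_on (- K) m" by (rule continuous_on_eq[OF continuous_on_const[of _ 0]]) (simp add: z)
  have "continuous_on (\<Omega> \<union> - K) m"
    by (rule continuous_on_open_Un[OF open_\<Omega> _ 1 2]) (use K(1) compact_imp_closed in auto)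
  moreover have "\<Omega> \<union> - K = UNIV" using K(2) by blast
  ultimately show mc: "continuous_on UNIV m" by simp
  have c\<phi>: "continuous_on (closure \<Omega>) \<phi>" by (rule continuous_on_subset[OF test_continuous[OF \<phi>] subset_UNIV])
  define p where "p x = \<phi> x + v x" for x
  define d where "d x = \<phi> x - v x" for x
  define q where "q x = \<bar>d x\<bar>" for x
  have pH: "p \<in> H1 \<Omega>" unfolding p_def[abs_def] by (rule H1.D_add[OF \<phi>H v'(1)])
  have dH: "d \<in> H1 \<Omega>" unfolding d_def[abs_def] by (rule H1.D_diff[OF \<phi>H v'(1)])
  have "continuous_on (closure \<Omega>) d" unfolding d_def[abs_def] by (intro continuous_on_diff c\<phi> v')
  note Q = abs_H1[OF dH this, folded q_def[abs_def]]
  have eq: "min a b = (- (1/2)) * \<bar>a - b\<bar> + (1/2) * (a + b)" "max a b = (1/2) * \<bar>a - b\<bar> + (1/2) * (a + b)" for a b :: real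
    by (auto simp: min_def max_def abs_if field_simps)
  show mH: "m \<in> H1 \<Omega>"
    by (rule H1_cong(1)[OF H1.D_lin[OF Q(1) H1.D_scale[OF pH, of "1/2"], of "- (1/2)"]])
      (simp only: m_def if_True eq(1) q_def d_def p_def)
  have MH: "M \<in> H1 \<Omega>"
    by (rule H1_cong(1)[OF H1.D_lin[OF Q(1) H1.D_scale[OF pH, of "1/2"], of "1/2"]])
      (simp only: M_def eq(2) q_def d_def p_def)
  have Mc: "continuous_on (closure \<Omega>) M" unfolding M_def by (intro continuous_on_max c\<phi> v')
  have Mv: "M x = v x" if "x \<in> frontier \<Omega>" for x
  proof -
    have "\<phi> x = 0" by (rule K(3)) (use K(2) frontier_disjoint[OF that] in blast)
    then show ?thesis using v(2)[of x] by (simp add: M_def)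
  qed
  have jMv: "jump M z = jump v z" if "z \<in> off_diagonal (frontier \<Omega>)" for z
    using that Mv unfolding jump_def off_diagonal_def by auto
  have "integrable \<kappa> (\<lambda>x. (M x)\<^sup>2) \<longleftrightarrow> integrable \<kappa> (\<lambda>x. (v x)\<^sup>2)"
    by (rule Bochner_Integration.integrable_cong[OF refl]) (simp add: space_\<kappa> Mv)
  then have M\<kappa>: "M \<in> S\<kappa>" using v'(3) trace_measurable[OF Mc] unfolding S\<kappa>_def by simp
  have "integrable \<theta> (\<lambda>x. (jump M x)\<^sup>2) \<longleftrightarrow> integrable \<theta> (\<lambda>x. (jump v x)\<^sup>2)"
    by (rule Bochner_Integration.integrable_cong[OF refl]) (simp add: space_\<theta> jMv)
  then have M\<theta>: "jump M \<in> S\<theta>" using v'(4) jump_measurable[OF Mc] unfolding S\<theta>_def by simp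
  show "M \<in> E_domain \<Omega> \<kappa> \<theta>" unfolding E_domain_iff using MH Mc M\<kappa> M\<theta> by blast
  have b: "(LINT x|\<kappa>. M x * M x) = (LINT x|\<kappa>. v x * v x)"
    by (rule Bochner_Integration.integral_cong[OF refl]) (simp add: space_\<kappa> Mv)
  have j: "(LINT x|\<theta>. jump M x * jump M x) = (LINT x|\<theta>. jump v x * jump v x)"
    by (rule Bochner_Integration.integral_cong[OF refl]) (simp add: space_\<theta> jMv)
  have dp: "dirichlet_form \<Omega> (\<lambda>x. m x + M x) (\<lambda>x. m x + M x) = dirichlet_form \<Omega> p p"
  proof -
    have e: "p x = m x + M x" if "x \<in> \<Omega>" for x using that unfolding p_def m_def M_def by simp
    show ?thesis using H1_cong(2)[OF pH e, of "\<lambda>x. m x + M x"] H1_cong(3)[OF pH e, of p] by simp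
  qed
  have dq: "dirichlet_form \<Omega> (\<lambda>x. m x - M x) (\<lambda>x. m x - M x) = dirichlet_form \<Omega> q q"
  proof -
    have q': "(\<lambda>x. (- 1) * q x) \<in> H1 \<Omega>" by (rule H1.D_scale[OF Q(1)])
    have e: "(- 1) * q x = m x - M x" if "x \<in> \<Omega>" for x using that unfolding q_def d_def m_def M_def by simp
    show ?thesis using H1_cong(2)[OF q' e, of "\<lambda>x. m x - M x"] H1_cong(3)[OF q' e, of "\<lambda>x. (- 1) * q x"] H1.square_scale[OF Q(1), of "-1"] by simp
  qed
  have pp: "dirichlet_form \<Omega> p p = dirichlet_form \<Omega> \<phi> \<phi> + 2 * dirichlet_form \<Omega> \<phi> v + dirichlet_form \<Omega> v v"
    unfolding p_def[abs_def] by (rule H1.square_add[OF \<phi>H v'(1)])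
  have dd: "dirichlet_form \<Omega> d d = dirichlet_form \<Omega> \<phi> \<phi> - 2 * dirichlet_form \<Omega> \<phi> v + dirichlet_form \<Omega> v v"
    unfolding d_def[abs_def] by (rule H1.square_diff[OF \<phi>H v'(1)])
  \<comment> \<open>The parallelogram identity is used twice: the forms of \<open>m\<close> and
    \<open>M\<close> add up to half of those of \<open>p\<close> and \<open>q\<close>, the forms of
    \<phi> and \<open>v\<close> to half of those of \<open>p\<close> and \<open>d\<close>. Passing
    from \<open>d\<close> to \<open>q\<close>, its absolute value, does not increase the
    form.\<close>
  show "dirichlet_form \<Omega> m m + dirichlet_form \<Omega> M M \<le> dirichlet_form \<Omega> \<phi> \<phi> + dirichlet_form \<Omega> v v"
    using H1.square_add[OF mH MH] H1.square_diff[OF mH MH] dp dq pp dd Q(2) by linarith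
  note L = H1D(1)[OF mH] H1D(1)[OF MH] H1D(1)[OF \<phi>H] v'(5)
  have "L2_inner \<Omega> m m + L2_inner \<Omega> M M = (LINT x|lebesgue_on \<Omega>. m x * m x + M x * M x)"
    unfolding L2_inner_def by (rule Bochner_Integration.integral_add[symmetric]) (rule L2_mult_integrable; rule L)+
  also have "\<dots> = (LINT x|lebesgue_on \<Omega>. \<phi> x * \<phi> x + v x * v x)"
    by (rule Bochner_Integration.integral_cong[OF refl]) (auto simp: m_def M_def min_def max_def)
  also have "\<dots> = L2_inner \<Omega> \<phi> \<phi> + L2_inner \<Omega> v v"
    unfolding L2_inner_def by (rule Bochner_Integration.integral_add) (rule L2_mult_integrable; rule L)+
  finally have i2: "L2_inner \<Omega> m m + L2_inner \<Omega> M M = L2_inner \<Omega> \<phi> \<phi> + L2_inner \<Omega> v v" .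
  have "L2_inner \<Omega> f m + L2_inner \<Omega> f M = (LINT x|lebesgue_on \<Omega>. f x * m x + f x * M x)"
    unfolding L2_inner_def by (rule Bochner_Integration.integral_add[symmetric]) (rule L2_mult_integrable[OF f]; rule L)+
  also have "\<dots> = (LINT x|lebesgue_on \<Omega>. f x * \<phi> x + f x * v x)"
    by (rule Bochner_Integration.integral_cong[OF refl]) (auto simp: m_def M_def min_def max_def)
  also have "\<dots> = L2_inner \<Omega> f \<phi> + L2_inner \<Omega> f v"
    unfolding L2_inner_def by (rule Bochner_Integration.integral_add) (rule L2_mult_integrable[OF f]; rule L)+
  finally have i1: "L2_inner \<Omega> f m + L2_inner \<Omega> f M = L2_inner \<Omega> f \<phi> + L2_inner \<Omega> f v" .
  show "energy \<Omega> (dirichlet_form \<Omega>) s f m + energy \<Omega> (E_form \<Omega> \<kappa> \<theta>) s f M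
      = s * (dirichlet_form \<Omega> m m + dirichlet_form \<Omega> M M - dirichlet_form \<Omega> \<phi> \<phi> - dirichlet_form \<Omega> v v)
        + energy \<Omega> (dirichlet_form \<Omega>) s f \<phi> + energy \<Omega> (E_form \<Omega> \<kappa> \<theta>) s f v"
    unfolding energy_def E_form_eq b j using i1 i2 by (simp add: algebra_simps)
qed

lemma resolvent_le:
  assumes uz: "(u, z) \<in> D.Op" and vy: "(v, y) \<in> B.Op" and s: "s > 0" and f: "f \<in> L2 \<Omega>"
    and fu: "AE x in lebesgue_on \<Omega>. u x - s * z x = f x" and fv: "AE x in lebesgue_on \<Omega>. v x - s * y x = f x"
    and nn: "AE x in lebesgue_on \<Omega>. 0 \<le> f x"
  shows "AE x in lebesgue_on \<Omega>. u x \<le> v x"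
proof -
  obtain us where us: "\<And>n. us n \<in> test_functions \<Omega>" "(\<lambda>n. energy \<Omega> (dirichlet_form \<Omega>) s f (us n)) \<longlonglongrightarrow> - L2_inner \<Omega> f u"
    by (rule D.energy_eq[OF uz s f fu]) blast
  obtain vs where vs: "\<And>n. vs n \<in> E_domain \<Omega> \<kappa> \<theta>" "\<And>n x. 0 \<le> vs n x" "(\<lambda>n. l2_of \<Omega> (vs n)) \<longlonglongrightarrow> l2_of \<Omega> v"
    "(\<lambda>n. energy \<Omega> (E_form \<Omega> \<kappa> \<theta>) s f (vs n)) \<longlonglongrightarrow> - L2_inner \<Omega> f v"
    using boundary_resolvent_nonneg(1)[OF vy s f fv nn] by blast
  have min: "- L2_inner \<Omega> f v \<le> energy \<Omega> (E_form \<Omega> \<kappa> \<theta>) s f w" if "w \<in> E_domain \<Omega> \<kappa> \<theta>" for w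
    by (rule B.energy_eq[OF vy s f fv]) (use that in blast)
  define m where "m n = (\<lambda>x. if x \<in> \<Omega> then min (us n x) (vs n x) else 0)" for n
  define M where "M n = (\<lambda>x. max (us n x) (vs n x))" for n
  \<comment> \<open>The energy of \<open>M n\<close> is at least the minimum
    \<open>- (f, v)\<close>. What is left of the total energy of the pair bounds the energy of
    \<open>m n\<close>, and it tends to the Dirichlet minimum \<open>- (f, u)\<close>.\<close>
  define c where "c n = energy \<Omega> (dirichlet_form \<Omega>) s f (us n) + energy \<Omega> (E_form \<Omega> \<kappa> \<theta>) s f (vs n) + L2_inner \<Omega> f v" for n
  have T: "continuous_on UNIV (m n)" "m n \<in> H1 \<Omega>" "\<exists>K. compact K \<and> K \<subseteq> \<Omega> \<and> (\<forall>x. x \<notin> K \<longrightarrow> m n x = 0)"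
    "M n \<in> E_domain \<Omega> \<kappa> \<theta>"
    "energy \<Omega> (dirichlet_form \<Omega>) s f (m n) + energy \<Omega> (E_form \<Omega> \<kappa> \<theta>) s f (M n)
      = s * (dirichlet_form \<Omega> (m n) (m n) + dirichlet_form \<Omega> (M n) (M n) - dirichlet_form \<Omega> (us n) (us n) - dirichlet_form \<Omega> (vs n) (vs n))
        + energy \<Omega> (dirichlet_form \<Omega>) s f (us n) + energy \<Omega> (E_form \<Omega> \<kappa> \<theta>) s f (vs n)"
    "dirichlet_form \<Omega> (m n) (m n) + dirichlet_form \<Omega> (M n) (M n) \<le> dirichlet_form \<Omega> (us n) (us n) + dirichlet_form \<Omega> (vs n) (vs n)" for n
    unfolding m_def M_def by (rule truncation[OF us(1) vs(1) vs(2) f])+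
  have le: "energy \<Omega> (dirichlet_form \<Omega>) s f (m n) \<le> c n" for n
  proof -
    have "s * (dirichlet_form \<Omega> (m n) (m n) + dirichlet_form \<Omega> (M n) (M n) - dirichlet_form \<Omega> (us n) (us n) - dirichlet_form \<Omega> (vs n) (vs n)) \<le> 0"
      using s T(6)[of n] by (intro mult_nonneg_nonpos) auto
    then show ?thesis using T(5)[of n] min[OF T(4)[of n]] unfolding c_def by linarith
  qed
  have "c \<longlonglongrightarrow> - L2_inner \<Omega> f u + - L2_inner \<Omega> f v + L2_inner \<Omega> f v"
    unfolding c_def[abs_def] by (intro tendsto_intros us vs)
  then have c: "c \<longlonglongrightarrow> - L2_inner \<Omega> f u" by simp
  have ml: "(\<lambda>n. l2_of \<Omega> (m n)) \<longlonglongrightarrow> l2_of \<Omega> u"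
    by (rule core_minimizing[OF uz s f fu T(1) T(2) T(3) le c])
  note vL = E_domainD(5)[OF vs(1)] and mL = H1D(1)[OF T(2)]
  note uL = D.Op_L2(1)[OF uz] and vL' = B.Op_L2(1)[OF vy]
  have "(\<lambda>n. l2_of \<Omega> (\<lambda>x. vs n x - m n x)) \<longlonglongrightarrow> l2_of \<Omega> (\<lambda>x. v x - u x)"
    unfolding l2_of_diff[OF meas vL mL] l2_of_diff[OF meas vL' uL] by (rule tendsto_diff[OF vs(3) ml])
  then have "AE x in lebesgue_on \<Omega>. 0 \<le> v x - u x"
    by (rule L2_lim_nonneg[OF meas L2_diff[OF vL mL] L2_diff[OF vL' uL]])
      (rule AE_I2, use vs(2) in \<open>simp add: m_def min_def\<close>)
  then show ?thesis by eventually_elim simp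
qed

text \<open>\<open>resolvent_le\<close> compares the two resolvents on the same function, while the
  iterates drift apart. For \<open>u \<le> v\<close> the image of \<open>v\<close> under
  \<open>B.J s\<close> is split into that of \<open>v - u\<close>, which is nonnegative, and that of
  \<open>u\<close>, which dominates the Dirichlet resolvent of \<open>u\<close>. Nonnegativity of
  \<open>u\<close> is carried along because \<open>resolvent_le\<close> asks for it.\<close>

lemma iterates_le:
  assumes f: "f \<in> L2 \<Omega>" "AE x in lebesgue_on \<Omega>. 0 \<le> f x" and s: "s > 0"
  shows "\<exists>u v. u \<in> L2 \<Omega> \<and> v \<in> L2 \<Omega> \<and> (D.J s ^^ n) (l2_of \<Omega> f) = l2_of \<Omega> u \<and> (B.J s ^^ n) (l2_of \<Omega> f) = l2_of \<Omega> v \<and>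
    (AE x in lebesgue_on \<Omega>. 0 \<le> u x) \<and> (AE x in lebesgue_on \<Omega>. u x \<le> v x)"
proof (induction n)
  case 0
  show ?case using f by (intro exI[of _ f]) simp
next
  case (Suc n)
  then obtain u v where uv: "u \<in> L2 \<Omega>" "v \<in> L2 \<Omega>" "(D.J s ^^ n) (l2_of \<Omega> f) = l2_of \<Omega> u" "(B.J s ^^ n) (l2_of \<Omega> f) = l2_of \<Omega> v"
    "AE x in lebesgue_on \<Omega>. 0 \<le> u x" "AE x in lebesgue_on \<Omega>. u x \<le> v x" by blast
  have dL: "(\<lambda>x. v x - u x) \<in> L2 \<Omega>" by (rule L2_diff[OF uv(2,1)])
  have dnn: "AE x in lebesgue_on \<Omega>. 0 \<le> v x - u x" using uv(6) by eventually_elim simp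
  obtain u1 w1 where 1: "(u1, w1) \<in> D.Op" "\<And>x. u1 x - s * w1 x = u x" "D.J s (l2_of \<Omega> u) = l2_of \<Omega> u1"
    by (rule D.resolvent[OF uv(1) s]) blast
  obtain v1 y1 where 2: "(v1, y1) \<in> B.Op" "\<And>x. v1 x - s * y1 x = u x" "B.J s (l2_of \<Omega> u) = l2_of \<Omega> v1"
    by (rule B.resolvent[OF uv(1) s]) blast
  obtain v2 y2 where 3: "(v2, y2) \<in> B.Op" "\<And>x. v2 x - s * y2 x = v x - u x" "B.J s (l2_of \<Omega> (\<lambda>x. v x - u x)) = l2_of \<Omega> v2"
    by (rule B.resolvent[OF dL s]) blast
  note L = D.Op_L2(1)[OF 1(1)] B.Op_L2(1)[OF 2(1)] B.Op_L2(1)[OF 3(1)]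
  have e: "B.J s (l2_of \<Omega> v) = l2_of \<Omega> (\<lambda>x. v2 x + v1 x)"
  proof -
    have "l2_of \<Omega> v = 1 *\<^sub>R l2_of \<Omega> (\<lambda>x. v x - u x) + l2_of \<Omega> u" unfolding l2_of_diff[OF meas uv(2,1)] by simp
    then have "B.J s (l2_of \<Omega> v) = 1 *\<^sub>R B.J s (l2_of \<Omega> (\<lambda>x. v x - u x)) + B.J s (l2_of \<Omega> u)"
      using B.J_lin[of "l2_of \<Omega> (\<lambda>x. v x - u x)" "l2_of \<Omega> u" s 1] dL uv(1) s by simp
    then show ?thesis unfolding 2(3) 3(3) using l2_of_lin[OF meas L(3,2), of 1] by simp
  qed
  have nn1: "AE x in lebesgue_on \<Omega>. 0 \<le> u1 x" by (rule dirichlet_resolvent_nonneg[OF 1(1) s uv(1) _ uv(5)]) (simp add: 1(2))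
  have le1: "AE x in lebesgue_on \<Omega>. u1 x \<le> v1 x"
    by (rule resolvent_le[OF 1(1) 2(1) s uv(1) _ _ uv(5)]) (simp_all add: 1(2) 2(2))
  have nn2: "AE x in lebesgue_on \<Omega>. 0 \<le> v2 x" by (rule boundary_resolvent_nonneg(2)[OF 3(1) s dL _ dnn]) (simp add: 3(2))
  have le2: "AE x in lebesgue_on \<Omega>. u1 x \<le> v2 x + v1 x" using le1 nn2 by eventually_elim simp
  have vL: "(\<lambda>x. v2 x + v1 x) \<in> L2 \<Omega>" using L2_lin[OF L(3,2), of 1] by simp
  have "(D.J s ^^ Suc n) (l2_of \<Omega> f) = l2_of \<Omega> u1" "(B.J s ^^ Suc n) (l2_of \<Omega> f) = l2_of \<Omega> (\<lambda>x. v2 x + v1 x)"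
    using uv(3,4) 1(3) e by simp_all
  then show ?case using L(1) vL nn1 le2 by blast
qed

section \<open>From the Euler iterates to the semigroups\<close>

lemma semigroup_exp_spec:
  assumes "\<exists>T. C0_semigroup \<Omega> T \<and> generator \<Omega> T = A"
  shows "C0_semigroup \<Omega> (semigroup_exp \<Omega> A)" "generator \<Omega> (semigroup_exp \<Omega> A) = A"
  using someI_ex[OF assms] unfolding semigroup_exp_def by blast+

lemma semigroup_le:
  assumes t: "t \<ge> 0"
  shows "operator_le \<Omega> (semigroup_exp \<Omega> (dirichlet_laplacian \<Omega>) t) (semigroup_exp \<Omega> (boundary_laplacian \<Omega> \<kappa> \<theta>) t)"
  unfolding operator_le_def dirichlet_laplacian_eq boundary_laplacian_def
proof (intro ballI impI)
  fix f assume f: "f \<in> L2 \<Omega>" "AE x in lebesgue_on \<Omega>. 0 \<le> f x"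
  note SD = semigroup_exp_spec[OF D.C0_semigroup_exists] and SB = semigroup_exp_spec[OF B.C0_semigroup_exists]
  define P where "P = semigroup_exp \<Omega> D.Op t f"
  define Q where "Q = semigroup_exp \<Omega> B.Op t f"
  have PL: "P \<in> L2 \<Omega>" unfolding P_def using SD(1) t f(1) unfolding C0_semigroup_def bounded_operator_def by blast
  have QL: "Q \<in> L2 \<Omega>" unfolding Q_def using SB(1) t f(1) unfolding C0_semigroup_def bounded_operator_def by blast
  have "AE x in lebesgue_on \<Omega>. P x \<le> Q x"
  proof (cases "t = 0")
    case True
    \<comment> \<open>\<open>iterates_le\<close> needs a positive step length, so time
      \<open>0\<close>, where both semigroups are the identity, is separate.\<close>
    have "AE x in lebesgue_on \<Omega>. P x = f x" unfolding P_def True using SD(1) f(1) unfolding C0_semigroup_def by blast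
    moreover have "AE x in lebesgue_on \<Omega>. Q x = f x" unfolding Q_def True using SB(1) f(1) unfolding C0_semigroup_def by blast
    ultimately show ?thesis by eventually_elim simp
  next
    case False
    then have tk: "t / 2 ^ k > 0" for k :: nat using t by simp
    have "\<exists>u v. u \<in> L2 \<Omega> \<and> v \<in> L2 \<Omega> \<and> D.euler k t (l2_of \<Omega> f) = l2_of \<Omega> u \<and> B.euler k t (l2_of \<Omega> f) = l2_of \<Omega> v \<and>
      (AE x in lebesgue_on \<Omega>. u x \<le> v x)" for k
      using iterates_le[OF f tk[of k], of "2 ^ k"] unfolding D.euler_def B.euler_def by blast
    then obtain u v where uv: "\<And>k. u k \<in> L2 \<Omega>" "\<And>k. v k \<in> L2 \<Omega>" "\<And>k. D.euler k t (l2_of \<Omega> f) = l2_of \<Omega> (u k)"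
      "\<And>k. B.euler k t (l2_of \<Omega> f) = l2_of \<Omega> (v k)" "\<And>k. AE x in lebesgue_on \<Omega>. u k x \<le> v k x" by metis
    have "(\<lambda>k. l2_of \<Omega> (u k)) \<longlonglongrightarrow> l2_of \<Omega> P" "(\<lambda>k. l2_of \<Omega> (v k)) \<longlonglongrightarrow> l2_of \<Omega> Q"
      unfolding uv(3,4)[symmetric] P_def Q_def
      by (rule D.C0_semigroup_euler[OF SD f(1) t], rule B.C0_semigroup_euler[OF SB f(1) t])
    then have "(\<lambda>k. l2_of \<Omega> (\<lambda>x. v k x - u k x)) \<longlonglongrightarrow> l2_of \<Omega> (\<lambda>x. Q x - P x)"
      unfolding l2_of_diff[OF meas uv(2,1)] l2_of_diff[OF meas QL PL] by (intro tendsto_diff)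
    then have "AE x in lebesgue_on \<Omega>. 0 \<le> Q x - P x"
    proof (rule L2_lim_nonneg[OF meas L2_diff[OF uv(2,1)] L2_diff[OF QL PL]])
      show "AE x in lebesgue_on \<Omega>. 0 \<le> v k x - u k x" for k using uv(5)[of k] by eventually_elim simp
    qed
    then show ?thesis by eventually_elim simp
  qed
  then show "AE x in lebesgue_on \<Omega>. semigroup_exp \<Omega> D.Op t f x \<le> semigroup_exp \<Omega> B.Op t f x" unfolding P_def Q_def .
qed

end

theorem theorem5p1:
  fixes \<Omega> :: "'a::euclidean_space set"
    and \<kappa> :: "'a measure"
    and \<theta> :: "('a \<times> 'a) measure"
  assumes "open \<Omega>" and "bounded \<Omega>"
    and "borel_measure_on (frontier \<Omega>) \<kappa>"
    and "radon_measure_on (off_diagonal (frontier \<Omega>)) \<theta>"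
    and "symmetric_measure \<theta>"
    and "admissible \<Omega> \<kappa> \<theta>"
  shows "\<forall>t\<ge>0. operator_le \<Omega> (semigroup_exp \<Omega> (dirichlet_laplacian \<Omega>) t)
                            (semigroup_exp \<Omega> (boundary_laplacian \<Omega> \<kappa> \<theta>) t)"
proof -
  have "boundary_measures \<Omega> \<kappa> \<theta>"
    using assms unfolding radon_measure_on_def by unfold_locales auto
  then show ?thesis using boundary_measures.semigroup_le by blast
qed

end
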